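(* (1) Let $f$ be a continuous map of a compact interval to itself. If $\mathcal N\gg\mathcal M$ are finite towers and $f$ has a cycle with tower $\mathcal N$, then $f$ has a cycle with tower $\mathcal M$; and so there exists an infinite tower $\mathcal K$ such that the set of all (finite) towers of cycles of $f$ is $\mathrm{Tow}(\mathcal K)$. (2) Conversely, if $\mathcal K$ is an infinite tower, then there exists a continuous map $g$ of a compact interval to itself such that the set of all (finite) towers of cycles of $g$ coincides with $\mathrm{Tow}(\mathcal K)$.
   Context: A cycle of an interval map is a periodic orbit. A cycle of period $N$ induces a cyclic permutation $\pi$ of $\{1,\dots,N\}$ by numbering its points from left to right. A cyclic permutation $\pi$ of $\{1,\dots,N\}$ has a block structure of period $k$, where $k\notin\{1,N\}$, if there is a partition of $\{1,\dots,N\}$ into $k$ segments (sets of consecutive integers), called blocks, that are permuted by $\pi$. Let $p_1<\dots<p_s$ be the periods of all possible block structures on $\pi$ (it is a fact that smaller periods divide larger ones). The (renormalization) tower of $\pi$ is the finite string $(p_1/1,\,p_2/p_1,\dots,p_s/p_{s-1},\,N/p_s)$; if $\pi$ has no block structure its tower is $(N)$. The tower of a cycle is the tower of the permutation it induces. Convention: singletons of fixed points are not regarded as cycles when speaking of towers. A finite tower is a nonempty finite string of integers larger than $1$. An infinite tower is an infinite string $(m_0,m_1,\dots)$ of positive integers such that either $m_i>1$ for all $i$, or there is a $j\ge 0$ with $m_i>1$ for $i<j$ and $m_i=1$ for $i\ge j$. The canonical extension of a finite tower is the infinite tower obtained by appending infinitely many $1$s. The order $\gg$ on positive integers is the strict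 linear order $$4\gg 6\gg 3\gg 8\gg 10\gg 5\gg\dots\gg 4n\gg 4n+2\gg 2n+1\gg\dots\gg 2\gg 1$$ (so $k\gg k$ is false). It is extended lexicographically to towers: replace finite towers by their canonical extensions; for two different infinite strings, if $i$ is the first place where they differ and the entries there are $n_i$ and $m_i$, the first string is $\gg$ the second if and only if $n_i\gg m_i$. For an infinite tower $\mathcal K$, $\mathrm{Tow}(\mathcal K)$ is the set of all finite towers $\mathcal N$ with $\mathcal K\gg\mathcal N$, together with the finite tower $\widetilde{\mathcal K}$ in case $\mathcal K$ is the canonical extension of $\widetilde{\mathcal K}$. (In particular $\mathrm{Tow}((1,1,1,\dots))=\emptyset$ under the convention that fixed points are ignored.) *)

theory Defs
  imports Complex_Main "HOL-Library.Disjoint_Sets" "HOL-Combinatorics.Orbits"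
begin

section \<open>Block structures and the tower of a cyclic permutation of \<open>{1..N}\<close>\<close>

definition block_structure :: "nat \<Rightarrow> (nat \<Rightarrow> nat) \<Rightarrow> nat set set \<Rightarrow> bool" where
  "block_structure N \<pi> \<B> \<longleftrightarrow>
     partition_on {1..N} \<B> \<and> (\<forall>B\<in>\<B>. \<exists>i j. B = {i..j}) \<and> bij_betw (\<lambda>B. \<pi> ` B) \<B> \<B>"

definition block_periods :: "nat \<Rightarrow> (nat \<Rightarrow> nat) \<Rightarrow> nat set" where
  "block_periods N \<pi> = {k. k \<notin> {1, N} \<and> (\<exists>\<B>. block_structure N \<pi> \<B> \<and> card \<B> = k)}"

text \<open>With \<open>ps = [p\<^sub>1, \<dots>, p\<^sub>s]\<close> this is \<open>[p\<^sub>1/1, p\<^sub>2/p\<^sub>1, \<dots>, N/p\<^sub>s]\<close>, and it is \<open>[N]\<close> if there is no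
  block structure. All quotients are exact when \<open>\<pi>\<close> is a cyclic permutation of \<open>{1..N}\<close>.\<close>

definition perm_tower :: "nat \<Rightarrow> (nat \<Rightarrow> nat) \<Rightarrow> nat list" where
  "perm_tower N \<pi> =
     (let ps = sorted_list_of_set (block_periods N \<pi>) in map2 (div) (ps @ [N]) (1 # ps))"

section \<open>Cycles of interval maps\<close>

text \<open>The predicate \<open>cyclic_on f P\<close> says that \<open>P = {f x, f (f x), \<dots>}\<close> for some \<open>x \<in> P\<close>; such a \<open>P\<close>
  is finite and is precisely a periodic orbit of \<open>f\<close>, of period \<open>card P\<close>.\<close>

definition is_cycle :: "real \<Rightarrow> real \<Rightarrow> (real \<Rightarrow> real) \<Rightarrow> real set \<Rightarrow> bool" where
  "is_cycle a b f P \<longleftrightarrow> P \<subseteq> {a..b} \<and> cyclic_on f P"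

definition cycle_point :: "real set \<Rightarrow> nat \<Rightarrow> real" where
  "cycle_point P i = sorted_list_of_set P ! (i - 1)"

definition cycle_index :: "real set \<Rightarrow> real \<Rightarrow> nat" where
  "cycle_index P x = card {y \<in> P. y \<le> x}"

definition induced_perm :: "(real \<Rightarrow> real) \<Rightarrow> real set \<Rightarrow> nat \<Rightarrow> nat" where
  "induced_perm f P i =
     (if i \<in> {1..card P} then cycle_index P (f (cycle_point P i)) else i)"

definition cycle_tower :: "(real \<Rightarrow> real) \<Rightarrow> real set \<Rightarrow> nat list" where
  "cycle_tower f P = perm_tower (card P) (induced_perm f P)"

text \<open>Singletons of fixed points are not regarded as cycles here, hence \<open>card P \<noteq> 1\<close>.\<close>

definition towers_of_cycles :: "real \<Rightarrow> real \<Rightarrow> (real \<Rightarrow> real) \<Rightarrow> nat list set" where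
  "towers_of_cycles a b f = {cycle_tower f P | P. is_cycle a b f P \<and> card P \<noteq> 1}"

section \<open>Finite and infinite towers and their order\<close>

definition finite_tower :: "nat list \<Rightarrow> bool" where
  "finite_tower \<N> \<longleftrightarrow> \<N> \<noteq> [] \<and> (\<forall>m\<in>set \<N>. 1 < m)"

definition infinite_tower :: "(nat \<Rightarrow> nat) \<Rightarrow> bool" where
  "infinite_tower \<K> \<longleftrightarrow>
     (\<forall>i. 1 < \<K> i) \<or> (\<exists>j. (\<forall>i<j. 1 < \<K> i) \<and> (\<forall>i\<ge>j. \<K> i = 1))"

definition canonical_extension :: "nat list \<Rightarrow> nat \<Rightarrow> nat" where
  "canonical_extension \<N> i = (if i < length \<N> then \<N> ! i else 1)"

text \<open>The sequence \<open>4, 6, 3, 8, 10, 5, \<dots>, 4n, 4n+2, 2n+1, \<dots>\<close>, whose index \<open>i\<close> starts at \<open>0\<close> and whose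
  triples are numbered by \<open>n = i div 3 + 1\<close>. It enumerates all positive integers other than 2 and 1,
  which come after it in the order.\<close>

definition gg_seq :: "nat \<Rightarrow> nat" where
  "gg_seq i = (let n = i div 3 + 1 in [4 * n, 4 * n + 2, 2 * n + 1] ! (i mod 3))"

definition gg :: "nat \<Rightarrow> nat \<Rightarrow> bool" (infix \<open>\<ggreater>\<close> 50) where
  "k \<ggreater> l \<longleftrightarrow>
     (\<exists>i j. i < j \<and> k = gg_seq i \<and> l = gg_seq j) \<or>
     (\<exists>i. k = gg_seq i \<and> l \<in> {2, 1}) \<or>
     (k = 2 \<and> l = 1)"

definition gg_inf :: "(nat \<Rightarrow> nat) \<Rightarrow> (nat \<Rightarrow> nat) \<Rightarrow> bool" (infix \<open>\<ggreater>\<^sub>\<omega>\<close> 50) where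
  "\<K> \<ggreater>\<^sub>\<omega> \<L> \<longleftrightarrow> (\<exists>i. (\<forall>j<i. \<K> j = \<L> j) \<and> \<K> i \<noteq> \<L> i \<and> \<K> i \<ggreater> \<L> i)"

definition gg_fin :: "nat list \<Rightarrow> nat list \<Rightarrow> bool" (infix \<open>\<ggreater>\<^sub>f\<close> 50) where
  "\<N> \<ggreater>\<^sub>f \<M> \<longleftrightarrow> canonical_extension \<N> \<ggreater>\<^sub>\<omega> canonical_extension \<M>"

definition Tow :: "(nat \<Rightarrow> nat) \<Rightarrow> nat list set" where
  "Tow \<K> = {\<N>. finite_tower \<N> \<and> \<K> \<ggreater>\<^sub>\<omega> canonical_extension \<N>}
         \<union> {\<N>. finite_tower \<N> \<and> \<K> = canonical_extension \<N>}"

end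

theory Submission
  imports Defs "HOL-Analysis.Analysis"
begin

text \<open>
  Numbering a cycle by time instead of by position makes it an \<open>N\<close>-periodic sequence of reals.  Blocks that
  are permuted cyclically are then the residue classes of the time modulo \<open>k\<close>, and the cycle has a block
  structure of period \<open>k\<close> iff these classes have disjoint convex hulls.  Block structures are nested, so a tower is
  nothing but the set of its partial products (\<open>towers_of_cycles_eq\<close>), and everything is about the order
  of the points of periodic sequences.

  \<^bold>\<open>Forcing.\<close>  Let \<open>f\<close> have a cycle \<open>p\<close> with tower \<open>\<tau> @ [n]\<close>, let \<open>K\<close> be the product of \<open>\<tau>\<close>, and let \<open>n\<close> precede \<open>m\<close>
  in the order of the periods.  It suffices to find cycles with tower \<open>\<tau> @ [m] @ \<sigma>\<close> for all \<open>\<sigma>\<close>, since cutting off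
  the end of a tower amounts to collapsing blocks (\<open>realizes_prefix\<close>).  The search is for long cycles of the
  connect-the-dots map \<open>F\<close> of \<open>p\<close>; these persist for \<open>f\<close> with the same order of points
  (\<open>dots_cycle_transfer\<close>).

  In the hull of each of the \<open>K\<close> blocks of \<open>p\<close> there is one point of a cycle, the centre, at which the \<open>K\<close>-th
  iterate of \<open>F\<close> reverses orientation (\<open>centre_exists\<close>).  The two sides of the \<open>K\<close> points of the centre are \<open>2 K\<close> rays
  which \<open>F\<close>, near the centre, permutes cyclically; points of \<open>p\<close> mostly follow this rotation but sometimes
  violate it and pass to the opposite ray.  Loops of rays with one violation in an odd number of turns or with two
  violations carry periodic orbits of \<open>F\<close>, provided that some point is covered by its image along the
  loop.  That this happens for the loops of length \<open>m K\<close> follows from an averaging argument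
  (\<open>average_return\<close>): if \<open>p\<close> violates often enough on average, then some violation is followed by a return that is
  early enough, and further turns without violation expand (\<open>two_turns\<close>).  The order of the periods reflects
  exactly which loops are obtained in this way: the number of violations of \<open>p\<close> has the parity of \<open>n\<close>, so there are at
  least two of them if \<open>n\<close> is even.

  An innermost orbit on such a loop is repelling outwards (\<open>innermost_cycle\<close>).  Its blocks are grown outwards
  from it until one of them folds over (\<open>folding\<close>).  The fold makes the return map of a block unimodal, and a
  unimodal map with full branches has cycles with all towers, by repeated renormalization
  (\<open>branch_pair_cycle\<close>).  This produces cycles with the tower \<open>\<sigma>\<close> inside blocks of period \<open>m K\<close>
  (\<open>fold_cycle\<close>).  Finally there is no block structure of a period strictly between \<open>K\<close> and \<open>m K\<close>: with
  at most two violations per loop, the blocks that meet both sides of the centre would otherwise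
  produce a return with a single violation in a single turn (\<open>word_no_block\<close>), and in that case all periods are forced anyway.

  \<^bold>\<open>The set of towers of a map.\<close>  The set of its towers is therefore closed under passing to smaller towers.  Its
  supremum is computed entry by entry (\<open>closed_set_is_Tow\<close>).

  \<^bold>\<open>Realization.\<close>  The tent map has cycles with all towers.  Truncating it at the height \<open>h\<close> removes the cycles that
  exceed \<open>h\<close> and adds at most the orbit of \<open>h\<close>.  For a finite tower \<open>h\<close> is the smallest possible maximum of a tent cycle
  with that tower, and for an infinite one it is the supremum of these heights over the finite initial segments.
  In the latter case the orbit of \<open>h\<close> is not periodic (\<open>plateau_not_limit\<close>).
\<close>


section \<open>Periodic sequences, convex residue classes and towers\<close>

definition cyc :: "nat \<Rightarrow> (nat \<Rightarrow> real) \<Rightarrow> bool" where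
  "cyc N x \<longleftrightarrow> 0 < N \<and> (\<forall>i. x (i + N) = x i) \<and> inj_on x {..<N}"

text \<open>Of the cyclic permutation only the order of the points is used: the blocks of a structure of period \<open>k\<close> are
  the residue classes modulo \<open>k\<close>, and a class is a segment iff no other class has a point between two of its points.\<close>

definition blk :: "nat \<Rightarrow> (nat \<Rightarrow> real) \<Rightarrow> nat \<Rightarrow> bool" where
  "blk N x k \<longleftrightarrow> k dvd N \<and> (\<forall>i j l. x i < x l \<and> x l < x j \<and> i mod k = j mod k \<longrightarrow> l mod k = i mod k)"

text \<open>The tower \<open>(p\<^sub>1 / 1, p\<^sub>2 / p\<^sub>1, \<dots>, N / p\<^sub>s)\<close> has the partial products \<open>1, p\<^sub>1, \<dots>, p\<^sub>s, N\<close>; the trivial periods \<open>1\<close> and \<open>N\<close>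
  are included, which makes concatenation of towers multiplicative.\<close>

definition prods :: "nat list \<Rightarrow> nat set" where
  "prods M = (\<lambda>i. prod_list (take i M)) ` {..length M}"

definition realizes :: "(real \<Rightarrow> real) \<Rightarrow> real set \<Rightarrow> nat list \<Rightarrow> bool" where
  "realizes f I M \<longleftrightarrow> (\<exists>x N. cyc N x \<and> (\<forall>i. f (x i) = x (Suc i)) \<and> range x \<subseteq> I \<and> {k. blk N x k} = prods M)"

lemma add_mod_iff: "(i + a) mod k = i mod k \<longleftrightarrow> k dvd a" for k :: nat
  by (metis add_diff_cancel_left' le_add1 mod_eq_dvd_iff_nat)

lemma mod_mod_dvd: "i mod N = j mod N \<Longrightarrow> k dvd N \<Longrightarrow> i mod k = j mod k" for k :: nat
  by (metis mod_mod_cancel)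

lemma periodic_add_mult:
  fixes x :: "nat \<Rightarrow> 'a" assumes "\<And>i. x (i + N) = x i" shows "x (i + a * N) = x i"
proof (induction a)
  case (Suc a)
  have "x (i + Suc a * N) = x ((i + a * N) + N)" by (simp add: algebra_simps)
  then show ?case using assms Suc by metis
qed simp

lemma periodic_mod:
  fixes x :: "nat \<Rightarrow> 'a" assumes "\<And>i. x (i + N) = x i" shows "x (i mod N) = x i"
  using periodic_add_mult[of x N "i mod N" "i div N"] assms by (simp add: mult.commute)

lemma periodic_cong:
  fixes x :: "nat \<Rightarrow> 'a" assumes "\<And>i. x (i + N) = x i" "i mod N = j mod N" shows "x i = x j"
  by (metis assms periodic_mod)

lemma cyc_pos: "cyc N x \<Longrightarrow> 0 < N" and cyc_periodic: "cyc N x \<Longrightarrow> x (i + N) = x i"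
  by (auto simp: cyc_def)

lemma cyc_eq_iff: assumes "cyc N x" shows "x i = x j \<longleftrightarrow> i mod N = j mod N"
proof
  assume "x i = x j"
  then have "x (i mod N) = x (j mod N)" using periodic_mod[of x N] assms by (simp add: cyc_def)
  then show "i mod N = j mod N" using assms unfolding cyc_def inj_on_def by simp
next
  assume "i mod N = j mod N"
  then show "x i = x j" using periodic_cong[of x N i j] assms unfolding cyc_def by blast
qed

lemma cycI:
  assumes "0 < N" "\<And>i. x (i + N) = x i" "\<And>i j. x i = x j \<Longrightarrow> i mod N = j mod N" shows "cyc N x"
  unfolding cyc_def inj_on_def using assms by (metis lessThan_iff mod_less)

lemma cyc_range: assumes "cyc N x" shows "range x = x ` {..<N}"
proof -
  have "x i \<in> x ` {..<N}" for i
    using periodic_mod[of x N i] assms by (metis cyc_def imageI lessThan_iff mod_less_divisor)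
  then show ?thesis by auto
qed

lemma cyc_finite: "cyc N x \<Longrightarrow> finite (range x)" and cyc_card: "cyc N x \<Longrightarrow> card (range x) = N"
  by (simp_all add: cyc_range card_image cyc_def)

lemma cyc_shift: assumes "cyc N x" shows "cyc N (\<lambda>i. x (i + s))"
proof (rule cycI)
  fix i j assume "x (i + s) = x (j + s)"
  then have "(i + s) mod N = (j + s) mod N" using cyc_eq_iff[OF assms] by simp
  then show "i mod N = j mod N" by (auto simp: nat_mod_eq_iff)
next
  show "x (i + N + s) = x (i + s)" for i
    using cyc_periodic[OF assms, of "i + s"] by (simp add: algebra_simps)
qed (use assms in \<open>simp add: cyc_def\<close>)

lemma blkI:
  assumes "k dvd N" "\<And>i j l. x i < x l \<Longrightarrow> x l < x j \<Longrightarrow> i mod k = j mod k \<Longrightarrow> l mod k = i mod k"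
  shows "blk N x k"
  using assms unfolding blk_def by blast

lemma blkD: "blk N x k \<Longrightarrow> x i < x l \<Longrightarrow> x l < x j \<Longrightarrow> i mod k = j mod k \<Longrightarrow> l mod k = i mod k"
  unfolding blk_def by blast

lemma blk_dvd_period: "blk N x k \<Longrightarrow> k dvd N" by (simp add: blk_def)

lemma blk_1: "blk N x 1" by (simp add: blk_def)

lemma blk_N: assumes "cyc N x" shows "blk N x N"
  by (rule blkI) (use cyc_eq_iff[OF assms] in \<open>metis dvd_refl less_asym\<close>)+

text \<open>Block structures are nested: the block containing the leftmost point is an initial segment
  for either structure, so the two are comparable, and a residue class is determined by one block.\<close>

lemma blk_nested:
  assumes c: "cyc N x" and k: "blk N x k" and k': "blk N x k'" and le: "k \<le> k'" shows "k dvd k'"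
proof (rule ccontr)
  assume nd: "\<not> k dvd k'"
  have fin: "finite (range x)" using c by (rule cyc_finite)
  obtain i0 where i0: "\<And>i. x i0 \<le> x i"
    using Min_in[OF fin] Min_le[OF fin] by (metis UNIV_I empty_iff imageE imageI rangeI)
  have k0: "0 < k" "0 < k'" using k k' c cyc_pos dvd_pos_nat blk_dvd_period by blast+
  have ncl: "(i0 + k') mod k \<noteq> i0 mod k" using nd add_mod_iff by blast
  have neq: "x u \<noteq> x v" if "u mod k \<noteq> v mod k" for u v
    using that cyc_eq_iff[OF c] mod_mod_dvd blk_dvd_period[OF k] by blast
  have lt: "x (i0 + k) < x (i0 + k')"
  proof (rule ccontr)
    assume "\<not> ?thesis"
    moreover have "x (i0 + k) \<noteq> x (i0 + k')" using neq ncl by (metis mod_add_self2)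
    moreover have "x i0 < x (i0 + k')" using i0 neq ncl by (metis less_eq_real_def)
    ultimately show False using blkD[OF k, of i0 "i0 + k'" "i0 + k"] ncl by auto
  qed
  show False
  proof (cases "x i0 = x (i0 + k)")
    case True
    then have "N dvd k" using cyc_eq_iff[OF c] add_mod_iff by metis
    then have "k' dvd k" using blk_dvd_period[OF k'] dvd_trans by blast
    then show False using le k0 nd dvd_imp_le by (metis dvd_refl le_antisym)
  next
    case False
    then have "x i0 < x (i0 + k)" using i0 by (metis less_eq_real_def)
    then have "(i0 + k) mod k' = i0 mod k'" using blkD[OF k' _ lt, of i0] by simp
    then have "k' dvd k" using add_mod_iff by blast
    then show False using le k0 nd dvd_imp_le by (metis dvd_refl le_antisym)
  qed
qed

subsection \<open>Partial products\<close>

lemma prods_Nil [simp]: "prods [] = {1}" by (simp add: prods_def)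

lemma prods_Cons: "prods (m # M) = insert 1 ((*) m ` prods M)"
proof -
  have "{..length (m # M)} = insert 0 (Suc ` {..length M})" by (simp add: atMost_Suc_eq_insert_0)
  then show ?thesis by (simp add: prods_def image_image)
qed

lemma prods_append: "prods (M @ M') = prods M \<union> (*) (prod_list M) ` prods M'"
proof (induction M)
  case Nil
  have "1 \<in> prods M'" unfolding prods_def by (metis (no_types) atMost_iff image_eqI le0 prod_list.Nil take_0)
  then show ?case by auto
qed (auto simp: prods_Cons image_Un image_image mult.assoc)

lemma one_in_prods: "1 \<in> prods M" by (cases M) (auto simp: prods_Cons)

lemma prod_list_in_prods: "prod_list M \<in> prods M"
  by (induction M) (auto simp: prods_Cons)

lemma prods_dvd: "k \<in> prods M \<Longrightarrow> k dvd prod_list M"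
  by (induction M arbitrary: k) (auto simp: prods_Cons)

lemma prod_list_ge1: "\<forall>m\<in>set M. 1 < m \<Longrightarrow> 1 \<le> prod_list (M :: nat list)"
  by (induction M) (auto simp: Suc_le_eq)

lemma prods_pos: "\<forall>m\<in>set M. 1 < m \<Longrightarrow> k \<in> prods M \<Longrightarrow> 0 < k"
  by (metis dvd_pos_nat less_le_trans prod_list_ge1 prods_dvd zero_less_one)

lemma prod_list_gt1: "\<forall>m\<in>set M. 1 < m \<Longrightarrow> M \<noteq> [] \<Longrightarrow> 1 < prod_list (M :: nat list)"
proof (cases M)
  case (Cons m M')
  assume "\<forall>m\<in>set M. 1 < m"
  then have "1 < m" "1 \<le> prod_list M'" using Cons prod_list_ge1 by auto
  moreover from this have "m * 1 \<le> m * prod_list M'" by (intro mult_left_mono) auto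
  ultimately have "1 < m * prod_list M'" by linarith
  then show ?thesis using Cons by simp
qed simp

lemma prods_inj:
  "\<forall>m\<in>set M. 1 < m \<Longrightarrow> \<forall>m\<in>set M'. 1 < m \<Longrightarrow> prods M = prods M' \<Longrightarrow> M = M'"
proof (induction M arbitrary: M')
  case Nil
  then have "prods M' = {1}" by simp
  then have "prod_list M' = 1" using prod_list_in_prods[of M'] by blast
  then show ?case using Nil prod_list_gt1[of M'] by fastforce
next
  case (Cons m M)
  have "prod_list (m # M) \<noteq> 1" using Cons.prems prod_list_gt1[of "m # M"] by simp
  then have "M' \<noteq> []" using Cons.prems(3) prod_list_in_prods[of "m # M"] by auto
  then obtain m' M'' where M': "M' = m' # M''" by (cases M') auto
  have gt: "1 < m" "1 < m'" using Cons.prems M' by auto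
  have pos: "\<And>k. k \<in> prods M \<Longrightarrow> 0 < k" "\<And>k. k \<in> prods M'' \<Longrightarrow> 0 < k"
    using prods_pos[of M] prods_pos[of M''] Cons.prems(1,2) M' by simp_all
  have ni: "1 \<notin> (*) m ` prods M" "1 \<notin> (*) m' ` prods M''" using gt by force+
  have eq: "(*) m ` prods M = (*) m' ` prods M''"
    using Cons.prems(3) ni unfolding M' prods_Cons by (metis Diff_insert_absorb)
  have "m \<in> (*) m' ` prods M''" unfolding eq[symmetric] using one_in_prods[of M] by force
  then have "m' dvd m" by auto
  moreover have "m' \<in> (*) m ` prods M" unfolding eq using one_in_prods[of M''] by force
  then have "m dvd m'" by auto
  ultimately have "m = m'" by (simp add: dvd_antisym)
  moreover from this have "prods M = prods M''" using eq gt
    by (metis inj_image_eq_iff inj_on_def mult_cancel1 not_one_less_zero)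
  ultimately show ?case using Cons.IH[of M''] Cons.prems M' by auto
qed

lemma map2_div_chain:
  assumes "sorted_wrt (\<lambda>u v. u < v \<and> u dvd v) (a # ys)" "0 < (a::nat)"
  shows "(\<forall>m\<in>set (map2 (div) ys (a # ys)). 1 < m) \<and> (*) a ` prods (map2 (div) ys (a # ys)) = set (a # ys)"
  using assms
proof (induction ys arbitrary: a)
  case (Cons b ys)
  have "a < b" "a dvd b" using Cons.prems by auto
  from \<open>a dvd b\<close> obtain q where "b = a * q" by (elim dvdE)
  then have q: "a * (b div a) = b" "1 < b div a" using Cons.prems(2) \<open>a < b\<close> by auto
  have IH: "(\<forall>m\<in>set (map2 (div) ys (b # ys)). 1 < m) \<and> (*) b ` prods (map2 (div) ys (b # ys)) = set (b # ys)"
    using Cons.IH[of b] Cons.prems \<open>a < b\<close> by simp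
  have "(*) a ` prods ((b div a) # map2 (div) ys (b # ys))
      = insert a ((*) b ` prods (map2 (div) ys (b # ys)))"
    by (simp add: prods_Cons image_image mult.assoc[symmetric] q)
  then show ?case using IH q by simp
qed simp

subsection \<open>The link with block structures\<close>

lemma cycle_point_index:
  assumes "finite P" "p \<in> P" shows "cycle_point P (cycle_index P p) = p"
proof -
  let ?L = "sorted_list_of_set P"
  have L: "sorted_wrt (<) ?L" "set ?L = P" using assms(1) by auto
  then obtain m where m: "m < length ?L" "?L ! m = p" using assms(2) by (metis in_set_conv_nth)
  have "{y \<in> P. y \<le> p} = (\<lambda>j. ?L ! j) ` {..m}"
  proof (intro equalityI subsetI)
    fix y assume "y \<in> {y \<in> P. y \<le> p}"
    then obtain j where j: "j < length ?L" "?L ! j = y" "y \<le> p" using L by (metis (lifting) in_set_conv_nth mem_Collect_eq)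
    then have "j \<le> m" using m sorted_wrt_nth_less[OF L(1), of m j] by (metis leD leI)
    then show "y \<in> (\<lambda>j. ?L ! j) ` {..m}" using j by blast
  next
    fix y assume "y \<in> (\<lambda>j. ?L ! j) ` {..m}"
    then obtain j where j: "j \<le> m" "y = ?L ! j" by auto
    then have "j < length ?L" using m by simp
    then show "y \<in> {y \<in> P. y \<le> p}" using j m sorted_wrt_nth_less[OF L(1), of j m] L(2)
      by (metis (mono_tags, lifting) le_neq_implies_less less_eq_real_def mem_Collect_eq nth_mem)
  qed
  moreover have "inj_on (\<lambda>j. ?L ! j) {..m}"
    using m by (intro inj_on_nth) (auto)
  ultimately have "cycle_index P p = Suc m" by (simp add: cycle_index_def card_image)
  then show ?thesis using m by (simp add: cycle_point_def)
qed

lemma cycle_index_less: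
  assumes "finite P" "p \<in> P" "q \<in> P" shows "cycle_index P p < cycle_index P q \<longleftrightarrow> p < q"
proof -
  have lt: "cycle_index P p < cycle_index P q" if "p < q" "q \<in> P" for p q
  proof -
    have "{y \<in> P. y \<le> p} \<subset> {y \<in> P. y \<le> q}" using that by force
    then show ?thesis unfolding cycle_index_def using assms(1) by (simp add: psubset_card_mono)
  qed
  have "\<not> p < q \<Longrightarrow> \<not> cycle_index P p < cycle_index P q"
    using lt[of q p] assms by (metis less_irrefl less_trans linorder_neqE_linordered_idom)
  then show ?thesis using lt assms by blast
qed

lemma cycle_index_bij: assumes "finite P" shows "cycle_index P ` P = {1..card P}"
proof (rule card_subset_eq)
  show "cycle_index P ` P \<subseteq> {1..card P}"
  proof
    fix n assume "n \<in> cycle_index P ` P"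
    then obtain p where p: "p \<in> P" "n = card {y \<in> P. y \<le> p}" by (auto simp: cycle_index_def)
    then have "{y \<in> P. y \<le> p} \<noteq> {}" by auto
    then show "n \<in> {1..card P}" using p assms by (auto simp: Suc_le_eq card_gt_0_iff intro!: card_mono)
  qed
  have "inj_on (cycle_index P) P" by (metis assms cycle_point_index inj_onI)
  then show "card (cycle_index P ` P) = card {1..card P}" by (simp add: card_image)
qed simp

lemma block_periods_eq:
  assumes c: "cyc N x" and f: "\<And>i. f (x i) = x (Suc i)"
  shows "block_periods N (induced_perm f (range x)) = {k. blk N x k} - {1, N}"
proof -
  define P where "P = range x"
  define \<pi> where "\<pi> = induced_perm f P"
  define rk where "rk i = cycle_index P (x i)" for i
  have fin: "finite P" and card: "card P = N" using c by (simp_all add: P_def cyc_finite cyc_card)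
  have xP: "x i \<in> P" for i by (simp add: P_def)
  have rk_less: "rk i < rk j \<longleftrightarrow> x i < x j" for i j using cycle_index_less[OF fin xP xP] by (simp add: rk_def)
  have rk_eq: "rk i = rk j \<longleftrightarrow> i mod N = j mod N" for i j
    using cyc_eq_iff[OF c, of i j] cycle_point_index[OF fin xP] by (metis rk_def)
  have rk_range: "range rk = {1..N}"
    using cycle_index_bij[OF fin, unfolded card] by (simp add: rk_def[abs_def] P_def image_image)
  have pi: "\<pi> (rk i) = rk (Suc i)" for i
  proof -
    have "rk i \<in> {1..card P}" using rk_range card by blast
    then show ?thesis by (simp add: \<pi>_def induced_perm_def cycle_point_index[OF fin xP] rk_def f)
  qed
  have N0: "0 < N" using c by (rule cyc_pos)
  have "k \<in> block_periods N \<pi> \<longleftrightarrow> blk N x k \<and> k \<notin> {1, N}" for k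
  proof
    assume "k \<in> block_periods N \<pi>"
    then obtain \<B> where B: "block_structure N \<pi> \<B>" "card \<B> = k" and k: "k \<notin> {1, N}"
      by (auto simp: block_periods_def)
    have part: "partition_on {1..N} \<B>" and seg: "\<And>b. b \<in> \<B> \<Longrightarrow> \<exists>i j. b = {i..j}"
      and perm: "(\<lambda>b. \<pi> ` b) ` \<B> = \<B>"
      using B(1) unfolding block_structure_def bij_betw_def by auto
    have ex: "\<exists>b\<in>\<B>. rk i \<in> b" for i
    proof -
      have "rk i \<in> \<Union>\<B>" using rk_range partition_onD1[OF part] by (metis rangeI)
      then show ?thesis by blast
    qed
    define bl where "bl i = (THE b. b \<in> \<B> \<and> rk i \<in> b)" for i
    have uniq: "b = b'" if "b \<in> \<B>" "b' \<in> \<B>" "n \<in> b" "n \<in> b'" for b b' n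
      using part that unfolding partition_on_def disjoint_def by blast
    have blP: "bl i \<in> \<B> \<and> rk i \<in> bl i" for i
      unfolding bl_def by (rule theI') (use ex uniq in blast)
    have blE: "bl i = b" if "b \<in> \<B>" "rk i \<in> b" for i b using uniq blP that by blast
    have step: "bl (Suc i) = \<pi> ` bl i" for i
      by (rule blE) (use perm blP pi in \<open>auto intro!: image_eqI[of _ _ "rk i"]\<close>)
    have per: "bl (i + N) = bl i" for i by (rule blE) (use blP rk_eq[of "i + N" i] in auto)
    have det: "bl (i + s) = bl (j + s)" if "bl i = bl j" for i j s
      by (induction s) (use that step in auto)
    have rng: "range bl = \<B>"
    proof (intro equalityI subsetI)
      fix b assume b: "b \<in> \<B>"
      then have "b \<noteq> {}" "b \<subseteq> {1..N}" using part unfolding partition_on_def by auto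
      then obtain i where "rk i \<in> b" using rk_range by (metis ex_in_conv imageE subsetD)
      then show "b \<in> range bl" using blE b by blast
    qed (use blP in auto)
    define d where "d = (LEAST d. 0 < d \<and> bl d = bl 0)"
    have d: "0 < d" "bl d = bl 0" and dmin: "\<And>e. 0 < e \<Longrightarrow> bl e = bl 0 \<Longrightarrow> d \<le> e"
      using LeastI[of "\<lambda>d. 0 < d \<and> bl d = bl 0" N] per[of 0] N0 Least_le[of "\<lambda>d. 0 < d \<and> bl d = bl 0"]
      unfolding d_def by auto
    have perd: "bl (i + d) = bl i" for i using det[OF d(2), of i] by (simp add: add.commute)
    have key: "i mod d = j mod d" if "bl i = bl j" for i j
    proof -
      have le: "j mod d \<le> i mod d" if "bl i = bl j" for i j
      proof (rule ccontr)
        assume "\<not> ?thesis"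
        then have lt: "i mod d < j mod d" by simp
        have "bl (i mod d) = bl (j mod d)" using that periodic_mod[of bl d] perd by metis
        then have "bl (i mod d + (d - j mod d)) = bl (j mod d + (d - j mod d))" by (rule det)
        also have "j mod d + (d - j mod d) = d" using d(1) by (simp add: less_imp_le)
        finally have "d \<le> i mod d + (d - j mod d)" using dmin d lt
          by (metis add_gr_0 mod_less_divisor zero_less_diff)
        then show False using lt d(1) by (metis add_diff_inverse_nat leD mod_less_divisor nat_add_left_cancel_less not_less_iff_gr_or_eq add.commute)
      qed
      then show ?thesis using that by (metis le_antisym)
    qed
    have "bl ` {..<d} = \<B>"
    proof -
      have "bl i \<in> bl ` {..<d}" for i
        using periodic_mod[of bl d i] perd d(1) by (metis imageI lessThan_iff mod_less_divisor)
      then show ?thesis using rng by blast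
    qed
    moreover have "inj_on bl {..<d}" using key by (intro inj_onI) (metis lessThan_iff mod_less)
    ultimately have "k = d" using B(2) by (metis card_image card_lessThan)
    have "blk N x d"
    proof (rule blkI)
      show "d dvd N" using key[of N 0] per[of 0] by auto
      fix i j l assume *: "x i < x l" "x l < x j" "i mod d = j mod d"
      then have "bl i = bl j" using periodic_cong[of bl d] perd by blast
      moreover obtain u v where uv: "bl i = {u..v}" using seg blP by blast
      ultimately have "rk i \<in> {u..v}" "rk j \<in> {u..v}" using blP[of i] blP[of j] by auto
      then have "rk l \<in> {u..v}" using * rk_less[of i l] rk_less[of l j] by simp
      then have "rk l \<in> bl i" using uv by simp
      then show "l mod d = i mod d" using blE[of "bl i" l] blP key by metis
    qed
    then show "blk N x k \<and> k \<notin> {1, N}" using k \<open>k = d\<close> by simp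
  next
    assume a: "blk N x k \<and> k \<notin> {1, N}"
    then have b: "blk N x k" and dv: "k dvd N" using blk_dvd_period by auto
    have k0: "0 < k" using dv N0 dvd_pos_nat by blast
    define cl where "cl u = rk ` {i. i mod k = u}" for u
    have cl_mem: "rk i \<in> cl u \<longleftrightarrow> i mod k = u" for i u
      unfolding cl_def using rk_eq mod_mod_dvd[OF _ dv] by blast
    have inj: "inj_on cl {..<k}"
      by (rule inj_onI) (metis cl_mem lessThan_iff mod_less)
    have "partition_on {1..N} (cl ` {..<k})"
    proof (rule partition_onI)
      show "\<Union> (cl ` {..<k}) = {1..N}"
      proof -
        have "\<Union> (cl ` {..<k}) = range rk"
          unfolding cl_def using k0 by (auto intro!: bexI[of _ "_ mod k"])
        then show ?thesis using rk_range by simp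
      qed
      have "cl u \<noteq> {}" if "u < k" for u using cl_mem[of u u] that by auto
      then show "{} \<notin> cl ` {..<k}" by fastforce
      show "disjnt p q" if "p \<in> cl ` {..<k}" "q \<in> cl ` {..<k}" "p \<noteq> q" for p q
      proof -
        obtain u v where uv: "p = cl u" "q = cl v" using \<open>p \<in> _\<close> \<open>q \<in> _\<close> by blast
        have "u = v" if "n \<in> cl u" "n \<in> cl v" for n
        proof -
          obtain i where "n = rk i" using \<open>n \<in> cl u\<close> by (auto simp: cl_def)
          then show ?thesis using that cl_mem by simp
        qed
        then show ?thesis using uv \<open>p \<noteq> q\<close> unfolding disjnt_def by blast
      qed
    qed
    moreover have "\<exists>i j. cl u = {i..j}" if "u < k" for u
    proof -
      have ne: "cl u \<noteq> {}" using cl_mem[of u u] that by auto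
      have sub: "cl u \<subseteq> {1..N}" using rk_range unfolding cl_def by blast
      then have fin: "finite (cl u)" using finite_subset by blast
      have "\<exists>i. rk i = n \<and> i mod k = u" if "n \<in> cl u" for n using that unfolding cl_def by auto
      then obtain i j where ij: "rk i = Min (cl u)" "rk j = Max (cl u)" "i mod k = u" "j mod k = u"
        using Min_in[OF fin ne] Max_in[OF fin ne] by metis
      have "n \<in> cl u" if n: "Min (cl u) \<le> n" "n \<le> Max (cl u)" for n
      proof -
        have "n \<in> {1..N}" using n Min_in[OF fin ne] Max_in[OF fin ne] sub by (meson atLeastAtMost_iff le_trans subsetD)
        then obtain l where l: "n = rk l" using rk_range by (metis imageE)
        show ?thesis
        proof (cases "rk l = rk i \<or> rk l = rk j")
          case True then show ?thesis using l ij cl_mem by metis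
        next
          case False
          then have "rk i < rk l" "rk l < rk j" using n l ij by auto
          then have "l mod k = u" using blkD[OF b, of i l j] rk_less ij by metis
          then show ?thesis using l cl_mem by simp
        qed
      qed
      then have "{Min (cl u)..Max (cl u)} \<subseteq> cl u" by auto
      then have "cl u = {Min (cl u)..Max (cl u)}" using fin by (auto simp: Min_le Max_ge)
      then show ?thesis by blast
    qed
    moreover have img: "\<pi> ` cl u = cl (Suc u mod k)" if "u < k" for u
    proof (intro equalityI subsetI)
      fix n assume "n \<in> \<pi> ` cl u"
      then obtain i where i: "n = rk (Suc i)" "i mod k = u" using pi by (auto simp: cl_def)
      then have "Suc i mod k = Suc u mod k" by (metis mod_Suc_eq)
      then show "n \<in> cl (Suc u mod k)" using i cl_mem by simp
    next
      fix n assume "n \<in> cl (Suc u mod k)"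
      then obtain i where i: "n = rk i" "i mod k = Suc u mod k" by (auto simp: cl_def)
      define i' where "i' = i + N - 1"
      have "Suc i' = i + N" using N0 by (simp add: i'_def)
      moreover have "(i + N) mod k = i mod k" using dv add_mod_iff by blast
      ultimately have *: "Suc i' mod k = Suc u mod k" "rk (Suc i') = n"
        using i rk_eq[of "i + N" i] by auto
      have "i' mod k = u mod k"
      proof -
        have "(i' + 1 + (k - 1)) mod k = (u + 1 + (k - 1)) mod k" using *(1) by (metis Suc_eq_plus1 mod_add_left_eq)
        then show ?thesis using k0 by simp
      qed
      then show "n \<in> \<pi> ` cl u" using * pi[of i'] cl_mem that by (metis image_eqI mod_less)
    qed
    have "bij_betw (\<lambda>B. \<pi> ` B) (cl ` {..<k}) (cl ` {..<k})"
    proof -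
      have "(\<lambda>B. \<pi> ` B) ` (cl ` {..<k}) = cl ` {..<k}"
      proof (intro equalityI subsetI)
        fix p assume "p \<in> cl ` {..<k}"
        then obtain u where u: "u < k" "p = cl u" by auto
        define v where "v = (u + k - 1) mod k"
        have "Suc v mod k = u" "v < k" using u k0 by (simp_all add: v_def mod_Suc_eq)
        then have "p = \<pi> ` cl v" "v \<in> {..<k}" using img[of v] u by auto
        then show "p \<in> (\<lambda>B. \<pi> ` B) ` (cl ` {..<k})" by blast
      qed (use img k0 in auto)
      moreover have "finite (cl ` {..<k})" by simp
      ultimately show ?thesis unfolding bij_betw_def by (metis eq_card_imp_inj_on)
    qed
    ultimately have "block_structure N \<pi> (cl ` {..<k})" unfolding block_structure_def by blast
    moreover have "card (cl ` {..<k}) = k" using inj by (simp add: card_image)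
    ultimately show "k \<in> block_periods N \<pi>" using a unfolding block_periods_def by blast
  qed
  then show ?thesis unfolding \<pi>_def P_def by auto
qed

lemma perm_tower_chain:
  assumes S: "block_periods N \<pi> = S - {1, N}" and fin: "finite S" and mem: "1 \<in> S" "N \<in> S" "1 < N"
    and dv: "\<And>k. k \<in> S \<Longrightarrow> 0 < k \<and> k dvd N" and ch: "\<And>k k'. k \<in> S \<Longrightarrow> k' \<in> S \<Longrightarrow> k \<le> k' \<Longrightarrow> k dvd k'"
  shows "finite_tower (perm_tower N \<pi>) \<and> prods (perm_tower N \<pi>) = S"
proof -
  define ps where "ps = sorted_list_of_set (S - {1, N})"
  have ps: "sorted_wrt (<) ps" "set ps = S - {1, N}" using fin by (auto simp: ps_def)
  have bnd: "1 < k \<and> k < N" if "k \<in> set ps" for k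
  proof -
    have "k \<noteq> 1" "k \<noteq> N" "0 < k" "k dvd N" using that ps(2) dv[of k] by auto
    then show ?thesis using dvd_imp_le[of k N] mem(3) by linarith
  qed
  have chn: "sorted_wrt (\<lambda>u v. u < v \<and> u dvd v) (1 # ps @ [N])"
  proof -
    have "sorted_wrt (<) (1 # ps @ [N])" using ps(1) bnd mem(3) by (auto simp: sorted_wrt_append)
    moreover have "set (1 # ps @ [N]) \<subseteq> S" using ps(2) mem by auto
    ultimately show ?thesis
      by (metis (mono_tags, lifting) ch less_imp_le sorted_wrt_mono_rel subsetD)
  qed
  have "perm_tower N \<pi> = map2 (div) (ps @ [N]) (1 # ps @ [N])"
    unfolding perm_tower_def Let_def S ps_def[symmetric]
    by (simp add: zip_append2[of "ps @ [N]" "1 # ps" "[N]", simplified])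
  then have "(\<forall>m\<in>set (perm_tower N \<pi>). 1 < m) \<and> prods (perm_tower N \<pi>) = set (1 # ps @ [N])"
    using map2_div_chain[OF chn] by simp
  moreover have "set (1 # ps @ [N]) = S" using ps(2) mem by auto
  ultimately show ?thesis
    unfolding finite_tower_def by (metis mem(2,3) nat_neq_iff prods_Nil singletonD)
qed

text \<open>The tower of a cycle is determined by the set of the periods \<open>k\<close> whose residue classes are
  convex along the orbit; all further reasoning about towers goes through this set.\<close>

lemma towers_of_cycles_eq: "towers_of_cycles a b f = {M. finite_tower M \<and> realizes f {a..b} M}"
proof -
  have tower: "finite_tower (cycle_tower f (range x)) \<and> prods (cycle_tower f (range x)) = {k. blk N x k}"
    if c: "cyc N x" and f: "\<And>i. f (x i) = x (Suc i)" and N: "1 < N" for x N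
    unfolding cycle_tower_def cyc_card[OF c]
  proof (rule perm_tower_chain[OF block_periods_eq[OF c f]])
    show "0 < k \<and> k dvd N" if "k \<in> {k. blk N x k}" for k
      using that N blk_dvd_period by (metis dvd_pos_nat less_trans mem_Collect_eq zero_less_one)
    have "{k. blk N x k} \<subseteq> {..N}" using N blk_dvd_period dvd_imp_le by fastforce
    then show "finite {k. blk N x k}" using finite_subset by blast
  qed (use N blk_1 blk_N[OF c] blk_nested[OF c] in auto)
  show ?thesis
  proof (intro equalityI subsetI)
    fix M assume "M \<in> towers_of_cycles a b f"
    then obtain P where M: "M = cycle_tower f P" and P: "P \<subseteq> {a..b}" "cyclic_on f P" "card P \<noteq> 1"
      unfolding towers_of_cycles_def is_cycle_def by blast
    then obtain s where s: "s \<in> P" "P = orbit f s" unfolding cyclic_on_def by blast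
    define x where "x i = (f ^^ i) s" for i
    have orb: "P = {x n | n. 0 < n}" using s orbit_altdef[of f s] by (simp add: x_def)
    then obtain n where n: "0 < n" "x n = s" using s(1) by auto
    define N where "N = (LEAST n. 0 < n \<and> x n = s)"
    have N: "0 < N" "x N = s" and Nmin: "\<And>e. 0 < e \<Longrightarrow> x e = s \<Longrightarrow> N \<le> e"
      using LeastI[of "\<lambda>n. 0 < n \<and> x n = s" n] n Least_le[of "\<lambda>n. 0 < n \<and> x n = s"]
      unfolding N_def by auto
    have xs: "x (i + j) = (f ^^ i) (x j)" for i j by (simp add: x_def funpow_add)
    have per: "x (i + N) = x i" for i using xs[of i N] N xs[of i 0] by (simp add: x_def)
    have c: "cyc N x"
    proof -
      have "\<not> i < j" if "i < N" "j < N" "x i = x j" for i j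
      proof
        assume "i < j"
        have "x (N - j + i) = x (N - j + j)" using xs that(3) by metis
        then have "x (N - j + i) = s" using N that by simp
        moreover have "0 < N - j + i" "N - j + i < N" using that \<open>i < j\<close> by auto
        ultimately show False using Nmin[of "N - j + i"] by linarith
      qed
      then show ?thesis unfolding cyc_def inj_on_def using N per by (metis lessThan_iff nat_neq_iff)
    qed
    have rng: "range x = P"
    proof -
      have "x i \<in> P" for i unfolding orb using per[of i] N by (metis (mono_tags, lifting) add_gr_0 mem_Collect_eq)
      then show ?thesis unfolding orb by auto
    qed
    have f: "f (x i) = x (Suc i)" for i by (simp add: x_def)
    have "N \<noteq> 1" using P(3) cyc_card[OF c] rng by simp
    then have "1 < N" using N by simp
    then show "M \<in> {M. finite_tower M \<and> realizes f {a..b} M}"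
      using tower[OF c f] M rng P(1) c f unfolding realizes_def by auto
  next
    fix M assume "M \<in> {M. finite_tower M \<and> realizes f {a..b} M}"
    then obtain x N where M: "finite_tower M" and c: "cyc N x" and f: "\<And>i. f (x i) = x (Suc i)"
      and r: "range x \<subseteq> {a..b}" and D: "{k. blk N x k} = prods M"
      unfolding realizes_def by auto
    have "1 < prod_list M" using M prod_list_gt1 unfolding finite_tower_def by blast
    moreover have "prod_list M dvd N" using prod_list_in_prods[of M] D blk_dvd_period by blast
    ultimately have N: "1 < N" using cyc_pos[OF c] by (metis dvd_imp_le less_le_trans)
    have xs: "x i = (f ^^ i) (x 0)" for i by (induction i) (simp_all flip: f)
    have "orbit f (x 0) = range x"
    proof -
      have "x i = x (i + N)" "0 < i + N" for i using cyc_periodic[OF c, of i] N by auto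
      then have "x i \<in> {x n | n. 0 < n}" for i by blast
      moreover have "orbit f (x 0) = {x n | n. 0 < n}" unfolding orbit_altdef xs[symmetric] by simp
      ultimately show ?thesis by auto
    qed
    then have "cyclic_on f (range x)" unfolding cyclic_on_def by (metis rangeI)
    moreover have "cycle_tower f (range x) = M"
      using tower[OF c f N] M D prods_inj unfolding finite_tower_def by metis
    ultimately show "M \<in> towers_of_cycles a b f"
      using r N cyc_card[OF c] unfolding towers_of_cycles_def is_cycle_def by force
  qed
qed

lemma blk_separated:
  assumes c: "cyc N x" and b: "blk N x K" and ij: "i mod K \<noteq> j mod K" "x i < x j"
    and c': "i' mod K = i mod K" "j' mod K = j mod K"
  shows "x i' < x j'"
proof (rule ccontr)
  assume n: "\<not> x i' < x j'"
  have neq: "x u \<noteq> x v" if "u mod K \<noteq> v mod K" for u v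
    using that cyc_eq_iff[OF c] mod_mod_dvd blk_dvd_period[OF b] by blast
  then have gt: "x j' < x i'" using n neq[of i' j'] ij c' by (metis linorder_neqE_linordered_idom)
  show False
  proof (cases "x i < x j'")
    case True then show False using blkD[OF b, of i j' i'] gt ij c' by metis
  next
    case False
    then have "x j' < x i" using neq[of i j'] ij c' by (metis linorder_neqE_linordered_idom)
    then show False using blkD[OF b, of j' i j] ij c' by metis
  qed
qed

text \<open>Blocks that are unions of classes modulo \<open>K\<close> depend only on the order of these classes.\<close>

lemma blk_transfer:
  assumes x: "blk N x k" and K: "k dvd K" "blk N' y K"
    and ord: "\<And>i j. i mod K \<noteq> j mod K \<Longrightarrow> y i < y j \<Longrightarrow> x i < x j"
  shows "blk N' y k"
proof (rule blkI)
  show "k dvd N'" using K blk_dvd_period dvd_trans by blast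
  fix i j l assume a: "y i < y l" "y l < y j" "i mod k = j mod k"
  show "l mod k = i mod k"
  proof (cases "l mod K = i mod K \<or> l mod K = j mod K")
    case True then show ?thesis using a(3) mod_mod_dvd[OF _ K(1)] by metis
  next
    case False
    then have "i mod K \<noteq> l mod K" "l mod K \<noteq> j mod K" by auto
    then show ?thesis using ord a blkD[OF x, of i l j] by blast
  qed
qed

text \<open>Inside the blocks of period \<open>m\<close> every class is ordered like the sequence \<open>z\<close> of the points in one of them, up to
  a shift of time and a reversal, so finer blocks of \<open>Z\<close> are blocks of \<open>z\<close>.\<close>

lemma blk_mult_iff:
  assumes m: "0 < m" and b: "blk (m * q) Z m"
    and c0: "\<And>i j. Z (m * i) < Z (m * j) \<longleftrightarrow> z i < z j"
    and cl: "\<And>c. c < m \<Longrightarrow> \<exists>\<delta>. (\<forall>i j. Z (m * i + c) < Z (m * j + c) \<longrightarrow> z (i + \<delta>) < z (j + \<delta>)) \<or>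
                                   (\<forall>i j. Z (m * i + c) < Z (m * j + c) \<longrightarrow> z (j + \<delta>) < z (i + \<delta>))"
  shows "blk (m * q) Z (m * k) \<longleftrightarrow> blk q z k"
proof
  assume B: "blk (m * q) Z (m * k)"
  show "blk q z k"
  proof (rule blkI)
    show "k dvd q" using blk_dvd_period[OF B] m by simp
    fix i j l assume "z i < z l" "z l < z j" "i mod k = j mod k"
    then have "(m * l) mod (m * k) = (m * i) mod (m * k)"
      using blkD[OF B, of "m * i" "m * l" "m * j"] c0 by (simp add: mult_mod_right[symmetric])
    then show "l mod k = i mod k" using m by (simp add: mult_mod_right[symmetric])
  qed
next
  assume B: "blk q z k"
  show "blk (m * q) Z (m * k)"
  proof (rule blkI)
    show "m * k dvd m * q" using blk_dvd_period[OF B] by simp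
    fix i j l assume a: "Z i < Z l" "Z l < Z j" "i mod (m * k) = j mod (m * k)"
    define c where "c = i mod m"
    have cj: "j mod m = c" using mod_mod_dvd[OF a(3)] by (simp add: c_def)
    then have cl': "l mod m = c" using blkD[OF b a(1,2)] by (simp add: c_def)
    have e: "i = m * (i div m) + c" "j = m * (j div m) + c" "l = m * (l div m) + c"
      using cj cl' c_def by (metis mult_div_mod_eq)+
    have q: "(i div m) mod k = (j div m) mod k" using a(3) m cj c_def by (simp add: mod_mult2_eq)
    have "c < m" using m by (simp add: c_def)
    then obtain \<delta> where \<delta>: "(\<forall>i j. Z (m * i + c) < Z (m * j + c) \<longrightarrow> z (i + \<delta>) < z (j + \<delta>)) \<or>
                            (\<forall>i j. Z (m * i + c) < Z (m * j + c) \<longrightarrow> z (j + \<delta>) < z (i + \<delta>))"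
      using cl by blast
    have q': "(i div m + \<delta>) mod k = (j div m + \<delta>) mod k" using q by (metis mod_add_left_eq)
    have "(l div m + \<delta>) mod k = (i div m + \<delta>) mod k"
      using \<delta> a(1,2) e q' blkD[OF B, of "i div m + \<delta>" "l div m + \<delta>" "j div m + \<delta>"]
        blkD[OF B, of "j div m + \<delta>" "l div m + \<delta>" "i div m + \<delta>"] by metis
    then have "(l div m) mod k = (i div m) mod k" by (auto simp: nat_mod_eq_iff)
    then show "l mod (m * k) = i mod (m * k)" using cl' c_def by (simp add: mod_mult2_eq)
  qed
qed

text \<open>The periods of a cycle built as an extension with \<open>m\<close> blocks: those of the pattern of the
  blocks, and \<open>m\<close> times those of the return map.\<close>

lemma blk_set_extension:
  assumes c: "cyc (m * q) Z" and m: "0 < m" and b: "blk (m * q) Z m"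
    and c0: "\<And>i j. Z (m * i) < Z (m * j) \<longleftrightarrow> z i < z j"
    and cl: "\<And>c. c < m \<Longrightarrow> \<exists>\<delta>. (\<forall>i j. Z (m * i + c) < Z (m * j + c) \<longrightarrow> z (i + \<delta>) < z (j + \<delta>)) \<or>
                                   (\<forall>i j. Z (m * i + c) < Z (m * j + c) \<longrightarrow> z (j + \<delta>) < z (i + \<delta>))"
  shows "{k. blk (m * q) Z k} = {k. blk (m * q) Z k \<and> k dvd m} \<union> (*) m ` {k. blk q z k}"
proof -
  have "k dvd m \<or> (\<exists>k'. k = m * k')" if "blk (m * q) Z k" for k
    using blk_nested[OF c that b] blk_nested[OF c b that] by (metis dvdE nat_le_linear)
  then show ?thesis using blk_mult_iff[OF m b c0 cl] by blast
qed

section \<open>Covering loops\<close>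

lemma least_preimage:
  fixes g :: "real \<Rightarrow> real"
  assumes "continuous_on {l..u} g" "t0 \<in> {l..u}" "g t0 = v"
  shows "\<exists>s\<in>{l..u}. g s = v \<and> (\<forall>t\<in>{l..u}. g t = v \<longrightarrow> s \<le> t)"
proof -
  have "closed {t \<in> {l..u}. g t = v}" using assms(1) by (intro continuous_closed_preimage_constant) auto
  then have "compact {t \<in> {l..u}. g t = v}"
    by (intro compact_Int_closed[of "{l..u}" "{t \<in> {l..u}. g t = v}", simplified Int_absorb1 Collect_restrict]) auto
  then show ?thesis using compact_attains_inf[of "{t \<in> {l..u}. g t = v}"] assms(2,3) by blast
qed

lemma greatest_preimage:
  fixes g :: "real \<Rightarrow> real"
  assumes "continuous_on {l..u} g" "t0 \<in> {l..u}" "g t0 = v"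
  shows "\<exists>s\<in>{l..u}. g s = v \<and> (\<forall>t\<in>{l..u}. g t = v \<longrightarrow> t \<le> s)"
proof -
  have "closed {t \<in> {l..u}. g t = v}" using assms(1) by (intro continuous_closed_preimage_constant) auto
  then have "compact {t \<in> {l..u}. g t = v}"
    by (intro compact_Int_closed[of "{l..u}" "{t \<in> {l..u}. g t = v}", simplified Int_absorb1 Collect_restrict]) auto
  then show ?thesis using compact_attains_sup[of "{t \<in> {l..u}. g t = v}"] assms(2,3) by blast
qed

lemma exact_cover_incr:
  fixes g :: "real \<Rightarrow> real"
  assumes g: "continuous_on {x..y} g" and le: "x \<le> y" "g x \<le> g y"
  shows "\<exists>l u. x \<le> l \<and> l \<le> u \<and> u \<le> y \<and> g l = g x \<and> g u = g y \<and> g ` {l..u} \<subseteq> {g x..g y}"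
proof -
  obtain u where u: "u \<in> {x..y}" "g u = g y" and umin: "\<And>t. t \<in> {x..y} \<Longrightarrow> g t = g y \<Longrightarrow> u \<le> t"
    using least_preimage[OF g, of y] le by auto
  have gu: "continuous_on {x..u} g" using g u by (auto intro: continuous_on_subset)
  obtain l where l: "l \<in> {x..u}" "g l = g x" and lmax: "\<And>t. t \<in> {x..u} \<Longrightarrow> g t = g x \<Longrightarrow> t \<le> l"
    using greatest_preimage[OF gu, of x] u by auto
  have "g t \<in> {g x..g y}" if t: "t \<in> {l..u}" for t
  proof -
    have "g t \<le> g y"
    proof (rule ccontr)
      assume "\<not> ?thesis"
      moreover have "continuous_on {x..t} g" using g u l t by (auto intro: continuous_on_subset)
      ultimately obtain s where "x \<le> s" "s \<le> t" "g s = g y" using IVT'[of g x "g y" t] le l t by auto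
      then show False using umin[of s] u t \<open>\<not> g t \<le> g y\<close> by (cases "s = t") auto
    qed
    moreover have "g x \<le> g t"
    proof (rule ccontr)
      assume "\<not> ?thesis"
      moreover have "continuous_on {t..u} g" using g u l t by (auto intro: continuous_on_subset)
      ultimately obtain s where "t \<le> s" "s \<le> u" "g s = g x" using IVT'[of g t "g x" u] le u t by auto
      then show False using lmax[of s] l t \<open>\<not> g x \<le> g t\<close> by (cases "s = t") auto
    qed
    ultimately show ?thesis by simp
  qed
  then show ?thesis using u l by (intro exI[of _ l] exI[of _ u]) auto
qed

lemma exact_cover:
  fixes g :: "real \<Rightarrow> real"
  assumes g: "continuous_on {p..q} g" and cd: "c \<le> d" "{c..d} \<subseteq> g ` {p..q}"
  shows "\<exists>l u. p \<le> l \<and> l \<le> u \<and> u \<le> q \<and> g ` {l..u} = {c..d}"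
proof -
  have "c \<in> g ` {p..q}" "d \<in> g ` {p..q}" using cd by auto
  then obtain x y where xy: "x \<in> {p..q}" "g x = c" "y \<in> {p..q}" "g y = d" by blast
  have "\<exists>l u. p \<le> l \<and> l \<le> u \<and> u \<le> q \<and> {g l, g u} = {c, d} \<and> g ` {l..u} \<subseteq> {c..d}"
  proof (cases "x \<le> y")
    case True
    moreover have "continuous_on {x..y} g" using g xy by (auto intro: continuous_on_subset)
    ultimately obtain l u where "x \<le> l" "l \<le> u" "u \<le> y" "g l = c" "g u = d" "g ` {l..u} \<subseteq> {c..d}"
      using exact_cover_incr[of x y g] xy cd by auto
    then show ?thesis using xy by (intro exI[of _ l] exI[of _ u]) auto
  next
    case False
    moreover have "continuous_on {y..x} (\<lambda>t. - g t)" using g xy by (auto intro!: continuous_on_minus intro: continuous_on_subset)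
    ultimately obtain l u where lu: "y \<le> l" "l \<le> u" "u \<le> x" "- g l = - d" "- g u = - c" "(\<lambda>t. - g t) ` {l..u} \<subseteq> {-d..-c}"
      using exact_cover_incr[of y x "\<lambda>t. - g t"] xy cd by auto
    have "g ` {l..u} \<subseteq> {c..d}" using lu(6) by force
    then show ?thesis using lu xy by (intro exI[of _ l] exI[of _ u]) auto
  qed
  then obtain l u where lu: "p \<le> l" "l \<le> u" "u \<le> q" "{g l, g u} = {c, d}" "g ` {l..u} \<subseteq> {c..d}" by blast
  have "connected (g ` {l..u})" using g lu
    by (intro connected_continuous_image) (auto intro: continuous_on_subset)
  moreover have "c \<in> g ` {l..u}" "d \<in> g ` {l..u}" using lu(2,4) by (auto simp: doubleton_eq_iff)
  ultimately have "{c..d} \<subseteq> g ` {l..u}" using connected_contains_Icc by blast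
  then show ?thesis using lu by blast
qed

lemma loop_lemma:
  fixes f :: "real \<Rightarrow> real"
  assumes f: "continuous_on {a..b} f" and J: "\<And>t. l t \<le> u t" "\<And>t. {l t..u t} \<subseteq> {a..b}"
    and cov: "\<And>t. t < L \<Longrightarrow> {l (Suc t)..u (Suc t)} \<subseteq> f ` {l t..u t}" and per: "l L = l 0" "u L = u 0"
  shows "\<exists>z. (\<forall>t\<le>L. (f ^^ t) z \<in> {l t..u t}) \<and> (f ^^ L) z = z"
proof -
  have "\<exists>p q. l 0 \<le> p \<and> p \<le> q \<and> q \<le> u 0 \<and> (\<forall>t\<le>n. (f ^^ t) ` {p..q} \<subseteq> {l t..u t}) \<and>
          (f ^^ n) ` {p..q} = {l n..u n} \<and> continuous_on {p..q} (f ^^ n)" if "n \<le> L" for n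
    using that
  proof (induction n)
    case 0
    show ?case using J(1)[of 0] by (intro exI[of _ "l 0"] exI[of _ "u 0"]) (auto simp: continuous_on_id)
  next
    case (Suc n)
    then obtain p q where pq: "l 0 \<le> p" "p \<le> q" "q \<le> u 0" "\<forall>t\<le>n. (f ^^ t) ` {p..q} \<subseteq> {l t..u t}"
      "(f ^^ n) ` {p..q} = {l n..u n}" "continuous_on {p..q} (f ^^ n)" by auto
    have eq: "f ^^ Suc n = f \<circ> (f ^^ n)" by simp
    have cont: "continuous_on {p..q} (f ^^ Suc n)" unfolding eq
      using pq(5,6) f J(2)[of n] by (intro continuous_on_compose) (auto intro: continuous_on_subset)
    have "{l (Suc n)..u (Suc n)} \<subseteq> (f ^^ Suc n) ` {p..q}"
      unfolding eq image_comp[symmetric] pq(5) using cov Suc.prems by simp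
    then obtain p' q' where p': "p \<le> p'" "p' \<le> q'" "q' \<le> q" "(f ^^ Suc n) ` {p'..q'} = {l (Suc n)..u (Suc n)}"
      using exact_cover[OF cont J(1)] by blast
    have "(f ^^ t) ` {p'..q'} \<subseteq> {l t..u t}" if "t \<le> Suc n" for t
    proof (cases "t = Suc n")
      case False
      then have "(f ^^ t) ` {p..q} \<subseteq> {l t..u t}" using pq(4) that by simp
      then show ?thesis using p' by (meson atLeastatMost_subset_iff image_mono order_trans)
    qed (use p' in simp)
    moreover have "continuous_on {p'..q'} (f ^^ Suc n)" using cont p' by (auto intro: continuous_on_subset)
    ultimately show ?case using p' pq by (intro exI[of _ p'] exI[of _ q']) auto
  qed
  from this[of L] obtain p q where pq: "l 0 \<le> p" "p \<le> q" "q \<le> u 0" "\<forall>t\<le>L. (f ^^ t) ` {p..q} \<subseteq> {l t..u t}"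
      "(f ^^ L) ` {p..q} = {l 0..u 0}" "continuous_on {p..q} (f ^^ L)" using per by auto
  let ?h = "\<lambda>x. (f ^^ L) x - x"
  have "connected (?h ` {p..q})" using pq(6) by (intro connected_continuous_image continuous_intros) auto
  moreover have "l 0 \<in> (f ^^ L) ` {p..q}" "u 0 \<in> (f ^^ L) ` {p..q}" using pq(5) J(1)[of 0] by auto
  then obtain s t where "s \<in> {p..q}" "(f ^^ L) s = l 0" "t \<in> {p..q}" "(f ^^ L) t = u 0" by fastforce
  moreover from this have "?h s \<le> 0" "0 \<le> ?h t" using pq by auto
  ultimately have "0 \<in> ?h ` {p..q}"
    using connected_contains_Icc[of "?h ` {p..q}" "?h s" "?h t"] by (meson atLeastAtMost_iff imageI subsetD)
  then obtain z where "z \<in> {p..q}" "(f ^^ L) z = z" by auto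
  then show ?thesis using pq(4) by blast
qed

lemma funpow_periodic: assumes "(f ^^ K) z = z" shows "(f ^^ (t + K)) z = (f ^^ t) z"
  using assms by (simp add: funpow_add)

text \<open>Collapsing blocks: the convex hulls of the blocks cover each other cyclically, so the map has a
  cycle with one point in each of them.\<close>

lemma realizes_prefix:
  assumes f: "continuous_on {a..b} f" and r: "realizes f {a..b} (M @ M')"
    and gt: "\<forall>m\<in>set (M @ M'). 1 < m"
  shows "realizes f {a..b} M"
proof -
  obtain x N where c: "cyc N x" and fx: "\<And>i. f (x i) = x (Suc i)" and rng: "range x \<subseteq> {a..b}"
    and D: "{k. blk N x k} = prods (M @ M')" using r unfolding realizes_def by blast
  define K where "K = prod_list M"
  have "K \<in> prods (M @ M')" unfolding prods_append K_def using prod_list_in_prods by blast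
  then have bK: "blk N x K" using D by blast
  have K0: "0 < K" using prod_list_ge1[of M] gt by (simp add: K_def)
  define cl where "cl t = x ` {i. i mod K = t mod K}" for t
  have fin: "finite (cl t)" and ne: "cl t \<noteq> {}" for t
    using cyc_finite[OF c] by (auto simp: cl_def intro: finite_subset[of _ "range x"])
  define l u where "l t = Min (cl t)" and "u t = Max (cl t)" for t
  have lu: "l t \<in> cl t" "u t \<in> cl t" for t using Min_in[OF fin ne] Max_in[OF fin ne] by (auto simp: l_def u_def)
  have bnd: "cl t \<subseteq> {l t..u t}" for t using fin by (auto simp: l_def u_def)
  have clab: "cl t \<subseteq> {a..b}" for t using rng by (auto simp: cl_def)
  have luab: "l t \<le> u t" "{l t..u t} \<subseteq> {a..b}" for t
  proof -
    have "l t \<in> {a..b}" "u t \<in> {a..b}" "u t \<in> {l t..u t}" using lu[of t] bnd[of t] clab[of t] by blast+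
    then show "l t \<le> u t" "{l t..u t} \<subseteq> {a..b}" by auto
  qed
  have step: "cl (Suc t) \<subseteq> f ` cl t" for t
  proof
    fix y assume "y \<in> cl (Suc t)"
    then obtain i where i: "y = x i" "i mod K = Suc t mod K" by (auto simp: cl_def)
    define i' where "i' = i + N - 1"
    have S: "Suc i' = i + N" using cyc_pos[OF c] by (simp add: i'_def)
    have "Suc i' mod K = Suc t mod K" using S i(2) blk_dvd_period[OF bK] add_mod_iff by metis
    then have "(i' + 1 + (K - 1)) mod K = (t + 1 + (K - 1)) mod K" by (metis Suc_eq_plus1 mod_add_left_eq)
    then have "i' mod K = t mod K" using K0 by simp
    moreover have "y = f (x i')" using fx[of i'] S i(1) cyc_periodic[OF c] by simp
    ultimately show "y \<in> f ` cl t" by (auto simp: cl_def)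
  qed
  have cov: "{l (Suc t)..u (Suc t)} \<subseteq> f ` {l t..u t}" for t
  proof -
    have "continuous_on {l t..u t} f" by (rule continuous_on_subset[OF f luab(2)])
    then have "connected (f ` {l t..u t})" by (intro connected_continuous_image) auto
    moreover have "l (Suc t) \<in> f ` {l t..u t}" "u (Suc t) \<in> f ` {l t..u t}"
      using lu[of "Suc t"] step[of t] bnd[of t] by blast+
    ultimately show ?thesis using connected_contains_Icc by blast
  qed
  have "cl K = cl 0" by (simp add: cl_def)
  then obtain z0 where z0: "\<And>t. t \<le> K \<Longrightarrow> (f ^^ t) z0 \<in> {l t..u t}" "(f ^^ K) z0 = z0"
    using loop_lemma[where l = l and u = u and L = K, OF f luab cov] by (auto simp: l_def u_def)
  define z where "z t = (f ^^ t) z0" for t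
  have zper: "z (t + K) = z t" for t using funpow_periodic[OF z0(2)] by (simp add: z_def)
  have zin: "z t \<in> {l t..u t}" for t
  proof -
    have "z (t mod K) \<in> {l (t mod K)..u (t mod K)}" using z0(1)[of "t mod K"] K0 by (simp add: z_def)
    moreover have "z (t mod K) = z t" using periodic_mod[of z K] zper by blast
    moreover have "cl (t mod K) = cl t" by (simp add: cl_def)
    ultimately show ?thesis by (simp add: l_def u_def)
  qed
  have zless: "z i < z j" if "i mod K \<noteq> j mod K" "x i < x j" for i j
  proof -
    obtain i' j' where "u i = x i'" "i' mod K = i mod K" "l j = x j'" "j' mod K = j mod K"
      using lu(2)[of i] lu(1)[of j] by (auto simp: cl_def)
    then have "u i < l j" using blk_separated[OF c bK that] by simp
    then show ?thesis using zin[of i] zin[of j] by simp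
  qed
  have xneq: "x i \<noteq> x j" if "i mod K \<noteq> j mod K" for i j
    using that cyc_eq_iff[OF c] mod_mod_dvd blk_dvd_period[OF bK] by blast
  have xless: "x i < x j" if "i mod K \<noteq> j mod K" "z i < z j" for i j
    using zless[of j i] that xneq[of i j] by (metis less_asym linorder_neqE_linordered_idom)
  have cz: "cyc K z"
  proof (rule cycI)
    fix i j assume "z i = z j"
    then show "i mod K = j mod K" using zless[of i j] zless[of j i] xneq[of i j]
      by (metis less_irrefl linorder_neqE_linordered_idom)
  qed (use K0 zper in auto)
  have "{k. blk K z k} = prods M"
  proof (intro equalityI subsetI)
    fix k assume "k \<in> {k. blk K z k}"
    then have k: "blk K z k" "k dvd K" using blk_dvd_period by auto
    have "blk N x k" using blk_transfer[OF k(1,2) bK] zless by blast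
    then have "k \<in> prods M \<or> (\<exists>k'\<in>prods M'. k = K * k')" using D unfolding prods_append K_def by blast
    then show "k \<in> prods M"
      using k(2) K0 prod_list_in_prods[of M] by (auto simp: K_def)
  next
    fix k assume k: "k \<in> prods M"
    then have "blk N x k" using D unfolding prods_append by blast
    then show "k \<in> {k. blk K z k}" using blk_transfer[OF _ _ blk_N[OF cz]] xless prods_dvd[OF k] by (simp add: K_def)
  qed
  moreover have "range z \<subseteq> {a..b}" using zin luab by blast
  moreover have "f (z i) = z (Suc i)" for i by (simp add: z_def)
  ultimately show ?thesis using cz unfolding realizes_def by blast
qed

section \<open>Cycles of a pair of inverse branches\<close>

lemma blk_by_key:
  fixes key :: "nat \<Rightarrow> nat"
  assumes "m dvd N" "\<And>i j. key i < key j \<Longrightarrow> Z i < Z j" "\<And>i j. key i = key j \<longleftrightarrow> i mod m = j mod m"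
  shows "blk N Z m"
proof (rule blkI)
  fix i j l assume a: "Z i < Z l" "Z l < Z j" "i mod m = j mod m"
  then have "key i = key j" using assms(3) by blast
  then have "key l = key i" using assms(2)[of l i] assms(2)[of j l] a by (metis less_asym linorder_neqE_nat)
  then show "l mod m = i mod m" using assms(3) by blast
qed (rule assms)

lemma blk_uminus: "blk N (\<lambda>i. - x i) k \<longleftrightarrow> blk N x k"
proof -
  have *: "blk N x k \<Longrightarrow> blk N (\<lambda>i. - x i) k" for x
  proof (rule blkI)
    fix i j l assume b: "blk N x k" and "- x i < - x l" "- x l < - x j" "i mod k = j mod k"
    then show "l mod k = i mod k" using blkD[OF b, of j l i] by simp
  qed (rule blk_dvd_period)
  show ?thesis using *[of x] *[of "\<lambda>i. - x i"] by auto
qed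

lemma cyc_uminus: "cyc N (\<lambda>i. - x i) \<longleftrightarrow> cyc N x"
  by (simp add: cyc_def inj_on_def)

lemma mono_fixed_point:
  fixes g :: "real \<Rightarrow> real"
  assumes "al \<le> be" "\<And>x. x \<in> {al..be} \<Longrightarrow> g x \<in> {al..be}"
    and mono: "\<And>x y. x \<in> {al..be} \<Longrightarrow> y \<in> {al..be} \<Longrightarrow> x \<le> y \<Longrightarrow> g x \<le> g y"
  shows "\<exists>x\<in>{al..be}. g x = x"
proof -
  define S where "S = {x \<in> {al..be}. x \<le> g x}"
  define s where "s = Sup S"
  have al: "al \<in> S" using assms by (auto simp: S_def)
  have bdd: "bdd_above S" by (auto simp: S_def intro: bdd_aboveI[of _ be])
  have s: "s \<in> {al..be}" using al bdd unfolding s_def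
    by (auto simp: S_def intro!: cSup_upper cSup_least)
  have "x \<le> g s" if "x \<in> S" for x
  proof -
    have "x \<le> s" using that bdd unfolding s_def by (rule cSup_upper)
    then show ?thesis using mono[of x s] that s by (auto simp: S_def)
  qed
  then have sg: "s \<le> g s" unfolding s_def using al by (intro cSup_least) auto
  then have "g s \<in> S" using assms(2)[OF s] mono[of s "g s"] s by (simp add: S_def)
  then have "g s \<le> s" using bdd unfolding s_def by (rule cSup_upper)
  then show ?thesis using sg s by (intro bexI[of _ s]) auto
qed

text \<open>The two monotone inverse branches of a unimodal map; the values of the increasing one are to the left.
  Working with inverse branches avoids any choice of preimages when following an itinerary backwards.\<close>

definition branch_pair :: "(real \<Rightarrow> real) \<Rightarrow> (real \<Rightarrow> real) \<Rightarrow> real \<Rightarrow> real \<Rightarrow> bool" where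
  "branch_pair A B al be \<longleftrightarrow> al < be \<and> (\<forall>x\<in>{al..be}. A x \<in> {al..be} \<and> B x \<in> {al..be}) \<and>
     (\<forall>x\<in>{al..be}. \<forall>y\<in>{al..be}. x < y \<longrightarrow> A x < A y \<and> B y < B x) \<and>
     (\<forall>x\<in>{al..be}. \<forall>y\<in>{al..be}. A x \<le> B y)"

text \<open>The word \<open>W\<close> followed by either branch describes the \<open>m\<close>-th iterate on an interval that returns to
  itself.  There it is again unimodal, but upside down, which is why the new pair is conjugated by negation.\<close>

lemma branch_pair_renormalize:
  fixes A B :: "real \<Rightarrow> real" and m :: nat
  defines "W \<equiv> \<lambda>x. B ((A ^^ (m - 2)) x)"
  assumes bp: "branch_pair A B al be" and m: "2 \<le> m"
  shows "\<exists>xs. xs \<in> {al..be} \<and> xs \<le> W xs \<and> (3 \<le> m \<longrightarrow> xs < W xs) \<and> al < A (W xs) \<and> A (W xs) < xs \<and>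
           branch_pair (\<lambda>x. - B (W (- x))) (\<lambda>x. - A (W (- x))) (- xs) (- A (W xs))"
proof -
  have ab: "al < be" and rA: "\<And>x. x \<in> {al..be} \<Longrightarrow> A x \<in> {al..be}" and rB: "\<And>x. x \<in> {al..be} \<Longrightarrow> B x \<in> {al..be}"
    and mA: "\<And>x y. x \<in> {al..be} \<Longrightarrow> y \<in> {al..be} \<Longrightarrow> x < y \<Longrightarrow> A x < A y"
    and mB: "\<And>x y. x \<in> {al..be} \<Longrightarrow> y \<in> {al..be} \<Longrightarrow> x < y \<Longrightarrow> B y < B x"
    and sep: "\<And>x y. x \<in> {al..be} \<Longrightarrow> y \<in> {al..be} \<Longrightarrow> A x \<le> B y"
    using bp unfolding branch_pair_def by blast+
  have I: "al \<in> {al..be}" "be \<in> {al..be}" using ab by auto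
  have mA': "A x \<le> A y" if "x \<in> {al..be}" "y \<in> {al..be}" "x \<le> y" for x y
    using mA[of x y] that by (cases "x = y") auto
  have mB': "B y \<le> B x" if "x \<in> {al..be}" "y \<in> {al..be}" "x \<le> y" for x y
    using mB[of x y] that by (cases "x = y") auto
  define P where "P e = A ^^ e" for e
  have P0: "P 0 x = x" and PS: "P (Suc e) x = A (P e x)" for e x by (simp_all add: P_def)
  have rP: "P e x \<in> {al..be}" if "x \<in> {al..be}" for e x by (induction e) (use that rA in \<open>simp_all add: P0 PS\<close>)
  have mP: "P e x < P e y" if "x \<in> {al..be}" "y \<in> {al..be}" "x < y" for e x y
    by (induction e) (use that rP mA in \<open>simp_all add: P0 PS\<close>)
  have mP': "P e x \<le> P e y" if "x \<in> {al..be}" "y \<in> {al..be}" "x \<le> y" for e x y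
    using mP[of x y e] that by (cases "x = y") auto
  have A_gt: "al < A x" if "x \<in> {al..be}" "al < x" for x using mA[OF I(1) that] rA[OF I(1)] by simp
  have B_gt: "al < B x" if "x \<in> {al..be}" for x using A_gt[OF I(2) ab] sep[OF I(2) that] by simp
  have P_gt: "al < P e x" if "x \<in> {al..be}" "al < x" for e x
    by (induction e) (use that A_gt rP in \<open>simp_all add: P0 PS\<close>)
  have A_lt: "A x < be" if "x \<in> {al..be}" for x
    using mA'[OF that I(2)] sep[OF I(2) I(2)] mB[OF I ab] rB[OF I(1)] that by simp
  \<comment> \<open>For \<open>m = 2\<close> the fixed point of \<open>B \<circ> B\<close> may be one of \<open>B\<close>; otherwise the left one of a pair is taken.\<close>
  have "\<exists>x\<in>{al..be}. B (B (P (m - 2) x)) = x \<and> x \<le> B (P (m - 2) x) \<and> (3 \<le> m \<longrightarrow> x < B (P (m - 2) x))"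
  proof -
    have "\<exists>x\<in>{al..be}. B (B (P (m - 2) x)) = x"
      using ab by (intro mono_fixed_point) (auto intro!: mB' mP' simp del: atLeastAtMost_iff dest: rP rB intro: rP rB)
    then obtain x where x: "x \<in> {al..be}" "B (B (P (m - 2) x)) = x" by blast
    show ?thesis
    proof (cases "3 \<le> m")
      case True
      define e where "e = m - 3"
      have e: "m - 2 = Suc e" using True by (simp add: e_def)
      define U where "U = P (m - 2) x"
      have U: "U = A (P e x)" "U \<in> {al..be}" "U < be" using x A_lt rP rA by (simp_all add: U_def e PS)
      have "U < B U" using mB[OF U(2) I(2) U(3)] sep[OF rP[OF x(1)] I(2), of e] U(1) by simp
      then have "x < B U" using mB[OF U(2) rB[OF U(2)]] x(2) by (simp add: U_def)
      then show ?thesis using x by (auto simp: U_def)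
    next
      case False
      then have "m - 2 = 0" by simp
      then show ?thesis using x rB[OF x(1)] by (cases "x \<le> B x") (auto simp: P0 intro: bexI[of _ "B x"])
    qed
  qed
  then obtain xs where xs: "xs \<in> {al..be}" "B (B (P (m - 2) xs)) = xs" "xs \<le> B (P (m - 2) xs)"
    "3 \<le> m \<Longrightarrow> xs < B (P (m - 2) xs)" by blast
  define U where "U = P (m - 2) xs"
  define V where "V = B U"
  define xt where "xt = A V"
  have U: "U \<in> {al..be}" "al < U" and xs_gt: "al < xs"
    using rP[OF xs(1)] P_gt[OF xs(1)] B_gt[of "B (P (m - 2) xs)"] rB rP xs(1,2) by (auto simp: U_def)
  have V: "V \<in> {al..be}" "V < be" "al < V" "B V = xs" "xs \<le> V"
    using rB[OF U(1)] mB[OF I(1) U] rB[OF I(1)] B_gt[OF U(1)] xs by (auto simp: V_def U_def)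
  have xt: "xt \<in> {al..be}" "al < xt" "xt < xs"
    using rA[OF V(1)] A_gt[OF V(1,3)] mA[OF V(1) I(2) V(2)] sep[OF I(2) I(2)] mB[OF V(1) I(2) V(2)] V(4)
    by (auto simp: xt_def)
  define X where "X = {xt..xs}"
  have X: "x \<in> {al..be}" "al < x" if "x \<in> X" for x using that xt xs by (auto simp: X_def)
  have W_def: "W x = B (P (m - 2) x)" for x by (simp add: assms(1) P_def)
  have W: "W x \<in> {al..be}" if "x \<in> X" for x using rB rP X that by (simp add: W_def)
  have mW: "W y < W x" if "x \<in> X" "y \<in> X" "x < y" for x y
    using that X unfolding W_def by (intro mB mP rP)
  have VW: "V \<le> W x" if "x \<in> X" for x
    unfolding V_def W_def U_def using that X xs by (intro mB' mP' rP) (auto simp: X_def)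
  define A' B' where "A' x = - B (W (- x))" and "B' x = - A (W (- x))" for x
  have bp: "branch_pair A' B' (- xs) (- xt)"
  proof -
    have neg: "- x \<in> X" if "x \<in> {- xs..- xt}" for x using that by (auto simp: X_def)
    have "A' x \<in> {- xs..- xt} \<and> B' x \<in> {- xs..- xt}" if "x \<in> {- xs..- xt}" for x
    proof -
      have "B (W (- x)) \<le> xs" "xt \<le> B (W (- x))" "A (W (- x)) \<le> xs" "xt \<le> A (W (- x))"
        using mB'[OF V(1) W VW] sep[OF V(1) W] sep[OF W V(1)] mA'[OF V(1) W VW] neg[OF that] V(4) by (auto simp: xt_def)
      then show ?thesis by (simp add: A'_def B'_def)
    qed
    moreover have "A' x < A' y \<and> B' y < B' x" if "x \<in> {- xs..- xt}" "y \<in> {- xs..- xt}" "x < y" for x y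
      using mB[OF W W mW] mA[OF W W mW] neg that by (simp add: A'_def B'_def)
    moreover have "A' x \<le> B' y" if "x \<in> {- xs..- xt}" "y \<in> {- xs..- xt}" for x y
      using sep[OF W W] neg that by (simp add: A'_def B'_def)
    ultimately show ?thesis using xt(3) unfolding branch_pair_def by simp
  qed
  have "W xs = V" by (simp add: W_def V_def U_def)
  then have "xs \<in> {al..be} \<and> xs \<le> W xs \<and> (3 \<le> m \<longrightarrow> xs < W xs) \<and> al < A (W xs) \<and> A (W xs) < xs \<and>
      branch_pair (\<lambda>x. - B (W (- x))) (\<lambda>x. - A (W (- x))) (- xs) (- A (W xs))"
    using bp xs xt V by (simp add: xt_def A'_def[abs_def] B'_def[abs_def] W_def)
  then show ?thesis ..
qed

lemma branch_pair_extend: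
  fixes A B :: "real \<Rightarrow> real" and m :: nat
  defines "W \<equiv> \<lambda>x. B ((A ^^ (m - 2)) x)"
  assumes bp: "branch_pair A B al be" and m: "2 \<le> m"
    and xs: "xs \<in> {al..be}" and xt: "al < A (W xs)" "A (W xs) < xs"
    and zX: "\<And>i. z i \<in> {A (W xs)..xs}" and zlt: "\<And>i. z i < W xs"
    and zc: "\<And>i. z i = c i (W (z (Suc i)))" and cAB: "\<And>i. c i = A \<or> c i = B"
    and cper: "\<And>i. c (i + q) = c i" and cz: "cyc q z"
  shows "\<exists>Z C. (\<forall>i. (C i = A \<or> C i = B) \<and> Z i \<in> {al..be} \<and> Z i = C i (Z (Suc i)) \<and> C (i + m * q) = C i)
          \<and> cyc (m * q) Z \<and> {k. blk (m * q) Z k} = {1, m} \<union> (*) m ` {k. blk q z k} \<and> (\<forall>i. al < Z i)"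
proof -
  have ab: "al < be" and rA: "\<And>x. x \<in> {al..be} \<Longrightarrow> A x \<in> {al..be}" and rB: "\<And>x. x \<in> {al..be} \<Longrightarrow> B x \<in> {al..be}"
    and mA: "\<And>x y. x \<in> {al..be} \<Longrightarrow> y \<in> {al..be} \<Longrightarrow> x < y \<Longrightarrow> A x < A y"
    and mB: "\<And>x y. x \<in> {al..be} \<Longrightarrow> y \<in> {al..be} \<Longrightarrow> x < y \<Longrightarrow> B y < B x"
    and sep: "\<And>x y. x \<in> {al..be} \<Longrightarrow> y \<in> {al..be} \<Longrightarrow> A x \<le> B y"
    using bp unfolding branch_pair_def by blast+
  have I: "al \<in> {al..be}" "be \<in> {al..be}" using ab by auto
  have mA': "A x \<le> A y" if "x \<in> {al..be}" "y \<in> {al..be}" "x \<le> y" for x y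
    using mA[of x y] that by (cases "x = y") auto
  have mB': "B y \<le> B x" if "x \<in> {al..be}" "y \<in> {al..be}" "x \<le> y" for x y
    using mB[of x y] that by (cases "x = y") auto
  define P where "P e = A ^^ e" for e
  have P0: "P 0 x = x" and PS: "P (Suc e) x = A (P e x)" for e x by (simp_all add: P_def)
  have rP: "P e x \<in> {al..be}" if "x \<in> {al..be}" for e x by (induction e) (use that rA in \<open>simp_all add: P0 PS\<close>)
  have mP: "P e x < P e y" if "x \<in> {al..be}" "y \<in> {al..be}" "x < y" for e x y
    by (induction e) (use that rP mA in \<open>simp_all add: P0 PS\<close>)
  have mP': "P e x \<le> P e y" if "x \<in> {al..be}" "y \<in> {al..be}" "x \<le> y" for e x y
    using mP[of x y e] that by (cases "x = y") auto
  have A_gt: "al < A x" if "x \<in> {al..be}" "al < x" for x using mA[OF I(1) that] rA[OF I(1)] by simp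
  have B_gt: "al < B x" if "x \<in> {al..be}" for x using A_gt[OF I(2) ab] sep[OF I(2) that] by simp
  have P_gt: "al < P e x" if "x \<in> {al..be}" "al < x" for e x
    by (induction e) (use that A_gt rP in \<open>simp_all add: P0 PS\<close>)
  have A_lt: "A x < be" if "x \<in> {al..be}" for x
    using mA'[OF that I(2)] sep[OF I(2) I(2)] mB[OF I ab] rB[OF I(1)] that by simp
  define V where "V = W xs"
  define xt where "xt = A V"
  define X where "X = {xt..xs}"
  have zX: "z i \<in> X" for i using zX by (simp add: X_def xt_def V_def)
  have zlt: "x < V" if "x = z i" for x i using zlt that by (simp add: V_def)
  have xt: "xt \<in> {al..be}" "al < xt" "xt < xs" using xt xs by (auto simp: xt_def V_def)
  have q0: "0 < q" using cyc_pos[OF cz] .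
  have W_def: "W x = B (P (m - 2) x)" for x by (simp add: assms(1) P_def)
  have V: "V \<in> {al..be}" unfolding V_def W_def by (rule rB[OF rP[OF xs]])
  have X: "x \<in> {al..be}" "al < x" if "x \<in> X" for x using that xt xs by (auto simp: X_def)
  have W: "W x \<in> {al..be}" if "x \<in> X" for x using rB rP X that by (simp add: W_def)
  have mW: "W y < W x" if "x \<in> X" "y \<in> X" "x < y" for x y
    using that X unfolding W_def by (intro mB mP rP)
  have VW: "V \<le> W x" if "x \<in> X" for x
    unfolding V_def W_def using that X xs by (intro mB' mP' rP) (auto simp: X_def)
  define h where "h r x = (if r = 0 then x else if r = 1 then W x else P (m - r) x)" for r :: nat and x
  define \<delta> :: "nat \<Rightarrow> nat" where "\<delta> r = (if r = 0 then 0 else 1)" for r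
  define Z where "Z i = h (i mod m) (z (i div m + \<delta> (i mod m)))" for i
  define CC where "CC i = (if i mod m = 0 then c (i div m) else if i mod m = 1 then B else A)" for i
  have hX: "h r x \<in> {al..be}" "al < h r x" if "x \<in> X" for r x
    using X[OF that] rP[of x] P_gt[of x] W[OF that] B_gt rP by (auto simp: h_def W_def)
  have Zstep: "Z i = CC i (Z (Suc i))" for i
  proof -
    define j r where "j = i div m" and "r = i mod m"
    have r: "r < m" using m by (simp add: r_def)
    have S: "Suc i div m = (if Suc r = m then Suc j else j)" "Suc i mod m = (if Suc r = m then 0 else Suc r)"
      by (simp_all add: j_def r_def div_Suc mod_Suc)
    have Zi: "Z i = h r (z (j + \<delta> r))" "CC i = (if r = 0 then c j else if r = 1 then B else A)"
      by (simp_all add: Z_def CC_def j_def r_def)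
    have ZS: "Z (Suc i) = (if Suc r = m then z (Suc j) else h (Suc r) (z (Suc j)))"
      unfolding Z_def S by (simp add: h_def \<delta>_def)
    consider "r = 0" | "r = 1" | "2 \<le> r" by linarith
    then show ?thesis
    proof cases
      case 1 then show ?thesis using m unfolding Zi ZS by (simp add: h_def \<delta>_def zc[of j])
    next
      case 2 then show ?thesis using m unfolding Zi ZS by (auto simp: h_def \<delta>_def W_def P0 numeral_2_eq_2)
    next
      case 3
      then have "m - r = Suc (m - Suc r)" using r by simp
      then show ?thesis using 3 r unfolding Zi ZS by (auto simp: h_def \<delta>_def PS P0)
    qed
  qed
  have Alt: "A x < y" if "x = z i" "y = z j" for x y i j
  proof -
    have "x \<in> X" "y \<in> X" using zX that by auto
    then have "A x < A V" using mA[OF X(1) V] zlt that by blast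
    then show ?thesis using \<open>y \<in> X\<close> by (simp add: X_def xt_def)
  qed
  have P_lt: "P (Suc e) (z i) < z j" for e i j
  proof (induction e arbitrary: j)
    case 0 then show ?case using Alt by (simp add: PS P0)
  next
    case (Suc e)
    have "P (Suc (Suc e)) (z i) < A (z 0)"
      unfolding PS[of "Suc e"] by (rule mA[OF rP[OF X(1)[OF zX]] X(1)[OF zX] Suc])
    then show ?case using Alt[of "z 0" 0 "z j" j] by simp
  qed
  have PP_lt: "P e (z i) < P e' (z j)" if lt: "e' < e" for e e' i j
  proof -
    obtain d where d: "e = e' + Suc d" using less_imp_Suc_add[OF lt] by auto
    have "P e (z i) = P e' (P (Suc d) (z i))" 
      using fun_cong[OF funpow_add[of e' "Suc d" A], of "z i"] by (simp only: d P_def o_apply)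
    then show ?thesis using mP[OF rP[OF X(1)[OF zX]] X(1)[OF zX] P_lt] by simp
  qed
  define key where "key i = (i + m - 2) mod m" for i
  have key_eq: "key i = key j \<longleftrightarrow> i mod m = j mod m" for i j
  proof -
    have "i + m - 2 = i + (m - 2)" for i using m by simp
    then show ?thesis unfolding key_def by (auto simp: nat_mod_eq_iff)
  qed
  have key_val: "key i = (if i mod m = 0 then m - 2 else if i mod m = 1 then m - 1 else i mod m - 2)" for i
  proof -
    define r where "r = i mod m"
    have r: "r < m" using m by (simp add: r_def)
    have "key i = key r" unfolding key_eq r_def by simp
    moreover have "key r = r - 2" if "2 \<le> r"
    proof -
      have "r + m - 2 = (r - 2) + m" using that by simp
      then show ?thesis unfolding key_def using r by (metis mod_add_self2 mod_less less_imp_diff_less)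
    qed
    ultimately show ?thesis using m r unfolding r_def[symmetric] by (auto simp: key_def)
  qed
  have key_less: "Z i < Z j" if "key i < key j" for i j
  proof -
    define r s where "r = i mod m" and "s = j mod m"
    have rs: "r < m" "s < m" using m by (simp_all add: r_def s_def)
    have k: "(if r = 0 then m - 2 else if r = 1 then m - 1 else r - 2) < (if s = 0 then m - 2 else if s = 1 then m - 1 else s - 2)"
      using that unfolding key_val r_def s_def .
    obtain i' j' where Zij: "Z i = h r (z i')" "Z j = h s (z j')" by (simp add: Z_def r_def s_def)
    have zW: "z i < W (z j)" for i j using zlt[of "z i" i] VW[OF zX[of j]] by simp
    show ?thesis
    proof (cases "s = 1")
      case True
      then have "r \<noteq> 1" using k by auto
      moreover have "P (m - r) (z i') < W (z j')" if "r \<noteq> 0"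
      proof -
        have "m - r = Suc (m - r - 1)" using rs by simp
        then show ?thesis using P_lt[of "m - r - 1" i' 0] zW[of 0 j'] by (metis less_trans)
      qed
      ultimately show ?thesis using zW True unfolding Zij by (simp add: h_def)
    next
      case False
      then have r: "2 \<le> r" using k rs by (auto split: if_splits)
      show ?thesis
      proof (cases "s = 0")
        case True
        then show ?thesis using r PP_lt[of 0 "m - r" i' j'] rs unfolding Zij by (simp add: h_def P0)
      next
        case False
        then have "2 \<le> s" "r < s" using \<open>s \<noteq> 1\<close> k r by auto
        then show ?thesis using r PP_lt[of "m - s" "m - r" i' j'] rs unfolding Zij by (simp add: h_def)
      qed
    qed
  qed
  have mh: "if r = 1 then h r y < h r x else h r x < h r y" if "x \<in> X" "y \<in> X" "x < y" for r x y
    using mW[OF that] mP[of x y] X that by (simp add: h_def)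
  have hinj: "x = y" if "h r x = h r y" "x \<in> X" "y \<in> X" for r x y
  proof (rule ccontr)
    assume "x \<noteq> y"
    then consider "x < y" | "y < x" by linarith
    then show False using mh[of x y r] mh[of y x r] that by cases (auto split: if_splits)
  qed
  have Zform: "Z (m * i + r) = h r (z (i + \<delta> r))" if "r < m" for i r
    using that by (simp add: Z_def)
  have bZ: "blk (m * q) Z m"
    by (rule blk_by_key[of m "m * q" key]) (use key_less key_eq in auto)
  have cZ: "cyc (m * q) Z"
  proof (rule cycI)
    show "0 < m * q" using m q0 by simp
    show "Z (i + m * q) = Z i" for i
    proof -
      have "(i + m * q) div m = i div m + q" "(i + m * q) mod m = i mod m" using m by auto
      then show ?thesis unfolding Z_def using cyc_periodic[OF cz, of "i div m + \<delta> (i mod m)"] by (simp add: algebra_simps)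
    qed
    fix i j assume eq: "Z i = Z j"
    then have "key i = key j" using key_less[of i j] key_less[of j i] by (metis less_irrefl linorder_neqE_nat)
    then have r: "i mod m = j mod m" using key_eq by blast
    then have "z (i div m + \<delta> (i mod m)) = z (j div m + \<delta> (i mod m))" using eq hinj zX unfolding Z_def by metis
    then have "(i div m + \<delta> (i mod m)) mod q = (j div m + \<delta> (i mod m)) mod q" using cyc_eq_iff[OF cz] by blast
    then have "(i div m) mod q = (j div m) mod q" by (auto simp: nat_mod_eq_iff)
    then show "i mod (m * q) = j mod (m * q)" using r by (simp add: mod_mult2_eq)
  qed
  have D1: "{k. blk (m * q) Z k \<and> k dvd m} = {1, m}"
  proof -
    have "k = 1 \<or> k = m" if k: "blk (m * q) Z k" "k dvd m" for k
    proof (rule ccontr)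
      assume n: "\<not> ?thesis"
      then have lt: "1 < k" "k < m" 
        using dvd_imp_le[OF k(2)] dvd_pos_nat[OF _ k(2)] m by linarith+
      have "3 + m - 2 = 1 + m" "2 + k + m - 2 = k + m" by simp_all
      then have "key 2 = 0" "key 3 = 1" "key (2 + k) = k"
        using lt m mod_add_self2[of 1 m] mod_add_self2[of k m] unfolding key_def by simp_all
      then have "Z 2 < Z 3" "Z 3 < Z (2 + k)" using key_less lt by simp_all
      then have "3 mod k = 2 mod k" using blkD[OF k(1), of 2 3 "2 + k"] mod_add_self2[of 2 k] by metis
      then have "k dvd 1" using add_mod_iff[of 2 1 k] by simp
      then show False using lt by simp
    qed
    then show ?thesis using bZ blk_1 by auto
  qed
  have D: "{k. blk (m * q) Z k} = {1, m} \<union> (*) m ` {k. blk q z k}"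
    unfolding D1[symmetric]
  proof (rule blk_set_extension[OF cZ _ bZ])
    show "0 < m" using m by simp
    show "Z (m * i) < Z (m * j) \<longleftrightarrow> z i < z j" for i j using Zform[of 0 i] Zform[of 0 j] m by (simp add: h_def \<delta>_def)
    fix r assume r: "r < m"
    have ord: "z a < z b" if "(r = 1 \<and> h r (z b) < h r (z a)) \<or> (r \<noteq> 1 \<and> h r (z a) < h r (z b))" for a b
      using that mh[of "z b" "z a" r] zX[of a] zX[of b]
      by (cases "z a" "z b" rule: linorder_cases) auto
    show "\<exists>\<delta>. (\<forall>i j. Z (m * i + r) < Z (m * j + r) \<longrightarrow> z (i + \<delta>) < z (j + \<delta>)) \<or>
               (\<forall>i j. Z (m * i + r) < Z (m * j + r) \<longrightarrow> z (j + \<delta>) < z (i + \<delta>))"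
      unfolding Zform[OF r] using ord by (intro exI[of _ "\<delta> r"]) (cases "r = 1", auto)
  qed
  have Zin: "Z i \<in> {al..be}" "al < Z i" for i unfolding Z_def using hX[OF zX] by blast+
  have CCper: "CC (i + m * q) = CC i" for i
  proof -
    have "(i + m * q) div m = i div m + q" "(i + m * q) mod m = i mod m" using m by auto
    then show ?thesis by (simp add: CC_def cper)
  qed
  have "CC i = A \<or> CC i = B" for i using cAB by (simp add: CC_def)
  then show ?thesis using Zin Zstep CCper cZ D by blast
qed

text \<open>By induction on the tower: its first entry is produced by a renormalization, and the remaining ones inside
  the interval of the renormalized map.\<close>

lemma branch_pair_cycle:
  assumes "branch_pair A B al be" "\<forall>m\<in>set ms. 1 < m" "ms \<noteq> [] \<Longrightarrow> 3 \<le> last ms"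
  shows "\<exists>z C. (\<forall>i. (C i = A \<or> C i = B) \<and> z i \<in> {al..be} \<and> z i = C i (z (Suc i)) \<and> C (i + prod_list ms) = C i)
          \<and> cyc (prod_list ms) z \<and> {k. blk (prod_list ms) z k} = prods ms \<and> (ms \<noteq> [] \<longrightarrow> (\<forall>i. al < z i))"
  using assms
proof (induction ms arbitrary: A B al be)
  case Nil
  have "\<exists>x\<in>{al..be}. A x = x"
    using Nil.prems(1) unfolding branch_pair_def by (intro mono_fixed_point) (auto simp: le_less)
  then obtain x where x: "x \<in> {al..be}" "A x = x" by blast
  have "cyc 1 (\<lambda>_. x)" by (rule cycI) auto
  moreover have "{k. blk 1 (\<lambda>_. x) k} = {1}" by (auto simp: blk_def)
  ultimately show ?case using x by (intro exI[of _ "\<lambda>_. x"] exI[of _ "\<lambda>_. A"]) simp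
next
  case (Cons m ms)
  define q where "q = prod_list ms"
  define W where "W x = B ((A ^^ (m - 2)) x)" for x
  have m: "2 \<le> m" using Cons.prems(2) by simp
  obtain xs where xs: "xs \<in> {al..be}" "xs \<le> W xs" "3 \<le> m \<Longrightarrow> xs < W xs" "al < A (W xs)" "A (W xs) < xs"
    and bp: "branch_pair (\<lambda>x. - B (W (- x))) (\<lambda>x. - A (W (- x))) (- xs) (- A (W xs))"
    using branch_pair_renormalize[OF Cons.prems(1) m] unfolding W_def by blast
  have "\<forall>m\<in>set ms. 1 < m" "ms \<noteq> [] \<Longrightarrow> 3 \<le> last ms" using Cons.prems by auto
  from Cons.IH[OF bp this] obtain zn Cn where IH:
    "\<And>i. Cn i = (\<lambda>x. - B (W (- x))) \<or> Cn i = (\<lambda>x. - A (W (- x)))" "\<And>i. zn i \<in> {- xs..- A (W xs)}"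
    "\<And>i. zn i = Cn i (zn (Suc i))" "\<And>i. Cn (i + q) = Cn i" "cyc q zn" "{k. blk q zn k} = prods ms"
    "ms \<noteq> [] \<longrightarrow> (\<forall>i. - xs < zn i)"
    unfolding q_def by blast
  define z where "z i = - zn i" for i
  define c where "c i = (if Cn i = (\<lambda>x. - B (W (- x))) then B else A)" for i
  have zc: "z i = c i (W (z (Suc i)))" for i
  proof (cases "Cn i = (\<lambda>x. - B (W (- x)))")
    case True
    then have "zn i = - B (W (- zn (Suc i)))" using IH(3)[of i] by simp
    then show ?thesis using True by (simp add: z_def c_def)
  next
    case False
    then have "zn i = - A (W (- zn (Suc i)))" using IH(1,3)[of i] by simp
    then show ?thesis using False by (simp add: z_def c_def)
  qed
  have cz: "cyc q z" using IH(5) unfolding z_def[abs_def] cyc_uminus .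
  have Dz: "{k. blk q z k} = prods ms" using IH(6) unfolding z_def[abs_def] blk_uminus .
  have zX: "z i \<in> {A (W xs)..xs}" for i using IH(2)[of i] by (auto simp: z_def)
  have zlt: "z i < W xs" for i
  proof (cases "3 \<le> m")
    case True
    then show ?thesis using xs(3) zX[of i] by auto
  next
    case False
    then have "ms \<noteq> []" using Cons.prems(3) m by auto
    then have "- xs < zn i" using IH(7) by blast
    then show ?thesis using xs(2) by (simp add: z_def)
  qed
  have D: "prods (m # ms) = {1, m} \<union> (*) m ` {k. blk q z k}"
    unfolding Dz prods_Cons using one_in_prods[of ms] by force
  have cAB: "c i = A \<or> c i = B" and cper: "c (i + q) = c i" for i by (simp_all add: c_def IH(4))
  have "\<exists>Z C. (\<forall>i. (C i = A \<or> C i = B) \<and> Z i \<in> {al..be} \<and> Z i = C i (Z (Suc i)) \<and> C (i + m * q) = C i)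
          \<and> cyc (m * q) Z \<and> {k. blk (m * q) Z k} = {1, m} \<union> (*) m ` {k. blk q z k} \<and> (\<forall>i. al < Z i)"
    using branch_pair_extend[OF Cons.prems(1) m xs(1), folded W_def, OF xs(4,5) zX zlt zc cAB cper cz] .
  then obtain Z C where ZC: "\<forall>i. (C i = A \<or> C i = B) \<and> Z i \<in> {al..be} \<and> Z i = C i (Z (Suc i)) \<and> C (i + m * q) = C i"
    "cyc (m * q) Z" "{k. blk (m * q) Z k} = prods (m # ms)" "\<forall>i. al < Z i"
    unfolding D[symmetric] by (elim exE conjE)
  show ?case unfolding prod_list.Cons q_def[symmetric] 
    by (intro exI[of _ Z] exI[of _ C] conjI impI) (rule ZC)+
qed

section \<open>Connect-the-dots maps\<close>

definition adjacent :: "real set \<Rightarrow> real \<Rightarrow> real \<Rightarrow> bool" where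
  "adjacent P u v \<longleftrightarrow> u \<in> P \<and> v \<in> P \<and> u < v \<and> (\<forall>p\<in>P. \<not> (u < p \<and> p < v))"

definition dots_map :: "real set \<Rightarrow> (real \<Rightarrow> real) \<Rightarrow> bool" where
  "dots_map P F \<longleftrightarrow> continuous_on UNIV F \<and>
     (\<forall>u v. adjacent P u v \<longrightarrow> (\<exists>s. \<forall>x\<in>{u..v}. F x = F u + s * (x - u)))"

lemma dots_map_exists: assumes "finite P" shows "\<exists>F. dots_map P F \<and> (\<forall>p\<in>P. F p = g p)"
  using assms
proof (induction rule: finite_linorder_max_induct)
  case empty
  show ?case by (intro exI[of _ "\<lambda>_. 0"]) (auto simp: dots_map_def adjacent_def)
next
  case (insert b A)
  then obtain F where F: "continuous_on UNIV F" "\<And>p. p \<in> A \<Longrightarrow> F p = g p"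
    "\<And>u v. adjacent A u v \<Longrightarrow> \<exists>s. \<forall>x\<in>{u..v}. F x = F u + s * (x - u)" unfolding dots_map_def by blast
  show ?case
  proof (cases "A = {}")
    case True
    then show ?thesis by (intro exI[of _ "\<lambda>_. g b"]) (auto simp: dots_map_def adjacent_def)
  next
    case False
    define M where "M = Max A"
    have M: "M \<in> A" "\<And>p. p \<in> A \<Longrightarrow> p \<le> M" using insert.hyps(1) False by (auto simp: M_def)
    have Mb: "M < b" using M insert.hyps(2) by blast
    define s where "s = (g b - g M) / (b - M)"
    define G where "G x = F (min x M) + s * max (x - M) 0" for x
    have "continuous_on UNIV (\<lambda>x. F (min x M))"
      by (rule continuous_on_compose2[OF F(1)]) (auto intro!: continuous_intros)
    then have "continuous_on UNIV G" unfolding G_def by (intro continuous_intros)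
    moreover have GF: "G x = F x" if "x \<le> M" for x using that by (simp add: G_def min_def max_def)
    moreover have GM: "G x = g M + s * (x - M)" if "M \<le> x" for x using that F(2)[OF M(1)] by (simp add: G_def min_def max_def)
    moreover have "G b = g b" using GM[of b] Mb by (simp add: s_def)
    moreover have "\<exists>s. \<forall>x\<in>{u..v}. G x = G u + s * (x - u)" if a: "adjacent (insert b A) u v" for u v
    proof (cases "v = b")
      case True
      then have "u \<in> A" using a by (auto simp: adjacent_def)
      then have "u \<le> M" "\<not> u < M" using a M Mb True unfolding adjacent_def by auto
      then have "u = M" by simp
      then show ?thesis using GM True by (intro exI[of _ s]) auto
    next
      case False
      then have "v \<in> A" "u \<in> A" using a insert.hyps(2) unfolding adjacent_def by (auto dest: less_asym)
      then have ad: "adjacent A u v" and le: "v \<le> M" "u \<le> M" using a M(2) by (auto simp: adjacent_def)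
      from F(3)[OF ad] obtain s where s: "\<forall>x\<in>{u..v}. F x = F u + s * (x - u)" ..
      have "G x = G u + s * (x - u)" if x: "x \<in> {u..v}" for x
      proof -
        have "x \<le> M" using x le by simp
        then show ?thesis using bspec[OF s x] GF[of x] GF[OF le(2)] by linarith
      qed
      then show ?thesis by blast
    qed
    ultimately show ?thesis using F(2) M(2) by (intro exI[of _ G]) (auto simp: dots_map_def)
  qed
qed

definition left_nb :: "real set \<Rightarrow> real \<Rightarrow> real" where "left_nb P x = Max {p \<in> P. p < x}"
definition right_nb :: "real set \<Rightarrow> real \<Rightarrow> real" where "right_nb P x = Min {p \<in> P. x < p}"

lemma nb_gap:
  assumes "finite P" "x \<notin> P" "lo \<in> P" "hi \<in> P" "lo \<le> x" "x \<le> hi"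
  shows "adjacent P (left_nb P x) (right_nb P x)" "left_nb P x < x" "x < right_nb P x"
proof -
  have "finite {p \<in> P. p < x}" "{p \<in> P. p < x} \<noteq> {}" "finite {p \<in> P. x < p}" "{p \<in> P. x < p} \<noteq> {}"
    using assms by (auto simp: le_less)
  then have l: "left_nb P x \<in> {p \<in> P. p < x}" "right_nb P x \<in> {p \<in> P. x < p}"
    unfolding left_nb_def right_nb_def using Max_in Min_in by blast+
  have m: "p \<le> left_nb P x" if "p \<in> P" "p < x" for p
    unfolding left_nb_def using that assms(1) by (intro Max_ge) auto
  have m': "right_nb P x \<le> p" if "p \<in> P" "x < p" for p
    unfolding right_nb_def using that assms(1) by (intro Min_le) auto
  show "left_nb P x < x" "x < right_nb P x" using l by auto
  have "\<not> (left_nb P x < p \<and> p < right_nb P x)" if "p \<in> P" for p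
    using m[OF that] m'[OF that] that assms(2) by (cases "p < x") (auto simp: not_less le_less)
  then show "adjacent P (left_nb P x) (right_nb P x)" using l unfolding adjacent_def by auto
qed

lemma adjacent_unique:
  assumes "adjacent P u v" "adjacent P u' v'" "u < x" "x < v" "u' \<le> x" "x \<le> v'"
  shows "u' = u" "v' = v"
  using assms unfolding adjacent_def
  by (metis dual_order.strict_trans1 dual_order.strict_trans2 le_less_trans less_le_trans linorder_neqE_linordered_idom)+

text \<open>A gap containing the image of a point of a gap is covered by the image of that gap; so the
  lengths of the gaps along a periodic itinerary force the product of the slopes to be at least one,
  and it equals one only if the gaps are permuted exactly.  Two periodic orbits with a common
  itinerary make it equal to one, and then there is hardly any room for the orbits: the return map
  of a gap is the identity or a reflection.\<close>

lemma common_itinerary_short: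
  assumes c: "cyc N p" and Fp: "\<And>i. F (p i) = p (Suc i)" and F: "dots_map (range p) F"
    and x: "cyc q x" "\<And>i. F (x i) = x (Suc i)"
    and gap: "\<And>i. adjacent (range p) (u i) (v i)" "\<And>i. u i < x i" "\<And>i. x i < v i"
    and y: "\<And>i. F (y i) = y (Suc i)" "\<And>i. y (i + r) = y i" "\<And>i. u i \<le> y i" "\<And>i. y i \<le> v i"
    and qr: "q dvd r" "0 < r" and ne: "x 0 \<noteq> y 0"
  shows "q \<le> 2 * (N - 1)"
proof -
  let ?P = "range p"
  have fin: "finite ?P" using c by (rule cyc_finite)
  have "\<exists>s. \<forall>t\<in>{u i..v i}. F t = F (u i) + s * (t - u i)" for i using F gap(1) unfolding dots_map_def by blast
  then obtain s where s: "\<And>i t. u i \<le> t \<Longrightarrow> t \<le> v i \<Longrightarrow> F t = F (u i) + s i * (t - u i)" by (metis atLeastAtMost_iff)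
  have uv: "u i < v i" for i using gap(2,3)[of i] by simp
  have FP: "F t \<in> ?P" if "t \<in> ?P" for t using that Fp by auto
  have uvP: "u i \<in> ?P" "v i \<in> ?P" for i using gap(1)[of i] by (auto simp: adjacent_def)
  have xr: "x (i + r) = x i" for i
    using periodic_add_mult[of x q i] cyc_periodic[OF x(1)] qr(1) by (metis dvdE mult.commute)
  have det: "u i = u j \<and> v i = v j" if "u i \<le> x j" "x j \<le> v i" for i j
    using adjacent_unique[OF gap(1)[of j] gap(1)[of i] gap(2)[of j] gap(3)[of j]] that by simp
  have ur: "u (i + r) = u i" "v (i + r) = v i" for i
    using det[of "i + r" i] gap(2,3)[of "i + r"] xr[of i] by auto
  have dxy: "x (Suc i) - y (Suc i) = s i * (x i - y i)" for i
    using s[of i "x i"] s[of i "y i"] gap(2,3)[of i] y[of i] x(2) by (simp add: algebra_simps)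
  have dn: "\<bar>x n - y n\<bar> = (\<Prod>i<n. \<bar>s i\<bar>) * \<bar>x 0 - y 0\<bar>" for n
    by (induction n) (simp_all add: dxy abs_mult)
  have prod1: "(\<Prod>i<r. \<bar>s i\<bar>) = 1" using dn[of r] xr[of 0] y(2)[of 0] ne by simp
  define len where "len i = v i - u i" for i
  have len0: "0 < len i" for i using uv by (simp add: len_def)
  have Fv: "F (v i) = F (u i) + s i * len i" for i using s[of i "v i"] uv[of i] by (simp add: len_def)
  have xs: "x (Suc i) = F (u i) + s i * (x i - u i)" for i using s[of i "x i"] gap(2,3)[of i] x(2) by simp
  have s0: "s i \<noteq> 0" for i
  proof -
    have "s j \<noteq> 0" if "j < r" for j
      using prod1 that by (metis abs_eq_0 finite_lessThan lessThan_iff prod_zero_iff zero_neq_one)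
    moreover have "s i = s (i mod r)"
    proof -
      have "u (i mod r) = u i" "v (i mod r) = v i" using ur periodic_mod by blast+
      then show ?thesis using Fv[of i] Fv[of "i mod r"] len0[of i] by (simp add: len_def)
    qed
    ultimately show ?thesis using qr(2) by simp
  qed
  have cov: "min (F (u i)) (F (v i)) \<le> u (Suc i)" "v (Suc i) \<le> max (F (u i)) (F (v i))" for i
  proof -
    have btw: "min (F (u i)) (F (v i)) < x (Suc i)" "x (Suc i) < max (F (u i)) (F (v i))"
    proof -
      have d: "0 < x i - u i" "x i - u i < len i" using gap(2,3)[of i] by (simp_all add: len_def)
      have "min (F (u i)) (F (v i)) < x (Suc i) \<and> x (Suc i) < max (F (u i)) (F (v i))"
      proof (cases "0 < s i")
        case True
        then have "0 < s i * (x i - u i)" "s i * (x i - u i) < s i * len i" using d by simp_all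
        then show ?thesis unfolding xs Fv[of i] by (simp add: min_def max_def)
      next
        case False
        then have "s i < 0" using s0[of i] by simp
        then have "s i * (x i - u i) < 0" "s i * len i < s i * (x i - u i)" using d by (simp_all add: mult_neg_pos)
        then show ?thesis unfolding xs Fv[of i] by (simp add: min_def max_def)
      qed
      then show "min (F (u i)) (F (v i)) < x (Suc i)" "x (Suc i) < max (F (u i)) (F (v i))" by auto
    qed
    have "min (F (u i)) (F (v i)) \<in> ?P" "max (F (u i)) (F (v i)) \<in> ?P"
      using FP[OF uvP(1)] FP[OF uvP(2)] by (simp_all add: min_def max_def)
    then show "min (F (u i)) (F (v i)) \<le> u (Suc i)" "v (Suc i) \<le> max (F (u i)) (F (v i))"
      using gap[of "Suc i"] btw unfolding adjacent_def by (meson less_trans not_less)+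
  qed
  define a where "a i = \<bar>s i\<bar> * len i / len (Suc i)" for i
  have slen: "\<bar>s i\<bar> * len i = max (F (u i)) (F (v i)) - min (F (u i)) (F (v i))" for i
  proof -
    have "\<bar>s i\<bar> * len i = \<bar>F (v i) - F (u i)\<bar>" using Fv[of i] len0[of i] by (simp add: abs_mult)
    then show ?thesis by (simp add: abs_real_def max_def min_def)
  qed
  have a1: "1 \<le> a i" for i using cov[of i] len0[of "Suc i"] by (simp add: a_def slen len_def[of "Suc i"])
  have an: "a n * len (Suc n) = \<bar>s n\<bar> * len n" for n using len0[of "Suc n"] by (simp add: a_def)
  have "(\<Prod>i<n. a i) * len n = (\<Prod>i<n. \<bar>s i\<bar>) * len 0" for n
  proof (induction n)
    case (Suc n)
    have "(\<Prod>i<Suc n. a i) * len (Suc n) = (\<Prod>i<n. a i) * (a n * len (Suc n))" by simp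
    also have "\<dots> = ((\<Prod>i<n. a i) * len n) * \<bar>s n\<bar>" unfolding an by simp
    finally show ?case unfolding Suc by simp
  qed simp
  from this[of r] have pa: "(\<Prod>i<r. a i) = 1" using prod1 ur(1)[of 0] ur(2)[of 0] len0[of 0] by (simp add: len_def)
  have "a i = 1" if "i < r" for i
  proof (rule ccontr)
    assume "a i \<noteq> 1"
    then have "1 < a i" using a1[of i] by simp
    moreover have "(\<Prod>j<r. a j) = a i * (\<Prod>j\<in>{..<r} - {i}. a j)" using that by (simp add: prod.remove)
    moreover have "1 \<le> (\<Prod>j\<in>{..<r} - {i}. a j)" using a1 by (intro prod_ge_1) auto
    then have "a i * 1 \<le> a i * (\<Prod>j\<in>{..<r} - {i}. a j)" using a1[of i] by (intro mult_left_mono) auto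
    ultimately show False using pa by linarith
  qed
  moreover have "a i = a (i mod r)" for i
  proof -
    have "u (i mod r) = u i" "v (i mod r) = v i" "u (Suc (i mod r)) = u (Suc i)" "v (Suc (i mod r)) = v (Suc i)"
      by (rule periodic_cong[of _ r]; use ur in \<open>simp add: mod_Suc_eq\<close>)+
    then show ?thesis unfolding a_def slen by (simp add: len_def)
  qed
  ultimately have "a i = 1" for i using qr(2) by (metis mod_less_divisor)
  then have exact: "u (Suc i) = min (F (u i)) (F (v i))" "v (Suc i) = max (F (u i)) (F (v i))" for i
  proof -
    have "len (Suc i) = max (F (u i)) (F (v i)) - min (F (u i)) (F (v i))"
      using an[of i] \<open>a i = 1\<close> slen[of i] by simp
    then show "u (Suc i) = min (F (u i)) (F (v i))" "v (Suc i) = max (F (u i)) (F (v i))"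
      using cov[of i] unfolding len_def by linarith+
  qed
  have vdet: "v i = v j" if "u i = u j" for i j
  proof -
    have "\<not> v i < v j" "\<not> v j < v i" using gap(1)[of i] gap(1)[of j] that unfolding adjacent_def by auto
    then show ?thesis by simp
  qed
  have udet: "u (i + n) = u (j + n) \<and> v (i + n) = v (j + n)" if "u i = u j" for i j n
  proof (induction n)
    case 0 show ?case using that vdet[OF that] by simp
  next
    case (Suc n) then show ?case using exact[of "i + n"] exact[of "j + n"] by simp
  qed
  have "\<exists>i j. i < j \<and> j < N \<and> u i = u j"
  proof -
    define hi where "hi = Max ?P"
    have "u i \<in> ?P - {hi}" for i
      using uvP uv[of i] Max_ge[OF fin uvP(2), of i] by (auto simp: hi_def)
    then have "u ` {..<N} \<subseteq> ?P - {hi}" by blast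
    moreover have "card (?P - {hi}) < N"
      using cyc_card[OF c] Max_in[OF fin] cyc_pos[OF c] fin by (simp add: hi_def)
    ultimately have "\<not> inj_on u {..<N}"
      using fin by (metis card_image card_lessThan card_mono finite_Diff not_less)
    then show ?thesis unfolding inj_on_def by (metis lessThan_iff linorder_neqE_nat)
  qed
  then obtain i0 j0 where ij: "i0 < j0" "j0 < N" "u i0 = u j0" by blast
  define g where "g = j0 - i0"
  have g: "0 < g" "g \<le> N - 1" "j0 = i0 + g" using ij by (auto simp: g_def)
  have ug: "u (k + g) = u k \<and> v (k + g) = v k" for k
  proof -
    define n where "n = k + i0 * r - i0"
    have "i0 \<le> k + i0 * r" using qr(2) by (simp add: trans_le_add2)
    then have n: "i0 + n = k + i0 * r" by (simp only: n_def le_add_diff_inverse)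
    then have "j0 + n = (k + g) + i0 * r" using g by simp
    then have "u (k + i0 * r) = u ((k + g) + i0 * r) \<and> v (k + i0 * r) = v ((k + g) + i0 * r)"
      using udet[OF ij(3), of n] n by simp
    then show ?thesis using periodic_add_mult[of u r, OF ur(1)] periodic_add_mult[of v r, OF ur(2)] by simp
  qed
  define mid where "mid i = (u i + v i) / 2" for i
  define \<sigma> where "\<sigma> i = sgn (s i)" for i
  define \<eta> where "\<eta> i = (x i - mid i) / len i" for i
  have sl: "\<bar>s i\<bar> * len i = len (Suc i)" for i using exact[of i] slen[of i] by (simp add: len_def)
  have eta: "\<eta> (Suc i) = \<sigma> i * \<eta> i" for i
  proof -
    have "mid (Suc i) = F (u i) + s i * len i / 2"
      unfolding mid_def exact by (simp add: min_def max_def Fv)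
    then have "x (Suc i) - mid (Suc i) = s i * (x i - mid i)" unfolding xs by (simp add: mid_def len_def field_simps)
    then have "\<eta> (Suc i) = s i * (x i - mid i) / (\<bar>s i\<bar> * len i)" by (simp add: \<eta>_def sl)
    also have "\<dots> = (s i / \<bar>s i\<bar>) * \<eta> i" by (simp add: \<eta>_def)
    finally show ?thesis by (simp add: \<sigma>_def sgn_real_def abs_real_def s0)
  qed
  have eta_n: "\<eta> (k + n) = (\<Prod>i<n. \<sigma> (k + i)) * \<eta> k" for k n by (induction n) (simp_all add: eta)
  have sg: "\<sigma> (g + i) = \<sigma> i" for i
  proof -
    have "s i = s (g + i)" using Fv[of i] Fv[of "g + i"] ug[of i] len0[of i] by (simp add: len_def add.commute)
    then show ?thesis by (simp add: \<sigma>_def)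
  qed
  have "\<eta> (g + g) = (\<Prod>i<g. \<sigma> i) * ((\<Prod>i<g. \<sigma> i) * \<eta> 0)" using eta_n[of g g] eta_n[of 0 g] sg by simp
  moreover have "(\<Prod>i<g. \<sigma> i) * (\<Prod>i<g. \<sigma> i) = 1"
    by (subst prod.distrib[symmetric]) (simp add: \<sigma>_def s0 sgn_mult_self_eq)
  ultimately have "\<eta> (g + g) = \<eta> 0" by (simp add: mult.assoc[symmetric])
  moreover have "u (g + g) = u 0 \<and> v (g + g) = v 0" using ug[of g] ug[of 0] by simp
  ultimately have "x (g + g) = x 0" using len0[of 0] by (simp add: \<eta>_def mid_def len_def)
  then have "q dvd g + g" using cyc_eq_iff[OF x(1), of "g + g" 0] by auto
  then have "q \<le> g + g" using g by (intro dvd_imp_le) auto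
  then show ?thesis using g by simp
qed


lemma gap_image:
  assumes F: "dots_map P F" and uv: "adjacent P u v" "u < x" "x < v" "F u \<in> P" "F v \<in> P" "F x \<notin> P"
    and uv': "adjacent P u' v'" "u' < F x" "F x < v'"
  obtains (inc) "\<And>s t. u \<le> s \<Longrightarrow> s < t \<Longrightarrow> t \<le> v \<Longrightarrow> F s < F t" "F u \<le> u'" "v' \<le> F v"
  | (dec) "\<And>s t. u \<le> s \<Longrightarrow> s < t \<Longrightarrow> t \<le> v \<Longrightarrow> F t < F s" "F v \<le> u'" "v' \<le> F u"
proof -
  have "\<exists>s. \<forall>t\<in>{u..v}. F t = F u + s * (t - u)" using F uv(1) unfolding dots_map_def by blast
  then obtain m where m: "\<And>t. u \<le> t \<Longrightarrow> t \<le> v \<Longrightarrow> F t = F u + m * (t - u)" by (metis atLeastAtMost_iff)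
  have diff: "F t - F s = m * (t - s)" if "u \<le> s" "s < t" "t \<le> v" for s t
    using m[of s] m[of t] that by (simp add: algebra_simps)
  have "m \<noteq> 0" using m[of x] uv by (metis add.right_neutral less_imp_le mult_zero_left)
  have nb: "q \<le> u'" if "q \<in> P" "q < F x" for q using uv' that unfolding adjacent_def by (meson less_trans not_less)
  have nb': "v' \<le> q" if "q \<in> P" "F x < q" for q using uv' that unfolding adjacent_def by (meson less_trans not_less)
  show ?thesis
  proof (cases "0 < m")
    case True
    then have mono: "F s < F t" if "u \<le> s" "s < t" "t \<le> v" for s t
    proof -
      have "0 < m * (t - s)" using True that by simp
      then show ?thesis using diff[OF that] by linarith
    qed
    show ?thesis by (rule inc) (use mono uv nb nb' in auto)
  next
    case False
    then have "m < 0" using \<open>m \<noteq> 0\<close> by simp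
    then have mono: "F t < F s" if "u \<le> s" "s < t" "t \<le> v" for s t
    proof -
      have "m * (t - s) < 0" using \<open>m < 0\<close> that by (simp add: mult_neg_pos)
      then show ?thesis using diff[OF that] by linarith
    qed
    show ?thesis by (rule dec) (use mono uv nb nb' in auto)
  qed
qed

text \<open>The connect-the-dots map of a cycle has the fewest cycles.  The inverse branches of \<open>f\<close> over the
  gaps that select leftmost preimages are strictly monotone, hence along the itinerary of a cycle
  their composition applied twice is increasing and has a fixed point, even though it is in general not
  continuous.  This gives a cycle of the right period or of twice that; in the latter case pairs of
  points span disjoint intervals that cover each other cyclically.\<close>

lemma dots_cycle_transfer:
  fixes f F :: "real \<Rightarrow> real"
  assumes f: "continuous_on {a..b} f" and c: "cyc N p" and fp: "\<And>i. f (p i) = p (Suc i)" and rng: "range p \<subseteq> {a..b}"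
    and F: "dots_map (range p) F" and Fp: "\<And>i. F (p i) = p (Suc i)"
    and x: "cyc q x" "\<And>i. F (x i) = x (Suc i)" and hull: "\<And>i. \<exists>j k. p j \<le> x i \<and> x i \<le> p k" and big: "2 * N \<le> q"
  shows "\<exists>z. cyc q z \<and> (\<forall>i. f (z i) = z (Suc i)) \<and> range z \<subseteq> {a..b} \<and> (\<forall>i j. x i < x j \<longleftrightarrow> z i < z j)"
proof -
  let ?P = "range p"
  have fin: "finite ?P" using c by (rule cyc_finite)
  have N0: "0 < N" and q0: "0 < q" using cyc_pos[OF c] cyc_pos[OF x(1)] by auto
  have xper: "x (i + q) = x i" for i using cyc_periodic[OF x(1)] .
  have xP: "x i \<notin> ?P" for i
  proof
    assume "x i \<in> ?P"
    then obtain j where j: "x i = p j" by auto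
    have "x (i + k) = p (j + k)" for k
    proof (induction k)
      case (Suc k) then show ?case using x(2)[of "i + k"] Fp[of "j + k"] by simp
    qed (use j in simp)
    then have "x (i + N) = x i" using cyc_periodic[OF c, of j] j by metis
    then have "q dvd N" using cyc_eq_iff[OF x(1)] add_mod_iff by blast
    then show False using dvd_imp_le[OF _ N0] big N0 by fastforce
  qed
  define u v where "u i = left_nb ?P (x i)" and "v i = right_nb ?P (x i)" for i
  have gap: "adjacent ?P (u i) (v i)" "u i < x i" "x i < v i" for i
    using hull[of i] nb_gap[OF fin xP[of i]] unfolding u_def v_def by blast+
  have uper: "u (i + q) = u i" "v (i + q) = v i" for i by (simp_all add: u_def v_def xper)
  have umod: "u (i mod q) = u i" "v (i mod q) = v i" for i using periodic_mod uper by blast+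
  have uvP: "u i \<in> ?P" "v i \<in> ?P" "u i < v i" for i using gap(1)[of i] by (auto simp: adjacent_def)
  have fF: "f t = F t" if "t \<in> ?P" for t using that fp Fp by auto
  have FP: "F t \<in> ?P" if "t \<in> ?P" for t using that Fp by auto
  have vdet: "v i = v j" if "u i = u j" for i j
  proof -
    have "\<not> v i < v j" "\<not> v j < v i" using gap(1)[of i] gap(1)[of j] that unfolding adjacent_def by auto
    then show ?thesis by simp
  qed
  define G where "G i = {u i..v i}" for i
  have Gab: "G i \<subseteq> {a..b}" for i using uvP[of i] rng unfolding G_def by (meson atLeastatMost_subset_iff atLeastAtMost_iff subsetD)
  have cG: "continuous_on {u i..s} f" if "s \<le> v i" for i s
    using f Gab[of i] that unfolding G_def by (elim continuous_on_subset) auto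
  define inc where "inc i \<longleftrightarrow> F (u i) < F (v i)" for i
  have gi: "(F (u i) < F (v i) \<and> F (u i) \<le> u (Suc i) \<and> v (Suc i) \<le> F (v i) \<and> (\<forall>s t. u i \<le> s \<and> s < t \<and> t \<le> v i \<longrightarrow> F s < F t)) \<or>
      (F (v i) < F (u i) \<and> F (v i) \<le> u (Suc i) \<and> v (Suc i) \<le> F (u i) \<and> (\<forall>s t. u i \<le> s \<and> s < t \<and> t \<le> v i \<longrightarrow> F t < F s))" for i
  proof -
    have Fx: "F (x i) \<notin> ?P" "u (Suc i) < F (x i)" "F (x i) < v (Suc i)" using xP gap x(2) by auto
    show ?thesis
      by (rule gap_image[OF F gap(1)[of i] gap(2)[of i] gap(3)[of i] FP[OF uvP(1)[of i]] FP[OF uvP(2)[of i]] Fx(1) gap(1)[of "Suc i"] Fx(2,3)])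
        (use uvP(3)[of i] in blast)+
  qed
  have incI: "F (u i) \<le> u (Suc i)" "v (Suc i) \<le> F (v i)" "s \<in> G i \<Longrightarrow> t \<in> G i \<Longrightarrow> s < t \<Longrightarrow> F s < F t" if "inc i" for i s t
    using gi[of i] that unfolding inc_def G_def by auto
  have decI: "F (v i) \<le> u (Suc i)" "v (Suc i) \<le> F (u i)" "F (v i) < F (u i)" "s \<in> G i \<Longrightarrow> t \<in> G i \<Longrightarrow> s < t \<Longrightarrow> F t < F s" if "\<not> inc i" for i s t
    using gi[of i] that unfolding inc_def G_def by auto
  define D where "D i = {min (F (u i)) (F (v i))..max (F (u i)) (F (v i))}" for i
  have GD: "G (Suc i) \<subseteq> D i" for i using gi[of i] by (auto simp: G_def D_def)
  have Dinc: "D i = {F (u i)..F (v i)}" if "inc i" for i using that by (simp add: D_def inc_def)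
  have Ddec: "D i = {F (v i)..F (u i)}" if "\<not> inc i" for i using decI(3)[OF that] by (simp add: D_def)
  define \<kappa> where "\<kappa> u v y = (SOME s. s \<in> {u..v} \<and> f s = y \<and> (\<forall>t\<in>{u..v}. f t = y \<longrightarrow> s \<le> t))" for u v y :: real
  define K where "K i = \<kappa> (u i) (v i)" for i
  have Kall: "K i y \<in> G i \<and> f (K i y) = y \<and> (\<forall>t\<in>G i. f t = y \<longrightarrow> K i y \<le> t)" if y: "y \<in> D i" for i y
  proof -
    have ex: "\<exists>t\<in>{u i..v i}. f t = y"
    proof (cases "inc i")
      case True
      then have "f (u i) \<le> y" "y \<le> f (v i)" using Dinc[OF True] y fF[OF uvP(1)[of i]] fF[OF uvP(2)[of i]] by auto
      then show ?thesis using IVT'[of f "u i" y "v i"] cG[of "v i" i] uvP(3)[of i] by auto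
    next
      case False
      then have "f (v i) \<le> y" "y \<le> f (u i)" using Ddec[OF False] y fF[OF uvP(1)[of i]] fF[OF uvP(2)[of i]] by auto
      then show ?thesis using IVT2'[of f "v i" y "u i"] cG[of "v i" i] uvP(3)[of i] by auto
    qed
    then have "\<exists>s\<in>{u i..v i}. f s = y \<and> (\<forall>t\<in>{u i..v i}. f t = y \<longrightarrow> s \<le> t)"
      using least_preimage[OF cG[of "v i" i]] by blast
    then show ?thesis unfolding K_def \<kappa>_def G_def by (rule someI2_bex) blast
  qed
  have Kin: "K i y \<in> G i" and fK: "f (K i y) = y" and Kle: "t \<in> G i \<Longrightarrow> f t = y \<Longrightarrow> K i y \<le> t"
    if "y \<in> D i" for i y t using Kall[OF that] by auto
  have Kinc: "K i y < K i y'" if y: "y \<in> D i" "y' \<in> D i" "y < y'" and i: "inc i" for i y y'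
  proof -
    have K': "u i \<le> K i y'" "K i y' \<le> v i" using Kin[OF y(2)] by (auto simp: G_def)
    have "f (u i) \<le> y" "y \<le> f (K i y')" using Dinc[OF i] y fF[OF uvP(1)[of i]] fK[OF y(2)] by auto
    then obtain t where t: "u i \<le> t" "t \<le> K i y'" "f t = y" using IVT'[of f "u i" y "K i y'"] K' cG by blast
    then have "K i y \<le> t" using Kle[OF y(1)] K' by (auto simp: G_def)
    moreover have "K i y \<noteq> K i y'" using fK[OF y(1)] fK[OF y(2)] y(3) by auto
    ultimately show ?thesis using t by simp
  qed
  have Kdec: "K i y' < K i y" if y: "y \<in> D i" "y' \<in> D i" "y < y'" and i: "\<not> inc i" for i y y'
  proof -
    have K': "u i \<le> K i y" "K i y \<le> v i" using Kin[OF y(1)] by (auto simp: G_def)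
    have "y' \<le> f (u i)" "f (K i y) \<le> y'" using Ddec[OF i] y fF[OF uvP(1)[of i]] fK[OF y(1)] by auto
    then obtain t where t: "u i \<le> t" "t \<le> K i y" "f t = y'" using IVT2'[of f "K i y" y' "u i"] K' cG by blast
    then have "K i y' \<le> t" using Kle[OF y(2)] K' by (auto simp: G_def)
    moreover have "K i y \<noteq> K i y'" using fK[OF y(1)] fK[OF y(2)] y(3) by auto
    ultimately show ?thesis using t by simp
  qed
  define H where "H i n y = foldr K [i..<i+n] y" for i n y
  have H0: "H i 0 y = y" and HS: "H i (Suc n) y = K i (H (Suc i) n y)" for i n y
    by (simp_all add: H_def upt_conv_Cons del: upt_Suc)
  have Hin: "H i n y \<in> G i" if "y \<in> G (i + n)" for i n y
    using that
  proof (induction n arbitrary: i)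
    case (Suc n)
    then have "H (Suc i) n y \<in> G (Suc i)" by simp
    then show ?case unfolding HS using Kin GD by blast
  qed (simp add: H0)
  have Hmono: "(\<forall>y\<in>G (i + n). \<forall>y'\<in>G (i + n). y < y' \<longrightarrow> H i n y < H i n y') \<or>
      (\<forall>y\<in>G (i + n). \<forall>y'\<in>G (i + n). y < y' \<longrightarrow> H i n y' < H i n y)" for i n
  proof (induction n arbitrary: i)
    case (Suc n)
    have in': "H (Suc i) n y \<in> G (Suc i)" if "y \<in> G (i + Suc n)" for y using Hin[of y "Suc i" n] that by simp
    then have in': "H (Suc i) n y \<in> D i" if "y \<in> G (i + Suc n)" for y using GD that by blast
    show ?case unfolding HS using Suc[of "Suc i"] Kinc[OF in' in'] Kdec[OF in' in'] by (cases "inc i") (simp_all, blast+)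
  qed (simp add: H0)
  have Gper: "G (i + q) = G i" "G (i mod q) = G i" for i by (simp_all add: G_def uper umod)
  define g where "g = H 0 q"
  have gin: "g y \<in> G 0" if "y \<in> G 0" for y using Hin[of y 0 q] that Gper(1)[of 0] by (simp add: g_def)
  have gg: "g (g y) \<le> g (g y')" if "y \<in> {u 0..v 0}" "y' \<in> {u 0..v 0}" "y \<le> y'" for y y'
  proof (cases "y = y'")
    case False
    then have "y < y'" "y \<in> G 0" "y' \<in> G 0" using that by (auto simp: G_def)
    then show ?thesis using Hmono[of 0 q] Gper(1)[of 0] gin unfolding g_def[symmetric] by (metis add_0 less_imp_le)
  qed simp
  have "\<exists>y\<in>{u 0..v 0}. g (g y) = y"
    using uvP(3)[of 0] gin gg by (intro mono_fixed_point[where g = "\<lambda>y. g (g y)"]) (simp_all add: G_def)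
  then obtain y0 where y0: "y0 \<in> G 0" "g (g y0) = y0" by (auto simp: G_def)
  define e where "e b n = (if even (n div q) = b then g y0 else y0)" for b n
  define Z where "Z b n = H (n mod q) (q - n mod q) (e b n)" for b n
  have eG: "e b n \<in> G q" for b n using y0 gin Gper(1)[of 0] by (simp add: e_def)
  have Zin: "Z b n \<in> G n" for b n
    unfolding Z_def Gper(2)[of n, symmetric] by (rule Hin) (use q0 eG mod_less_divisor[OF q0, of n] in simp)
  have ZK: "Z b n = K n (Z b (Suc n))" for b n
  proof -
    define r where "r = n mod q"
    have r: "r < q" using q0 by (simp add: r_def)
    then have "q - r = Suc (q - Suc r)" by simp
    then have "Z b n = K r (H (Suc r) (q - Suc r) (e b n))" by (simp add: Z_def r_def[symmetric] HS)
    moreover have "H (Suc r) (q - Suc r) (e b n) = Z b (Suc n)"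
    proof (cases "Suc r = q")
      case True
      then have "Suc n mod q = 0" "Suc n div q = Suc (n div q)" by (simp_all add: r_def mod_Suc div_Suc)
      then show ?thesis using True y0(2) by (simp add: Z_def H0 e_def g_def[symmetric])
    next
      case False
      then have "Suc n mod q = Suc r" "Suc n div q = n div q" by (simp_all add: r_def mod_Suc div_Suc)
      then show ?thesis by (simp add: Z_def e_def)
    qed
    moreover have "K r = K n" by (simp add: K_def r_def umod)
    ultimately show ?thesis by simp
  qed
  have ZD: "Z b (Suc n) \<in> D n" for b n using Zin GD by blast
  have fZ: "f (Z b n) = Z b (Suc n)" for b n using fK[OF ZD] ZK by metis
  have Zq: "Z b (n + q) = Z (\<not> b) n" for b n using q0 by (simp add: Z_def e_def)
  have Zqq: "Z b (n + 2 * q) = Z b n" for b n using Zq[of b "n + q"] Zq[of "\<not> b" n] by (simp add: mult_2 add.assoc)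
  have short: False if "i0 \<ge> 0" "\<And>k. F (y k) = y (Suc k)" "\<And>k. y (k + 2 * q) = y k" "\<And>k. y k \<in> G (i0 + k)" "x i0 \<noteq> y 0" for y i0
  proof -
    have "q \<le> 2 * (N - 1)"
    proof (rule common_itinerary_short[OF c Fp F, where x = "\<lambda>k. x (k + i0)" and y = y and u = "\<lambda>k. u (k + i0)" and v = "\<lambda>k. v (k + i0)" and r = "2 * q"])
      show "cyc q (\<lambda>k. x (k + i0))" by (rule cyc_shift[OF x(1)])
    qed (use that x(2) gap q0 in \<open>auto simp: G_def add.commute\<close>)
    then show False using big N0 by simp
  qed
  have ZP: "Z b n \<notin> ?P" for b n
  proof
    assume a: "Z b n \<in> ?P"
    have "Z b (n + k) \<in> ?P" for k
    proof (induction k)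
      case (Suc k) then show ?case using fZ[of b "n + k"] fF FP by (metis add_Suc_right)
    qed (use a in simp)
    then have "F (Z b (n + k)) = Z b (n + Suc k)" for k using fZ[of b "n + k"] fF by (metis add_Suc_right)
    then show False using short[of n "\<lambda>k. Z b (n + k)"] Zin Zqq[of b] a xP[of n] by (metis add.assoc add.right_neutral le0)
  qed
  have sep: "\<exists>n. u (i + n) \<noteq> u (j + n)" if "x i \<noteq> x j" for i j
  proof (rule ccontr)
    assume n: "\<nexists>n. u (i + n) \<noteq> u (j + n)"
    have "x (j + k) \<in> G (i + k)" for k
      using n vdet[of "i + k" "j + k"] gap(2,3)[of "j + k"] by (auto simp: G_def less_imp_le)
    moreover have "x (j + k + 2 * q) = x (j + k)" for k using periodic_add_mult[of x q "j + k" 2] xper by simp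
    ultimately show False using short[of i "\<lambda>k. x (j + k)"] x(2) that by (simp add: add.assoc)
  qed
  have Zapart: "Z b i < Z b' j" if "u i \<noteq> u j" "x i < x j" for b b' i j
  proof -
    have "\<not> (u i < u j \<and> u j < v i)" using gap(1)[of i] uvP(1)[of j] unfolding adjacent_def by blast
    then have "u j < u i \<or> v i \<le> u j" using that(1) by linarith
    moreover have "\<not> u j < u i"
    proof
      assume "u j < u i"
      then have "v j \<le> u i" using gap(1)[of j] uvP(1)[of i] unfolding adjacent_def by force
      then show False using gap(2)[of i] gap(3)[of j] that(2) by simp
    qed
    moreover have "Z b i \<noteq> v i" "Z b i \<le> v i" "u j \<le> Z b' j"
      using Zin[of b i] Zin[of b' j] ZP[of b i] uvP(2)[of i] by (auto simp: G_def)
    ultimately show ?thesis by simp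
  qed
  have Zord: "Z b i < Z b' j" if "u (i + n) \<noteq> u (j + n)" "x i < x j" for b b' i j n
    using that
  proof (induction n arbitrary: b b' i j)
    case 0 then show ?case using Zapart by simp
  next
    case (Suc n)
    show ?case
    proof (cases "u i = u j")
      case True
      then have eq: "G i = G j" "K i = K j" "D i = D j" using vdet[OF True] by (simp_all add: G_def K_def D_def)
      have xG: "x i \<in> G i" "x j \<in> G i" using gap(2,3)[of i] gap(2,3)[of j] unfolding eq(1) by (auto simp: G_def True vdet[OF True])
      have ne: "u (Suc i + n) \<noteq> u (Suc j + n)" "u (Suc j + n) \<noteq> u (Suc i + n)" using Suc.prems(1) by simp_all
      have ZD': "Z b (Suc i) \<in> D i" "Z b' (Suc j) \<in> D i" using ZD eq(3) by auto
      show ?thesis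
      proof (cases "inc i")
        case inc: True
        then have "x (Suc i) < x (Suc j)" using incI(3)[OF inc xG Suc.prems(2)] x(2) by simp
        then have "Z b (Suc i) < Z b' (Suc j)" by (rule Suc.IH[OF ne(1)])
        then show ?thesis using Kinc[OF ZD' _ inc] ZK[of b i] ZK[of b' j] eq(2) by simp
      next
        case dec: False
        then have "x (Suc j) < x (Suc i)" using decI(4)[OF dec xG Suc.prems(2)] x(2) by simp
        then have "Z b' (Suc j) < Z b (Suc i)" by (rule Suc.IH[OF ne(2)])
        then show ?thesis using Kdec[OF ZD'(2,1) _ dec] ZK[of b i] ZK[of b' j] eq(2) by simp
      qed
    qed (use Zapart Suc.prems(2) in simp)
  qed
  have Zless: "Z b i < Z b' j" if "x i < x j" for b b' i j
    using sep[of i j] Zord that by (metis less_irrefl)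
  define l w where "l t = min (Z True t) (Z False t)" and "w t = max (Z True t) (Z False t)" for t
  have lG: "{l t..w t} \<subseteq> G t" for t using Zin[of True t] Zin[of False t] by (auto simp: G_def l_def w_def)
  have lab: "l t \<le> w t" "{l t..w t} \<subseteq> {a..b}" for t
    using subset_trans[OF lG Gab, of t] by (simp_all add: l_def w_def)
  have cov: "{l (Suc t)..w (Suc t)} \<subseteq> f ` {l t..w t}" for t
  proof -
    have "connected (f ` {l t..w t})" by (intro connected_continuous_image continuous_on_subset[OF f lab(2)]) auto
    moreover have "Z b (Suc t) \<in> f ` {l t..w t}" for b
      by (rule image_eqI[of _ _ "Z b t"]) (use fZ in \<open>cases b; simp add: l_def w_def\<close>)+
    then have "l (Suc t) \<in> f ` {l t..w t}" "w (Suc t) \<in> f ` {l t..w t}" by (simp_all add: l_def w_def min_def max_def)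
    ultimately show ?thesis using connected_contains_Icc by blast
  qed
  have lq: "l (t + q) = l t" "w (t + q) = w t" for t by (simp_all add: l_def w_def Zq min.commute max.commute)
  obtain z0 where z0: "\<And>t. t \<le> q \<Longrightarrow> (f ^^ t) z0 \<in> {l t..w t}" "(f ^^ q) z0 = z0"
    using loop_lemma[where l = l and u = w and L = q, OF f lab cov] lq(1)[of 0] lq(2)[of 0] by auto
  define z where "z t = (f ^^ t) z0" for t
  have zper: "z (t + q) = z t" for t using funpow_periodic[OF z0(2)] by (simp add: z_def)
  have zin: "z t \<in> {l t..w t}" for t
  proof -
    have "z (t mod q) \<in> {l (t mod q)..w (t mod q)}" using z0(1)[of "t mod q"] q0 by (simp add: z_def)
    moreover have "z (t mod q) = z t" "l (t mod q) = l t" "w (t mod q) = w t"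
      using periodic_mod[of z q] periodic_mod[of l q] periodic_mod[of w q] zper lq by blast+
    ultimately show ?thesis by simp
  qed
  have zless: "z i < z j" if "x i < x j" for i j
  proof -
    have "w i < l j" using Zless[OF that] by (simp add: l_def w_def)
    then show ?thesis using zin[of i] zin[of j] by simp
  qed
  have ziff: "x i < x j \<longleftrightarrow> z i < z j" for i j
  proof
    assume a: "z i < z j"
    have "x i \<noteq> x j"
    proof
      assume "x i = x j"
      then have "i mod q = j mod q" using cyc_eq_iff[OF x(1)] by blast
      then show False using periodic_cong[of z q i j] zper a by simp
    qed
    then show "x i < x j" using zless[of j i] a by linarith
  qed (rule zless)
  have "cyc q z"
  proof (rule cycI)
    fix i j assume "z i = z j"
    then have "x i = x j" using zless[of i j] zless[of j i] by linarith
    then show "i mod q = j mod q" using cyc_eq_iff[OF x(1)] by blast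
  qed (use q0 zper in auto)
  moreover have "f (z i) = z (Suc i)" for i by (simp add: z_def)
  moreover have "range z \<subseteq> {a..b}" using zin lab by blast
  ultimately show ?thesis using ziff by blast
qed

section \<open>Running maxima and growth\<close>

definition sup_to :: "(real \<Rightarrow> real) \<Rightarrow> real \<Rightarrow> real \<Rightarrow> real" where
  "sup_to g l w = Sup (g ` {l..max l w})"

context
  fixes g :: "real \<Rightarrow> real" assumes g: "continuous_on UNIV g"
begin

lemma sup_to_attained: "\<exists>s. l \<le> s \<and> s \<le> max l w \<and> g s = sup_to g l w \<and> (\<forall>t. l \<le> t \<and> t \<le> max l w \<longrightarrow> g t \<le> sup_to g l w)"
proof -
  have "compact {l..max l w}" "{l..max l w} \<noteq> {}" "continuous_on {l..max l w} g"
    using g by (auto intro: continuous_on_subset)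
  then obtain s where s: "s \<in> {l..max l w}" "\<forall>t\<in>{l..max l w}. g t \<le> g s"
    using continuous_attains_sup by blast
  then have "sup_to g l w = g s" unfolding sup_to_def by (intro cSup_eq_maximum) auto
  then show ?thesis using s by (intro exI[of _ s]) auto
qed

lemma sup_to_ge: "l \<le> s \<Longrightarrow> s \<le> w \<Longrightarrow> g s \<le> sup_to g l w"
  using sup_to_attained[of l w] by fastforce

lemma sup_to_le: "(\<And>s. l \<le> s \<Longrightarrow> s \<le> max l w \<Longrightarrow> g s \<le> B) \<Longrightarrow> sup_to g l w \<le> B"
  using sup_to_attained[of l w] by metis

lemma sup_to_mono: assumes "w \<le> w'" shows "sup_to g l w \<le> sup_to g l w'"
proof (rule sup_to_le)
  fix s assume "l \<le> s" "s \<le> max l w"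
  then have "s \<le> max l w'" using assms by (simp add: max_def split: if_splits)
  then show "g s \<le> sup_to g l w'" using sup_to_attained[of l w'] \<open>l \<le> s\<close> by blast
qed

lemma sup_to_base: "w \<le> l \<Longrightarrow> sup_to g l w = g l"
  using sup_to_attained[of l w] by (metis max.absorb1 order_antisym)

lemma sup_to_ge_base: "g l \<le> sup_to g l w"
  using sup_to_attained[of l w] by (metis max.cobounded1 order_refl)

lemma sup_to_continuous: "continuous_on UNIV (sup_to g l)"
  unfolding continuous_on_iff
proof (intro ballI allI impI)
  fix w0 e :: real assume e: "0 < e"
  define m0 where "m0 = max l w0"
  have "isCont g m0" using g by (simp add: continuous_on_eq_continuous_at)
  then obtain d where d: "0 < d" "\<And>s. \<bar>s - m0\<bar> < d \<Longrightarrow> \<bar>g s - g m0\<bar> < e / 3"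
    using e unfolding continuous_at_eps_delta by (metis divide_pos_pos zero_less_numeral dist_real_def)
  have "\<bar>sup_to g l w - sup_to g l w0\<bar> < e" if w: "\<bar>w - w0\<bar> < d" for w
  proof -
    define m where "m = max l w"
    have md: "\<bar>m - m0\<bar> < d" using w d(1) by (auto simp: m_def m0_def max_def abs_real_def)
    have key: "sup_to g l a \<le> sup_to g l b + 2 * e / 3"
      if ab: "\<bar>max l a - m0\<bar> < d" "\<bar>max l b - m0\<bar> < d" for a b
    proof (rule sup_to_le)
      fix s assume s: "l \<le> s" "s \<le> max l a"
      show "g s \<le> sup_to g l b + 2 * e / 3"
      proof (cases "s \<le> max l b")
        case True
        then show ?thesis using sup_to_attained[of l b] s e by (smt (verit) divide_pos_pos)
      next
        case False
        then have "\<bar>s - m0\<bar> < d" using s ab by linarith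
        then have "g s < g m0 + e / 3" "g m0 < g (max l b) + e / 3" using d(2)[of s] d(2)[OF ab(2)] by linarith+
        moreover have "g (max l b) \<le> sup_to g l b" using sup_to_attained[of l b] by (metis max.cobounded1 order_refl)
        ultimately show ?thesis by linarith
      qed
    qed
    have "sup_to g l w \<le> sup_to g l w0 + 2 * e / 3" "sup_to g l w0 \<le> sup_to g l w + 2 * e / 3"
      by (rule key; use md d(1) in \<open>simp add: m_def m0_def\<close>)+
    then show ?thesis using e by linarith
  qed
  then show "\<exists>d>0. \<forall>x'\<in>UNIV. dist x' w0 < d \<longrightarrow> dist (sup_to g l x') (sup_to g l w0) < e"
    using d(1) by (auto simp: dist_real_def)
qed

end

primrec comp_from :: "(nat \<Rightarrow> real \<Rightarrow> real) \<Rightarrow> nat \<Rightarrow> nat \<Rightarrow> real \<Rightarrow> real" where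
  "comp_from A s 0 w = w"
| "comp_from A s (Suc i) w = A (s + i) (comp_from A s i w)"

lemma comp_from_add: "comp_from A s (i + j) w = comp_from A (s + i) j (comp_from A s i w)"
  by (induction j) (simp_all add: add.assoc)

lemma comp_from_mono:
  assumes "\<And>t w w'. w \<le> w' \<Longrightarrow> A t w \<le> A t w'" "w \<le> w'" shows "comp_from A s i w \<le> comp_from A s i w'"
  by (induction i) (use assms in auto)

lemma comp_from_cong:
  assumes "\<And>i. A (s + i) = A' (s' + i)" shows "comp_from A s i w = comp_from A' s' i w"
  by (induction i) (simp_all add: assms)

lemma comp_from_periodic:
  assumes "\<And>t. A (t + L) = A t" "s mod L = s' mod L" shows "comp_from A s i w = comp_from A s' i w"
proof (rule comp_from_cong)
  show "A (s + i) = A (s' + i)" for i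
  proof -
    have "(s + i) mod L = (s' + i) mod L" using assms(2) by (metis mod_add_left_eq)
    then show ?thesis by (rule periodic_cong[of A L, OF assms(1)])
  qed
qed

lemma comp_from_continuous:
  assumes "\<And>t. continuous_on UNIV (A t)" shows "continuous_on UNIV (comp_from A s i)"
proof (induction i)
  case 0 then show ?case by (simp add: continuous_on_id)
next
  case (Suc i)
  have "continuous_on UNIV (\<lambda>w. A (s + i) (comp_from A s i w))"
    by (rule continuous_on_compose2[OF assms Suc]) auto
  then show ?case by simp
qed

definition grown :: "(nat \<Rightarrow> real \<Rightarrow> real) \<Rightarrow> (nat \<Rightarrow> real) \<Rightarrow> nat \<Rightarrow> nat \<Rightarrow> real set" where
  "grown A y L t = {w. \<exists>s i. (s + i) mod L = t mod L \<and> w \<le> comp_from A s i (y s)}"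

lemma grown_base: "y t \<in> grown A y L t"
  unfolding grown_def by (intro CollectI exI[of _ t] exI[of _ 0]) simp

lemma grown_down: "w \<in> grown A y L t \<Longrightarrow> w' \<le> w \<Longrightarrow> w' \<in> grown A y L t"
  unfolding grown_def by force

lemma grown_cong: "t mod L = t' mod L \<Longrightarrow> grown A y L t = grown A y L t'"
  unfolding grown_def by simp

lemma grown_step:
  assumes "\<And>t w w'. w \<le> w' \<Longrightarrow> A t w \<le> A t w'" "\<And>t. A (t + L) = A t" "w \<in> grown A y L t"
  shows "A t w \<in> grown A y L (Suc t)"
proof -
  obtain s i where s: "(s + i) mod L = t mod L" "w \<le> comp_from A s i (y s)" using assms(3) unfolding grown_def by blast
  have "A t = A (s + i)" by (rule periodic_cong[of A L, OF assms(2) s(1)[symmetric]])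
  then have "A t w \<le> comp_from A s (Suc i) (y s)" using assms(1)[OF s(2)] by simp
  moreover have "(s + Suc i) mod L = Suc t mod L" using s(1) by (metis add_Suc_right mod_Suc_eq)
  ultimately show ?thesis unfolding grown_def by blast
qed

text \<open>Intervals that grow under a cyclic sequence of coverings keep growing: whatever they have reached
  at a level covers itself after one round.  If \<open>w\<close> was reached after \<open>i\<close> steps but not earlier, then it
  lies beyond what was reached one step less, and a full round takes that to at least the next stage.\<close>

lemma grown_return:
  assumes mono: "\<And>t w w'. w \<le> w' \<Longrightarrow> A t w \<le> A t w'" and per: "\<And>t. A (t + L) = A t" "\<And>t. y (t + L) = y t"
    and gr: "\<And>t. y (Suc t) \<le> A t (y t)" and L: "0 < L" and w: "w \<in> grown A y L t" "y t \<le> w"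
  shows "w \<le> comp_from A t L w"
proof -
  have base: "y (s + i) \<le> comp_from A s i (y s)" for s i
  proof (induction i)
    case (Suc i)
    show ?case using gr[of "s + i"] mono[OF Suc, of "s + i"] by simp
  qed simp
  define Q where "Q i \<longleftrightarrow> (\<exists>s. (s + i) mod L = t mod L \<and> w \<le> comp_from A s i (y s))" for i
  have "\<exists>i. Q i" using w(1) unfolding grown_def Q_def by blast
  then have Qi: "Q (LEAST i. Q i)" and Qmin: "\<And>i. i < (LEAST i. Q i) \<Longrightarrow> \<not> Q i" by (auto intro: LeastI dest: not_less_Least)
  obtain i where i: "i = (LEAST i. Q i)" by simp
  have "Q i" using Qi i by simp
  then obtain s where s: "(s + i) mod L = t mod L" "w \<le> comp_from A s i (y s)" unfolding Q_def by blast
  show ?thesis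
  proof (cases i)
    case 0
    then have "w \<le> y t" using s periodic_cong[of y L s t, OF per(2)] 0 by simp
    then have "w = y t" using w(2) by simp
    then show ?thesis using base[of t L] per(2)[of t] by simp
  next
    case (Suc j)
    then have "\<not> Q j" using Qmin[of j] i by simp
    moreover have m: "(Suc s + j) mod L = t mod L" using s(1) Suc by simp
    ultimately have lt: "comp_from A (Suc s) j (y (Suc s)) \<le> w" unfolding Q_def by (metis less_imp_le not_less)
    have "w \<le> comp_from A s i (y s)" by (rule s(2))
    also have "\<dots> = comp_from A (s + L) i (y (s + L))" using comp_from_periodic[of A L s "s + L", OF per(1)] per(2)[of s] by simp
    also have "\<dots> \<le> comp_from A (s + L) i (comp_from A (Suc s) (L - 1) (y (Suc s)))"
      using base[of "Suc s" "L - 1"] L by (intro comp_from_mono mono) simp_all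
    also have "\<dots> = comp_from A (Suc s) (L - 1 + i) (y (Suc s))"
      using L comp_from_add[of A "Suc s" "L - 1" i] by simp
    also have "\<dots> = comp_from A (Suc s) (j + L) (y (Suc s))" using Suc L by (simp add: add.commute)
    also have "\<dots> = comp_from A t L (comp_from A (Suc s) j (y (Suc s)))"
      unfolding comp_from_add by (rule comp_from_periodic[of A L, OF per(1) m])
    also have "\<dots> \<le> comp_from A t L w" by (intro comp_from_mono mono lt)
    finally show ?thesis .
  qed
qed

section \<open>Rays of a cycle around a repelling centre\<close>

locale block_cycle =
  fixes F :: "real \<Rightarrow> real" and p :: "nat \<Rightarrow> real" and N K :: nat
  assumes cp: "cyc N p" and Fp: "\<And>i. F (p i) = p (Suc i)" and dm: "dots_map (range p) F" and bK: "blk N p K"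
begin

lemma K0: "0 < K" and N0: "0 < N"
  using cyc_pos[OF cp] blk_dvd_period[OF bK] dvd_pos_nat by blast+

lemma class_convex: "i mod K = j mod K \<Longrightarrow> i' mod K = j mod K \<Longrightarrow> p i \<le> p l \<Longrightarrow> p l \<le> p i' \<Longrightarrow> l mod K = j mod K"
proof -
  assume a: "i mod K = j mod K" "i' mod K = j mod K" "p i \<le> p l" "p l \<le> p i'"
  have "p u = p v \<Longrightarrow> u mod K = v mod K" for u v
    using cyc_eq_iff[OF cp] mod_mod_dvd blk_dvd_period[OF bK] by blast
  then show ?thesis using a blkD[OF bK, of i l i'] by (metis order_le_less)
qed

lemma dots_between:
  assumes "adjacent (range p) u v" "u \<le> t" "t \<le> v"
  shows "min (F u) (F v) \<le> F t" "F t \<le> max (F u) (F v)"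
proof -
  obtain s where s: "\<forall>x\<in>{u..v}. F x = F u + s * (x - u)" using dm assms(1) unfolding dots_map_def by blast
  have Ft: "F t = F u + s * (t - u)" "F v = F u + s * (v - u)" using bspec[OF s, of t] bspec[OF s, of v] assms by auto
  have d: "0 \<le> t - u" "t - u \<le> v - u" using assms by auto
  show "min (F u) (F v) \<le> F t" "F t \<le> max (F u) (F v)"
  proof (atomize (full), cases "0 \<le> s")
    case True
    then have "0 \<le> s * (t - u)" "s * (t - u) \<le> s * (v - u)" using d by (simp_all add: mult_left_mono)
    then show "min (F u) (F v) \<le> F t \<and> F t \<le> max (F u) (F v)" unfolding Ft by simp
  next
    case False
    then have "s * (t - u) \<le> 0" "s * (v - u) \<le> s * (t - u)"
      using d by (simp_all add: mult_nonpos_nonneg mult_left_mono_neg)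
    then show "min (F u) (F v) \<le> F t \<and> F t \<le> max (F u) (F v)" unfolding Ft by simp
  qed
qed

lemma hull_image:
  assumes "i mod K = j mod K" "i' mod K = j mod K" "p i \<le> t" "t \<le> p i'"
  obtains a a' where "a mod K = Suc j mod K" "a' mod K = Suc j mod K" "p a \<le> F t" "F t \<le> p a'"
proof (cases "t \<in> range p")
  case True
  then obtain l where l: "t = p l" by blast
  then have "l mod K = j mod K" using class_convex assms by blast
  then have "Suc l mod K = Suc j mod K" by (metis mod_Suc_eq)
  then show ?thesis using that[of "Suc l" "Suc l"] l Fp by simp
next
  case False
  have g: "adjacent (range p) (left_nb (range p) t) (right_nb (range p) t)" "left_nb (range p) t < t" "t < right_nb (range p) t"
    using nb_gap[OF cyc_finite[OF cp] False, of "p i" "p i'"] assms by auto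
  then obtain a a' where a: "left_nb (range p) t = p a" "right_nb (range p) t = p a'" by (auto simp: adjacent_def)
  have "\<not> (p a < p i \<and> p i < p a')" "\<not> (p a < p i' \<and> p i' < p a')" using g(1) unfolding a adjacent_def by blast+
  then have "p i \<le> p a" "p a' \<le> p i'" using g(2,3) assms(3,4) unfolding a by linarith+
  then have "a mod K = j mod K" "a' mod K = j mod K"
    using class_convex[OF assms(1,2), of a] class_convex[OF assms(1,2), of a'] g assms unfolding a by simp_all
  then have S: "Suc a mod K = Suc j mod K" "Suc a' mod K = Suc j mod K" by (metis mod_Suc_eq)+
  have "min (p (Suc a)) (p (Suc a')) \<le> F t" "F t \<le> max (p (Suc a)) (p (Suc a'))"
    using dots_between[OF g(1), of t] g unfolding a Fp by simp_all
  then show ?thesis using that S by (smt (verit) min_def max_def)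
qed

end

text \<open>The cycle \<open>p\<close> of the connect-the-dots map \<open>F\<close> has a block structure with \<open>K\<close> blocks and none that is
  finer.  The centre \<open>c\<close> is a cycle with one point inside the hull of each block, at which \<open>F\<close> to the power
  \<open>K\<close> reverses orientation.  Going \<open>K\<close> steps around interchanges the two sides of a centre, so the sides
  are numbered consistently by the integers modulo \<open>2K\<close>: on ray \<open>j\<close> the positions are \<open>c j + \<epsilon> j * r\<close> with
  \<open>r \<ge> 0\<close>, and close to the centre \<open>F\<close> maps ray \<open>j\<close> to ray \<open>j + 1\<close>.\<close>

locale spiral = block_cycle F p N K for F p N K +
  fixes c \<epsilon> :: "nat \<Rightarrow> real"
  assumes big: "3 * K \<le> N" and prime: "\<And>k. blk N p k \<Longrightarrow> K < k \<Longrightarrow> k = N"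
    and c_per: "\<And>j. c (j + K) = c j" and Fc: "\<And>j. F (c j) = c (Suc j)"
    and c_hull: "\<And>j. \<exists>i i'. i mod K = j mod K \<and> i' mod K = j mod K \<and> p i < c j \<and> c j < p i'"
    and cP: "\<And>j. c j \<notin> range p"
    and eps: "\<And>j. \<epsilon> j = 1 \<or> \<epsilon> j = -1" and eps_K: "\<And>j. \<epsilon> (j + K) = - \<epsilon> j"
    and near: "\<And>j r i. 0 < r \<Longrightarrow> i mod K = j mod K \<Longrightarrow> r \<le> \<epsilon> j * (p i - c j) \<Longrightarrow>
      (\<And>s. 0 < s \<Longrightarrow> s < r \<Longrightarrow> c j + \<epsilon> j * s \<notin> range p) \<Longrightarrow> 0 < \<epsilon> (Suc j) * (F (c j + \<epsilon> j * r) - c (Suc j))"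
begin

definition pos :: "nat \<Rightarrow> real \<Rightarrow> real" where "pos j r = c j + \<epsilon> j * r"

definition PC :: "nat \<Rightarrow> real set" where
  "PC j = {r. 0 < r \<and> (\<exists>i. i mod K = j mod K \<and> p i = pos j r)}"

definition R :: "nat \<Rightarrow> real" where "R j = Max (PC j)"
definition \<rho> :: "nat \<Rightarrow> real" where "\<rho> j = Min (PC j)"

text \<open>The map \<open>F\<close> in radial coordinates.  A negative value means that the image lies on the opposite ray, and beyond
  the points of \<open>p\<close> the map is continued by a constant, so that it is defined for all radii.\<close>

definition \<Phi> :: "nat \<Rightarrow> real \<Rightarrow> real" where
  "\<Phi> j r = \<epsilon> (Suc j) * (F (pos j (min r (R j))) - c (Suc j))"

lemma eps2 [simp]: "\<epsilon> j * \<epsilon> j = 1" and eps_abs [simp]: "\<bar>\<epsilon> j\<bar> = 1" and eps_ne [simp]: "\<epsilon> j \<noteq> 0"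
  using eps[of j] by auto

lemma eps_mult [simp]: "\<epsilon> j * (\<epsilon> j * r) = r"
  using eps[of j] by auto

lemma pos_coord: "pos j (\<epsilon> j * (x - c j)) = x" by (simp add: pos_def)

lemma coord_pos: "\<epsilon> j * (pos j r - c j) = r" by (simp add: pos_def)

lemma pos_inj: "pos j r = pos j s \<longleftrightarrow> r = s" by (simp add: pos_def)

lemma pos_0 [simp]: "pos j 0 = c j" by (simp add: pos_def)

lemma pos_opp: "pos (j + K) r = pos j (- r)" by (simp add: pos_def c_per eps_K)

lemma two_K: "c (j + 2 * K) = c j" "\<epsilon> (j + 2 * K) = \<epsilon> j"
  using c_per[of j] c_per[of "j + K"] eps_K[of j] eps_K[of "j + K"] by (simp_all add: mult_2 add.assoc)

lemma mod2K_modK: "j mod (2 * K) = j' mod (2 * K) \<Longrightarrow> j mod K = j' mod K"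
  by (rule mod_mod_dvd) auto

lemma ray_cong:
  assumes "j mod (2 * K) = j' mod (2 * K)"
  shows "c j = c j'" "\<epsilon> j = \<epsilon> j'" "pos j = pos j'" "PC j = PC j'" "R j = R j'" "\<rho> j = \<rho> j'" "\<Phi> j = \<Phi> j'"
proof -
  have S: "Suc j mod (2 * K) = Suc j' mod (2 * K)" using assms by (metis mod_Suc_eq)
  note c = periodic_cong[of c "2 * K", OF two_K(1)] periodic_cong[of \<epsilon> "2 * K", OF two_K(2)]
  show e1: "c j = c j'" by (rule c(1)[OF assms])
  show e2: "\<epsilon> j = \<epsilon> j'" by (rule c(2)[OF assms])
  show 2: "pos j = pos j'" by (rule ext) (simp add: pos_def e1 e2)
  show 3: "PC j = PC j'" unfolding PC_def 2 using mod2K_modK[OF assms] by simp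
  then show 4: "R j = R j'" "\<rho> j = \<rho> j'" by (simp_all add: R_def \<rho>_def)
  show "\<Phi> j = \<Phi> j'" by (rule ext) (simp add: \<Phi>_def 2 4 c[OF S])
qed

lemma PC_fin: "finite (PC j)"
proof -
  have "PC j \<subseteq> (\<lambda>x. \<epsilon> j * (x - c j)) ` range p" using coord_pos[of j] by (auto simp: PC_def) (metis rangeI image_eqI)
  then show ?thesis using cyc_finite[OF cp] finite_subset by blast
qed

lemma PC_ne: "PC j \<noteq> {}"
proof -
  obtain i i' where i: "i mod K = j mod K" "i' mod K = j mod K" "p i < c j" "c j < p i'" using c_hull by blast
  show ?thesis
  proof (cases "\<epsilon> j = 1")
    case True
    then have "p i' - c j \<in> PC j" using i by (auto simp: PC_def pos_def)
    then show ?thesis by blast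
  next
    case False
    then have "\<epsilon> j = -1" using eps by blast
    then have "c j - p i \<in> PC j" using i by (auto simp: PC_def pos_def)
    then show ?thesis by blast
  qed
qed

lemma R_in: "R j \<in> PC j" and \<rho>_in: "\<rho> j \<in> PC j"
  unfolding R_def \<rho>_def using PC_fin PC_ne by auto

lemma PC_le: "r \<in> PC j \<Longrightarrow> r \<le> R j" and PC_ge: "r \<in> PC j \<Longrightarrow> \<rho> j \<le> r"
  unfolding R_def \<rho>_def using PC_fin by auto

lemma PC_pos: "r \<in> PC j \<Longrightarrow> 0 < r" by (simp add: PC_def)

lemma R_pos: "0 < R j" and \<rho>_pos: "0 < \<rho> j" using R_in \<rho>_in PC_pos by blast+

lemma \<Phi>_0: "\<Phi> j 0 = 0" using R_pos[of j] Fc by (simp add: \<Phi>_def min_def)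

lemma \<Phi>_cont: "continuous_on UNIV (\<Phi> j)"
proof -
  have "continuous_on UNIV F" using dm by (simp add: dots_map_def)
  then have "continuous_on UNIV (\<lambda>r. F (pos j (min r (R j))))"
    by (rule continuous_on_compose2) (auto simp: pos_def intro!: continuous_intros)
  then show ?thesis unfolding \<Phi>_def by (intro continuous_intros)
qed

lemma step: "r \<le> R j \<Longrightarrow> F (pos j r) = pos (Suc j) (\<Phi> j r)"
  by (simp add: \<Phi>_def min_absorb1 pos_coord)

lemma step_opp: "r \<le> R j \<Longrightarrow> F (pos j r) = pos (Suc j + K) (- \<Phi> j r)"
  using step pos_opp[of "Suc j" "- \<Phi> j r"] by simp

lemma hull_coord:
  assumes "i mod K = j mod K" "i' mod K = j mod K" "p i \<le> t" "t \<le> p i'"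
  shows "\<epsilon> j * (t - c j) \<le> R j" "- (\<epsilon> j * (t - c j)) \<le> R (j + K)"
proof -
  have *: "\<epsilon> j' * (x - c j') \<le> R j'" if x: "x = p a" "a mod K = j' mod K" for a x j'
  proof (cases "0 < \<epsilon> j' * (x - c j')")
    case True
    then have "\<epsilon> j' * (x - c j') \<in> PC j'" unfolding PC_def using x pos_coord by auto
    then show ?thesis by (rule PC_le)
  qed (use R_pos[of j'] in simp)
  have ix: "i mod K = (j + K) mod K" "i' mod K = (j + K) mod K" using assms by simp_all
  show "\<epsilon> j * (t - c j) \<le> R j" "- (\<epsilon> j * (t - c j)) \<le> R (j + K)"
    using *[OF refl assms(1)] *[OF refl assms(2)] *[OF refl ix(1)] *[OF refl ix(2)] assms(3,4) eps[of j]
    by (auto simp: eps_K c_per)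
qed

lemma pos_hull:
  assumes "0 \<le> r" "r \<le> R j" obtains i i' where "i mod K = j mod K" "i' mod K = j mod K" "p i \<le> pos j r" "pos j r \<le> p i'"
proof -
  obtain i i' where i: "i mod K = j mod K" "i' mod K = j mod K" "p i < c j" "c j < p i'" using c_hull by blast
  obtain a where a: "a mod K = j mod K" "p a = pos j (R j)" using R_in[of j] by (auto simp: PC_def)
  show ?thesis
    using eps[of j]
  proof
    assume "\<epsilon> j = 1" then show ?thesis using that[of i a] i a assms by (simp add: pos_def)
  next
    assume "\<epsilon> j = -1" then show ?thesis using that[of a i'] i a assms by (simp add: pos_def)
  qed
qed

lemma \<Phi>_bound: assumes "0 \<le> r" shows "\<Phi> j r \<le> R (Suc j)" "- \<Phi> j r \<le> R (Suc j + K)"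
proof -
  have r: "0 \<le> min r (R j)" "min r (R j) \<le> R j" using assms R_pos[of j] by auto
  obtain i i' where "i mod K = j mod K" "i' mod K = j mod K" "p i \<le> pos j (min r (R j))" "pos j (min r (R j)) \<le> p i'"
    using pos_hull[OF r] .
  from hull_image[OF this] obtain a a' where "a mod K = Suc j mod K" "a' mod K = Suc j mod K"
    "p a \<le> F (pos j (min r (R j)))" "F (pos j (min r (R j))) \<le> p a'" .
  from hull_coord[OF this] show "\<Phi> j r \<le> R (Suc j)" "- \<Phi> j r \<le> R (Suc j + K)" by (simp_all add: \<Phi>_def)
qed

lemma \<Phi>_near: assumes "0 < r" "r \<le> \<rho> j" shows "0 < \<Phi> j r"
proof -
  obtain i where i: "i mod K = j mod K" "p i = pos j (\<rho> j)" using \<rho>_in[of j] by (auto simp: PC_def)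
  have "r \<le> \<epsilon> j * (p i - c j)" using assms coord_pos i by simp
  moreover have "c j + \<epsilon> j * s \<notin> range p" if s: "0 < s" "s < r" for s
  proof
    assume "c j + \<epsilon> j * s \<in> range p"
    then obtain l where l: "p l = pos j s" by (auto simp: pos_def)
    have "0 \<le> s" "s \<le> R j" using s assms PC_le[OF \<rho>_in, of j] by auto
    from pos_hull[OF this] have "l mod K = j mod K" using class_convex l by metis
    then have "s \<in> PC j" using l s by (auto simp: PC_def)
    then show False using PC_ge s assms by fastforce
  qed
  ultimately have "0 < \<epsilon> (Suc j) * (F (pos j r) - c (Suc j))" using near[OF assms(1) i(1)] by (simp add: pos_def)
  moreover have "r \<le> R j" using assms PC_le[OF \<rho>_in, of j] by simp
  ultimately show ?thesis by (simp add: \<Phi>_def min_absorb1)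
qed

lemma \<Phi>_affine:
  assumes "0 \<le> r1" "r1 < r2" "r2 \<le> R j" "\<And>r. r \<in> PC j \<Longrightarrow> \<not> (r1 < r \<and> r < r2)"
  shows "\<exists>s. s \<noteq> 0 \<and> (\<forall>r. r1 \<le> r \<and> r \<le> r2 \<longrightarrow> \<Phi> j r = \<Phi> j r1 + s * (r - r1))"
proof -
  define m where "m = (r1 + r2) / 2"
  have m: "r1 < m" "m < r2" "0 \<le> m" "m \<le> R j" using assms by (auto simp: m_def)
  obtain i i' where i: "i mod K = j mod K" "i' mod K = j mod K" "p i \<le> pos j m" "pos j m \<le> p i'" using pos_hull[OF m(3,4)] .
  have inP: "r \<in> PC j" if rr: "pos j r \<in> range p" "0 < r" "r \<le> R j" for r
  proof -
    obtain l where l: "pos j r = p l" using rr(1) by blast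
    from rr obtain a a' where "a mod K = j mod K" "a' mod K = j mod K" "p a \<le> pos j r" "pos j r \<le> p a'"
      using pos_hull[of r j] by auto
    then have "l mod K = j mod K" using class_convex l by metis
    then show ?thesis using l rr unfolding PC_def by fastforce
  qed
  have mP: "pos j m \<notin> range p" using inP[of m] m assms by auto
  define u v where "u = left_nb (range p) (pos j m)" and "v = right_nb (range p) (pos j m)"
  have g: "adjacent (range p) u v" "u < pos j m" "pos j m < v"
    using nb_gap[OF cyc_finite[OF cp] mP, of "p i" "p i'"] i unfolding u_def v_def by auto
  have noP: "pos j r \<noteq> u \<and> pos j r \<noteq> v" if "r1 < r" "r < r2" for r
    using inP[of r] that assms g(1) unfolding adjacent_def by auto
  have in_gap: "u \<le> pos j r \<and> pos j r \<le> v" if r: "r1 \<le> r" "r \<le> r2" for r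
  proof (rule ccontr)
    assume "\<not> ?thesis"
    then have "\<epsilon> j * (u - c j) \<in> {r1<..<r2} \<or> \<epsilon> j * (v - c j) \<in> {r1<..<r2}"
      using g(2,3) eps[of j] r m by (auto simp: pos_def)
    then show False using noP[of "\<epsilon> j * (u - c j)"] noP[of "\<epsilon> j * (v - c j)"] pos_coord by auto
  qed
  obtain s where s: "\<forall>x\<in>{u..v}. F x = F u + s * (x - u)" using dm g(1) unfolding dots_map_def by blast
  have "F u \<noteq> F v"
  proof
    assume eq: "F u = F v"
    obtain a a' where a: "u = p a" "v = p a'" using g(1) by (auto simp: adjacent_def)
    then have "p (Suc a) = p (Suc a')" using eq Fp by simp
    then have "Suc a mod N = Suc a' mod N" using cyc_eq_iff[OF cp] by blast
    then have "a mod N = a' mod N" by (auto simp: nat_mod_eq_iff)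
    then show False using a g cyc_eq_iff[OF cp] by force
  qed
  then have "s \<noteq> 0" using bspec[OF s, of v] g by auto
  have "\<Phi> j r = \<Phi> j r1 + (\<epsilon> (Suc j) * \<epsilon> j * s) * (r - r1)" if r: "r1 \<le> r" "r \<le> r2" for r
  proof -
    have "F (pos j r) - F (pos j r1) = s * (\<epsilon> j * (r - r1))"
      using bspec[OF s, of "pos j r"] bspec[OF s, of "pos j r1"] in_gap[OF r] in_gap[of r1] assms(2)
      by (simp add: pos_def algebra_simps)
    moreover have "r \<le> R j" "r1 \<le> R j" using r assms by auto
    then have "\<Phi> j r - \<Phi> j r1 = \<epsilon> (Suc j) * (F (pos j r) - F (pos j r1))"
      by (simp add: \<Phi>_def min_absorb1 right_diff_distrib)
    ultimately show ?thesis by (simp add: mult.assoc mult.left_commute)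
  qed
  moreover have "\<epsilon> (Suc j) * \<epsilon> j * s \<noteq> 0" using \<open>s \<noteq> 0\<close> by simp
  ultimately show ?thesis by blast
qed

subsection \<open>The cycle in ray coordinates\<close>

definition ix :: "nat \<Rightarrow> nat" where "ix i = (if 0 < \<epsilon> i * (p i - c i) then i else i + K)"
definition \<xi> :: "nat \<Rightarrow> real" where "\<xi> i = \<bar>p i - c i\<bar>"
definition viol :: "nat \<Rightarrow> bool" where "viol i \<longleftrightarrow> \<Phi> (ix i) (\<xi> i) < 0"

lemma p_ne_c: "p i \<noteq> c j"
  using cP[of j] by (metis rangeI)

lemma \<xi>_pos: "0 < \<xi> i"
  using p_ne_c[of i i] by (simp add: \<xi>_def)

lemma pos_ix: "pos (ix i) (\<xi> i) = p i"
  using eps[of i] p_ne_c[of i i] by (auto simp: ix_def \<xi>_def pos_def eps_K c_per abs_real_def split: if_splits)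

lemma ix_modK: "ix i mod K = i mod K" by (simp add: ix_def)

lemma \<xi>_PC: "\<xi> i \<in> PC (ix i)"
  unfolding PC_def using \<xi>_pos[of i] pos_ix[of i] ix_modK[of i] by (intro CollectI conjI exI[of _ i]) simp_all

lemma level_iff: "j mod K = j' mod K \<longleftrightarrow> j mod (2 * K) = j' mod (2 * K) \<or> j mod (2 * K) = (j' + K) mod (2 * K)"
proof -
  have *: "(a + K) mod (2 * K) = (if a mod (2 * K) < K then a mod (2 * K) + K else a mod (2 * K) - K)" for a
  proof -
    have "(a + K) mod (2 * K) = (a mod (2 * K) + K) mod (2 * K)" by (simp add: mod_add_left_eq)
    moreover have "(m + K) mod (2 * K) = (if m < K then m + K else m - K)" if "m < 2 * K" for m
    proof (cases "m < K")
      case False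
      then have "m + K = (m - K) + 2 * K" by simp
      then have "(m + K) mod (2 * K) = (m - K) mod (2 * K)" by (metis mod_add_self2)
      then show ?thesis using that False by simp
    qed simp
    ultimately show ?thesis using K0 by simp
  qed
  have **: "a mod K = (if a mod (2 * K) < K then a mod (2 * K) else a mod (2 * K) - K)" for a
  proof -
    have "a mod K = (a mod (2 * K)) mod K" by (simp add: mod_mod_cancel)
    moreover have "m mod K = (if m < K then m else m - K)" if "m < 2 * K" for m
    proof (cases "m < K")
      case False
      then have "m = (m - K) + K" by simp
      then have "m mod K = (m - K) mod K" by (metis mod_add_self2)
      then show ?thesis using that False by simp
    qed simp
    ultimately show ?thesis using K0 by simp
  qed
  have "j mod (2 * K) < 2 * K" "j' mod (2 * K) < 2 * K" using K0 by simp_all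
  then show ?thesis unfolding * **[of j] **[of j'] by (auto split: if_splits)
qed

lemma pos_eq_iff:
  assumes "j mod K = j' mod K" "0 < r" "0 < s"
  shows "pos j r = pos j' s \<longleftrightarrow> j mod (2 * K) = j' mod (2 * K) \<and> r = s"
proof (cases "j mod (2 * K) = j' mod (2 * K)")
  case True then show ?thesis using ray_cong(3)[OF True] pos_inj by simp
next
  case False
  then have "j mod (2 * K) = (j' + K) mod (2 * K)" using level_iff assms(1) by blast
  then have "pos j r = pos j' (- r)" using ray_cong(3)[of j "j' + K"] pos_opp by simp
  then show ?thesis using False pos_inj assms by auto
qed

lemma \<xi>_step:
  "viol i \<Longrightarrow> ix (Suc i) mod (2 * K) = (Suc (ix i) + K) mod (2 * K) \<and> \<xi> (Suc i) = - \<Phi> (ix i) (\<xi> i)"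
  "\<not> viol i \<Longrightarrow> ix (Suc i) mod (2 * K) = Suc (ix i) mod (2 * K) \<and> \<xi> (Suc i) = \<Phi> (ix i) (\<xi> i)"
proof -
  have le: "\<xi> i \<le> R (ix i)" using PC_le \<xi>_PC by blast
  have lev: "ix (Suc i) mod K = Suc (ix i) mod K" "ix (Suc i) mod K = (Suc (ix i) + K) mod K"
    using ix_modK[of "Suc i"] ix_modK[of i] by (metis mod_Suc_eq, metis mod_Suc_eq mod_add_self2)
  have eq: "pos (ix (Suc i)) (\<xi> (Suc i)) = F (pos (ix i) (\<xi> i))" by (simp add: pos_ix Fp)
  show "viol i \<Longrightarrow> ix (Suc i) mod (2 * K) = (Suc (ix i) + K) mod (2 * K) \<and> \<xi> (Suc i) = - \<Phi> (ix i) (\<xi> i)"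
    using eq pos_eq_iff[OF lev(2) \<xi>_pos, of "- \<Phi> (ix i) (\<xi> i)"] step_opp[OF le] by (simp add: viol_def)
  assume nv: "\<not> viol i"
  have "\<Phi> (ix i) (\<xi> i) \<noteq> 0"
  proof
    assume "\<Phi> (ix i) (\<xi> i) = 0"
    then have "p (Suc i) = c (Suc (ix i))" using step[OF le] pos_ix[of i] Fp[of i] by simp
    then show False using cP by (metis rangeI)
  qed
  then show "ix (Suc i) mod (2 * K) = Suc (ix i) mod (2 * K) \<and> \<xi> (Suc i) = \<Phi> (ix i) (\<xi> i)"
    using eq pos_eq_iff[OF lev(1) \<xi>_pos, of "\<Phi> (ix i) (\<xi> i)"] step[OF le] nv by (simp add: viol_def)
qed

lemma PC_iff: "r \<in> PC j \<longleftrightarrow> (\<exists>i. ix i mod (2 * K) = j mod (2 * K) \<and> \<xi> i = r)"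
proof
  assume "r \<in> PC j"
  then obtain i where i: "0 < r" "i mod K = j mod K" "p i = pos j r" by (auto simp: PC_def)
  then have "ix i mod K = j mod K" using ix_modK by simp
  then show "\<exists>i. ix i mod (2 * K) = j mod (2 * K) \<and> \<xi> i = r"
    using pos_eq_iff[of "ix i" j "\<xi> i" r] \<xi>_pos i pos_ix by metis
next
  assume "\<exists>i. ix i mod (2 * K) = j mod (2 * K) \<and> \<xi> i = r"
  then show "r \<in> PC j" using \<xi>_PC ray_cong(4) by metis
qed

lemma K_dvd_N: "K dvd N" by (rule blk_dvd_period[OF bK])

lemma per_N: "ix (i + N) mod (2 * K) = ix i mod (2 * K)" "\<xi> (i + N) = \<xi> i" "viol (i + N) = viol i"
proof -
  have "ix (i + N) mod K = ix i mod K" using ix_modK K_dvd_N add_mod_iff by metis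
  then show 1: "ix (i + N) mod (2 * K) = ix i mod (2 * K)" "\<xi> (i + N) = \<xi> i"
    using pos_eq_iff[of "ix (i + N)" "ix i" "\<xi> (i + N)" "\<xi> i"] \<xi>_pos pos_ix cyc_periodic[OF cp, of i] by simp_all
  show "viol (i + N) = viol i" unfolding viol_def 1(2) ray_cong(7)[OF 1(1)] ..
qed

end

context spiral
begin

section \<open>Loops of rays\<close>

text \<open>A path is given by its initial ray and the set of times at which it violates the cyclic order of
  the rays by passing to the opposite side.\<close>

primrec path :: "nat \<Rightarrow> (nat \<Rightarrow> bool) \<Rightarrow> nat \<Rightarrow> nat" where
  "path t v 0 = t"
| "path t v (Suc i) = Suc (path t v i) + (if v i then K else 0)"

definition gs :: "nat \<Rightarrow> (nat \<Rightarrow> bool) \<Rightarrow> nat \<Rightarrow> real \<Rightarrow> real" where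
  "gs t v i r = (if v i then - \<Phi> (path t v i) r else \<Phi> (path t v i) r)"

definition closed_path :: "nat \<Rightarrow> (nat \<Rightarrow> bool) \<Rightarrow> nat \<Rightarrow> bool" where
  "closed_path t v L \<longleftrightarrow> 0 < L \<and> (\<forall>i. v (i + L) = v i) \<and> path t v L mod (2 * K) = t mod (2 * K)"

lemma path_level: "path t v i mod K = (t + i) mod K"
proof (induction i)
  case (Suc i)
  have "path t v (Suc i) mod K = Suc (path t v i) mod K"
    using mod_add_self2[of "Suc (path t v i)" K] by simp
  also have "\<dots> = Suc (t + i) mod K" using Suc by (metis mod_Suc_eq)
  finally show ?case by simp
qed simp

lemma path_shift: "path (path t v i) (\<lambda>j. v (i + j)) j = path t v (i + j)"
  by (induction j) simp_all

lemma path_cong: "t mod (2 * K) = t' mod (2 * K) \<Longrightarrow> path t v i mod (2 * K) = path t' v i mod (2 * K)"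
proof (induction i)
  case (Suc i)
  then have "(path t v i + (1 + (if v i then K else 0))) mod (2 * K) = (path t' v i + (1 + (if v i then K else 0))) mod (2 * K)"
    by (metis mod_add_left_eq)
  then show ?case by (simp add: ac_simps)
qed simp

lemma closed_path_periodic: assumes "closed_path t v L" shows "path t v (i + L) mod (2 * K) = path t v i mod (2 * K)"
proof -
  have "(\<lambda>j. v (L + j)) = v" using assms by (auto simp: closed_path_def add.commute)
  then have "path t v (i + L) = path (path t v L) v i" using path_shift[of t v L i] by (simp add: add.commute)
  then show ?thesis using path_cong assms unfolding closed_path_def by metis
qed

lemma closed_path_shift: assumes "closed_path t v L" shows "closed_path (path t v i) (\<lambda>j. v (i + j)) L"
proof -
  have "v (i + (j + L)) = v (i + j)" for j using assms by (metis add.assoc closed_path_def)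
  then show ?thesis using assms closed_path_periodic[OF assms, of i] unfolding closed_path_def path_shift by simp
qed

lemma gs_periodic: assumes "closed_path t v L" shows "gs t v (i + L) = gs t v i"
  using ray_cong(7)[OF closed_path_periodic[OF assms, of i]] assms unfolding gs_def closed_path_def by auto

lemma gs_0: "gs t v i 0 = 0" by (simp add: gs_def \<Phi>_0)

lemma gs_cont: "continuous_on UNIV (gs t v i)"
  unfolding gs_def using \<Phi>_cont by (cases "v i") (auto intro!: continuous_intros)

lemma gs_bound: "0 \<le> r \<Longrightarrow> gs t v i r \<le> R (path t v (Suc i))"
  using \<Phi>_bound by (simp add: gs_def)

lemma gs_step: "r \<le> R (path t v i) \<Longrightarrow> F (pos (path t v i) r) = pos (path t v (Suc i)) (gs t v i r)"
  using step step_opp by (simp add: gs_def)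

definition ext :: "nat \<Rightarrow> (nat \<Rightarrow> bool) \<Rightarrow> nat \<Rightarrow> real \<Rightarrow> real" where
  "ext t v i = sup_to (gs t v i) 0"

lemma ext_mono: "w \<le> w' \<Longrightarrow> ext t v i w \<le> ext t v i w'"
  unfolding ext_def by (rule sup_to_mono[OF gs_cont])

lemma ext_cont: "continuous_on UNIV (ext t v i)"
  unfolding ext_def by (rule sup_to_continuous[OF gs_cont])

lemma ext_le_0: "w \<le> 0 \<Longrightarrow> ext t v i w = 0"
  unfolding ext_def using sup_to_base[OF gs_cont] gs_0 by metis

lemma ext_nonneg: "0 \<le> ext t v i w"
proof -
  have "gs t v i 0 \<le> sup_to (gs t v i) 0 w" by (rule sup_to_ge_base[OF gs_cont])
  then show ?thesis by (simp add: ext_def gs_0)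
qed

lemma ext_ge: "0 \<le> s \<Longrightarrow> s \<le> w \<Longrightarrow> gs t v i s \<le> ext t v i w"
  unfolding ext_def by (rule sup_to_ge[OF gs_cont])

abbreviation cext :: "nat \<Rightarrow> (nat \<Rightarrow> bool) \<Rightarrow> nat \<Rightarrow> nat \<Rightarrow> real \<Rightarrow> real" where
  "cext t v \<equiv> comp_from (ext t v)"

lemma cext_mono: "w \<le> w' \<Longrightarrow> cext t v s i w \<le> cext t v s i w'"
  by (rule comp_from_mono) (rule ext_mono)

lemma cext_cont: "continuous_on UNIV (cext t v s i)"
  by (rule comp_from_continuous) (rule ext_cont)

lemma cext_0: "cext t v s i 0 = 0"
  by (induction i) (simp_all add: ext_le_0)

lemma ext_viol_near: assumes "v i" "w \<le> \<rho> (path t v i)" shows "ext t v i w = 0"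
proof (rule antisym)
  show "ext t v i w \<le> 0" unfolding ext_def
  proof (rule sup_to_le[OF gs_cont])
    fix s assume s: "0 \<le> s" "s \<le> max 0 w"
    then have "s \<le> \<rho> (path t v i)" using assms \<rho>_pos[of "path t v i"] by (simp add: max_def split: if_splits)
    then have "0 \<le> \<Phi> (path t v i) s" using \<Phi>_near[of s] \<Phi>_0 s(1) by (cases "s = 0") (auto simp: less_imp_le)
    then show "gs t v i s \<le> 0" using assms(1) by (simp add: gs_def)
  qed
qed (rule ext_nonneg)

text \<open>The innermost fixed point of the composition of the running maxima along a closed path is an
  actual periodic point: were one of the maxima attained further inside, then by the intermediate
  value theorem a point further inside would be mapped to the fixed point already.\<close>

lemma innermost_cycle:
  assumes cl: "closed_path t v L" and i0: "i0 < L" "v i0" and b: "0 < b" "b \<le> cext t v 0 L b"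
  shows "\<exists>r. \<forall>i. 0 < r i \<and> r i \<le> R (path t v i) \<and> r (i + L) = r i \<and> gs t v i (r i) = r (Suc i) \<and>
           (\<forall>w. 0 \<le> w \<and> w < r i \<longrightarrow> gs t v i w < r (Suc i))"
proof -
  have L: "0 < L" using cl by (simp add: closed_path_def)
  define h where "h = cext t v 0 L"
  have hc: "continuous_on UNIV h" unfolding h_def by (rule cext_cont)
  have "\<exists>d>0. \<forall>w\<le>d. h w = 0"
  proof -
    have "isCont (cext t v 0 i0) 0" using cext_cont[of t v 0 i0] by (simp add: continuous_on_eq_continuous_at)
    then obtain d where d: "0 < d" "\<And>s. \<bar>s\<bar> < d \<Longrightarrow> \<bar>cext t v 0 i0 s\<bar> < \<rho> (path t v i0)"
      using \<rho>_pos[of "path t v i0"] cext_0 unfolding continuous_at_eps_delta by (force simp: dist_real_def)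
    have "h w = 0" if w: "w \<le> d / 2" for w
    proof -
      have "cext t v 0 i0 w \<le> cext t v 0 i0 (d / 2)" by (rule cext_mono[OF w])
      also have "\<dots> \<le> \<rho> (path t v i0)" using d(2)[of "d / 2"] d(1) by simp
      finally have "cext t v 0 (Suc i0) w = 0" using ext_viol_near[where v = v and i = i0 and t = t, OF i0(2)] by simp
      moreover have "h w = cext t v (Suc i0) (L - Suc i0) (cext t v 0 (Suc i0) w)"
        using comp_from_add[of "ext t v" 0 "Suc i0" "L - Suc i0" w] i0(1) by (simp add: h_def)
      ultimately show ?thesis by (simp add: cext_0)
    qed
    then show ?thesis using d(1) by (intro exI[of _ "d / 2"]) auto
  qed
  then obtain d where d: "0 < d" "\<And>w. w \<le> d \<Longrightarrow> h w = 0" by blast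
  define X where "X = {w \<in> {d..b}. 0 \<le> h w - w}"
  have "closed X" unfolding X_def
    by (rule continuous_closed_preimage[of "{d..b}" "\<lambda>w. h w - w" "{0..}", unfolded Collect_conj_eq[symmetric] vimage_def Int_def mem_Collect_eq atLeast_iff])
      (auto intro!: continuous_intros continuous_on_subset[OF hc])
  then have "compact X" by (intro compact_eq_bounded_closed[THEN iffD2] conjI bounded_subset[OF bounded_closed_interval[of d b]]) (auto simp: X_def)
  moreover have "d < b" using b d by (metis h_def leD not_less order_trans)
  then have "b \<in> X" using b by (simp add: X_def h_def)
  ultimately obtain x where x: "x \<in> X" "\<And>w. w \<in> X \<Longrightarrow> x \<le> w" using compact_attains_inf[of X] by blast
  have dx: "d \<le> x" "x \<le> b" "x \<le> h x" using x(1) by (auto simp: X_def)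
  have inner: "h w < w" if "0 < w" "w < x" for w
  proof (cases "w \<le> d")
    case True then show ?thesis using d(2) that by simp
  next
    case False
    have "w \<notin> X" using x(2)[of w] that by auto
    then show ?thesis using False that dx by (simp add: X_def)
  qed
  have fix_x: "h x = x"
  proof (rule ccontr)
    assume "h x \<noteq> x"
    then have "h d - d \<le> 0" "0 \<le> h x - x" "h x - x \<noteq> 0" using dx d by auto
    moreover have "continuous_on {d..x} (\<lambda>w. h w - w)" by (auto intro!: continuous_intros continuous_on_subset[OF hc])
    ultimately obtain w where w: "d \<le> w" "w \<le> x" "h w - w = 0" using IVT'[of "\<lambda>w. h w - w" d 0 x] dx by auto
    then have "w < x" using \<open>h x - x \<noteq> 0\<close> by (cases "w = x") auto
    then show False using inner[of w] w d(1) by simp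
  qed
  define r where "r i = cext t v 0 i x" for i
  have rS: "r (Suc i) = ext t v i (r i)" for i by (simp add: r_def)
  have r0: "r 0 = x" and rL: "r L = x" using fix_x by (simp_all add: r_def h_def)
  have eper: "ext t v (i + L) = ext t v i" for i using gs_periodic[OF cl] by (simp add: ext_def)
  have rper: "r (i + L) = r i" for i
  proof -
    have "r (L + i) = cext t v (0 + L) i (r L)" by (simp only: r_def comp_from_add)
    also have "\<dots> = cext t v 0 i x" unfolding rL by (rule comp_from_periodic[where A = "ext t v" and L = L, OF eper]) simp
    finally show ?thesis by (simp add: r_def add.commute)
  qed
  have rest: "r (i + j) = cext t v i j (r i)" for i j using comp_from_add[of "ext t v" 0 i j x] by (simp add: r_def)
  have pos0: "0 < r i" if "i < L" for i
  proof (rule ccontr)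
    assume "\<not> 0 < r i"
    then have "cext t v i (L - i) (r i) \<le> cext t v i (L - i) 0" by (intro cext_mono) simp
    then show False using rest[of i "L - i"] that rL dx d(1) cext_0 by simp
  qed
  have strict: "ext t v i w < r (Suc i)" if i: "i < L" and w: "0 \<le> w" "w < r i" for i w
  proof (rule ccontr)
    assume "\<not> ?thesis"
    then have ge: "r (Suc i) \<le> ext t v i w" by simp
    have "continuous_on {0..x} (cext t v 0 i)" by (rule continuous_on_subset[OF cext_cont]) simp
    moreover have "cext t v 0 i 0 \<le> w" "w \<le> cext t v 0 i x" using w cext_0 by (simp_all add: r_def)
    ultimately obtain y where y: "0 \<le> y" "y \<le> x" "cext t v 0 i y = w" using IVT'[of "cext t v 0 i" 0 w x] dx d(1) by auto
    have "y \<noteq> x" using y(3) w(2) by (auto simp: r_def)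
    have "h y = cext t v (Suc i) (L - Suc i) (ext t v i w)"
      using comp_from_add[of "ext t v" 0 "Suc i" "L - Suc i" y] i y(3) by (simp add: h_def)
    also have "\<dots> \<ge> cext t v (Suc i) (L - Suc i) (r (Suc i))" by (rule cext_mono[OF ge])
    also have "cext t v (Suc i) (L - Suc i) (r (Suc i)) = x" using rest[of "Suc i" "L - Suc i"] i rL by simp
    finally have "x \<le> h y" .
    then show False using inner[of y] y \<open>y \<noteq> x\<close> d by (cases "y = 0") auto
  qed
  have main: "0 < r i \<and> gs t v i (r i) = r (Suc i) \<and> (\<forall>w. 0 \<le> w \<and> w < r i \<longrightarrow> gs t v i w < r (Suc i))" if i: "i < L" for i
  proof -
    obtain s where s: "0 \<le> s" "s \<le> max 0 (r i)" "gs t v i s = r (Suc i)"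
      using sup_to_attained[OF gs_cont, of 0 "r i" t v i] rS[of i] by (auto simp: ext_def)
    have "gs t v i w < r (Suc i)" if "0 \<le> w" "w < r i" for w
      using ext_ge[of w w t v i] strict[OF i that] that by simp
    moreover from this have "s = r i" using s pos0[OF i] by (metis less_irrefl max.absorb4 order_le_less)
    ultimately show ?thesis using s pos0[OF i] by blast
  qed
  have rle: "r (Suc i) \<le> R (path t v (Suc i))" if "i < L" for i
    using main[OF that] gs_bound[of "r i" t v i] by auto
  have all: "0 < r i \<and> r i \<le> R (path t v i) \<and> r (i + L) = r i \<and> gs t v i (r i) = r (Suc i) \<and>
           (\<forall>w. 0 \<le> w \<and> w < r i \<longrightarrow> gs t v i w < r (Suc i))" for i
  proof -
    define a where "a = i mod L"
    have a: "a < L" using L by (simp add: a_def)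
    have Sa: "Suc a mod L = Suc i mod L" by (simp add: a_def mod_Suc_eq)
    have r: "r a = r i" "r (Suc a) = r (Suc i)" using periodic_cong[of r L] rper a_def Sa by (metis mod_mod_trivial)+
    have g: "gs t v a = gs t v i" using periodic_cong[of "gs t v" L a i] gs_periodic[OF cl] by (simp add: a_def)
    have "R (path t v i) = R (path t v (i + L))" using ray_cong(5)[OF closed_path_periodic[OF cl, of i]] by simp
    moreover obtain m where m: "i + L = Suc m" using L by (metis Suc_pred add_gr_0)
    define m' where "m' = m mod L"
    have "r (Suc m') \<le> R (path t v (Suc m'))" using rle L by (simp add: m'_def)
    moreover have "Suc m' mod L = (i + L) mod L" unfolding m m'_def by (simp add: mod_Suc_eq)
    then have "r (Suc m') = r (i + L)" "R (path t v (Suc m')) = R (path t v (i + L))"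
      using periodic_cong[of r L, OF rper] periodic_cong[of "\<lambda>i. R (path t v i)" L] ray_cong(5)[OF closed_path_periodic[OF cl]] by blast+
    ultimately have "r i \<le> R (path t v i)" using rper[of i] by simp
    then show ?thesis using main[OF a] rper[of i] unfolding r g by blast
  qed
  then show ?thesis by blast
qed

section \<open>Folding\<close>

text \<open>For a cycle of points \<open>pos (path t v i) (r i)\<close>, at each of which \<open>F\<close> is increasing in the outward
  direction up to the next point of the cycle \<open>p\<close>.\<close>

definition outer :: "nat \<Rightarrow> (nat \<Rightarrow> bool) \<Rightarrow> (nat \<Rightarrow> real) \<Rightarrow> nat \<Rightarrow> real" where
  "outer t v r i = Min {s \<in> PC (path t v i). r i < s}"

definition block_loop :: "nat \<Rightarrow> (nat \<Rightarrow> bool) \<Rightarrow> nat \<Rightarrow> (nat \<Rightarrow> real) \<Rightarrow> bool" where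
  "block_loop t v L r \<longleftrightarrow> closed_path t v L \<and> K dvd L \<and>
     (\<forall>i. 0 \<le> r i \<and> r i < R (path t v i) \<and> r i \<notin> PC (path t v i) \<and> r (i + L) = r i \<and> gs t v i (r i) = r (Suc i)) \<and>
     (\<forall>i w. r i < w \<and> w \<le> outer t v r i \<longrightarrow> r (Suc i) < gs t v i w) \<and>
     (\<forall>i j. path t v i mod (2 * K) = path t v j mod (2 * K) \<and> r i = r j \<longrightarrow> i mod L = j mod L)"

definition nb :: "nat \<Rightarrow> (nat \<Rightarrow> bool) \<Rightarrow> (nat \<Rightarrow> real) \<Rightarrow> nat \<Rightarrow> real" where
  "nb t v r i = Min (insert (R (path t v i)) {r j | j. path t v j mod (2 * K) = path t v i mod (2 * K) \<and> r i < r j})"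

definition grow :: "nat \<Rightarrow> (nat \<Rightarrow> bool) \<Rightarrow> (nat \<Rightarrow> real) \<Rightarrow> nat \<Rightarrow> real \<Rightarrow> real" where
  "grow t v r i w = min (nb t v r (Suc i)) (sup_to (gs t v i) (r i) w)"

context
  fixes t v L r assumes bl: "block_loop t v L r"
begin

lemma bl_closed: "closed_path t v L" and bl_K: "K dvd L"
  and bl_r: "0 \<le> r i" "r i < R (path t v i)" "r i \<notin> PC (path t v i)" "r (i + L) = r i" "gs t v i (r i) = r (Suc i)"
  and bl_slope: "r i < w \<Longrightarrow> w \<le> outer t v r i \<Longrightarrow> r (Suc i) < gs t v i w"
  and bl_dist: "path t v i mod (2 * K) = path t v j mod (2 * K) \<Longrightarrow> r i = r j \<Longrightarrow> i mod L = j mod L"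
  using bl unfolding block_loop_def by blast+

lemma bl_L: "0 < L" using bl_closed by (simp add: closed_path_def)

lemma bl_cong:
  assumes "i mod L = j mod L"
  shows "r i = r j" "path t v i mod (2 * K) = path t v j mod (2 * K)"
  using periodic_cong[of r L, OF bl_r(4) assms]
    periodic_cong[of "\<lambda>i. path t v i mod (2 * K)" L, OF closed_path_periodic[OF bl_closed] assms] by auto

lemma nb_fin: "finite {r j | j. path t v j mod (2 * K) = path t v i mod (2 * K) \<and> r i < r j}"
proof (rule finite_subset)
  show "{r j | j. path t v j mod (2 * K) = path t v i mod (2 * K) \<and> r i < r j} \<subseteq> r ` {..<L}"
  proof
    fix x assume "x \<in> {r j | j. path t v j mod (2 * K) = path t v i mod (2 * K) \<and> r i < r j}"
    then obtain j where "x = r j" by blast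
    then have "x = r (j mod L)" using bl_cong(1)[of "j mod L" j] by simp
    then show "x \<in> r ` {..<L}" using bl_L by simp
  qed
qed simp

lemma nb_cases: "nb t v r i = R (path t v i) \<or> (\<exists>j. nb t v r i = r j \<and> path t v j mod (2 * K) = path t v i mod (2 * K) \<and> r i < r j)"
  using Min_in[of "insert (R (path t v i)) {r j | j. path t v j mod (2 * K) = path t v i mod (2 * K) \<and> r i < r j}"] nb_fin
  unfolding nb_def by auto

lemma nb_le_R: "nb t v r i \<le> R (path t v i)"
  unfolding nb_def using nb_fin by (intro Min_le) auto

lemma nb_le: "path t v j mod (2 * K) = path t v i mod (2 * K) \<Longrightarrow> r i < r j \<Longrightarrow> nb t v r i \<le> r j"
  unfolding nb_def using nb_fin by (intro Min_le) auto

lemma nb_gt: "r i < nb t v r i"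
  using nb_cases[of i] bl_r(2)[of i] by auto

lemma nb_cong: assumes "i mod L = j mod L" shows "nb t v r i = nb t v r j"
  unfolding nb_def bl_cong[OF assms] ray_cong(5)[OF bl_cong(2)[OF assms]] ..

lemma outer_in: "outer t v r i \<in> PC (path t v i)" "r i < outer t v r i" "outer t v r i \<le> R (path t v i)"
proof -
  have "outer t v r i \<in> {s \<in> PC (path t v i). r i < s}"
    unfolding outer_def using PC_fin R_in bl_r(2) by (intro Min_in) auto
  then show "outer t v r i \<in> PC (path t v i)" "r i < outer t v r i" "outer t v r i \<le> R (path t v i)" using PC_le by auto
qed

lemma outer_le: "s \<in> PC (path t v i) \<Longrightarrow> r i < s \<Longrightarrow> outer t v r i \<le> s"
  unfolding outer_def using PC_fin by (intro Min_le) auto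

lemma outer_cong: assumes "i mod L = j mod L" shows "outer t v r i = outer t v r j"
  unfolding outer_def bl_cong(1)[OF assms] ray_cong(4)[OF bl_cong(2)[OF assms]] ..

lemma grow_mono: "w \<le> w' \<Longrightarrow> grow t v r i w \<le> grow t v r i w'"
  unfolding grow_def using sup_to_mono[OF gs_cont] by (meson min.mono order_refl)

lemma grow_periodic: "grow t v r (i + L) = grow t v r i"
  unfolding grow_def gs_periodic[OF bl_closed] bl_r(4) using nb_cong[of "Suc (i + L)" "Suc i"] by (simp flip: add_Suc)

lemma cycle_point_step:
  assumes i: "ix a mod (2 * K) = path t v i mod (2 * K)" and g: "0 < gs t v i (\<xi> a)"
  shows "ix (Suc a) mod (2 * K) = path t v (Suc i) mod (2 * K)" "\<xi> (Suc a) = gs t v i (\<xi> a)"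
proof -
  have \<Phi>: "\<Phi> (ix a) = \<Phi> (path t v i)" by (rule ray_cong(7)[OF i])
  have S: "Suc (ix a) mod (2 * K) = Suc (path t v i) mod (2 * K)" using i by (metis mod_Suc_eq)
  then have SK: "(Suc (ix a) + K) mod (2 * K) = (Suc (path t v i) + K) mod (2 * K)" by (metis mod_add_left_eq)
  have "viol a = v i" using g by (auto simp: viol_def gs_def \<Phi> split: if_splits)
  then show "ix (Suc a) mod (2 * K) = path t v (Suc i) mod (2 * K)" "\<xi> (Suc a) = gs t v i (\<xi> a)"
    using \<xi>_step[of a] S SK by (auto simp: gs_def \<Phi>)
qed

lemma loop_point_step:
  assumes i: "path t v j mod (2 * K) = path t v i mod (2 * K)" and g: "r (Suc i) < gs t v i (r j)"
  shows "path t v (Suc j) mod (2 * K) = path t v (Suc i) mod (2 * K)" "r (Suc j) = gs t v i (r j)"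
proof -
  have rj: "r j \<le> R (path t v i)" "0 < gs t v i (r j)"
    using bl_r(2)[of j] ray_cong(5)[OF i] g bl_r(1)[of "Suc i"] by simp_all
  have eq: "pos (path t v (Suc j)) (r (Suc j)) = pos (path t v (Suc i)) (gs t v i (r j))"
    using gs_step[of "r j" t v j] gs_step[OF rj(1)] bl_r(2,5)[of j] ray_cong(3)[OF i] by simp
  have lev: "path t v (Suc j) mod K = path t v (Suc i) mod K"
  proof -
    have "(t + j) mod K = (t + i) mod K" using mod2K_modK[OF i] by (simp only: path_level)
    then have "Suc (t + j) mod K = Suc (t + i) mod K" by (metis mod_Suc_eq)
    then show ?thesis by (simp only: path_level add_Suc_right)
  qed
  have "r (Suc j) \<noteq> 0"
  proof
    assume "r (Suc j) = 0"
    then have "c (path t v (Suc j)) = pos (path t v (Suc i)) (gs t v i (r j))" using eq by simp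
    moreover have "c (path t v (Suc j)) = c (path t v (Suc i))" by (rule periodic_cong[of c K, OF c_per lev])
    ultimately show False using rj(2) by (simp add: pos_def)
  qed
  then have "0 < r (Suc j)" using bl_r(1)[of "Suc j"] by simp
  then show "path t v (Suc j) mod (2 * K) = path t v (Suc i) mod (2 * K)" "r (Suc j) = gs t v i (r j)"
    using pos_eq_iff[OF lev _ rj(2)] eq by auto
qed

text \<open>The blocks \<open>[r i, nb i]\<close> have disjoint interiors.\<close>

lemma block_unique:
  assumes "path t v i mod (2 * K) = path t v j mod (2 * K)" "r i < s" "s \<le> nb t v r i" "r j < s" "s \<le> nb t v r j"
  shows "i mod L = j mod L"
  using assms nb_le[of j i] nb_le[of i j] bl_dist[of i j] by (cases "r i" "r j" rule: linorder_cases) auto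

lemma extreme_exists: "\<exists>i\<ge>m. nb t v r i = R (path t v i) \<and> (\<forall>j. path t v j mod (2 * K) = path t v i mod (2 * K) \<longrightarrow> r j \<le> r i)"
proof -
  define S where "S = {r j | j. j < L \<and> path t v j mod (2 * K) = path t v 0 mod (2 * K)}"
  have Siff: "x \<in> S \<longleftrightarrow> (\<exists>j. x = r j \<and> j < L \<and> path t v j mod (2 * K) = path t v 0 mod (2 * K))" for x
    by (auto simp: S_def)
  have "finite S" "r 0 \<in> S" using bl_L by (auto simp: S_def)
  then have "Max S \<in> S" using Max_in by blast
  then obtain i where i: "i < L" "path t v i mod (2 * K) = path t v 0 mod (2 * K)" "r i = Max S"
    unfolding Siff by metis
  have mx: "r j \<le> r i" if "path t v j mod (2 * K) = path t v i mod (2 * K)" for j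
  proof -
    have "r (j mod L) \<in> S" unfolding S_def using that i(2) bl_L bl_cong(2)[of "j mod L" j] by auto
    then show ?thesis using Max_ge[OF \<open>finite S\<close>] i(3) bl_cong(1)[of "j mod L" j] by simp
  qed
  define i' where "i' = i + m * L"
  have i': "i' mod L = i mod L" "m \<le> i'" using bl_L by (simp_all add: i'_def Suc_le_eq trans_le_add2)
  have "r j \<le> r i'" if "path t v j mod (2 * K) = path t v i' mod (2 * K)" for j
    using mx[of j] that bl_cong[OF i'(1)] by simp
  then show ?thesis using i'(2) nb_cases[of i'] by (metis not_less)
qed

text \<open>Starting from the gaps of \<open>p\<close> the blocks grow until one of them folds back onto its inner end
  point.  If this never happens, they are disjoint and mapped into each other, so \<open>p\<close> has a block
  structure over the loop.\<close>

theorem folding: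
  assumes LN: "L \<noteq> N"
  shows "\<exists>i w. r i < w \<and> w \<le> nb t v r i \<and> gs t v i w \<le> r (Suc i) \<and> w \<le> comp_from (grow t v r) i L w"
proof (rule ccontr)
  assume NF: "\<not> ?thesis"
  define y where "y i = min (outer t v r i) (nb t v r i)" for i
  have yper: "y (i + L) = y i" for i unfolding y_def using nb_cong[of "i + L" i] outer_cong[of "i + L" i] by simp
  have ygt: "r i < y i" for i using outer_in(2) nb_gt by (simp add: y_def)
  have sup_gs: "gs t v i w \<le> sup_to (gs t v i) (r i) w" if "r i \<le> w" for i w by (rule sup_to_ge[OF gs_cont that order_refl])
  have grow_y: "y (Suc i) \<le> grow t v r i (y i)" for i
  proof -
    have "y (Suc i) \<le> gs t v i (y i)"
    proof (cases "outer t v r i \<le> nb t v r i")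
      case True
      then have yi: "y i = outer t v r i" by (simp add: y_def)
      obtain a where a: "ix a mod (2 * K) = path t v i mod (2 * K)" "\<xi> a = y i" using outer_in(1)[of i] PC_iff yi by metis
      have g: "r (Suc i) < gs t v i (\<xi> a)" using bl_slope[of i "y i"] ygt[of i] yi a by simp
      then have "0 < gs t v i (\<xi> a)" using bl_r(1)[of "Suc i"] by simp
      from cycle_point_step[OF a(1) this] have "gs t v i (\<xi> a) \<in> PC (path t v (Suc i))" using PC_iff by metis
      then have "outer t v r (Suc i) \<le> gs t v i (\<xi> a)" using g by (rule outer_le)
      then show ?thesis using a(2) by (simp add: y_def[of "Suc i"])
    next
      case False
      then have yi: "y i = nb t v r i" "nb t v r i < outer t v r i" by (simp_all add: y_def)
      then obtain j where j: "nb t v r i = r j" "path t v j mod (2 * K) = path t v i mod (2 * K)" "r i < r j"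
        using nb_cases[of i] outer_in(3)[of i] by auto
      have g: "r (Suc i) < gs t v i (r j)" using bl_slope[of i "r j"] j yi by simp
      have "nb t v r (Suc i) \<le> gs t v i (r j)" using nb_le[OF loop_point_step(1)[OF j(2) g]] loop_point_step(2)[OF j(2) g] g by simp
      then show ?thesis using yi j by (simp add: y_def[of "Suc i"])
    qed
    moreover have "y (Suc i) \<le> nb t v r (Suc i)" by (simp add: y_def)
    ultimately show ?thesis using sup_gs[of i "y i"] ygt[of i] unfolding grow_def by simp
  qed
  define G where "G = grown (grow t v r) y L"
  have G_step: "grow t v r i w \<in> G (Suc i)" if "w \<in> G i" for i w
    unfolding G_def by (rule grown_step[where A = "grow t v r" and L = L, OF grow_mono grow_periodic]) (use that in \<open>simp_all add: G_def\<close>)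
  have G_le: "w \<le> nb t v r i" if wG: "w \<in> G i" for i w
  proof -
    obtain s j where s: "(s + j) mod L = i mod L" "w \<le> comp_from (grow t v r) s j (y s)"
      using wG unfolding G_def grown_def by blast
    have "comp_from (grow t v r) s j (y s) \<le> nb t v r (s + j)" by (cases j) (simp_all add: y_def grow_def)
    then show ?thesis using s nb_cong[OF s(1)] by simp
  qed
  have G_gs: "r (Suc i) < gs t v i w" if "w \<in> G i" "r i < w" for i w
  proof (cases "y i \<le> w")
    case True
    have "w \<le> comp_from (grow t v r) i L w"
      by (rule grown_return[where A = "grow t v r" and L = L and y = y, OF grow_mono grow_periodic yper grow_y bl_L]) (use that True in \<open>simp_all add: G_def\<close>)
    then show ?thesis using NF that G_le[OF that(1)] by (meson not_less)
  next
    case False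
    then show ?thesis using bl_slope that by (simp add: y_def)
  qed
  have noX: "\<not> (nb t v r i \<in> G i \<and> path t v j mod (2 * K) = path t v i mod (2 * K) \<and> r i < r j)" for i j
  proof
    assume a: "nb t v r i \<in> G i \<and> path t v j mod (2 * K) = path t v i mod (2 * K) \<and> r i < r j"
    have "nb t v r (i + n) \<in> G (i + n) \<and> (\<exists>j. path t v j mod (2 * K) = path t v (i + n) mod (2 * K) \<and> r (i + n) < r j)" for n
    proof (induction n)
      case 0 then show ?case using a by auto
    next
      case (Suc n)
      define m where "m = i + n"
      have m: "nb t v r m \<in> G m" and ex: "\<exists>j. path t v j mod (2 * K) = path t v m mod (2 * K) \<and> r m < r j"
        using Suc by (auto simp: m_def)
      then have "nb t v r m \<noteq> R (path t v m)" using nb_le bl_r(2) ray_cong(5) by (metis leD)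
      then obtain j where j: "nb t v r m = r j" "path t v j mod (2 * K) = path t v m mod (2 * K)" "r m < r j"
        using nb_cases[of m] by auto
      have g: "r (Suc m) < gs t v m (r j)" using G_gs[OF m] j by simp
      note st = loop_point_step[OF j(2) g]
      have gt: "r (Suc m) < r (Suc j)" using st g by simp
      have "nb t v r (Suc m) \<le> gs t v m (nb t v r m)" using nb_le[OF st(1) gt] st(2) j(1) by simp
      then have "grow t v r m (nb t v r m) = nb t v r (Suc m)" using sup_gs[of m "nb t v r m"] nb_gt[of m] by (simp add: grow_def)
      then have "nb t v r (Suc m) \<in> G (Suc m)" using G_step[OF m] by simp
      then show ?case using st(1) gt unfolding m_def add_Suc_right by blast
    qed
    moreover obtain i' where "i \<le> i'" "\<forall>j. path t v j mod (2 * K) = path t v i' mod (2 * K) \<longrightarrow> r j \<le> r i'" using extreme_exists by blast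
    ultimately show False by (metis le_add_diff_inverse not_less)
  qed
  have G_inv: "gs t v i w \<in> G (Suc i)" if w: "w \<in> G i" "r i < w" for i w
  proof (cases "gs t v i w \<le> nb t v r (Suc i)")
    case True
    then have "gs t v i w \<le> grow t v r i w" using sup_gs[of i w] w by (simp add: grow_def)
    then show ?thesis using G_step[OF w(1)] grown_down unfolding G_def by blast
  next
    case False
    then have "grow t v r i w = nb t v r (Suc i)" using sup_gs[of i w] w by (simp add: grow_def)
    then have "nb t v r (Suc i) \<in> G (Suc i)" using G_step[OF w(1)] by simp
    moreover have "nb t v r (Suc i) \<noteq> R (path t v (Suc i))" using False gs_bound[of w t v i] bl_r(1)[of i] w by auto
    ultimately show ?thesis using nb_cases[of "Suc i"] noX by blast
  qed
  obtain t0 where t0: "nb t v r t0 = R (path t v t0)" using extreme_exists by blast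
  then have "y t0 = outer t v r t0" using outer_in(3)[of t0] by (simp add: y_def)
  then obtain a where a: "ix a mod (2 * K) = path t v t0 mod (2 * K)" "\<xi> a = y t0"
    using outer_in(1)[of t0] PC_iff by metis
  have trap: "ix (a + n) mod (2 * K) = path t v (t0 + n) mod (2 * K) \<and> \<xi> (a + n) \<in> G (t0 + n) \<and> r (t0 + n) < \<xi> (a + n)" for n
  proof (induction n)
    case 0 then show ?case using a ygt[of t0] grown_base[of y t0] by (simp add: G_def)
  next
    case (Suc n)
    then have g: "r (Suc (t0 + n)) < gs t v (t0 + n) (\<xi> (a + n))" using G_gs by blast
    then have "0 < gs t v (t0 + n) (\<xi> (a + n))" using bl_r(1)[of "Suc (t0 + n)"] by simp
    then show ?case using cycle_point_step[of "a + n" "t0 + n"] G_inv[of "\<xi> (a + n)" "t0 + n"] Suc g by simp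
  qed
  define nn where "nn i = i + a * N - a" for i
  have nn: "a + nn i = i + a * N" for i
  proof -
    have "a \<le> i + a * N" using N0 by (simp add: trans_le_add2)
    then show ?thesis by (simp only: nn_def le_add_diff_inverse)
  qed
  have T: "path t v (t0 + nn i) mod (2 * K) = ix i mod (2 * K)" "\<xi> i \<in> G (t0 + nn i)" "r (t0 + nn i) < \<xi> i" for i
  proof -
    have "ix (i + a * N) mod (2 * K) = ix i mod (2 * K)" "\<xi> (i + a * N) = \<xi> i"
      using periodic_add_mult[of "\<lambda>i. ix i mod (2 * K)" N i a, OF per_N(1)] periodic_add_mult[of \<xi> N i a, OF per_N(2)] by auto
    then show "path t v (t0 + nn i) mod (2 * K) = ix i mod (2 * K)" "\<xi> i \<in> G (t0 + nn i)" "r (t0 + nn i) < \<xi> i"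
      using trap[of "nn i"] unfolding nn by auto
  qed
  have "t0 mod L = (t0 + N) mod L"
    by (rule block_unique[where s = "\<xi> a"])
      (use trap[of 0] trap[of N] per_N(1,2)[of a] G_le[of "\<xi> a"] in auto)
  then have LdN: "L dvd N" using add_mod_iff by metis
  have nn_mod: "(t0 + nn i) mod m = (t0 + nn j) mod m \<longleftrightarrow> i mod m = j mod m" for i j m
  proof -
    have "(t0 + nn i) mod m = (t0 + nn j) mod m \<longleftrightarrow> (a + nn i) mod m = (a + nn j) mod m"
      by (auto simp: nat_mod_eq_iff)
    also have "\<dots> \<longleftrightarrow> i mod m = j mod m" unfolding nn by (auto simp: nat_mod_eq_iff)
    finally show ?thesis .
  qed
  have "blk N p L"
  proof (rule blkI[OF LdN])
    fix i j l assume pp: "p i < p l" "p l < p j" "i mod L = j mod L"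
    define \<pi> where "\<pi> = path t v (t0 + nn i)"
    have ij: "(t0 + nn i) mod L = (t0 + nn j) mod L" using pp(3) nn_mod by blast
    have \<pi>: "ix i mod (2 * K) = \<pi> mod (2 * K)" "ix j mod (2 * K) = \<pi> mod (2 * K)"
      using T(1)[of i] T(1)[of j] bl_cong(2)[OF ij] by (simp_all add: \<pi>_def)
    have p\<pi>: "p i = pos \<pi> (\<xi> i)" "p j = pos \<pi> (\<xi> j)" using pos_ix ray_cong(3)[OF \<pi>(1)] ray_cong(3)[OF \<pi>(2)] by metis+
    define s where "s = \<epsilon> \<pi> * (p l - c \<pi>)"
    have ps: "pos \<pi> s = p l" by (simp add: s_def pos_coord)
    have sb: "min (\<xi> i) (\<xi> j) < s" "s < max (\<xi> i) (\<xi> j)"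
      using pp(1,2) eps[of \<pi>] unfolding ps[symmetric] p\<pi> by (auto simp: pos_def)
    have lev: "i mod K = \<pi> mod K" "j mod K = \<pi> mod K" using mod2K_modK[OF \<pi>(1)] mod2K_modK[OF \<pi>(2)] ix_modK by simp_all
    then have "ix l mod K = \<pi> mod K" using class_convex[OF lev, of l] pp ix_modK by simp
    moreover have "0 < s" using sb(1) \<xi>_pos[of i] \<xi>_pos[of j] by linarith
    ultimately have l: "ix l mod (2 * K) = \<pi> mod (2 * K)" "\<xi> l = s"
      using pos_eq_iff[of "ix l" \<pi> "\<xi> l" s] \<xi>_pos pos_ix ps by auto
    have "(t0 + nn l) mod L = (t0 + nn i) mod L"
    proof (rule block_unique[where s = "\<xi> l"])
      show "path t v (t0 + nn l) mod (2 * K) = path t v (t0 + nn i) mod (2 * K)" using T(1)[of l] l by (simp add: \<pi>_def)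
      show "r (t0 + nn l) < \<xi> l" "\<xi> l \<le> nb t v r (t0 + nn l)" using T(3) G_le[OF T(2)] by auto
      show "r (t0 + nn i) < \<xi> l" using T(3)[of i] T(3)[of j] bl_cong(1)[OF ij] sb(1) l(2) by linarith
      show "\<xi> l \<le> nb t v r (t0 + nn i)" using G_le[OF T(2)[of i]] G_le[OF T(2)[of j]] nb_cong[OF ij] sb(2) l(2) by linarith
    qed
    then show "l mod L = i mod L" using nn_mod by blast
  qed
  moreover have "K \<noteq> L"
  proof
    assume KL: "K = L"
    obtain a1 a2 where a12: "ix a1 mod (2 * K) = t0 mod (2 * K)" "ix a2 mod (2 * K) = (t0 + K) mod (2 * K)"
      using R_in[of t0] R_in[of "t0 + K"] PC_iff by metis
    have "a1 mod K = a2 mod K" using mod2K_modK[OF a12(1)] mod2K_modK[OF a12(2)] ix_modK by simp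
    then have "(t0 + nn a1) mod L = (t0 + nn a2) mod L" using nn_mod KL by blast
    from bl_cong(2)[OF this] have "(t0 + K) mod (2 * K) = t0 mod (2 * K)" using T(1)[of a1] T(1)[of a2] a12 by simp
    then show False using add_mod_iff[of t0 K "2 * K"] K0 dvd_imp_le[of "2 * K" K] by simp
  qed
  then have "K < L" using dvd_imp_le[OF bl_K bl_L] by simp
  ultimately show False using prime LN by blast
qed

end

end

lemma blk_shift: assumes "\<And>i. x (i + N) = x i" "0 < N" shows "blk N (\<lambda>i. x (i + s)) k \<longleftrightarrow> blk N x k"
proof
  assume b: "blk N x k"
  show "blk N (\<lambda>i. x (i + s)) k"
  proof (rule blkI[OF blk_dvd_period[OF b]])
    fix i j l assume "x (i + s) < x (l + s)" "x (l + s) < x (j + s)" "i mod k = j mod k"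
    moreover from this have "(i + s) mod k = (j + s) mod k" by (metis mod_add_left_eq)
    ultimately have "(l + s) mod k = (i + s) mod k" using blkD[OF b] by blast
    then show "l mod k = i mod k" by (auto simp: nat_mod_eq_iff)
  qed
next
  assume b: "blk N (\<lambda>i. x (i + s)) k"
  have d: "k dvd N" by (rule blk_dvd_period[OF b])
  define s' where "s' = s * N - s"
  have "s \<le> s * N" using assms(2) by (cases N) auto
  then have "s' + s = s * N" unfolding s'_def by (rule le_add_diff_inverse2)
  then have s': "i + s' + s = i + s * N" for i by simp
  have xs: "x (i + s' + s) = x i" for i unfolding s' by (rule periodic_add_mult[of x N, OF assms(1)])
  show "blk N x k"
  proof (rule blkI[OF d])
    fix i j l assume "x i < x l" "x l < x j" "i mod k = j mod k"
    moreover from this have "(i + s') mod k = (j + s') mod k" by (metis mod_add_left_eq)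
    ultimately have "(l + s') mod k = (i + s') mod k" using blkD[OF b, of "i + s'" "l + s'" "j + s'"] xs by simp
    then show "l mod k = i mod k" by (auto simp: nat_mod_eq_iff)
  qed
qed

context spiral
begin

lemma level_order:
  assumes l: "j mod K \<noteq> j' mod K" "i mod K = j mod K" "i' mod K = j' mod K" "p i < p i'"
    and r: "0 \<le> r" "r \<le> R j" "0 \<le> s" "s \<le> R j'"
  shows "pos j r < pos j' s"
proof -
  obtain a where a: "a mod K = j mod K" "pos j r \<le> p a" using pos_hull[OF r(1,2)] by metis
  obtain b where b: "b mod K = j' mod K" "p b \<le> pos j' s" using pos_hull[OF r(3,4)] by metis
  have "p a < p b" using blk_separated[OF cp bK _ l(4), of a b] l a b by simp
  then show ?thesis using a b by simp
qed

lemma level_neq: "i mod K \<noteq> i' mod K \<Longrightarrow> p i \<noteq> p i'"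
  using cyc_eq_iff[OF cp] mod_mod_dvd K_dvd_N by blast

lemma level_less_iff:
  assumes "j mod K \<noteq> j' mod K" "0 \<le> r" "r \<le> R j" "0 \<le> s" "s \<le> R j'"
  shows "pos j r < pos j' s \<longleftrightarrow> p j < p j'"
  using level_order[of j j' j j' r s] level_order[of j' j j' j s r] level_neq[OF assms(1)] assms
  by (metis less_asym linorder_neqE_linordered_idom)

text \<open>A fold gives two inverse branches of the return map of a block, one increasing and one decreasing,
  whose compositions with inverse branches along the rest of the loop form a branch pair.\<close>

context
  fixes t v L r i0 w
  assumes bl: "block_loop t v L r"
    and w: "r i0 < w" "w \<le> nb t v r i0" "gs t v i0 w \<le> r (Suc i0)" "w \<le> comp_from (grow t v r) i0 L w"
begin

definition e where "e j = comp_from (grow t v r) i0 j w"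
definition g where "g j = gs t v (i0 + j)"
definition rr where "rr j = r (i0 + j)"

lemma e_0: "e 0 = w" and e_L: "w \<le> e L" and rr_L: "rr (j + L) = rr j"
  using w bl_r(4)[OF bl, of "i0 + j"] by (simp_all add: e_def rr_def add.assoc)

lemma e_bounds: "rr j \<le> e j" "e j \<le> nb t v r (i0 + j)"
proof -
  have sup: "r (Suc i) \<le> sup_to (gs t v i) (r i) y" for i y
    using sup_to_ge_base[OF gs_cont, of t v i "r i" y] bl_r(5)[OF bl, of i] by simp
  show "rr j \<le> e j"
  proof (cases j)
    case (Suc m)
    then show ?thesis using sup[of "i0 + m"] nb_gt[OF bl, of "Suc (i0 + m)"] by (simp add: e_def rr_def grow_def)
  qed (use w in \<open>simp add: e_def rr_def\<close>)
  show "e j \<le> nb t v r (i0 + j)" using w by (cases j) (simp_all add: e_def grow_def)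
qed

lemma g_cont: "continuous_on S (g j)"
  unfolding g_def by (rule continuous_on_subset[OF gs_cont]) simp

lemma g_rr: "g j (rr j) = rr (Suc j)" by (simp add: g_def rr_def bl_r(5)[OF bl])

lemma e_Suc: "e (Suc j) \<le> sup_to (g j) (rr j) (e j)" by (simp add: e_def g_def rr_def grow_def)

lemma peak: obtains d where "rr j \<le> d" "d \<le> e j" "e (Suc j) \<le> g j d"
proof -
  obtain d where "rr j \<le> d" "d \<le> max (rr j) (e j)" "g j d = sup_to (g j) (rr j) (e j)"
    using sup_to_attained[of "g j" "rr j" "e j", OF g_cont] by blast
  then show ?thesis using that[of d] e_bounds(1)[of j] e_Suc[of j] by (simp add: max_def)
qed

definition \<psi> where "\<psi> j y = (SOME s. s \<in> {rr j..e j} \<and> g j s = y \<and> (\<forall>t\<in>{rr j..e j}. g j t = y \<longrightarrow> s \<le> t))"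
definition \<psi>' where "\<psi>' y = (SOME s. s \<in> {rr 0..e 0} \<and> g 0 s = y \<and> (\<forall>t\<in>{rr 0..e 0}. g 0 t = y \<longrightarrow> t \<le> s))"

lemma psi:
  assumes y: "rr (Suc j) \<le> y" "y \<le> e (Suc j)"
  shows "rr j \<le> \<psi> j y" "\<psi> j y \<le> e j" "g j (\<psi> j y) = y" "\<And>t. rr j \<le> t \<Longrightarrow> t \<le> e j \<Longrightarrow> g j t = y \<Longrightarrow> \<psi> j y \<le> t"
proof -
  obtain d where d: "rr j \<le> d" "d \<le> e j" "e (Suc j) \<le> g j d" using peak[of j] by blast
  then obtain t where t: "rr j \<le> t" "t \<le> d" "g j t = y"
    using IVT'[of "g j" "rr j" y d, OF _ _ _ g_cont] g_rr y by auto
  then have "\<exists>s\<in>{rr j..e j}. g j s = y \<and> (\<forall>t\<in>{rr j..e j}. g j t = y \<longrightarrow> s \<le> t)"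
    using least_preimage[OF g_cont, of t "rr j" "e j" j y] d by auto
  then have "\<psi> j y \<in> {rr j..e j} \<and> g j (\<psi> j y) = y \<and> (\<forall>t\<in>{rr j..e j}. g j t = y \<longrightarrow> \<psi> j y \<le> t)"
    unfolding \<psi>_def by (rule someI2_bex) blast
  then show "rr j \<le> \<psi> j y" "\<psi> j y \<le> e j" "g j (\<psi> j y) = y" "\<And>t. rr j \<le> t \<Longrightarrow> t \<le> e j \<Longrightarrow> g j t = y \<Longrightarrow> \<psi> j y \<le> t"
    by auto
qed

lemma psi_mono:
  assumes y: "rr (Suc j) \<le> y" "y < y'" "y' \<le> e (Suc j)" shows "\<psi> j y < \<psi> j y'"
proof -
  have y1: "y \<le> e (Suc j)" "rr (Suc j) \<le> y'" using y by auto
  note P = psi[OF y(1) y1(1)] and P' = psi[OF y1(2) y(3)]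
  obtain t where t: "rr j \<le> t" "t \<le> \<psi> j y'" "g j t = y"
    using IVT'[of "g j" "rr j" y "\<psi> j y'", OF _ _ _ g_cont] g_rr P' y by auto
  then have "\<psi> j y \<le> t" using P(4) P'(2) by simp
  moreover have "\<psi> j y \<noteq> \<psi> j y'" using P(3) P'(3) y(2) by auto
  ultimately show ?thesis using t by simp
qed

lemma psi':
  assumes y: "rr 1 \<le> y" "y \<le> e 1"
  shows "rr 0 \<le> \<psi>' y" "\<psi>' y \<le> e 0" "g 0 (\<psi>' y) = y" "\<And>t. rr 0 \<le> t \<Longrightarrow> t \<le> e 0 \<Longrightarrow> g 0 t = y \<Longrightarrow> t \<le> \<psi>' y"
proof -
  have gw: "g 0 (e 0) \<le> rr 1" using w(3) by (simp add: g_def rr_def e_def)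
  obtain d where d: "rr 0 \<le> d" "d \<le> e 0" "e (Suc 0) \<le> g 0 d" using peak[of 0] by blast
  then obtain t where t: "d \<le> t" "t \<le> e 0" "g 0 t = y"
    using IVT2'[of "g 0" "e 0" y d, OF _ _ _ g_cont] gw y by auto
  then have "\<exists>s\<in>{rr 0..e 0}. g 0 s = y \<and> (\<forall>t\<in>{rr 0..e 0}. g 0 t = y \<longrightarrow> t \<le> s)"
    using greatest_preimage[OF g_cont, of t "rr 0" "e 0" 0 y] d by auto
  then have "\<psi>' y \<in> {rr 0..e 0} \<and> g 0 (\<psi>' y) = y \<and> (\<forall>t\<in>{rr 0..e 0}. g 0 t = y \<longrightarrow> t \<le> \<psi>' y)"
    unfolding \<psi>'_def by (rule someI2_bex) blast
  then show "rr 0 \<le> \<psi>' y" "\<psi>' y \<le> e 0" "g 0 (\<psi>' y) = y" "\<And>t. rr 0 \<le> t \<Longrightarrow> t \<le> e 0 \<Longrightarrow> g 0 t = y \<Longrightarrow> t \<le> \<psi>' y"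
    by auto
qed

lemma psi'_anti:
  assumes y: "rr 1 \<le> y" "y < y'" "y' \<le> e 1" shows "\<psi>' y' < \<psi>' y"
proof -
  have y1: "y \<le> e 1" "rr 1 \<le> y'" using y by auto
  note P = psi'[OF y(1) y1(1)] and P' = psi'[OF y1(2) y(3)]
  have gw: "g 0 (e 0) \<le> y" using w(3) y(1) by (simp add: g_def rr_def e_def)
  obtain t where t: "\<psi>' y' \<le> t" "t \<le> e 0" "g 0 t = y"
    using IVT2'[of "g 0" "e 0" y "\<psi>' y'", OF _ _ _ g_cont] gw P' y by auto
  then have "t \<le> \<psi>' y" using P(4) P'(1) by simp
  moreover have "\<psi>' y \<noteq> \<psi>' y'" using P(3) P'(3) y(2) by auto
  ultimately show ?thesis using t by simp
qed

lemma psi_psi': assumes y: "rr 1 \<le> y" "y \<le> e 1" and y': "rr 1 \<le> y'" "y' \<le> e 1" shows "\<psi> 0 y \<le> \<psi>' y'"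
proof -
  obtain d where d: "rr 0 \<le> d" "d \<le> e 0" "e (Suc 0) \<le> g 0 d" using peak[of 0] by blast
  obtain t where t: "rr 0 \<le> t" "t \<le> d" "g 0 t = y"
    using IVT'[of "g 0" "rr 0" y d, OF _ _ _ g_cont] g_rr[of 0] y d by auto
  have "g 0 (e 0) \<le> y'" using w(3) y' by (simp add: g_def rr_def e_def)
  then obtain t' where t': "d \<le> t'" "t' \<le> e 0" "g 0 t' = y'"
    using IVT2'[of "g 0" "e 0" y' d, OF _ _ _ g_cont] y' d by auto
  show ?thesis using psi(4)[of 0 y t] psi'(4)[OF y', of t'] y t t' d by simp
qed

definition T where "T j x = foldr \<psi> [j..<L] x"

lemma T_L: "T L x = x" and T_Suc: "j < L \<Longrightarrow> T j x = \<psi> j (T (Suc j) x)"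
  by (simp_all add: T_def upt_conv_Cons)

lemma T_bounds:
  assumes x: "rr 0 \<le> x" "x \<le> w" and j: "j \<le> L"
  shows "rr j \<le> T j x \<and> T j x \<le> e j"
  using j
proof (induction rule: inc_induct)
  case base then show ?case using x e_L rr_L[of 0] by (simp add: T_L)
next
  case (step j) then show ?case using psi(1,2) by (simp add: T_Suc)
qed

lemma T_mono:
  assumes x: "rr 0 \<le> x" "x < x'" "x' \<le> w" and j: "j \<le> L"
  shows "T j x < T j x'"
  using j
proof (induction rule: inc_induct)
  case base then show ?case using x by (simp add: T_L)
next
  case (step j)
  then show ?case using psi_mono T_bounds[of x "Suc j"] T_bounds[of x' "Suc j"] x by (simp add: T_Suc)
qed

lemma T_gt:
  assumes x: "rr 0 < x" "x \<le> w" and j: "j \<le> L" shows "rr j < T j x"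
  using j
proof (induction rule: inc_induct)
  case base then show ?case using x rr_L[of 0] by (simp add: T_L)
next
  case (step j)
  have "rr (Suc j) \<le> T (Suc j) x" "T (Suc j) x \<le> e (Suc j)" using T_bounds[of x "Suc j"] x step by simp_all
  then have "rr j \<le> \<psi> j (T (Suc j) x)" "g j (\<psi> j (T (Suc j) x)) = T (Suc j) x" using psi by auto
  then show ?case using step g_rr[of j] by (cases "\<psi> j (T (Suc j) x) = rr j") (auto simp: T_Suc)
qed

lemma pair: "branch_pair (\<lambda>x. \<psi> 0 (T 1 x)) (\<lambda>x. \<psi>' (T 1 x)) (rr 0) w"
proof -
  have L: "1 \<le> L" using bl_L[OF bl] by simp
  have b: "rr 1 \<le> T 1 x" "T 1 x \<le> e 1" if "x \<in> {rr 0..w}" for x using T_bounds[of x 1] that L by auto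
  have m: "T 1 x < T 1 y" if "x \<in> {rr 0..w}" "y \<in> {rr 0..w}" "x < y" for x y using T_mono[of x y 1] that L by auto
  show ?thesis unfolding branch_pair_def
  proof (intro conjI ballI impI)
    show "rr 0 < w" using w by (simp add: rr_def)
    fix x assume x: "x \<in> {rr 0..w}"
    show "\<psi> 0 (T 1 x) \<in> {rr 0..w}" using psi(1,2)[of 0 "T 1 x"] b[OF x] e_0 by simp
    show "\<psi>' (T 1 x) \<in> {rr 0..w}" using psi'(1,2)[of "T 1 x"] b[OF x] e_0 by simp
    fix y assume y: "y \<in> {rr 0..w}"
    show "\<psi> 0 (T 1 x) \<le> \<psi>' (T 1 y)" by (rule psi_psi'[OF b[OF x] b[OF y]])
    assume "x < y"
    then show "\<psi> 0 (T 1 x) < \<psi> 0 (T 1 y)" "\<psi>' (T 1 y) < \<psi>' (T 1 x)"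
      using psi_mono[of 0 "T 1 x" "T 1 y"] psi'_anti[of "T 1 x" "T 1 y"] b[OF x] b[OF y] m[OF x y] by simp_all
  qed
qed

lemma fold_cycle:
  assumes ms: "\<forall>m\<in>set ms. 1 < m" "ms \<noteq> []" "3 \<le> last ms"
  shows "\<exists>U. (\<forall>i. r (i0 + i) < U i \<and> U i \<le> nb t v r (i0 + i) \<and> gs t v (i0 + i) (U i) = U (Suc i)) \<and>
     cyc (L * prod_list ms) (\<lambda>i. pos (path t v (i0 + i)) (U i)) \<and>
     {k. blk (L * prod_list ms) (\<lambda>i. pos (path t v (i0 + i)) (U i)) k} =
       {k. blk (L * prod_list ms) (\<lambda>i. pos (path t v (i0 + i)) (U i)) k \<and> k dvd L} \<union> (*) L ` prods ms"
proof -
  define q where "q = prod_list ms"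
  have L: "0 < L" by (rule bl_L[OF bl])
  define A where "A = (\<lambda>x. \<psi> 0 (T 1 x))"
  define B where "B = (\<lambda>x. \<psi>' (T 1 x))"
  obtain z C where zC: "\<And>i. (C i = A \<or> C i = B) \<and> z i \<in> {rr 0..w} \<and> z i = C i (z (Suc i))"
    and cz: "cyc q z" and Dz: "{k. blk q z k} = prods ms" and zgt: "\<And>i. rr 0 < z i"
    using branch_pair_cycle[OF pair ms(1)] ms unfolding A_def B_def q_def by blast
  have zb: "rr 0 \<le> z i" "z i \<le> w" for i using zC[of i] by auto
  define U where "U i = (if i mod L = 0 then z (i div L) else T (i mod L) (z (Suc (i div L))))" for i
  have gper: "gs t v (i0 + i) = g (i mod L)" for i
    unfolding g_def by (rule periodic_cong[of "gs t v" L, OF gs_periodic[OF bl_closed[OF bl]]]) (simp add: mod_add_right_eq)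
  have Ub: "rr (i mod L) < U i \<and> U i \<le> e (i mod L)" for i
    using T_bounds[OF zb, of "i mod L" "Suc (i div L)"] T_gt[OF zgt zb(2), of "i mod L"] L zgt[of "i div L"] zb(2)[of "i div L"] e_0
    by (auto simp: U_def less_imp_le)
  have rrm: "rr (i mod L) = r (i0 + i)" "nb t v r (i0 + i mod L) = nb t v r (i0 + i)" for i
  proof -
    have m: "(i0 + i mod L) mod L = (i0 + i) mod L" by (simp add: mod_add_right_eq)
    show "rr (i mod L) = r (i0 + i)" using bl_cong(1)[OF bl m] by (simp add: rr_def)
    show "nb t v r (i0 + i mod L) = nb t v r (i0 + i)" by (rule nb_cong[OF bl m])
  qed
  have U1: "r (i0 + i) < U i" "U i \<le> nb t v r (i0 + i)" for i
    using Ub[of i] e_bounds(2)[of "i mod L"] rrm[of i] by auto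
  have Upos: "0 < U i" "U i \<le> R (path t v (i0 + i))" for i
    using U1[of i] bl_r(1)[OF bl, of "i0 + i"] nb_le_R[OF bl, of "i0 + i"] by auto
  have U_step: "gs t v (i0 + i) (U i) = U (Suc i)" for i
  proof -
    define a j where "a = i div L" and "j = i mod L"
    have j: "j < L" using L by (simp add: j_def)
    have US: "U (Suc i) = T (Suc j) (z (Suc a))"
      by (simp add: U_def a_def j_def mod_Suc div_Suc T_L)
    have Tb: "rr (Suc j) \<le> T (Suc j) (z (Suc a))" "T (Suc j) (z (Suc a)) \<le> e (Suc j)"
      using T_bounds[OF zb, of "Suc j" "Suc a"] j by auto
    have "g j (U i) = T (Suc j) (z (Suc a))"
    proof (cases "j = 0")
      case True
      then have "U i = z a" by (simp add: U_def a_def j_def)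
      then have "U i = \<psi> 0 (T 1 (z (Suc a))) \<or> U i = \<psi>' (T 1 (z (Suc a)))" using zC[of a] by (auto simp: A_def B_def)
      then show ?thesis using psi(3)[of 0] psi'(3) Tb True by auto
    next
      case False
      then have "U i = \<psi> j (T (Suc j) (z (Suc a)))" using T_Suc[OF j] by (simp add: U_def a_def j_def)
      then show ?thesis using psi(3)[OF Tb] by simp
    qed
    then show ?thesis unfolding gper US j_def[symmetric] .
  qed
  define Z where "Z i = pos (path t v (i0 + i)) (U i)" for i
  have pathper: "path t v (i0 + i) mod (2 * K) = path t v (i0 + j) mod (2 * K)" if "i mod L = j mod L" for i j
    by (rule bl_cong(2)[OF bl]) (use that in \<open>metis mod_add_right_eq\<close>)
  have lev: "path t v (i0 + i) mod K = (t + i0 + i) mod K" for i by (simp add: path_level add.assoc)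
  have same_level: "path t v (i0 + l) mod K = path t v (i0 + i) mod K"
    if "path t v (i0 + i) mod K = path t v (i0 + j) mod K" "Z i \<le> Z l" "Z l \<le> Z j" for i j l
  proof (rule ccontr)
    assume n: "path t v (i0 + l) mod K \<noteq> path t v (i0 + i) mod K"
    then have n': "path t v (i0 + l) mod K \<noteq> path t v (i0 + j) mod K" using that(1) by simp
    define \<pi>i \<pi>j \<pi>l where "\<pi>i = path t v (i0 + i)" and "\<pi>j = path t v (i0 + j)" and "\<pi>l = path t v (i0 + l)"
    have "\<not> Z l < Z i" "\<not> Z j < Z l" using that by auto
    then have "\<not> p \<pi>l < p \<pi>i" "\<not> p \<pi>j < p \<pi>l"
      using level_less_iff[OF n, of "U l" "U i"] level_less_iff[OF n'[symmetric], of "U j" "U l"] Upos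
      by (simp_all add: Z_def less_imp_le \<pi>i_def \<pi>j_def \<pi>l_def)
    then have "p \<pi>i < p \<pi>l" "p \<pi>l < p \<pi>j" using level_neq[OF n] level_neq[OF n'] by (auto simp: \<pi>i_def \<pi>j_def \<pi>l_def)
    then show False using blkD[OF bK, of \<pi>i \<pi>l \<pi>j] n that(1) by (simp add: \<pi>i_def \<pi>j_def \<pi>l_def)
  qed
  have form: "Z (L * a + j) = pos (path t v (i0 + j)) (if j = 0 then z a else T j (z (Suc a)))" if "j < L" for a j
    using that ray_cong(3)[OF pathper[of "L * a + j" j]] by (simp add: Z_def U_def)
  have Z_eq: "i mod L = j mod L" if "path t v (i0 + i) mod (2 * K) = path t v (i0 + j) mod (2 * K)" "r (i0 + i) < U j" "U j \<le> nb t v r (i0 + i)" for i j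
    using block_unique[OF bl that(1,2,3) U1[of j]] by (auto simp: nat_mod_eq_iff)
  have bL: "blk (L * q) Z L"
  proof (rule blkI)
    fix i j l assume a: "Z i < Z l" "Z l < Z j" "i mod L = j mod L"
    define \<pi> where "\<pi> = path t v (i0 + i)"
    have pj: "pos (path t v (i0 + j)) = pos \<pi>" using ray_cong(3)[OF pathper[OF a(3)]] by (simp add: \<pi>_def)
    have lv: "path t v (i0 + l) mod K = \<pi> mod K"
      using same_level[of i j l] mod2K_modK[OF pathper[OF a(3)]] a by (simp add: \<pi>_def)
    define s where "s = \<epsilon> \<pi> * (Z l - c \<pi>)"
    have ps: "pos \<pi> s = Z l" by (simp add: s_def pos_coord)
    have Zi: "Z i = pos \<pi> (U i)" "Z j = pos \<pi> (U j)" by (simp_all add: Z_def \<pi>_def[symmetric] pj)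
    have sb: "min (U i) (U j) < s" "s < max (U i) (U j)"
      using a(1,2) eps[of \<pi>] unfolding ps[symmetric] Zi by (auto simp: pos_def)
    have "0 < s" using sb Upos[of i] Upos[of j] by linarith
    then have l: "path t v (i0 + l) mod (2 * K) = \<pi> mod (2 * K)" "U l = s"
      using pos_eq_iff[OF lv Upos(1)[of l], of s] ps by (auto simp: Z_def)
    have m: "(i0 + i) mod L = (i0 + j) mod L" using a(3) by (metis mod_add_right_eq)
    have "r (i0 + i) < U l" "U l \<le> nb t v r (i0 + i)"
      using sb l(2) U1[of i] U1[of j] bl_cong(1)[OF bl m] nb_cong[OF bl m] by linarith+
    then have "i mod L = l mod L" using Z_eq[of i l] l(1) by (simp add: \<pi>_def)
    then show "l mod L = i mod L" by simp
  qed simp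
  have cZ: "cyc (L * q) Z"
  proof (rule cycI)
    show "0 < L * q" using L cyc_pos[OF cz] by simp
    show "Z (i + L * q) = Z i" for i
    proof -
      have dm: "(i + L * q) div L = i div L + q" "(i + L * q) mod L = i mod L" using L by auto
      have "U (i + L * q) = U i" unfolding U_def dm using cyc_periodic[OF cz, of "i div L"] cyc_periodic[OF cz, of "Suc (i div L)"] by simp
      then show ?thesis unfolding Z_def using ray_cong(3)[OF pathper[OF dm(2)]] by simp
    qed
    fix i j assume eq: "Z i = Z j"
    then have "path t v (i0 + j) mod K = path t v (i0 + i) mod K" using same_level[of i i j] by simp
    then have ij: "path t v (i0 + i) mod (2 * K) = path t v (i0 + j) mod (2 * K)" "U i = U j"
      using pos_eq_iff[OF _ Upos(1)[of i] Upos(1)[of j]] eq by (auto simp: Z_def)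
    have mL: "i mod L = j mod L" using Z_eq[of i j] ij U1[of i] by simp
    define b where "b = i mod L"
    have "z (i div L) = z (j div L) \<or> z (Suc (i div L)) = z (Suc (j div L))"
    proof (cases "b = 0")
      case True then show ?thesis using ij(2) mL by (simp add: U_def b_def)
    next
      case False
      then have "T b (z (Suc (i div L))) = T b (z (Suc (j div L)))" using ij(2) mL by (simp add: U_def b_def)
      then have "z (Suc (i div L)) = z (Suc (j div L))"
        using T_mono[OF zb(1) _ zb(2), of "Suc (i div L)" "Suc (j div L)" b] T_mono[OF zb(1) _ zb(2), of "Suc (j div L)" "Suc (i div L)" b] L
        by (metis b_def less_irrefl less_imp_le linorder_neqE_linordered_idom mod_less_divisor)
      then show ?thesis by simp
    qed
    then have "(i div L) mod q = (j div L) mod q"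
      using cyc_eq_iff[OF cz] by (auto simp: nat_mod_eq_iff)
    then show "i mod (L * q) = j mod (L * q)" using mL by (simp add: mod_mult2_eq)
  qed
  define z' where "z' i = \<epsilon> (path t v i0) * z i" for i
  have Dz': "{k. blk q z' k} = prods ms"
    using eps[of "path t v i0"]
  proof
    assume "\<epsilon> (path t v i0) = 1" then show ?thesis using Dz by (simp add: z'_def[abs_def])
  next
    assume "\<epsilon> (path t v i0) = -1" then show ?thesis using Dz blk_uminus[of q z] by (simp add: z'_def[abs_def])
  qed
  have "{k. blk (L * q) Z k} = {k. blk (L * q) Z k \<and> k dvd L} \<union> (*) L ` {k. blk q z' k}"
  proof (rule blk_set_extension[OF cZ L bL])
    show "Z (L * a) < Z (L * b) \<longleftrightarrow> z' a < z' b" for a b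
      using form[of 0 a] form[of 0 b] L by (simp add: pos_def z'_def)
    fix j assume j: "j < L"
    define \<delta> where "\<delta> = (if j = 0 then 0 else 1::nat)"
    have form': "Z (L * a + j) = pos (path t v (i0 + j)) (T (if j = 0 then L else j) (z (a + \<delta>)))" for a
      using form[OF j, of a] by (simp add: \<delta>_def T_L)
    have mono: "T (if j = 0 then L else j) (z a) < T (if j = 0 then L else j) (z b) \<Longrightarrow> z a < z b" for a b
    proof -
      have "(if j = 0 then L else j) \<le> L" using j by simp
      then show "T (if j = 0 then L else j) (z a) < T (if j = 0 then L else j) (z b) \<Longrightarrow> z a < z b"
        using T_mono[OF zb(1) _ zb(2), of b a "if j = 0 then L else j"]
        by (cases "z a" "z b" rule: linorder_cases) auto
    qed
    show "\<exists>\<delta>. (\<forall>a b. Z (L * a + j) < Z (L * b + j) \<longrightarrow> z' (a + \<delta>) < z' (b + \<delta>)) \<or>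
              (\<forall>a b. Z (L * a + j) < Z (L * b + j) \<longrightarrow> z' (b + \<delta>) < z' (a + \<delta>))"
      unfolding form' z'_def pos_def
      using eps[of "path t v (i0 + j)"] eps[of "path t v i0"] mono by (intro exI[of _ \<delta>]) auto
  qed
  then have "{k. blk (L * q) Z k} = {k. blk (L * q) Z k \<and> k dvd L} \<union> (*) L ` prods ms" unfolding Dz' .
  then show ?thesis using U1 U_step cZ unfolding Z_def[abs_def] q_def by blast
qed

end

end

lemma comp_from_cong_less:
  assumes "\<And>i. i < n \<Longrightarrow> A (s + i) = A' (s' + i)" shows "comp_from A s n w = comp_from A' s' n w"
  using assms by (induction n) simp_all

context spiral
begin

section \<open>Words of violations\<close>

definition Sx :: "nat \<Rightarrow> real \<Rightarrow> real" where "Sx j = sup_to (\<Phi> j) 0"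
definition Tx :: "nat \<Rightarrow> real \<Rightarrow> real" where "Tx j = sup_to (\<lambda>r. - \<Phi> j r) 0"
definition trun :: "nat \<Rightarrow> nat \<Rightarrow> real \<Rightarrow> real" where "trun j n w = comp_from Sx (Suc j + K) (n - 1) (Tx j w)"

abbreviation run :: "nat \<Rightarrow> nat \<Rightarrow> real \<Rightarrow> real" where "run \<equiv> comp_from Sx"

lemma m\<Phi>_cont: "continuous_on UNIV (\<lambda>r. - \<Phi> j r)"
  using \<Phi>_cont by (auto intro: continuous_intros)

lemma Sx_mono: "w \<le> w' \<Longrightarrow> Sx j w \<le> Sx j w'" and Tx_mono: "w \<le> w' \<Longrightarrow> Tx j w \<le> Tx j w'"
  unfolding Sx_def Tx_def by (rule sup_to_mono[OF \<Phi>_cont], assumption) (rule sup_to_mono[OF m\<Phi>_cont], assumption)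

lemma run_mono: "w \<le> w' \<Longrightarrow> run j n w \<le> run j n w'"
  by (rule comp_from_mono) (rule Sx_mono)

lemma Sx_cong: "j mod (2 * K) = j' mod (2 * K) \<Longrightarrow> Sx j = Sx j'"
  unfolding Sx_def by (simp only: ray_cong(7)[of j j'])

lemma Sx_periodic: "Sx (j + 2 * K) = Sx j" by (rule Sx_cong) simp

lemma run_cong: "j mod (2 * K) = j' mod (2 * K) \<Longrightarrow> run j n w = run j' n w"
  by (rule comp_from_periodic[where A = Sx and L = "2 * K", OF Sx_periodic])

lemma trun_run: assumes "0 < n" shows "trun j (n + m) w = run (j + n + K) m (trun j n w)"
proof -
  have "n + m - 1 = (n - 1) + m" "Suc j + K + (n - 1) = j + n + K" using assms by auto
  then show ?thesis unfolding trun_def by (simp only: comp_from_add)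
qed

lemma ext_eq: "ext t v i = (if v i then Tx (path t v i) else Sx (path t v i))"
  unfolding ext_def Tx_def Sx_def gs_def by auto

lemma path_add_no: "(\<And>i. i < n \<Longrightarrow> \<not> v (s + i)) \<Longrightarrow> path t v (s + n) = path t v s + n"
  by (induction n) simp_all

lemma cext_run:
  assumes "\<And>i. i < n \<Longrightarrow> \<not> v (s + i)" "path t v s mod (2 * K) = j mod (2 * K)"
  shows "cext t v s n w = run j n w"
proof (rule comp_from_cong_less)
  fix i assume i: "i < n"
  have "path t v (s + i) = path t v s + i" by (rule path_add_no) (use assms i in auto)
  then have "path t v (s + i) mod (2 * K) = (j + i) mod (2 * K)" using assms(2) by (metis mod_add_left_eq)
  then have "Sx (path t v (s + i)) = Sx (j + i)" by (rule Sx_cong)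
  then show "ext t v (s + i) = Sx (j + i)" using assms(1)[OF i] by (simp add: ext_eq)
qed

lemma cext_trun:
  assumes "0 < n" "v s" "\<And>i. 0 < i \<Longrightarrow> i < n \<Longrightarrow> \<not> v (s + i)" "path t v s mod (2 * K) = j mod (2 * K)"
  shows "cext t v s n w = trun j n w"
proof -
  have "cext t v s (1 + (n - 1)) w = cext t v (s + 1) (n - 1) (cext t v s 1 w)" by (rule comp_from_add)
  also have "cext t v s 1 w = Tx j w" using assms(2) ray_cong(7)[OF assms(4)] by (simp add: ext_eq Tx_def)
  also have "cext t v (s + 1) (n - 1) (Tx j w) = run (Suc j + K) (n - 1) (Tx j w)"
  proof (rule cext_run)
    show "\<not> v (s + 1 + i)" if "i < n - 1" for i using assms(3)[of "1 + i"] that by (simp add: add.assoc)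
    show "path t v (s + 1) mod (2 * K) = (Suc j + K) mod (2 * K)"
      using assms(2,4) by simp (metis add_Suc mod_Suc_eq mod_add_left_eq)
  qed
  finally show ?thesis using assms(1) by (simp add: trun_def)
qed

lemma path_trun:
  assumes "0 < n" "v s" "\<And>i. 0 < i \<Longrightarrow> i < n \<Longrightarrow> \<not> v (s + i)" shows "path t v (s + n) = path t v s + n + K"
proof -
  have "path t v (Suc s + (n - 1)) = path t v (Suc s) + (n - 1)"
  proof (rule path_add_no)
    fix i assume "i < n - 1"
    then show "\<not> v (Suc s + i)" using assms(3)[of "Suc i"] by simp
  qed
  then show ?thesis using assms(1,2) by simp
qed

text \<open>The first condition below means that a path with a single violation covers itself already after
  one turn around the centre; then there is an abundance of cycles.  Otherwise two turns without
  violations expand.\<close>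

definition quick :: bool where "quick \<longleftrightarrow> (\<exists>j b. 0 < b \<and> b \<le> trun j K b)"

lemma \<rho>_grow: "\<rho> (Suc j) \<le> Sx j (\<rho> j)"
proof -
  obtain a where a: "ix a mod (2 * K) = j mod (2 * K)" "\<xi> a = \<rho> j" using \<rho>_in PC_iff by metis
  have \<Phi>: "\<Phi> (ix a) = \<Phi> j" by (rule ray_cong(7)[OF a(1)])
  have "\<not> viol a" using \<Phi>_near[OF \<rho>_pos order_refl, of j] a(2) by (simp add: viol_def \<Phi>)
  then have "ix (Suc a) mod (2 * K) = Suc j mod (2 * K)" "\<xi> (Suc a) = \<Phi> j (\<rho> j)"
    using \<xi>_step(2)[of a] a by (simp_all add: \<Phi>) (metis mod_Suc_eq)+
  then have "\<Phi> j (\<rho> j) \<in> PC (Suc j)" using PC_iff by metis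
  then have "\<rho> (Suc j) \<le> \<Phi> j (\<rho> j)" by (rule PC_ge)
  also have "\<dots> \<le> Sx j (\<rho> j)" unfolding Sx_def using \<rho>_pos[of j] by (intro sup_to_ge[OF \<Phi>_cont]) auto
  finally show ?thesis .
qed

text \<open>Call a radius reached if it is obtained from the innermost points of \<open>p\<close> by motions without
  violation.  What is reached covers itself in two turns.  A violation starting from a reached radius and leading to one that is not reached
  would come back in one turn beyond its start; so all points of \<open>p\<close> are reached.\<close>

lemma two_turns: assumes "\<not> quick" shows "\<xi> i \<le> run (ix i) (2 * K) (\<xi> i)"
proof -
  define B where "B = grown Sx \<rho> (2 * K)"
  have \<rho>per: "\<rho> (j + 2 * K) = \<rho> j" for j by (rule ray_cong(6)) simp
  have KK: "0 < 2 * K" using K0 by simp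
  have ret: "w \<le> run j (2 * K) w" if "w \<in> B j" "\<rho> j \<le> w" for j w
    by (rule grown_return[where A = Sx and L = "2 * K" and y = \<rho>, OF Sx_mono Sx_periodic \<rho>per \<rho>_grow KK])
      (use that in \<open>simp_all add: B_def\<close>)
  have stepB: "Sx j w \<in> B (Suc j)" if "w \<in> B j" for j w
    unfolding B_def by (rule grown_step[where A = Sx and L = "2 * K", OF Sx_mono Sx_periodic]) (use that in \<open>simp_all add: B_def\<close>)
  have runB: "run j n w \<in> B (j + n)" if "w \<in> B j" for j n w
    by (induction n) (use that stepB in auto)
  have down: "w' \<in> B j" if "w \<in> B j" "w' \<le> w" for j w w' using grown_down that unfolding B_def by blast
  have B0: "0 \<in> B j" for j using grown_base[of \<rho> j Sx "2 * K"] down[of "\<rho> j" j 0] \<rho>_pos[of j] by (simp add: B_def)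
  have Bcong: "B j = B j'" if "j mod (2 * K) = j' mod (2 * K)" for j j' unfolding B_def by (rule grown_cong[OF that])
  have T: "- \<Phi> j w \<in> B (Suc j + K)" if w: "0 \<le> w" "w \<in> B j" for j w
  proof (rule ccontr)
    assume n: "- \<Phi> j w \<notin> B (Suc j + K)"
    then have x0: "0 < - \<Phi> j w" using down[OF B0] by (meson not_less)
    then have "w \<noteq> 0" using \<Phi>_0 by auto
    then have wp: "0 < w" using w by simp
    moreover have "\<not> w \<le> \<rho> j" using \<Phi>_near[OF wp, of j] x0 by auto
    ultimately have w0: "0 < w" "\<rho> j < w" by simp_all
    have "2 * K = Suc K + (K - 1)" using K0 by simp
    then have "run j (2 * K) w = run (j + Suc K) (K - 1) (run j (Suc K) w)" by (metis comp_from_add)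
    also have "j + Suc K = Suc j + K" by simp
    finally have "w \<le> run (Suc j + K) (K - 1) (run j (Suc K) w)" using ret[OF w(2)] w0 by simp
    also have "run j (Suc K) w \<in> B (Suc j + K)" using runB[OF w(2), of "Suc K"] by simp
    then have "run j (Suc K) w \<le> - \<Phi> j w" using n down by (meson not_less less_imp_le)
    then have "run (Suc j + K) (K - 1) (run j (Suc K) w) \<le> run (Suc j + K) (K - 1) (Tx j w)"
      unfolding Tx_def using sup_to_ge[OF m\<Phi>_cont, of 0 w w j] w by (intro run_mono) simp
    finally have "w \<le> trun j K w" by (simp add: trun_def)
    then show False using assms w0(1) unfolding quick_def by blast
  qed
  obtain i0 where i0: "ix i0 mod (2 * K) = 0 mod (2 * K)" "\<xi> i0 = \<rho> 0" using \<rho>_in[of 0] PC_iff by metis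
  have orb: "\<xi> (i0 + n) \<in> B (ix (i0 + n))" for n
  proof (induction n)
    case 0 then show ?case using i0 Bcong[OF i0(1)] grown_base[of \<rho> 0 Sx "2 * K"] by (simp add: B_def)
  next
    case (Suc n)
    define m where "m = i0 + n"
    have m: "\<xi> m \<in> B (ix m)" "0 \<le> \<xi> m" using Suc \<xi>_pos[of m] by (auto simp: m_def)
    have "\<xi> (Suc m) \<in> B (ix (Suc m))"
    proof (cases "viol m")
      case True
      then show ?thesis using T[OF m(2,1)] \<xi>_step(1)[OF True] Bcong by (metis add_Suc)
    next
      case False
      have "\<Phi> (ix m) (\<xi> m) \<le> Sx (ix m) (\<xi> m)" unfolding Sx_def using m by (intro sup_to_ge[OF \<Phi>_cont]) auto
      then show ?thesis using down[OF stepB[OF m(1)]] \<xi>_step(2)[OF False] Bcong by metis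
    qed
    then show ?case by (simp add: m_def)
  qed
  define n where "n = i + i0 * N - i0"
  have "i0 \<le> i + i0 * N" using N0 by (simp add: trans_le_add2)
  then have n: "i0 + n = i + i0 * N" unfolding n_def by (rule le_add_diff_inverse)
  have "ix (i + i0 * N) mod (2 * K) = ix i mod (2 * K)" "\<xi> (i + i0 * N) = \<xi> i"
    using periodic_add_mult[of "\<lambda>i. ix i mod (2 * K)" N i i0, OF per_N(1)] periodic_add_mult[of \<xi> N i i0, OF per_N(2)] by auto
  then have "\<xi> i \<in> B (ix i)" using orb[of n] Bcong unfolding n by metis
  then show ?thesis using ret PC_ge[OF \<xi>_PC] by blast
qed

lemma many_turns: assumes "\<not> quick" shows "\<xi> i \<le> run (ix i) (2 * K * m) (\<xi> i)"
proof (induction m)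
  case (Suc m)
  have "\<xi> i \<le> run (ix i) (2 * K) (\<xi> i)" by (rule two_turns[OF assms])
  also have "\<dots> \<le> run (ix i) (2 * K) (run (ix i) (2 * K * m) (\<xi> i))" by (rule run_mono[OF Suc])
  also have "\<dots> = run (ix i + 2 * K * m) (2 * K) (run (ix i) (2 * K * m) (\<xi> i))" by (rule run_cong) simp
  also have "\<dots> = run (ix i) (2 * K * Suc m) (\<xi> i)" by (simp add: comp_from_add[symmetric] algebra_simps)
  finally show ?case .
qed simp

lemma follow:
  "ix (a + n) mod (2 * K) = path (ix a) (\<lambda>j. viol (a + j)) n mod (2 * K) \<and>
   \<xi> (a + n) \<le> cext (ix a) (\<lambda>j. viol (a + j)) 0 n (\<xi> a)"
proof (induction n)
  case (Suc n)
  let ?v = "\<lambda>j. viol (a + j)"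
  define m where "m = a + n"
  have ixm: "ix m mod (2 * K) = path (ix a) ?v n mod (2 * K)" and le: "\<xi> m \<le> cext (ix a) ?v 0 n (\<xi> a)"
    using Suc by (auto simp: m_def)
  have S: "ix (Suc m) mod (2 * K) = (Suc (ix m) + (if viol m then K else 0)) mod (2 * K)" using \<xi>_step[of m] by auto
  have "ix (Suc m) mod (2 * K) = (path (ix a) ?v n + (1 + (if viol m then K else 0))) mod (2 * K)"
    using S ixm by (metis mod_add_left_eq add.assoc plus_1_eq_Suc add.commute)
  then have 1: "ix (Suc m) mod (2 * K) = path (ix a) ?v (Suc n) mod (2 * K)" by (simp add: m_def)
  have "\<xi> (Suc m) = gs (ix a) ?v n (\<xi> m)"
    using \<xi>_step[of m] ray_cong(7)[OF ixm] by (auto simp: gs_def m_def)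
  also have "\<dots> \<le> ext (ix a) ?v n (\<xi> m)" by (rule ext_ge) (use \<xi>_pos[of m] in auto)
  also have "\<dots> \<le> ext (ix a) ?v n (cext (ix a) ?v 0 n (\<xi> a))" by (rule ext_mono[OF le])
  finally show ?case using 1 by (simp add: m_def)
qed simp

lemma follow_trun:
  assumes "viol a" "0 < n" "\<And>i. 0 < i \<Longrightarrow> i < n \<Longrightarrow> \<not> viol (a + i)"
  shows "\<xi> (a + n) \<le> trun (ix a) n (\<xi> a)" "ix (a + n) mod (2 * K) = (ix a + n + K) mod (2 * K)"
  using follow[of a n] cext_trun[of n "\<lambda>j. viol (a + j)" 0 "ix a" "ix a" "\<xi> a"] path_trun[of n "\<lambda>j. viol (a + j)" 0 "ix a"] assms by simp_all

lemma between_ray: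
  assumes "p i < p l" "p l < p j" "ix i mod (2 * K) = ix j mod (2 * K)"
  shows "ix l mod (2 * K) = ix i mod (2 * K)"
proof -
  define \<pi> where "\<pi> = ix i"
  have pj: "p j = pos \<pi> (\<xi> j)" "p i = pos \<pi> (\<xi> i)" using pos_ix[of j] pos_ix[of i] ray_cong(3)[OF assms(3)] by (simp_all add: \<pi>_def)
  define s where "s = \<epsilon> \<pi> * (p l - c \<pi>)"
  have ps: "pos \<pi> s = p l" by (simp add: s_def pos_coord)
  have "min (\<xi> i) (\<xi> j) < s" using assms(1,2) eps[of \<pi>] unfolding ps[symmetric] pj by (auto simp: pos_def)
  then have s0: "0 < s" using \<xi>_pos[of i] \<xi>_pos[of j] by linarith
  have "i mod K = j mod K" using mod2K_modK[OF assms(3)] ix_modK by simp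
  then have "l mod K = i mod K"
    using class_convex[OF refl _ less_imp_le[OF assms(1)] less_imp_le[OF assms(2)]] by simp
  then have "ix l mod K = \<pi> mod K" using ix_modK by (simp add: \<pi>_def)
  then show ?thesis using pos_eq_iff[of "ix l" \<pi> "\<xi> l" s] \<xi>_pos s0 pos_ix[of l] ps by (simp add: \<pi>_def)
qed

text \<open>A cycle without violations would have the \<open>2 K\<close> rays as blocks.\<close>

lemma viol_exists: "\<exists>i<N. viol i"
proof (rule ccontr)
  assume "\<not> ?thesis"
  then have "\<not> viol (i mod N)" for i using N0 by simp
  then have nv: "\<not> viol i" for i using periodic_mod[of viol N i] per_N(3) by simp
  have ixi: "ix i mod (2 * K) = (ix 0 + i) mod (2 * K)" for i
  proof -
    have "path (ix 0) (\<lambda>j. viol (0 + j)) (0 + i) = path (ix 0) (\<lambda>j. viol (0 + j)) 0 + i"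
      by (rule path_add_no) (rule nv)
    then show ?thesis using conjunct1[OF follow[of 0 i]] by (simp only: add_0 path.simps(1))
  qed
  have ii: "ix i mod (2 * K) = ix j mod (2 * K) \<longleftrightarrow> i mod (2 * K) = j mod (2 * K)" for i j
    unfolding ixi by (auto simp: nat_mod_eq_iff)
  have "blk N p (2 * K)"
  proof (rule blkI)
    show "2 * K dvd N" using per_N(1)[of 0] ii[of "0 + N" 0] by auto
    fix i j l assume "p i < p l" "p l < p j" "i mod (2 * K) = j mod (2 * K)"
    then show "l mod (2 * K) = i mod (2 * K)" using between_ray[of i l j] ii by blast
  qed
  then have "2 * K = N" using prime K0 by simp
  then show False using big K0 by simp
qed

definition cnt :: "nat \<Rightarrow> nat" where "cnt i = card {j. j < i \<and> viol j}"

lemma cnt_Suc: "cnt (Suc i) = cnt i + (if viol i then 1 else 0)"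
proof -
  have "{j. j < Suc i \<and> viol j} = (if viol i then insert i {j. j < i \<and> viol j} else {j. j < i \<and> viol j})"
    by (auto simp: less_Suc_eq)
  then show ?thesis by (simp add: cnt_def)
qed

lemma cnt_0: "cnt 0 = 0" by (simp add: cnt_def)

lemma cnt_N: "cnt (i + N) = cnt i + cnt N"
  by (induction i) (simp_all add: cnt_0 cnt_Suc per_N(3))

lemma cnt_path: "path (ix 0) viol i = ix 0 + i + K * cnt i"
  by (induction i) (simp_all add: cnt_0 cnt_Suc)

text \<open>Over a period the path closes up, and every violation adds as much as a turn, half a rotation of the rays.\<close>

lemma cnt_parity: "2 * K dvd N + K * cnt N"
proof -
  have "(ix 0 + (N + K * cnt N)) mod (2 * K) = ix 0 mod (2 * K)"
    using follow[of 0 N] per_N(1)[of 0] cnt_path[of N] by (simp add: add.assoc)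
  then show ?thesis using add_mod_iff by blast
qed

lemma cnt_pos: "0 < cnt N"
  using viol_exists by (auto simp: cnt_def card_gt_0_iff)

text \<open>Between its violations \<open>p\<close> performs turns around the centre.  If the average time between
  violations is at most \<open>D\<close>, then some path with one violation in time \<open>D\<close> covers itself.  Otherwise
  compare, along the cycle, the position of each violating point with that of the last one: writing
  \<open>e\<close> for the lead over a motion that violates every \<open>D\<close> steps and starting where it is maximal, the
  positions advanced by the missing steps decrease, strictly at first, but after one
  period the missing steps amount to full turns, which expand.\<close>

lemma average_return:
  assumes nq: "\<not> quick" and D: "D = (2 * k + 1) * K" and avg: "N \<le> cnt N * D"
  shows "\<exists>i. viol i \<and> \<xi> i \<le> trun (ix i) D (\<xi> i)"
proof (rule ccontr)
  assume "\<not> ?thesis"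
  then have H: "viol i \<Longrightarrow> trun (ix i) D (\<xi> i) < \<xi> i" for i by force
  have D0: "0 < D" using K0 by (simp add: D)
  define e where "e i = int i - int (D * cnt i)" for i
  have eN: "e (i + N) = e i - int (cnt N * D - N)" for i
    unfolding e_def cnt_N using avg by (simp add: of_nat_diff algebra_simps)
  have eNq: "e (i + q * N) \<le> e i" for i q
  proof (induction q)
    case (Suc q)
    have "e (i + Suc q * N) = e ((i + q * N) + N)" by (simp add: algebra_simps)
    then show ?case using Suc eN[of "i + q * N"] by simp
  qed simp
  define V where "V = {i. i < N \<and> viol i}"
  have V: "finite V" "V \<noteq> {}" using viol_exists by (auto simp: V_def)
  obtain t1 where t1: "t1 \<in> V" "\<And>i. i \<in> V \<Longrightarrow> e i \<le> e t1"
  proof -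
    have fin: "finite (e ` V)" "e ` V \<noteq> {}" using V by auto
    obtain t where t: "t \<in> V" "e t = Max (e ` V)" using Max_in[OF fin] by auto
    then have "e i \<le> e t" if "i \<in> V" for i using Max_ge[OF fin(1)] that by simp
    then show ?thesis using that t(1) by blast
  qed
  have emax: "e i \<le> e t1" if "viol i" for i
  proof -
    have "viol (i mod N)" using periodic_mod[of viol N i] per_N(3) that by simp
    then have "i mod N \<in> V" using N0 by (simp add: V_def)
    then have "e (i mod N) \<le> e t1" by (rule t1(2))
    moreover have "i mod N + (i div N) * N = i" by simp
    ultimately show ?thesis using eNq[of "i mod N" "i div N"] by (metis order_trans)
  qed
  have vt1: "viol t1" using t1(1) by (simp add: V_def)
  have claim: "run (ix \<tau>) (nat (e t1 - e \<tau>)) (\<xi> \<tau>) < \<xi> t1" if "t1 < \<tau>" "viol \<tau>" for \<tau>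
    using that
  proof (induction \<tau> rule: less_induct)
    case (less \<tau>)
    define S where "S = {j. t1 \<le> j \<and> j < \<tau> \<and> viol j}"
    have S: "finite S" "t1 \<in> S" using less.prems vt1 by (auto simp: S_def)
    define \<sigma> where "\<sigma> = Max S"
    have "S \<noteq> {}" using S(2) by blast
    then have \<sigma>: "\<sigma> \<in> S" "\<And>j. j \<in> S \<Longrightarrow> j \<le> \<sigma>"
      unfolding \<sigma>_def using Max_in[OF S(1)] Max_ge[OF S(1)] by blast+
    have \<sigma>': "t1 \<le> \<sigma>" "\<sigma> < \<tau>" "viol \<sigma>" using \<sigma>(1) by (auto simp: S_def)
    define n where "n = \<tau> - \<sigma>"
    have n: "0 < n" "\<tau> = \<sigma> + n" using \<sigma>' by (auto simp: n_def)
    have nv: "\<not> viol (\<sigma> + i)" if "0 < i" "i < n" for i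
    proof
      assume "viol (\<sigma> + i)"
      then have "\<sigma> + i \<in> S" using that n \<sigma>' by (simp add: S_def)
      then show False using \<sigma>(2) that by fastforce
    qed
    have "cnt (\<sigma> + i) = Suc (cnt \<sigma>)" if "0 < i" "i \<le> n" for i
      using that
    proof (induction i)
      case (Suc i) then show ?case using nv[of i] \<sigma>'(3) by (cases "i = 0") (simp_all add: cnt_Suc)
    qed simp
    then have "cnt \<tau> = Suc (cnt \<sigma>)" using n by simp
    then have e\<tau>: "e \<tau> = e \<sigma> + int n - int D" using n(2) by (simp add: e_def algebra_simps)
    define E E' where "E = nat (e t1 - e \<tau>)" and "E' = nat (e t1 - e \<sigma>)"
    have "int E = e t1 - e \<tau>" "int E' = e t1 - e \<sigma>" using emax[OF less.prems(2)] emax[OF \<sigma>'(3)] by (simp_all add: E_def E'_def)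
    then have EE: "n + E = D + E'" using e\<tau> by linarith
    have fol: "\<xi> \<tau> \<le> trun (ix \<sigma>) n (\<xi> \<sigma>)" "ix \<tau> mod (2 * K) = (ix \<sigma> + n + K) mod (2 * K)"
      using follow_trun[OF \<sigma>'(3) n(1) nv] n(2) by auto
    have "run (ix \<tau>) E (\<xi> \<tau>) \<le> run (ix \<tau>) E (trun (ix \<sigma>) n (\<xi> \<sigma>))" by (rule run_mono[OF fol(1)])
    also have "\<dots> = run (ix \<sigma> + n + K) E (trun (ix \<sigma>) n (\<xi> \<sigma>))" by (rule run_cong[OF fol(2)])
    also have "\<dots> = trun (ix \<sigma>) (D + E') (\<xi> \<sigma>)" using trun_run[OF n(1)] EE by metis
    also have "\<dots> = run (ix \<sigma> + D + K) E' (trun (ix \<sigma>) D (\<xi> \<sigma>))" by (rule trun_run[OF D0])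
    also have "\<dots> = run (ix \<sigma>) E' (trun (ix \<sigma>) D (\<xi> \<sigma>))"
    proof (rule run_cong)
      have "ix \<sigma> + D + K = ix \<sigma> + 2 * K * (k + 1)" by (simp add: D algebra_simps)
      then show "(ix \<sigma> + D + K) mod (2 * K) = ix \<sigma> mod (2 * K)" by simp
    qed
    finally have le: "run (ix \<tau>) E (\<xi> \<tau>) \<le> run (ix \<sigma>) E' (trun (ix \<sigma>) D (\<xi> \<sigma>))" .
    show ?case
    proof (cases "\<sigma> = t1")
      case True
      then have "E' = 0" by (simp add: E'_def)
      then show ?thesis using le H[OF \<sigma>'(3)] True by (simp add: E_def)
    next
      case False
      then have "run (ix \<sigma>) E' (\<xi> \<sigma>) < \<xi> t1" unfolding E'_def by (intro less.IH) (use \<sigma>' in auto)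
      moreover have "run (ix \<sigma>) E' (trun (ix \<sigma>) D (\<xi> \<sigma>)) \<le> run (ix \<sigma>) E' (\<xi> \<sigma>)" using H[OF \<sigma>'(3)] by (intro run_mono) simp
      ultimately show ?thesis using le by (simp add: E_def)
    qed
  qed
  have "run (ix (t1 + N)) (nat (e t1 - e (t1 + N))) (\<xi> (t1 + N)) < \<xi> t1"
    using claim[of "t1 + N"] N0 vt1 per_N(3) by simp
  moreover have "nat (e t1 - e (t1 + N)) = cnt N * D - N" using eN[of t1] by simp
  ultimately have lt: "run (ix t1) (cnt N * D - N) (\<xi> t1) < \<xi> t1" using run_cong[OF per_N(1)] per_N(2) by simp
  have "2 * K dvd cnt N * D - N"
  proof -
    have "cnt N * D + K * cnt N = 2 * K * (cnt N * (k + 1))" by (simp add: D algebra_simps)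
    then have "2 * K dvd (cnt N * D - N) + (N + K * cnt N)" using avg by simp
    then show ?thesis using cnt_parity by (metis dvd_add_left_iff)
  qed
  then obtain m where "cnt N * D - N = 2 * K * m" unfolding dvd_def by blast
  then show False using lt many_turns[OF nq, of t1 m] by simp
qed

end

context spiral
begin

section \<open>Periodic words with at most two violations\<close>

definition word :: "(nat \<Rightarrow> bool) \<Rightarrow> nat \<Rightarrow> bool" where
  "word v L \<longleftrightarrow> (\<forall>i j. (\<forall>n. v (i + n) = v (j + n)) \<longrightarrow> i mod L = j mod L) \<and>
     (\<forall>i j l. v i \<longrightarrow> v j \<longrightarrow> v l \<longrightarrow> i mod L = j mod L \<or> i mod L = l mod L \<or> j mod L = l mod L)"

lemma wordD:
  assumes "word v L"
  shows "(\<And>n. v (i + n) = v (j + n)) \<Longrightarrow> i mod L = j mod L"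
    "v i \<Longrightarrow> v j \<Longrightarrow> v l \<Longrightarrow> i mod L = j mod L \<or> i mod L = l mod L \<or> j mod L = l mod L"
  using assms unfolding word_def by blast+

lemma add_mod_cancel: "(a + i) mod L = (a + j) mod L \<longleftrightarrow> i mod L = j mod L" for L :: nat
  by (auto simp: nat_mod_eq_iff)

lemma word_shift: assumes w: "word v L" shows "word (\<lambda>i. v (a + i)) L"
  unfolding word_def
proof (intro conjI allI impI)
  fix i j assume "\<forall>n. v (a + (i + n)) = v (a + (j + n))"
  then have "v ((a + i) + n) = v ((a + j) + n)" for n unfolding add.assoc by (rule spec)
  from wordD(1)[OF w this] show "i mod L = j mod L" by (simp only: add_mod_cancel)
next
  fix i j l assume "v (a + i)" "v (a + j)" "v (a + l)"
  from wordD(2)[OF w this] show "i mod L = j mod L \<or> i mod L = l mod L \<or> j mod L = l mod L"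
    by (simp only: add_mod_cancel)
qed

lemma word_two:
  assumes b: "b < L" "2 * b \<noteq> L" shows "word (\<lambda>i. i mod L = 0 \<or> i mod L = b) L"
  unfolding word_def
proof (intro conjI allI impI)
  fix i j assume H: "\<forall>n. ((i + n) mod L = 0 \<or> (i + n) mod L = b) = ((j + n) mod L = 0 \<or> (j + n) mod L = b)"
  define n where "n = L - i mod L"
  have L: "0 < L" using b by simp
  have i0: "(i + n) mod L = 0"
  proof -
    have "i mod L \<le> L" using L by (simp add: less_imp_le)
    moreover have "i div L * L + i mod L = i" by simp
    ultimately have "i + n = i div L * L + L" unfolding n_def by linarith
    then show ?thesis by simp
  qed
  have "(j + n) mod L = 0"
  proof (rule ccontr)
    assume n0: "(j + n) mod L \<noteq> 0"
    then have jb: "(j + n) mod L = b" using spec[OF H, of n] i0 by simp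
    have "(i + (n + b)) mod L = b" using i0 b by (metis add.assoc add_0 mod_add_left_eq mod_less)
    then have "(j + (n + b)) mod L = 0 \<or> (j + (n + b)) mod L = b" using spec[OF H, of "n + b"] by blast
    moreover have "(j + (n + b)) mod L = (b + b) mod L" using jb by (metis add.assoc mod_add_left_eq)
    ultimately have "(b + b) mod L = 0 \<or> (b + b) mod L = b" by simp
    moreover have "(b + b) mod L = (if b + b < L then b + b else b + b - L)"
    proof (cases "b + b < L")
      case False
      then have "(b + b) mod L = (b + b - L) mod L" by (intro le_mod_geq) simp
      also have "\<dots> = b + b - L" by (rule mod_less) (use b(1) False in linarith)
      finally show ?thesis using False by simp
    qed simp
    ultimately have "(if b + b < L then b + b else b + b - L) = 0 \<or> (if b + b < L then b + b else b + b - L) = b" by metis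
    then have "b = 0 \<or> b + b = L" using b(1) L by presburger
    then show False using b(2) n0 jb by (cases "b = 0") simp_all
  qed
  then have "(n + i) mod L = (n + j) mod L" using i0 by (simp only: add.commute)
  then show "i mod L = j mod L" by (simp only: add_mod_cancel)
next
  fix i j l assume "i mod L = 0 \<or> i mod L = b" "j mod L = 0 \<or> j mod L = b" "l mod L = 0 \<or> l mod L = b"
  then show "i mod L = j mod L \<or> i mod L = l mod L \<or> j mod L = l mod L" by metis
qed

text \<open>The innermost orbit along the loop is aperiodic because its word is.  It is not the cycle \<open>p\<close>, as the lengths
  differ, so it stays in the interior of the gaps of \<open>p\<close>, where \<open>F\<close> is affine; being innermost it is increasing there.\<close>

lemma word_block_loop:
  assumes cl: "closed_path t v L" and KL: "K dvd L" and w: "word v L" and v0: "v 0" and LN: "L \<noteq> N"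
    and b: "0 < b" "b \<le> cext t v 0 L b"
  shows "\<exists>r. block_loop t v L r"
proof -
  have L: "0 < L" and vper: "\<And>i. v (i + L) = v i" using cl by (auto simp: closed_path_def)
  obtain r where r: "\<And>i. 0 < r i" "\<And>i. r i \<le> R (path t v i)" "\<And>i. r (i + L) = r i" "\<And>i. gs t v i (r i) = r (Suc i)"
    "\<And>i w. 0 \<le> w \<Longrightarrow> w < r i \<Longrightarrow> gs t v i w < r (Suc i)"
    using innermost_cycle[OF cl L v0 b] by blast
  have sgn: "v i \<longleftrightarrow> \<Phi> (path t v i) (r i) < 0" for i using r(4)[of i] r(1)[of "Suc i"] by (auto simp: gs_def split: if_splits)
  have dist: "i mod L = j mod L" if same: "path t v i mod (2 * K) = path t v j mod (2 * K)" "r i = r j" for i j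
  proof (rule wordD(1)[OF w])
    have ind: "path t v (i + n) mod (2 * K) = path t v (j + n) mod (2 * K) \<and> r (i + n) = r (j + n)" for n
    proof (induction n)
      case 0 then show ?case using same by simp
    next
      case (Suc n)
      then have \<Phi>: "\<Phi> (path t v (i + n)) = \<Phi> (path t v (j + n))" using ray_cong(7) by blast
      have v: "v (i + n) = v (j + n)" using sgn[of "i + n"] sgn[of "j + n"] \<Phi> Suc by metis
      define d where "d = 1 + (if v (j + n) then K else 0)"
      have "path t v (Suc (i + n)) = path t v (i + n) + d" "path t v (Suc (j + n)) = path t v (j + n) + d"
        using v by (simp_all add: d_def)
      then have "path t v (Suc (i + n)) mod (2 * K) = path t v (Suc (j + n)) mod (2 * K)"
        using Suc by (metis mod_add_left_eq)
      moreover have "gs t v (i + n) = gs t v (j + n)" by (rule ext) (simp only: gs_def \<Phi> v)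
      then have "r (Suc (i + n)) = r (Suc (j + n))" using Suc r(4)[of "i + n"] r(4)[of "j + n"] by simp
      ultimately show ?case by simp
    qed
    fix n show "v (i + n) = v (j + n)"
      using ind[of n] ray_cong(7)[of "path t v (i + n)" "path t v (j + n)"] sgn[of "i + n"] sgn[of "j + n"] by metis
  qed
  have nP: "r i \<notin> PC (path t v i)" for i
  proof
    assume "r i \<in> PC (path t v i)"
    then obtain a where a: "ix a mod (2 * K) = path t v i mod (2 * K)" "\<xi> a = r i" using PC_iff by blast
    have ind: "ix (a + n) mod (2 * K) = path t v (i + n) mod (2 * K) \<and> \<xi> (a + n) = r (i + n)" for n
    proof (induction n)
      case 0 then show ?case using a by simp
    next
      case (Suc n)
      then have \<Phi>: "\<Phi> (ix (a + n)) (\<xi> (a + n)) = \<Phi> (path t v (i + n)) (r (i + n))" using ray_cong(7) by metis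
      then have v: "viol (a + n) = v (i + n)" using sgn[of "i + n"] unfolding viol_def by metis
      have S: "Suc (ix (a + n)) mod (2 * K) = Suc (path t v (i + n)) mod (2 * K)" using Suc by (metis mod_Suc_eq)
      then have S': "(Suc (ix (a + n)) + K) mod (2 * K) = (Suc (path t v (i + n)) + K) mod (2 * K)" by (metis mod_add_left_eq)
      show ?case using \<xi>_step[of "a + n"] v S S' r(4)[of "i + n"] \<Phi> by (cases "v (i + n)") (auto simp: gs_def)
    qed
    have v: "viol (a + n) = v (i + n)" for n
      using ind[of n] ray_cong(7)[of "ix (a + n)" "path t v (i + n)"] sgn[of "i + n"] unfolding viol_def by metis
    have "v (i + N + n) = v (i + n)" for n
      using v[of n] v[of "n + N"] per_N(3)[of "a + n"] by (simp add: ac_simps)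
    then have "(i + N) mod L = i mod L" by (rule wordD(1)[OF w])
    then have 1: "L dvd N" by (simp only: add_mod_iff)
    have "ix (a + L) mod (2 * K) = ix a mod (2 * K)" "\<xi> (a + L) = \<xi> a"
      using ind[of L] a closed_path_periodic[OF cl, of i] r(3)[of i] by simp_all
    then have "p (a + L) = p a" using pos_ix[of a] pos_ix[of "a + L"] ray_cong(3)[of "ix (a + L)" "ix a"] by simp
    then have "(a + L) mod N = a mod N" using cyc_eq_iff[OF cp] by blast
    then have "N dvd L" by (simp only: add_mod_iff)
    then show False using 1 LN by (simp add: dvd_antisym)
  qed
  have rR: "r i < R (path t v i)" for i using r(2)[of i] nP[of i] R_in[of "path t v i"] by (cases "r i = R (path t v i)") auto
  have slope: "r (Suc i) < gs t v i w" if w: "r i < w" "w \<le> outer t v r i" for i w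
  proof -
    define \<pi> where "\<pi> = path t v i"
    define o' where "o' = outer t v r i"
    have fin: "finite {s \<in> PC \<pi>. r i < s}" "{s \<in> PC \<pi>. r i < s} \<noteq> {}" using PC_fin R_in[of \<pi>] rR[of i] by (auto simp: \<pi>_def)
    have o: "o' \<in> PC \<pi>" "r i < o'" "\<And>s. s \<in> PC \<pi> \<Longrightarrow> r i < s \<Longrightarrow> o' \<le> s"
      using Min_in[OF fin] Min_le[OF fin(1)] by (auto simp: o'_def outer_def \<pi>_def)
    define A where "A = insert 0 {s \<in> PC \<pi>. s < r i}"
    have A: "finite A" "A \<noteq> {}" using PC_fin by (auto simp: A_def)
    define r1 where "r1 = Max A"
    have "r1 \<in> A" unfolding r1_def by (rule Max_in[OF A])
    then have r1: "0 \<le> r1" "r1 < r i" using r(1)[of i] PC_pos by (auto simp: A_def less_imp_le)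
    have r1m: "s \<le> r1" if "s \<in> PC \<pi>" "s < r i" for s
      unfolding r1_def using that A by (intro Max_ge) (auto simp: A_def)
    have "\<not> (r1 < s \<and> s < o')" if "s \<in> PC \<pi>" for s
      using r1m[OF that] o(3)[OF that] nP[of i] that by (cases "s" "r i" rule: linorder_cases) (auto simp: \<pi>_def)
    then obtain s where s: "s \<noteq> 0" "\<And>x. r1 \<le> x \<Longrightarrow> x \<le> o' \<Longrightarrow> \<Phi> \<pi> x = \<Phi> \<pi> r1 + s * (x - r1)"
      using \<Phi>_affine[of r1 o' \<pi>] r1 o(1,2) PC_le by (metis order.strict_trans)
    define s' where "s' = (if v i then - s else s)"
    have g: "gs t v i x = gs t v i r1 + s' * (x - r1)" if "r1 \<le> x" "x \<le> o'" for x
      using s(2)[OF that] by (simp add: gs_def s'_def \<pi>_def)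
    have "gs t v i r1 < gs t v i (r i)" using r(5)[OF r1] r(4) by simp
    then have "0 < s' * (r i - r1)" using g[of "r i"] r1 o(2) by simp
    then have "0 < s'" using r1 by (simp add: zero_less_mult_iff)
    then have "s' * (r i - r1) < s' * (w - r1)" using w by simp
    then show ?thesis using g[of "r i"] g[of w] r(4)[of i] r1 o(2) w by (simp add: o'_def)
  qed
  have "block_loop t v L r"
    unfolding block_loop_def
  proof (intro conjI allI impI)
    fix i j
    show "0 \<le> r i" using r(1)[of i] by simp
    show "path t v i mod (2 * K) = path t v j mod (2 * K) \<and> r i = r j \<Longrightarrow> i mod L = j mod L" by (rule dist) simp_all
  qed (use cl KL r(3,4) rR nP slope in simp_all)
  then show ?thesis by blast
qed

text \<open>The centre itself, traversed twice, serves for doubling the period.\<close>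

lemma turning_block_loop: "block_loop 0 (\<lambda>_. False) (2 * K) (\<lambda>_. 0)"
proof -
  have p: "path 0 (\<lambda>_. False) i = i" for i by (induction i) simp_all
  have o: "outer 0 (\<lambda>_. False) (\<lambda>_. 0) i = \<rho> i" for i
  proof -
    have "{s \<in> PC i. 0 < s} = PC i" using PC_pos by blast
    then show ?thesis by (simp add: outer_def p \<rho>_def)
  qed
  show ?thesis unfolding block_loop_def
    using K0 R_pos PC_pos \<Phi>_near by (auto simp: closed_path_def p o gs_def \<Phi>_0)
qed

section \<open>Loops with few violations have no finer blocks\<close>

text \<open>Of two different blocks at the same level at most one contains points on both sides of the centre.
  Passing from such a two-sided block to a one-sided one takes a violation by some but not all of its
  points, and the way back takes a violation elsewhere.  So if there are at most two violations in a
  period, then a single point of the two-sided block violates; one turn later it is on the same ray but in another block,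
  therefore further out, and a path with a single violation has covered itself in one turn.\<close>

lemma word_no_block:
  assumes nq: "\<not> quick" and cl: "closed_path t v L" and w: "word v L"
    and U: "\<And>i. 0 < U i" "\<And>i. U i \<le> R (path t v i)" "\<And>i. gs t v i (U i) = U (Suc i)"
    and cZ: "cyc M Z" and Z: "\<And>i. Z i = pos (path t v i) (U i)"
    and bk: "blk M Z k" and k: "K dvd k" "K < k" "k dvd L" "k \<noteq> L"
  shows False
proof -
  have L: "0 < L" and vper: "\<And>i. v (i + L) = v i" using cl by (auto simp: closed_path_def)
  define P where "P i = path t v i mod (2 * K)" for i
  have Pcong: "P i = P j" if "i mod L = j mod L" for i j
    unfolding P_def by (rule periodic_cong[of "\<lambda>i. path t v i mod (2 * K)" L, OF closed_path_periodic[OF cl] that])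
  have kL: "i mod k = j mod k" if "i mod L = j mod L" for i j by (rule mod_mod_dvd[OF that k(3)])
  have kK: "i mod K = j mod K" if "i mod k = j mod k" for i j by (rule mod_mod_dvd[OF that k(1)])
  have PS: "P (Suc i) = (Suc (P i) + (if v i then K else 0)) mod (2 * K)" for i
    unfolding P_def path.simps by (metis mod_Suc_eq mod_add_left_eq)
  have Plt: "P i < 2 * K" for i using K0 by (simp add: P_def)
  have PSeq: "P (Suc i) = P (Suc j)" if "P i = P j" "v i = v j" for i j using that by (simp add: PS)
  have PSne: "P (Suc i) \<noteq> P (Suc j)" if "P i = P j" "v i \<noteq> v j" for i j
  proof
    assume "P (Suc i) = P (Suc j)"
    then have "(Suc (P j) + K) mod (2 * K) = Suc (P j) mod (2 * K)" using that by (auto simp: PS split: if_splits)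
    then have "2 * K dvd K" by (simp only: add_mod_iff)
    then show False using K0 by (simp add: dvd_imp_le leD)
  qed
  have level: "path t v i mod K = path t v j mod K" if "i mod k = j mod k" for i j
  proof -
    have "(t + i) mod K = (t + j) mod K" using kK[OF that] by (simp only: add_mod_cancel)
    then show ?thesis by (simp add: path_level)
  qed
  have PSne': "P (Suc i) \<noteq> P (Suc j)" if "path t v i mod K = path t v j mod K" "P i \<noteq> P j" "v i = v j" for i j
  proof
    assume "P (Suc i) = P (Suc j)"
    then have "(P i + (1 + (if v i then K else 0))) mod (2 * K) = (P j + (1 + (if v i then K else 0))) mod (2 * K)"
      using that by (simp add: PS)
    then have "P i mod (2 * K) = P j mod (2 * K)" by (simp only: add.commute[of "P _"] add_mod_cancel)
    then show False using that Plt by simp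
  qed
  define two where "two \<tau> \<longleftrightarrow> (\<exists>i j. i mod k = \<tau> mod k \<and> j mod k = \<tau> mod k \<and> P i \<noteq> P j)" for \<tau>
  have two_cong: "two \<tau> = two \<tau>'" if "\<tau> mod k = \<tau>' mod k" for \<tau> \<tau>' using that by (simp add: two_def)
  have posP: "pos a = pos b" if "a mod (2 * K) = b mod (2 * K)" for a b by (rule ray_cong(3)[OF that])
  have side: "\<exists>\<pi> i j. \<pi> mod K = path t v \<tau> mod K \<and> \<epsilon> \<pi> = 1 \<and> i mod k = \<tau> mod k \<and> j mod k = \<tau> mod k \<and> Z i < c \<pi> \<and> c \<pi> < Z j"
    if "two \<tau>" for \<tau>
  proof -
    obtain i j where ij: "i mod k = \<tau> mod k" "j mod k = \<tau> mod k" "P i \<noteq> P j" using \<open>two \<tau>\<close> two_def by blast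
    have lev: "path t v i mod K = path t v j mod K" using level ij by metis
    then have "path t v j mod (2 * K) = (path t v i + K) mod (2 * K)"
      using level_iff[of "path t v j" "path t v i"] ij(3) by (auto simp: P_def)
    then have Zj: "Z j = pos (path t v i) (- U j)" using Z[of j] posP[of "path t v j" "path t v i + K"] pos_opp by simp
    have Zi: "Z i = pos (path t v i) (U i)" by (rule Z)
    have li: "path t v i mod K = path t v \<tau> mod K" using level ij by metis
    show ?thesis
    proof (cases "\<epsilon> (path t v i) = 1")
      case True
      then have "Z j < c (path t v i)" "c (path t v i) < Z i" using Zi Zj U(1)[of i] U(1)[of j] by (simp_all add: pos_def)
      then show ?thesis using True ij li by blast
    next
      case False
      then have e: "\<epsilon> (path t v i) = -1" using eps by blast
      then have "Z i < c (path t v i + K)" "c (path t v i + K) < Z j" "\<epsilon> (path t v i + K) = 1"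
        using Zi Zj U(1)[of i] U(1)[of j] by (simp_all add: pos_def c_per eps_K)
      moreover have "(path t v i + K) mod K = path t v \<tau> mod K" using li by simp
      ultimately show ?thesis using ij by blast
    qed
  qed
  have nottwo: "\<not> two \<tau>'" if tt: "two \<tau>" "\<tau>' mod K = \<tau> mod K" "\<tau>' mod k \<noteq> \<tau> mod k" for \<tau> \<tau>'
  proof
    assume "two \<tau>'"
    then obtain \<pi>' i' j' where 1: "\<pi>' mod K = path t v \<tau>' mod K" "\<epsilon> \<pi>' = 1" "i' mod k = \<tau>' mod k" "j' mod k = \<tau>' mod k" "Z i' < c \<pi>'" "c \<pi>' < Z j'"
      using side by blast
    obtain \<pi> i j where 2: "\<pi> mod K = path t v \<tau> mod K" "\<epsilon> \<pi> = 1" "i mod k = \<tau> mod k" "j mod k = \<tau> mod k" "Z i < c \<pi>" "c \<pi> < Z j"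
      using side[OF tt(1)] by blast
    have "(t + \<tau>') mod K = (t + \<tau>) mod K" using tt(2) by (simp only: add_mod_cancel)
    then have "\<pi>' mod K = \<pi> mod K" using 1(1) 2(1) by (simp only: path_level)
    then have "c \<pi>' = c \<pi>" by (rule periodic_cong[of c K, OF c_per])
    then have c: "Z i' < Z j" "Z i < Z j'" using 1 2 by simp_all
    have "\<not> (Z i < Z i' \<and> Z i' < Z j)" "\<not> (Z i' < Z i \<and> Z i < Z j')"
      using blkD[OF bk, of i i' j] blkD[OF bk, of i' i j'] 1 2 tt(3) by auto
    then have "Z i = Z i'" using c by linarith
    then have "i mod M = i' mod M" using cyc_eq_iff[OF cZ] by blast
    then have "i mod k = i' mod k" using mod_mod_dvd blk_dvd_period[OF bk] by blast
    then show False using 1 2 tt(3) by simp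
  qed
  have k2: "0 < k" using k by simp
  have Kk: "(\<tau> + K) mod k \<noteq> \<tau> mod k" for \<tau>
  proof
    assume "(\<tau> + K) mod k = \<tau> mod k"
    then have "k dvd K" by (simp only: add_mod_iff)
    then show False using K0 k by (simp add: dvd_imp_le leD)
  qed
  have prev: "two \<tau>" if nv: "two (Suc \<tau>)" "\<And>i. i mod k = \<tau> mod k \<Longrightarrow> \<not> v i" for \<tau>
  proof -
    obtain i j where ij: "i mod k = Suc \<tau> mod k" "j mod k = Suc \<tau> mod k" "P i \<noteq> P j" using nv(1) two_def by blast
    show ?thesis
    proof (rule ccontr)
      assume one: "\<not> two \<tau>"
      have Pc: "P a = P b" if "a mod k = \<tau> mod k" "b mod k = \<tau> mod k" for a b using one that two_def by blast
      obtain L' where L': "L = k * L'" using k(3) by blast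
      \<comment> \<open>The class has no violations and is one-sided, so its successors are on one ray.\<close>
      have *: "P a = P (Suc b)" if "a mod k = Suc \<tau> mod k" "b mod k = \<tau> mod k" for a b
      proof -
        define a' where "a' = a + L - 1"
        have Sa: "Suc a' = a + L" using L by (simp add: a'_def)
        then have "Suc a' mod k = Suc \<tau> mod k" using that(1) by (simp add: L')
        then have "a' mod k = \<tau> mod k" using add_mod_cancel[of 1 a' k \<tau>] by simp
        then have "P (Suc a') = P (Suc b)" using PSeq Pc nv(2) that(2) by blast
        then show ?thesis using Sa Pcong[of "a + L" a] by simp
      qed
      show False using *[OF ij(1), of \<tau>] *[OF ij(2), of \<tau>] ij(3) by simp
    qed
  qed
  have "\<exists>\<tau>. two \<tau>"
  proof (rule ccontr)
    assume "\<not> ?thesis"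
    then have one: "P i = P j" if "i mod k = j mod k" for i j using that unfolding two_def by blast
    have "v (0 + n) = v (k + n)" for n
    proof (rule ccontr)
      assume "v (0 + n) \<noteq> v (k + n)"
      then have "P (Suc (0 + n)) \<noteq> P (Suc (k + n))" by (intro PSne one) simp_all
      moreover have "P (Suc (0 + n)) = P (Suc (k + n))" 
      proof -
        have "Suc n mod k = (k + Suc n) mod k" by (rule mod_add_self1[symmetric])
        from one[OF this] show ?thesis by simp
      qed
      ultimately show False by simp
    qed
    then have "0 mod L = k mod L" by (rule wordD(1)[OF w])
    then have "L dvd k" by auto
    then show False using k by (simp add: dvd_antisym)
  qed
  then obtain \<tau>0 where t0: "two \<tau>0" ..
  have "\<exists>\<tau>. two \<tau> \<and> \<not> two (Suc \<tau>)"
  proof (rule ccontr)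
    assume "\<not> ?thesis"
    then have S: "two \<tau> \<Longrightarrow> two (Suc \<tau>)" for \<tau> by blast
    have "two (\<tau>0 + n)" for n by (induction n) (use t0 S in auto)
    then show False using nottwo[OF t0, of "\<tau>0 + K"] Kk by simp
  qed
  then obtain \<tau> where \<tau>: "two \<tau>" "\<not> two (Suc \<tau>)" by blast
  have oneS: "P (Suc i) = P (Suc j)" if "i mod k = \<tau> mod k" "j mod k = \<tau> mod k" for i j
  proof -
    have "Suc i mod k = Suc \<tau> mod k" "Suc j mod k = Suc \<tau> mod k" using that by (metis mod_Suc_eq)+
    then show ?thesis using \<tau>(2) two_def by blast
  qed
  obtain i1 j1 where ij1: "i1 mod k = \<tau> mod k" "j1 mod k = \<tau> mod k" "P i1 \<noteq> P j1" using \<tau>(1) two_def by blast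
  have lev1: "path t v i mod K = path t v j mod K" if "i mod k = \<tau> mod k" "j mod k = \<tau> mod k" for i j
    by (rule level) (simp only: that)
  have vne: "v i \<noteq> v j" if "i mod k = \<tau> mod k" "j mod k = \<tau> mod k" "P i \<noteq> P j" for i j
    using PSne'[OF lev1[OF that(1,2)] that(3)] oneS[OF that(1,2)] by blast
  have veq: "v i = v j" if "i mod k = \<tau> mod k" "j mod k = \<tau> mod k" "P i = P j" for i j
    using PSne[OF that(3)] oneS[OF that(1,2)] by blast
  obtain \<beta> \<alpha> where \<beta>: "\<beta> mod k = \<tau> mod k" "v \<beta>" "\<alpha> mod k = \<tau> mod k" "\<not> v \<alpha>"
    using vne[OF ij1] ij1 by (cases "v i1") auto
  have nt: "\<not> two (\<tau> + K)" using nottwo[OF \<tau>(1), of "\<tau> + K"] Kk by simp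
  have "\<exists>s \<gamma>. K \<le> s \<and> s < k \<and> \<gamma> mod k = (\<tau> + s) mod k \<and> v \<gamma>"
  proof (rule ccontr)
    assume no: "\<not> ?thesis"
    have "two (\<tau> + (k - n))" if "n \<le> k - K" for n
      using that
    proof (induction n)
      case 0 then show ?case using \<tau>(1) two_cong[of "\<tau> + k" \<tau>] by simp
    next
      case (Suc n)
      have "two (\<tau> + (k - Suc n))"
      proof (rule prev)
        have "Suc (\<tau> + (k - Suc n)) = \<tau> + (k - n)" using Suc.prems by simp
        then show "two (Suc (\<tau> + (k - Suc n)))" using Suc by simp
        show "\<not> v i" if "i mod k = (\<tau> + (k - Suc n)) mod k" for i
          using no that Suc.prems k2 by (metis Suc_le_eq diff_Suc_less diff_diff_cancel diff_le_mono2 k(2) less_imp_le)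
      qed
      then show ?case .
    qed
    from this[of "k - K"] show False using nt k by simp
  qed
  then obtain s \<gamma> where \<gamma>: "K \<le> s" "s < k" "\<gamma> mod k = (\<tau> + s) mod k" "v \<gamma>" by blast
  have tm: "(\<tau> + a) mod k = (\<tau> + b) mod k \<longleftrightarrow> a = b" if "a < k" "b < k" for a b using that by (simp add: add_mod_cancel)
  have \<beta>\<gamma>: "\<beta> mod k \<noteq> \<gamma> mod k" using tm[of 0 s] \<gamma> \<beta>(1) K0 k2 by simp
  have only: "i mod L = \<beta> mod L \<or> i mod L = \<gamma> mod L" if "v i" for i
    using wordD(2)[OF w \<beta>(2) \<gamma>(4) that] kL \<beta>\<gamma> by metis
  have nv: "\<not> v (\<beta> + j)" if j: "0 < j" "j < K" for j
  proof
    assume "v (\<beta> + j)"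
    then have "(\<beta> + j) mod k = \<beta> mod k \<or> (\<beta> + j) mod k = \<gamma> mod k" using only kL by blast
    moreover have "(\<beta> + j) mod k = (\<tau> + j) mod k" using \<beta>(1) by (metis mod_add_left_eq)
    ultimately show False using tm[of j 0] tm[of j s] \<gamma> j k \<beta>(1) by simp
  qed
  have P\<alpha>: "P \<alpha> \<noteq> P \<beta>" using veq[of \<alpha> \<beta>] \<beta> by blast
  define \<pi> where "\<pi> = path t v \<beta>"
  have pathK: "path t v (\<beta> + K) = \<pi> + K + K" using path_trun[of K v \<beta> t] K0 \<beta>(2) nv by (simp add: \<pi>_def)
  then have P\<beta>K: "path t v (\<beta> + K) mod (2 * K) = \<pi> mod (2 * K)" by (simp add: add.assoc mult_2[symmetric])
  have Z1: "Z (\<beta> + K) = pos \<pi> (U (\<beta> + K))" "Z \<beta> = pos \<pi> (U \<beta>)" using Z posP[OF P\<beta>K] by (simp_all add: \<pi>_def)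
  have "path t v \<alpha> mod (2 * K) = (\<pi> + K) mod (2 * K)"
    using level_iff[of "path t v \<alpha>" \<pi>] lev1[OF \<beta>(3,1)] P\<alpha> by (auto simp: P_def \<pi>_def)
  then have Z\<alpha>: "Z \<alpha> = pos \<pi> (- U \<alpha>)" using Z[of \<alpha>] posP[of "path t v \<alpha>" "\<pi> + K"] pos_opp by simp
  have "U \<beta> < U (\<beta> + K)"
  proof (rule ccontr)
    assume "\<not> ?thesis"
    then consider "U (\<beta> + K) = U \<beta>" | "U (\<beta> + K) < U \<beta>" by linarith
    then have "(\<beta> + K) mod k = \<beta> mod k"
    proof cases
      case 1
      then have "Z (\<beta> + K) = Z \<beta>" using Z1 by simp
      then have "(\<beta> + K) mod M = \<beta> mod M" using cyc_eq_iff[OF cZ] by blast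
      then show ?thesis using mod_mod_dvd blk_dvd_period[OF bk] by blast
    next
      case 2
      then have lt: "- U \<alpha> < U (\<beta> + K)" using U(1)[of \<alpha>] U(1)[of "\<beta> + K"] by linarith
      show ?thesis using eps[of \<pi>]
      proof
        assume "\<epsilon> \<pi> = 1"
        then have "Z \<alpha> < Z (\<beta> + K)" "Z (\<beta> + K) < Z \<beta>" using Z1 Z\<alpha> lt 2 by (simp_all add: pos_def)
        then show ?thesis using blkD[OF bk, of \<alpha> "\<beta> + K" \<beta>] \<beta> by simp
      next
        assume "\<epsilon> \<pi> = -1"
        then have "Z (\<beta> + K) < Z \<alpha>" "Z \<beta> < Z (\<beta> + K)" using Z1 Z\<alpha> lt 2 by (simp_all add: pos_def)
        then show ?thesis using blkD[OF bk, of \<beta> "\<beta> + K" \<alpha>] \<beta> by simp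
      qed
    qed
    then show False using Kk by simp
  qed
  moreover have "U (\<beta> + n) \<le> cext t v \<beta> n (U \<beta>)" for n
  proof (induction n)
    case (Suc n)
    have "U (\<beta> + Suc n) = gs t v (\<beta> + n) (U (\<beta> + n))" using U(3)[of "\<beta> + n"] by simp
    also have "\<dots> \<le> ext t v (\<beta> + n) (U (\<beta> + n))" using U(1)[of "\<beta> + n"] by (intro ext_ge) auto
    also have "\<dots> \<le> ext t v (\<beta> + n) (cext t v \<beta> n (U \<beta>))" by (rule ext_mono[OF Suc])
    finally show ?case by simp
  qed simp
  from this[of K] have "U (\<beta> + K) \<le> trun \<pi> K (U \<beta>)"
    using cext_trun[of K v \<beta> t \<pi> "U \<beta>"] K0 \<beta>(2) nv by (simp add: \<pi>_def)
  ultimately have "U \<beta> \<le> trun \<pi> K (U \<beta>)" by linarith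
  then show False using nq U(1)[of \<beta>] unfolding quick_def by blast
qed

section \<open>Cycles from block loops\<close>

text \<open>Existence of the cycles of \<open>F\<close> that have the blocks of \<open>p\<close> up to period \<open>K\<close>, then blocks of period \<open>L\<close>,
  and inside these the tower \<open>ms\<close>.\<close>

definition forced :: "nat \<Rightarrow> nat list \<Rightarrow> bool" where
  "forced L ms \<longleftrightarrow> (\<exists>Z. cyc (L * prod_list ms) Z \<and> (\<forall>i. F (Z i) = Z (Suc i)) \<and> (\<forall>i. \<exists>j l. p j \<le> Z i \<and> Z i \<le> p l) \<and>
     {k. blk (L * prod_list ms) Z k} = {k. blk N p k \<and> k dvd K} \<union> (*) L ` prods ms)"

lemma block_loop_forced:
  assumes bl: "block_loop t v L r" and LN: "L \<noteq> N" and ms: "\<forall>m\<in>set ms. 1 < m" "ms \<noteq> []" "3 \<le> last ms"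
    and nb: "(\<not> quick \<and> word v L) \<or> L = K \<or> L = 2 * K"
  shows "forced L ms"
proof -
  obtain i0 w where w: "r i0 < w" "w \<le> nb t v r i0" "gs t v i0 w \<le> r (Suc i0)" "w \<le> comp_from (grow t v r) i0 L w"
    using folding[OF bl LN] by blast
  define M where "M = L * prod_list ms"
  define t' where "t' = path t v i0"
  define v' where "v' = (\<lambda>j. v (i0 + j))"
  have pp: "path t' v' j = path t v (i0 + j)" for j unfolding t'_def v'_def by (rule path_shift)
  have gg: "gs t' v' j = gs t v (i0 + j)" for j unfolding gs_def pp by (simp add: v'_def)
  obtain U where U: "\<And>i. r (i0 + i) < U i" "\<And>i. U i \<le> nb t v r (i0 + i)" "\<And>i. gs t v (i0 + i) (U i) = U (Suc i)"
    and cZ0: "cyc M (\<lambda>i. pos (path t v (i0 + i)) (U i))" and DZ0: "{k. blk M (\<lambda>i. pos (path t v (i0 + i)) (U i)) k} =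
       {k. blk M (\<lambda>i. pos (path t v (i0 + i)) (U i)) k \<and> k dvd L} \<union> (*) L ` prods ms"
    using fold_cycle[OF bl w ms] unfolding M_def by blast
  define Z where "Z = (\<lambda>i. pos (path t' v' i) (U i))"
  have cZ: "cyc M Z" and DZ: "{k. blk M Z k} = {k. blk M Z k \<and> k dvd L} \<union> (*) L ` prods ms"
    using cZ0 DZ0 unfolding Z_def pp by auto
  have U0: "0 < U i" for i using U(1)[of i] bl_r(1)[OF bl, of "i0 + i"] by simp
  have UR: "U i \<le> R (path t' v' i)" for i using U(2)[of i] nb_le_R[OF bl, of "i0 + i"] by (simp add: pp)
  have Ug: "gs t' v' i (U i) = U (Suc i)" for i using U(3) by (simp add: gg)
  have lev: "path t' v' i mod K = (t' + i) mod K" for i by (rule path_level)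
  have KL: "K dvd L" by (rule bl_K[OF bl])
  have KM: "K dvd M" using KL by (simp add: M_def)
  have iff: "Z i < Z j \<longleftrightarrow> p (t' + i) < p (t' + j)" if ne: "i mod K \<noteq> j mod K" for i j
  proof -
    have l: "path t' v' i mod K = (t' + i) mod K" "path t' v' j mod K = (t' + j) mod K" using lev by blast+
    then have "path t' v' i mod K \<noteq> path t' v' j mod K" using ne add_mod_cancel by metis
    then have *: "Z i < Z j \<longleftrightarrow> p (path t' v' i) < p (path t' v' j)" "path t' v' j mod K \<noteq> path t' v' i mod K"
      unfolding Z_def using level_less_iff[of "path t' v' i" "path t' v' j" "U i" "U j"] U0[of i] U0[of j] UR[of i] UR[of j] by auto
    have ne': "(t' + i) mod K \<noteq> (t' + j) mod K" using ne add_mod_cancel by metis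
    have a: "p (path t' v' i) < p (path t' v' j) \<Longrightarrow> p (t' + i) < p (t' + j)"
      by (rule blk_separated[OF cp bK *(2)[symmetric] _ l(1)[symmetric] l(2)[symmetric]])
    have b: "p (t' + i) < p (t' + j) \<Longrightarrow> p (path t' v' i) < p (path t' v' j)"
      by (rule blk_separated[OF cp bK ne' _ l])
    show ?thesis using * a b by blast
  qed
  define p' where "p' = (\<lambda>i. p (i + t'))"
  have p'iff: "blk N p' k \<longleftrightarrow> blk N p k" for k unfolding p'_def by (rule blk_shift[of p N t' k, OF cyc_periodic[OF cp] N0])
  have ord: "Z i < Z j \<longleftrightarrow> p' i < p' j" if "i mod K \<noteq> j mod K" for i j using iff[OF that] by (simp add: p'_def add.commute)
  have bZK: "blk M Z K"
  proof (rule blkI[OF KM])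
    fix i j l assume a: "Z i < Z l" "Z l < Z j" "i mod K = j mod K"
    show "l mod K = i mod K"
    proof (rule ccontr)
      assume ne: "l mod K \<noteq> i mod K"
      then have "p' i < p' l" "p' l < p' j" using ord[of i l] ord[of l j] a by auto
      then show False using blkD[OF p'iff[THEN iffD2, OF bK], of i l j] a(3) ne by simp
    qed
  qed
  have kk: "blk M Z k \<longleftrightarrow> blk N p k" if "k dvd K" for k
  proof
    assume "blk M Z k"
    then have "blk N p' k" by (rule blk_transfer[OF _ that p'iff[THEN iffD2, OF bK]]) (simp add: ord)
    then show "blk N p k" using p'iff by blast
  next
    assume "blk N p k"
    then have "blk N p' k" using p'iff by blast
    then show "blk M Z k" by (rule blk_transfer[OF _ that bZK]) (simp add: ord)
  qed
  have nob: "k = L" if b: "blk M Z k" "k dvd L" "K dvd k" "K < k" for k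
  proof (rule ccontr)
    assume kL: "k \<noteq> L"
    have k2: "k \<noteq> K" "\<not> L = K" "\<not> L = 2 * K"
    proof -
      have Lk: "k \<le> L" using b(2) bl_L[OF bl] by (rule dvd_imp_le)
      show "k \<noteq> K" "\<not> L = K" using b kL Lk by auto
      show "\<not> L = 2 * K"
      proof
        assume L2: "L = 2 * K"
        obtain m where m: "k = K * m" using b(3) by blast
        have "1 < m" using b(4) K0 m by simp
        then have "K * 2 \<le> k" unfolding m by (intro mult_le_mono) auto
        then show False using Lk kL L2 by simp
      qed
    qed
    then have nq: "\<not> quick" "word v L" using nb by blast+
    have cl: "closed_path t' v' L" unfolding t'_def v'_def by (rule closed_path_shift[OF bl_closed[OF bl]])
    have w': "word v' L" unfolding v'_def by (rule word_shift[OF nq(2)])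
    show False by (rule word_no_block[OF nq(1) cl w' U0 UR Ug cZ _ b(1,3,4,2) kL]) (simp add: Z_def)
  qed
  have D: "{k. blk M Z k} = {k. blk N p k \<and> k dvd K} \<union> (*) L ` prods ms"
  proof
    show "{k. blk N p k \<and> k dvd K} \<union> (*) L ` prods ms \<subseteq> {k. blk M Z k}" using kk DZ by blast
    have "k \<in> {k. blk N p k \<and> k dvd K} \<union> (*) L ` prods ms" if b: "blk M Z k" "k dvd L" for k
    proof (cases "k \<le> K")
      case True
      then have "k dvd K" using blk_nested[OF cZ b(1) bZK] by blast
      then show ?thesis using kk b by blast
    next
      case False
      then have "K dvd k" using blk_nested[OF cZ bZK b(1)] by simp
      then have "k = L * 1" using nob[OF b] False by simp
      then show ?thesis using one_in_prods by blast
    qed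
    then show "{k. blk M Z k} \<subseteq> {k. blk N p k \<and> k dvd K} \<union> (*) L ` prods ms" using DZ by blast
  qed
  have hull: "\<exists>j l. p j \<le> Z i \<and> Z i \<le> p l" for i
    unfolding Z_def by (rule pos_hull[OF less_imp_le[OF U0[of i]] UR[of i]]) blast
  have FZ: "F (Z i) = Z (Suc i)" for i using gs_step[OF UR[of i]] Ug[of i] by (simp add: Z_def)
  show ?thesis unfolding forced_def using cZ FZ hull D unfolding M_def by blast
qed

lemma trun_mono: "w \<le> w' \<Longrightarrow> trun j n w \<le> trun j n w'"
  unfolding trun_def by (intro run_mono Tx_mono)

text \<open>With two violations the path closes up after an even number of turns; the parts between the violations must
  have different lengths, since otherwise the word has a smaller period.\<close>

lemma two_violations:
  assumes d: "0 < d1" "0 < d2" "d1 \<noteq> d2" and L: "L = d1 + d2" "2 * K dvd L" "L \<noteq> N"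
    and x: "0 < x1" "x2 \<le> trun t1 d1 x1" "x1 \<le> trun t2 d2 x2" "t2 mod (2 * K) = (t1 + d1 + K) mod (2 * K)"
  shows "\<exists>v r. word v L \<and> block_loop t1 v L r"
proof -
  define v where "v = (\<lambda>i. i mod L = 0 \<or> i mod L = d1)"
  have dL: "0 < L" "d1 < L" "2 * d1 \<noteq> L" "\<And>i. i < d2 \<Longrightarrow> d1 + i < L" using d L(1) by simp_all
  have w: "word v L" unfolding v_def by (rule word_two[OF dL(2,3)])
  have nv: "\<not> v i" if "0 < i" "i < d1" for i
  proof -
    have "i mod L = i" using that dL(2) by simp
    then show ?thesis using that by (simp add: v_def)
  qed
  have nv2: "\<not> v (d1 + i)" if "0 < i" "i < d2" for i
  proof -
    have "(d1 + i) mod L = d1 + i" using dL(4)[OF that(2)] by simp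
    then show ?thesis using that by (simp add: v_def)
  qed
  have v0: "v 0" "v d1" using dL(1,2) by (simp_all add: v_def)
  have p1: "path t1 v d1 = t1 + d1 + K" using path_trun[of d1 v 0 t1] d(1) v0(1) nv by simp
  have p2: "path t1 v (d1 + d2) = t1 + d1 + K + d2 + K" using path_trun[OF d(2) v0(2) nv2, of t1] p1 by simp
  have KL: "K dvd L" by (rule dvd_trans[OF _ L(2)]) simp
  have "path t1 v L = t1 + (L + 2 * K)" using p2 unfolding L(1) by simp
  moreover have "2 * K dvd L + 2 * K" by (rule dvd_add[OF L(2)]) simp
  ultimately have "path t1 v L mod (2 * K) = t1 mod (2 * K)" by (simp only: add_mod_iff)
  moreover have "\<forall>i. v (i + L) = v i" by (simp add: v_def)
  ultimately have cl: "closed_path t1 v L" unfolding closed_path_def using dL(1) by blast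
  have "cext t1 v 0 L x1 = cext t1 v d1 d2 (cext t1 v 0 d1 x1)" unfolding L(1) comp_from_add by simp
  also have "cext t1 v 0 d1 x1 = trun t1 d1 x1" using cext_trun[of d1 v 0 t1 t1 x1] d(1) v0(1) nv by simp
  also have "cext t1 v d1 d2 (trun t1 d1 x1) = trun t2 d2 (trun t1 d1 x1)"
    by (rule cext_trun[OF d(2) v0(2) nv2]) (use p1 x(4) in simp_all)
  finally have "x1 \<le> cext t1 v 0 L x1" using x(3) trun_mono[OF x(2), of t2 d2] by linarith
  from word_block_loop[OF cl KL w v0(1) L(3) x(1) this] obtain r where r: "block_loop t1 v L r" ..
  show ?thesis by (rule exI[of _ v], rule exI[of _ r], rule conjI[OF w r])
qed

lemma one_violation:
  assumes L: "L = (2 * k + 1) * K" "L \<noteq> N" and x: "0 < x" "x \<le> trun t L x"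
  shows "\<exists>v r. word v L \<and> block_loop t v L r"
proof -
  define v where "v = (\<lambda>i. i mod L = 0)"
  have L0: "0 < L" unfolding L(1) using K0 by simp
  have w: "word v L" using word_two[of 0 L] L0 by (simp add: v_def)
  have nv: "\<not> v (0 + i)" if "0 < i" "i < L" for i using that by (simp add: v_def)
  have v0: "v 0" by (simp add: v_def)
  have "path t v L = t + L + K" using path_trun[of L v 0 t] L0 v0 nv by simp
  also have "\<dots> = t + 2 * K * (k + 1)" unfolding L(1) by (simp add: algebra_simps)
  finally have "path t v L mod (2 * K) = t mod (2 * K)" by (simp only: mod_mult_self2)
  moreover have "v (i + L) = v i" for i by (simp add: v_def)
  ultimately have cl: "closed_path t v L" using L0 by (simp add: closed_path_def)
  have "cext t v 0 L x = trun t L x" using cext_trun[of L v 0 t t x] L0 v0 nv by simp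
  then have "x \<le> cext t v 0 L x" using x by simp
  moreover have "K dvd L" unfolding L(1) by simp
  ultimately obtain r where "block_loop t v L r" using word_block_loop[OF cl _ w v0 L(2) x(1)] by blast
  then show ?thesis using w by blast
qed

definition returns :: "nat \<Rightarrow> nat \<Rightarrow> bool" where
  "returns i k \<longleftrightarrow> \<xi> i \<le> trun (ix i) ((2 * k + 1) * K) (\<xi> i)"

text \<open>Two more turns without violation do not decrease the radius.\<close>

lemma returns_mono: assumes nq: "\<not> quick" and "returns i k" "k \<le> k'" shows "returns i k'"
proof -
  obtain m where m: "k' = k + m" using assms(3) le_Suc_ex by blast
  define D where "D = (2 * k + 1) * K"
  have D0: "0 < D" using K0 by (simp add: D_def)
  have "\<xi> i \<le> run (ix i) (2 * K * m) (\<xi> i)" by (rule many_turns[OF nq])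
  also have "\<dots> \<le> run (ix i) (2 * K * m) (trun (ix i) D (\<xi> i))"
    using assms(2) unfolding returns_def D_def by (rule run_mono)
  also have "\<dots> = run (ix i + D + K) (2 * K * m) (trun (ix i) D (\<xi> i))"
  proof (rule run_cong)
    have "ix i + D + K = ix i + 2 * K * (k + 1)" by (simp add: D_def algebra_simps)
    then show "ix i mod (2 * K) = (ix i + D + K) mod (2 * K)" by simp
  qed
  also have "\<dots> = trun (ix i) (D + 2 * K * m) (\<xi> i)" by (rule trun_run[OF D0, symmetric])
  also have "D + 2 * K * m = (2 * k' + 1) * K" by (simp add: D_def m algebra_simps)
  finally show ?thesis by (simp add: returns_def)
qed

lemma returns_two:
  assumes nq: "\<not> quick" and "returns i k" "k < k'" and N: "(2 * (k + k') + 2) * K \<noteq> N"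
    and ms: "\<forall>m\<in>set ms. 1 < m" "ms \<noteq> []" "3 \<le> last ms"
  shows "forced ((2 * (k + k') + 2) * K) ms"
proof -
  have r: "returns i k'" by (rule returns_mono[OF nq assms(2)]) (use assms in simp)
  define d1 d2 where "d1 = (2 * k + 1) * K" and "d2 = (2 * k' + 1) * K"
  have "ix i + d1 + K = ix i + 2 * K * (k + 1)" by (simp add: d1_def algebra_simps)
  then have t: "ix i mod (2 * K) = (ix i + d1 + K) mod (2 * K)" by simp
  have L: "(2 * (k + k') + 2) * K = d1 + d2" by (simp add: d1_def d2_def algebra_simps)
  have "(2 * (k + k') + 2) * K = 2 * K * (k + k' + 1)" by (simp add: algebra_simps)
  then have dv: "2 * K dvd (2 * (k + k') + 2) * K" by (metis dvd_triv_left)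
  obtain v rr where "word v ((2 * (k + k') + 2) * K)" "block_loop (ix i) v ((2 * (k + k') + 2) * K) rr"
    using two_violations[of d1 d2 _ "\<xi> i" "\<xi> i" "ix i" "ix i", OF _ _ _ L dv N \<xi>_pos _ _ t] K0 assms(2,3) r
    unfolding returns_def d1_def d2_def by auto
  then show ?thesis using block_loop_forced[OF _ N ms] nq by blast
qed

section \<open>The forced periods\<close>

lemma twice_violating:
  assumes c2: "cnt N = 2"
  obtains i1 i2 where "viol i1" "viol i2" "i1 < i2" "i2 < i1 + N"
    "\<And>i. 0 < i \<Longrightarrow> i < i2 - i1 \<Longrightarrow> \<not> viol (i1 + i)" "\<And>i. 0 < i \<Longrightarrow> i < i1 + N - i2 \<Longrightarrow> \<not> viol (i2 + i)"
proof -
  define V where "V = {j. j < N \<and> viol j}"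
  have "card V = 2" using c2 by (simp add: cnt_def V_def)
  then obtain x y where "V = {x, y}" "x \<noteq> y" by (auto simp: card_2_iff)
  then obtain i1 i2 where i: "V = {i1, i2}" "i1 < i2" by (metis insert_commute linorder_neqE_nat)
  have V: "i1 \<in> V" "i2 \<in> V" using i by auto
  have nv: "j mod N = i1 \<or> j mod N = i2" if "viol j" for j
  proof -
    have "viol (j mod N)" using periodic_mod[of viol N j] per_N(3) that by simp
    then have "j mod N \<in> V" using N0 by (simp add: V_def)
    then show ?thesis using i by simp
  qed
  show ?thesis
  proof (rule that[of i1 i2])
    show "viol i1" "viol i2" "i1 < i2" "i2 < i1 + N" using V i by (auto simp: V_def)
    show "\<not> viol (i1 + j)" if "0 < j" "j < i2 - i1" for j
    proof
      assume "viol (i1 + j)"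
      moreover have "i2 < N" using V(2) by (simp add: V_def)
      then have "i1 + j < N" using that by linarith
      ultimately show False using nv[of "i1 + j"] that by simp
    qed
    show "\<not> viol (i2 + j)" if "0 < j" "j < i1 + N - i2" for j
    proof
      assume a: "viol (i2 + j)"
      show False
      proof (cases "i2 + j < N")
        case True then show ?thesis using nv[OF a] that i(2) by simp
      next
        case False
        have "i1 < N" using V(1) by (simp add: V_def)
        then have "i2 + j - N < N" using that by linarith
        moreover have "(i2 + j) mod N = (i2 + j - N) mod N" by (rule le_mod_geq) (use False in simp)
        ultimately have "(i2 + j) mod N = i2 + j - N" by simp
        then show ?thesis using nv[OF a] that i(2) V by (auto simp: V_def)
      qed
    qed
  qed
qed

text \<open>The cycle \<open>p\<close> itself gives a loop with two violations; making one of its two parts two turns longer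
  keeps it returning.\<close>

lemma insert_turn:
  assumes nq: "\<not> quick" and v: "viol i1" "viol i2" and n: "0 < n1" "0 < n2" "n1 + 2 * K \<noteq> n2" "2 * K dvd n1 + n2" "n1 + n2 = N"
    and i: "i2 mod N = (i1 + n1) mod N" "i1 mod N = (i2 + n2) mod N"
    and nv: "\<And>i. 0 < i \<Longrightarrow> i < n1 \<Longrightarrow> \<not> viol (i1 + i)" "\<And>i. 0 < i \<Longrightarrow> i < n2 \<Longrightarrow> \<not> viol (i2 + i)"
    and ms: "\<forall>m\<in>set ms. 1 < m" "ms \<noteq> []" "3 \<le> last ms"
  shows "forced (N + 2 * K) ms"
proof -
  have cong: "ix a mod (2 * K) = ix b mod (2 * K)" "\<xi> a = \<xi> b" if "a mod N = b mod N" for a b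
    using periodic_cong[of "\<lambda>i. ix i mod (2 * K)" N a b] periodic_cong[of \<xi> N a b] per_N that by auto
  have s1: "\<xi> i2 \<le> trun (ix i1) n1 (\<xi> i1)" "ix i2 mod (2 * K) = (ix i1 + n1 + K) mod (2 * K)"
    using follow_trun[OF v(1) n(1) nv(1)] cong[OF i(1)] by auto
  have s2: "\<xi> i1 \<le> trun (ix i2) n2 (\<xi> i2)"
    using follow_trun[OF v(2) n(2) nv(2)] cong[OF i(2)] by auto
  have "\<xi> i2 \<le> run (ix i2) (2 * K) (\<xi> i2)" by (rule two_turns[OF nq])
  also have "\<dots> \<le> run (ix i2) (2 * K) (trun (ix i1) n1 (\<xi> i1))" by (rule run_mono[OF s1(1)])
  also have "\<dots> = run (ix i1 + n1 + K) (2 * K) (trun (ix i1) n1 (\<xi> i1))" by (rule run_cong[OF s1(2)])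
  also have "\<dots> = trun (ix i1) (n1 + 2 * K) (\<xi> i1)" by (rule trun_run[OF n(1), symmetric])
  finally have x2: "\<xi> i2 \<le> trun (ix i1) (n1 + 2 * K) (\<xi> i1)" .
  have e: "ix i1 + (n1 + 2 * K) + K = ix i1 + n1 + K + 2 * K" by simp
  have t: "ix i2 mod (2 * K) = (ix i1 + (n1 + 2 * K) + K) mod (2 * K)" unfolding e mod_add_self2 by (rule s1(2))
  have L: "N + 2 * K = (n1 + 2 * K) + n2" "2 * K dvd N + 2 * K" "N + 2 * K \<noteq> N" using n K0 by auto
  obtain vv rr where "word vv (N + 2 * K)" "block_loop (ix i1) vv (N + 2 * K) rr"
    using two_violations[OF _ n(2) n(3) L \<xi>_pos x2 s2 t] n(1) by auto
  then show ?thesis using block_loop_forced[OF _ L(3) ms] nq by blast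
qed

lemma gg_seq_triple:
  "i mod 3 = 0 \<and> gg_seq i = 4 * (i div 3 + 1) \<or> i mod 3 = 1 \<and> gg_seq i = 4 * (i div 3 + 1) + 2 \<or>
   i mod 3 = 2 \<and> gg_seq i = 2 * (i div 3 + 1) + 1"
proof -
  consider "i mod 3 = 0" | "i mod 3 = 1" | "i mod 3 = 2" by linarith
  then show ?thesis by cases (simp_all add: gg_seq_def Let_def)
qed

text \<open>With \<open>a\<close> and \<open>b\<close> the positions of the triples of \<open>n\<close> and \<open>m\<close> in the order, averaging gives a return with one violation
  within \<open>2 a + 1\<close> turns, hence within every larger odd number of turns.  One such return yields the odd
  periods, and two successive ones of different lengths yield the periods divisible by \<open>4\<close> and the remaining even ones.  Only
  \<open>n = 4 a\<close> and \<open>m = 4 a + 2\<close> need more: either \<open>p\<close> has at least four violations, and the average is better, or it has two,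
  and two turns are inserted.\<close>

lemma forced_period:
  assumes N: "N = n * K" and nm: "n \<ggreater> m" "1 < m" and ms: "\<forall>m\<in>set ms. 1 < m" "ms \<noteq> []" "3 \<le> last ms"
  shows "forced (m * K) ms"
proof (cases quick)
  case True
  then obtain j b where b: "0 < b" "b \<le> trun j K b" unfolding quick_def by blast
  have "K \<noteq> N" using big K0 by simp
  then obtain v r where bl: "block_loop j v K r" using one_violation[of K 0 b j] b by auto
  have "forced K (m # ms)"
    by (rule block_loop_forced[OF bl \<open>K \<noteq> N\<close>]) (use ms nm in auto)
  moreover have "{k. blk N p k \<and> k dvd K} \<union> (*) K ` prods (m # ms) = {k. blk N p k \<and> k dvd K} \<union> (*) (m * K) ` prods ms"
    using bK by (auto simp: prods_Cons image_image mult.assoc mult.commute mult.left_commute)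
  ultimately show ?thesis unfolding forced_def by (simp add: mult.assoc mult.commute mult.left_commute)
next
  case nq: False
  show ?thesis
  proof (cases "m = 2")
    case True
    have "2 * K \<noteq> N" using big K0 by simp
    then show ?thesis using block_loop_forced[OF turning_block_loop _ ms] True by simp
  next
    case False
    then obtain i j where ij: "i < j" "n = gg_seq i" "m = gg_seq j" using nm unfolding gg_def by auto
    define a b where "a = i div 3 + 1" and "b = j div 3 + 1"
    have n: "i mod 3 = 0 \<and> n = 4 * a \<or> i mod 3 = 1 \<and> n = 4 * a + 2 \<or> i mod 3 = 2 \<and> n = 2 * a + 1"
      and m: "j mod 3 = 0 \<and> m = 4 * b \<or> j mod 3 = 1 \<and> m = 4 * b + 2 \<or> j mod 3 = 2 \<and> m = 2 * b + 1"
      unfolding ij(2,3) a_def b_def by (rule gg_seq_triple)+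
    have a1: "1 \<le> a" by (simp add: a_def)
    have "i div 3 \<le> j div 3" using ij(1) by (simp add: div_le_mono)
    then have ab: "a \<le> b" by (simp add: a_def b_def)
    have eqab: "i mod 3 < j mod 3" if "a = b"
    proof -
      have "i div 3 = j div 3" using that by (simp add: a_def b_def)
      moreover have "i = 3 * (i div 3) + i mod 3" "j = 3 * (j div 3) + j mod 3" by simp_all
      ultimately show ?thesis using ij(1) by linarith
    qed
    have nm': "n \<noteq> m"
    proof
      assume "n = m"
      with n m have "a = b \<and> i mod 3 = j mod 3" by (elim disjE conjE) (simp_all, presburger+)
      then show False using eqab by simp
    qed
    have mN: "m * K \<noteq> N" using nm' N K0 by simp
    have evenc: "even (cnt N)" if "even n"
    proof -
      have "K * 2 dvd K * (n + cnt N)" using cnt_parity N by (simp add: algebra_simps)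
      then have "2 dvd n + cnt N" using K0 by (simp only: nat_mult_dvd_cancel1)
      then show ?thesis using that by simp
    qed
    have ret: "\<exists>i. returns i k" if "n \<le> cnt N * (2 * k + 1)" for k
    proof -
      have "n * K \<le> cnt N * (2 * k + 1) * K" using that by (rule mult_le_mono1)
      then have "n * K \<le> cnt N * ((2 * k + 1) * K)" by (simp only: mult.assoc)
      then have "N \<le> cnt N * ((2 * k + 1) * K)" by (rule order_trans[OF eq_refl[OF N]])
      from average_return[OF nq refl this] show ?thesis unfolding returns_def by blast
    qed
    have c1: "1 \<le> cnt N" using cnt_pos by simp
    have "\<exists>i. returns i a"
    proof (rule ret)
      show "n \<le> cnt N * (2 * a + 1)"
      proof (cases "even n")
        case True
        then have "2 \<le> cnt N" using evenc c1 by (cases "cnt N = 1") auto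
        then have "2 * (2 * a + 1) \<le> cnt N * (2 * a + 1)" by (rule mult_le_mono1)
        then show ?thesis using n a1 by auto
      next
        case False
        then have "n = 2 * a + 1" using n by auto
        moreover have "1 * (2 * a + 1) \<le> cnt N * (2 * a + 1)" using c1 by (rule mult_le_mono1)
        ultimately show ?thesis by simp
      qed
    qed
    then obtain i0 where ra: "returns i0 a" ..
    consider (odd) "m = 2 * b + 1" | (four) "m = 4 * b" "a < b" | (six) "m = 4 * b + 2" "a < b" | (spec) "m = 4 * a + 2" "n = 4 * a" "a = b"
      using n m ab eqab by (cases "a = b") auto
    then show ?thesis
    proof cases
      case odd
      have "returns i0 b" by (rule returns_mono[OF nq ra ab])
      then obtain v r where "word v (m * K)" "block_loop (ix i0) v (m * K) r"
        using one_violation[of "m * K" b "\<xi> i0" "ix i0"] mN \<xi>_pos odd unfolding returns_def by auto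
      then show ?thesis using block_loop_forced[OF _ mN ms] nq by blast
    next
      case four
      have "returns i0 (b - 1)" by (rule returns_mono[OF nq ra]) (use four in simp)
      moreover have "m = 2 * (b - 1 + b) + 2" using four by simp
      ultimately show ?thesis using returns_two[OF nq _ _ _ ms, of i0 "b - 1" b] mN four by simp
    next
      case six
      have "returns i0 (b - 1)" by (rule returns_mono[OF nq ra]) (use six in simp)
      moreover have "m = 2 * (b - 1 + (b + 1)) + 2" using six by simp
      ultimately show ?thesis using returns_two[OF nq _ _ _ ms, of i0 "b - 1" "b + 1"] mN six by simp
    next
      case spec
      have "even (cnt N)" using evenc spec by simp
      show ?thesis
      proof (cases "cnt N = 2")
        case False
        obtain h where h: "cnt N = 2 * h" using \<open>even (cnt N)\<close> by blast
        have "h \<noteq> 1" "h \<noteq> 0" using False c1 unfolding h by simp_all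
        then have "4 \<le> cnt N" unfolding h by simp
        then have "4 * (2 * (a - 1) + 1) \<le> cnt N * (2 * (a - 1) + 1)" by (rule mult_le_mono1)
        then have "n \<le> cnt N * (2 * (a - 1) + 1)" using spec a1 by simp
        then obtain i' where "returns i' (a - 1)" using ret by blast
        moreover have "m = 2 * (a - 1 + (a + 1)) + 2" using spec a1 by simp
        ultimately show ?thesis using returns_two[OF nq _ _ _ ms, of i' "a - 1" "a + 1"] mN a1 by simp
      next
        case True
        obtain i1 i2 where I: "viol i1" "viol i2" "i1 < i2" "i2 < i1 + N"
          "\<And>i. 0 < i \<Longrightarrow> i < i2 - i1 \<Longrightarrow> \<not> viol (i1 + i)" "\<And>i. 0 < i \<Longrightarrow> i < i1 + N - i2 \<Longrightarrow> \<not> viol (i2 + i)"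
          using twice_violating[OF True] by blast
        define n1 n2 where "n1 = i2 - i1" and "n2 = i1 + N - i2"
        have nn: "0 < n1" "0 < n2" "n1 + n2 = N" "i1 + n1 = i2" "i2 + n2 = i1 + N" using I by (auto simp: n1_def n2_def)
        have "N = 2 * K * (2 * a)" using N spec by simp
        then have dv: "2 * K dvd n1 + n2" "2 * K dvd n2 + n1" using nn(3) by (simp_all add: add.commute)
        have nv: "\<And>i. 0 < i \<Longrightarrow> i < n1 \<Longrightarrow> \<not> viol (i1 + i)" "\<And>i. 0 < i \<Longrightarrow> i < n2 \<Longrightarrow> \<not> viol (i2 + i)"
          using I(5,6) by (simp_all add: n1_def n2_def)
        have md: "i2 mod N = (i1 + n1) mod N" "i1 mod N = (i2 + n2) mod N" using nn by simp_all
        have "forced (N + 2 * K) ms"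
        proof (cases "n1 + 2 * K = n2")
          case False
          show ?thesis by (rule insert_turn[OF nq I(1,2) nn(1,2) False dv(1) nn(3) md nv ms])
        next
          case True
          then have ne: "n2 + 2 * K \<noteq> n1" using K0 by simp
          have s: "n2 + n1 = N" using nn(3) by simp
          show ?thesis by (rule insert_turn[OF nq I(2,1) nn(2,1) ne dv(2) s md(2,1) nv(2,1) ms])
        qed
        moreover have "m * K = N + 2 * K" using N spec by (simp add: algebra_simps)
        ultimately show ?thesis by simp
      qed
    qed
  qed
qed

end

section \<open>Existence of the centre\<close>

context block_cycle
begin

lemma funpow_p: "(F ^^ k) (p i) = p (i + k)"
  by (induction k) (simp_all add: Fp)

lemma F_cont: "continuous_on S F"
  using dm continuous_on_subset[of UNIV F S] by (simp add: dots_map_def)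

lemma funpow_cont: "continuous_on S (F ^^ k)"
proof (induction k)
  case 0 show ?case by (simp add: id_def)
next
  case (Suc k)
  have "continuous_on S (\<lambda>x. F ((F ^^ k) x))" by (rule continuous_on_compose2[OF F_cont[of UNIV] Suc]) simp
  then show ?case by (simp add: comp_def)
qed

lemma last_fixed_point:
  assumes big: "K < N"
  obtains a b c0 where "a mod K = 0" "b mod K = 0" "p a < c0" "c0 < p b" "(F ^^ K) c0 = c0"
    "\<And>x. c0 < x \<Longrightarrow> x \<le> p b \<Longrightarrow> (F ^^ K) x < x" "\<And>i. i mod K = 0 \<Longrightarrow> p i \<le> p b"
proof -
  define C where "C = p ` {i. i mod K = 0}"
  have "C \<subseteq> range p" "p 0 \<in> C" by (auto simp: C_def)
  then have C: "finite C" "C \<noteq> {}" using cyc_finite[OF cp] finite_subset by blast+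
  have CE: "\<exists>i. i mod K = 0 \<and> p i = x" if "x \<in> C" for x
    using that unfolding C_def image_iff Bex_def mem_Collect_eq by metis
  obtain a where a: "a mod K = 0" "p a = Min C" using CE[OF Min_in[OF C]] by metis
  obtain b where b: "b mod K = 0" "p b = Max C" using CE[OF Max_in[OF C]] by metis
  have ab: "p a \<le> p i" "p i \<le> p b" if "i mod K = 0" for i
  proof -
    have "p i \<in> C" unfolding C_def by (rule imageI) (use that in simp)
    then show "p a \<le> p i" "p i \<le> p b" unfolding a(2) b(2) using C(1) by simp_all
  qed
  have nK: "\<not> N dvd K" using big K0 by (simp add: nat_dvd_not_less)
  have ne: "p (i + K) \<noteq> p i" for i
  proof
    assume "p (i + K) = p i"
    then have "(i + K) mod N = i mod N" using cyc_eq_iff[OF cp] by blast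
    then show False using nK by (simp only: add_mod_iff)
  qed
  have Ga: "p a < (F ^^ K) (p a)" using ab(1)[of "a + K"] ne[of a] a(1) by (simp add: funpow_p)
  have Gb: "(F ^^ K) (p b) < p b" using ab(2)[of "b + K"] ne[of b] b(1) by (simp add: funpow_p)
  define S where "S = {x \<in> {p a..p b}. 0 \<le> (F ^^ K) x - x}"
  have "closed S" unfolding S_def
    by (intro continuous_on_closed_Collect_le continuous_intros funpow_cont)
  moreover have "bounded S" unfolding S_def by (rule bounded_subset[of "{p a..p b}"]) auto
  ultimately have "compact S" by (simp add: compact_eq_bounded_closed)
  moreover have "p a \<in> S" using Ga ab(1)[OF b(1)] by (auto simp: S_def)
  ultimately obtain c0 where c0: "c0 \<in> S" "\<And>x. x \<in> S \<Longrightarrow> x \<le> c0" using compact_attains_sup[of S] by blast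
  have cb: "c0 < p b" using c0(1) Gb by (auto simp: S_def le_less)
  have "\<exists>x. c0 \<le> x \<and> x \<le> p b \<and> (F ^^ K) x - x = 0"
    by (rule IVT2') (use c0 cb Gb in \<open>auto simp: S_def intro!: continuous_intros funpow_cont\<close>)
  then obtain x where x: "c0 \<le> x" "x \<le> p b" "(F ^^ K) x - x = 0" by blast
  then have "x \<in> S" using c0(1) by (auto simp: S_def)
  then have fx: "(F ^^ K) c0 = c0" using c0(2) x by force
  have "p a < c0" using Ga fx c0(1) by (auto simp: S_def le_less)
  moreover have "(F ^^ K) x < x" if "c0 < x" "x \<le> p b" for x
  proof (rule ccontr)
    assume "\<not> ?thesis"
    then have "x \<in> S" using that c0(1) by (auto simp: S_def)
    then show False using c0(2) that by fastforce
  qed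
  ultimately show ?thesis using that[of a b c0] a b cb fx ab(2) by blast
qed

text \<open>The centre is the orbit of the last point of the block of \<open>p 0\<close> that \<open>F\<close> to the power \<open>K\<close>
  does not move to the left.  If the return map preserved orientation there, then the gap of
  \<open>range p\<close> to the right of that point would be covered by its image under the return map, and some point of this gap would
  move to the right.\<close>

theorem centre_exists:
  assumes big: "3 * K \<le> N" and prime: "\<And>k. blk N p k \<Longrightarrow> K < k \<Longrightarrow> k = N"
  shows "\<exists>c \<epsilon>. spiral F p N K c \<epsilon>"
proof -
  have KN: "K < N" using big K0 by simp
  obtain a b c0 where ab: "a mod K = 0" "b mod K = 0" "p a < c0" "c0 < p b" and fix0: "(F ^^ K) c0 = c0"
    and right: "\<And>x. c0 < x \<Longrightarrow> x \<le> p b \<Longrightarrow> (F ^^ K) x < x" and bmax: "\<And>i. i mod K = 0 \<Longrightarrow> p i \<le> p b"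
    using last_fixed_point[OF KN] by metis
  define P where "P = range p"
  have finP: "finite P" unfolding P_def by (rule cyc_finite[OF cp])
  define c where "c j = (F ^^ j) c0" for j
  have c0: "c 0 = c0" and Fc: "F (c j) = c (Suc j)" for j by (simp_all add: c_def)
  have c_per: "c (j + K) = c j" for j using funpow_periodic[OF fix0] by (simp add: c_def)
  have FKc: "(F ^^ K) (c j) = c j" for j
    using c_per[of j] unfolding c_def by (metis add.commute comp_apply funpow_add)
  have cP: "c j \<notin> P" for j
  proof
    assume "c j \<in> P"
    then obtain i where "c j = p i" by (auto simp: P_def)
    then have "p (i + K) = p i" using FKc[of j] funpow_p[of K i] by simp
    then have "(i + K) mod N = i mod N" using cyc_eq_iff[OF cp] by blast
    then have "N dvd K" by (simp only: add_mod_iff)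
    then show False using KN K0 by (simp add: nat_dvd_not_less)
  qed
  have c_hull: "\<exists>i i'. i mod K = j mod K \<and> i' mod K = j mod K \<and> p i < c j \<and> c j < p i'" for j
  proof (induction j)
    case 0 show ?case unfolding c0 by (rule exI[of _ a], rule exI[of _ b]) (use ab in simp)
  next
    case (Suc j)
    then obtain i i' where i: "i mod K = j mod K" "i' mod K = j mod K" "p i \<le> c j" "c j \<le> p i'" by (auto intro: less_imp_le)
    from hull_image[OF i] obtain d d' where d: "d mod K = Suc j mod K" "d' mod K = Suc j mod K" "p d \<le> c (Suc j)" "c (Suc j) \<le> p d'"
      unfolding Fc by blast
    moreover have "p d \<noteq> c (Suc j)" "p d' \<noteq> c (Suc j)" using cP[of "Suc j"] unfolding P_def by (metis rangeI)+
    ultimately show ?case by (metis order_le_less)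
  qed
  define u where "u j = left_nb P (c j)" for j
  define v where "v j = right_nb P (c j)" for j
  have gap: "adjacent P (u j) (v j)" "u j < c j" "c j < v j" for j
  proof -
    obtain i i' where "p i < c j" "c j < p i'" using c_hull[of j] by blast
    then show "adjacent P (u j) (v j)" "u j < c j" "c j < v j"
      using nb_gap[OF finP cP, of "p i" "p i'" j] unfolding u_def v_def by (auto simp: P_def less_imp_le)
  qed
  have uvP: "u j \<in> P" "v j \<in> P" for j using gap(1)[of j] by (auto simp: adjacent_def)
  have uv_per: "u (j + K) = u j" "v (j + K) = v j" for j by (simp_all add: u_def v_def c_per)
  have "\<exists>s. \<forall>x\<in>{u j..v j}. F x = F (u j) + s * (x - u j)" for j using dm gap(1)[of j] unfolding dots_map_def P_def by blast
  then obtain sl where sl: "\<And>j x. x \<in> {u j..v j} \<Longrightarrow> F x = F (u j) + sl j * (x - u j)" by metis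
  have slc: "F x - c (Suc j) = sl j * (x - c j)" if "u j \<le> x" "x \<le> v j" for j x
    using sl[of x j] sl[of "c j" j] gap(2,3)[of j] that Fc[of j] by (simp add: algebra_simps)
  have sl0: "sl j \<noteq> 0" for j
  proof
    assume "sl j = 0"
    then have "F (u j) = c (Suc j)" using slc[of j "u j"] gap[of j] by simp
    moreover obtain i where "u j = p i" using uvP(1)[of j] by (auto simp: P_def)
    ultimately show False using cP[of "Suc j"] Fp[of i] unfolding P_def by (metis rangeI)
  qed
  define sg where "sg j = (if F (u j) < F (v j) then 1 else -1 :: real)" for j
  have sg: "0 < sg j * sl j" for j
  proof -
    have "F (v j) - F (u j) = sl j * (v j - u j)" using sl[of "v j" j] gap(2,3)[of j] by simp
    moreover have "0 < v j - u j" using gap(2,3)[of j] by simp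
    ultimately have "F (u j) < F (v j) \<longleftrightarrow> 0 < sl j" by (metis diff_gt_0_iff_gt mult_pos_pos zero_less_mult_pos2)
    then show ?thesis using sl0[of j] by (auto simp: sg_def)
  qed
  have sg_per: "sg (j + K) = sg j" for j by (simp add: sg_def uv_per)
  define \<epsilon> where "\<epsilon> j = (\<Prod>i<j. sg i)" for j
  have eS: "\<epsilon> (Suc j) = \<epsilon> j * sg j" and e0: "\<epsilon> 0 = 1" for j by (simp_all add: \<epsilon>_def)
  have eps: "\<epsilon> j = 1 \<or> \<epsilon> j = -1" for j by (induction j) (auto simp: e0 eS sg_def)
  have eps_add: "\<epsilon> (j + K) = \<epsilon> j * \<epsilon> K" for j
    by (induction j) (simp_all add: e0 eS sg_per)
  have near: "0 < \<epsilon> (Suc j) * (F (c j + \<epsilon> j * r) - c (Suc j))"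
    if "0 < r" "u j \<le> c j + \<epsilon> j * r" "c j + \<epsilon> j * r \<le> v j" for j r
  proof -
    have "\<epsilon> (Suc j) * (F (c j + \<epsilon> j * r) - c (Suc j)) = (\<epsilon> j * \<epsilon> j) * (sg j * sl j) * r"
      unfolding slc[OF that(2,3)] eS by (simp add: algebra_simps)
    also have "\<epsilon> j * \<epsilon> j = 1" using eps[of j] by auto
    finally show ?thesis using sg[of j] that(1) by simp
  qed
  define \<rho> where "\<rho> j = (if \<epsilon> j = 1 then v j - c j else c j - u j)" for j
  have \<rho>0: "0 < \<rho> j" for j using gap(2,3)[of j] by (simp add: \<rho>_def)
  have \<rho>in: "u j \<le> c j + \<epsilon> j * r \<and> c j + \<epsilon> j * r \<le> v j" if "0 \<le> r" "r \<le> \<rho> j" for j r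
    using that gap(2,3)[of j] eps[of j] by (auto simp: \<rho>_def)
  have \<rho>P: "c j + \<epsilon> j * \<rho> j \<in> P" for j using uvP[of j] eps[of j] by (auto simp: \<rho>_def)
  have \<rho>min: "\<rho> j \<le> \<epsilon> j * (x - c j)" if "x \<in> P" "0 < \<epsilon> j * (x - c j)" for j x
  proof -
    have "\<not> (u j < x \<and> x < v j)" using gap(1)[of j] that(1) by (auto simp: adjacent_def)
    then show ?thesis using that(2) eps[of j] gap(2,3)[of j] by (auto simp: \<rho>_def)
  qed
  have pull: "\<exists>r. 0 < r \<and> r \<le> \<rho> j \<and> F (c j + \<epsilon> j * r) = c (Suc j) + \<epsilon> (Suc j) * r'" if r': "0 < r'" "r' \<le> \<rho> (Suc j)" for j r'
  proof -
    define h where "h r = \<epsilon> (Suc j) * (F (c j + \<epsilon> j * r) - c (Suc j))" for r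
    have hc: "continuous_on {0..\<rho> j} h" unfolding h_def
      by (intro continuous_intros continuous_on_compose2[OF F_cont[of UNIV]]) auto
    have h0: "h 0 = 0" by (simp add: h_def Fc)
    obtain i where "c j + \<epsilon> j * \<rho> j = p i" using \<rho>P[of j] by (auto simp: P_def)
    then have "F (c j + \<epsilon> j * \<rho> j) \<in> P" using Fp by (simp add: P_def)
    moreover have "0 < h (\<rho> j)" unfolding h_def by (rule near[OF \<rho>0]) (use \<rho>in[of "\<rho> j" j] \<rho>0[of j] in auto)
    ultimately have "\<rho> (Suc j) \<le> h (\<rho> j)" using \<rho>min unfolding h_def by blast
    then obtain r where r: "0 \<le> r" "r \<le> \<rho> j" "h r = r'" using IVT'[of h 0 r' "\<rho> j", OF _ _ _ hc] h0 r' \<rho>0[of j] by auto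
    have "r \<noteq> 0" using r h0 r' by auto
    moreover have "\<epsilon> (Suc j) * h r = F (c j + \<epsilon> j * r) - c (Suc j)" using eps[of "Suc j"] by (auto simp: h_def)
    then have "F (c j + \<epsilon> j * r) = c (Suc j) + \<epsilon> (Suc j) * r'" using r(3) by simp
    ultimately show ?thesis using r by (intro exI[of _ r]) auto
  qed
  have eK: "\<epsilon> K = -1"
  proof (rule ccontr)
    assume "\<epsilon> K \<noteq> -1"
    then have eK: "\<epsilon> K = 1" using eps by blast
    have "\<exists>r. 0 < r \<and> r \<le> \<rho> (K - j) \<and> (F ^^ j) (c (K - j) + \<epsilon> (K - j) * r) = c K + \<epsilon> K * \<rho> K" if "j \<le> K" for j
      using that
    proof (induction j)
      case 0 then show ?case using \<rho>0[of K] by auto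
    next
      case (Suc j)
      then obtain r' where r': "0 < r'" "r' \<le> \<rho> (K - j)" "(F ^^ j) (c (K - j) + \<epsilon> (K - j) * r') = c K + \<epsilon> K * \<rho> K" by auto
      have S: "K - j = Suc (K - Suc j)" using Suc.prems by simp
      obtain r where r: "0 < r" "r \<le> \<rho> (K - Suc j)" "F (c (K - Suc j) + \<epsilon> (K - Suc j) * r) = c (K - j) + \<epsilon> (K - j) * r'"
        using pull[of r' "K - Suc j"] r' unfolding S by blast
      have "(F ^^ Suc j) (c (K - Suc j) + \<epsilon> (K - Suc j) * r) = c K + \<epsilon> K * \<rho> K"
        unfolding funpow_Suc_right comp_apply r(3) by (rule r'(3))
      then show ?case using r by blast
    qed
    from this[of K] obtain r where r: "0 < r" "r \<le> \<rho> 0" "(F ^^ K) (c0 + r) = c K + \<rho> K" using eK e0 c0 by auto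
    have "c K = c0" "\<rho> K = \<rho> 0" using c_per[of 0] uv_per[of 0] eK e0 c0 by (simp_all add: \<rho>_def)
    then have "c0 + r \<le> (F ^^ K) (c0 + r)" using r by simp
    moreover have "c0 + r \<le> p b"
    proof -
      have "\<not> (u 0 < p b \<and> p b < v 0)" using gap(1)[of 0] by (auto simp: adjacent_def P_def)
      then have "v 0 \<le> p b" using gap(2)[of 0] ab(4) c0 by linarith
      then show ?thesis using r(2) e0 c0 by (simp add: \<rho>_def)
    qed
    ultimately show False using right[of "c0 + r"] r(1) by simp
  qed
  have "spiral F p N K c \<epsilon>"
  proof
    show "3 * K \<le> N" by (rule big)
    show "blk N p k \<Longrightarrow> K < k \<Longrightarrow> k = N" for k by (rule prime)
    show "c (j + K) = c j" "F (c j) = c (Suc j)" for j by (rule c_per, rule Fc)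
    show "\<exists>i i'. i mod K = j mod K \<and> i' mod K = j mod K \<and> p i < c j \<and> c j < p i'" for j by (rule c_hull)
    show "c j \<notin> range p" for j using cP by (simp add: P_def)
    show "\<epsilon> j = 1 \<or> \<epsilon> j = -1" "\<epsilon> (j + K) = - \<epsilon> j" for j using eps eps_add[of j] eK by simp_all
    fix j i r assume r: "0 < r" "r \<le> \<epsilon> j * (p i - c j)" and no: "\<And>s. 0 < s \<Longrightarrow> s < r \<Longrightarrow> c j + \<epsilon> j * s \<notin> range p"
    have "r \<le> \<rho> j"
    proof (rule ccontr)
      assume "\<not> ?thesis"
      then show False using no[of "\<rho> j"] \<rho>0[of j] \<rho>P[of j] by (simp add: P_def)
    qed
    then show "0 < \<epsilon> (Suc j) * (F (c j + \<epsilon> j * r) - c (Suc j))" using near[of r j] \<rho>in[of r j] r by simp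
  qed
  then show ?thesis by blast
qed

end

section \<open>The order of the periods\<close>

definition gg_index :: "nat \<Rightarrow> nat" where
  "gg_index n = (if odd n then 3 * (n div 2 - 1) + 2 else if n mod 4 = 0 then 3 * (n div 4 - 1) else 3 * (n div 4 - 1) + 1)"

lemma gg_seq_cases:
  "gg_seq (3 * a) = 4 * (a + 1)" "gg_seq (3 * a + 1) = 4 * (a + 1) + 2" "gg_seq (3 * a + 2) = 2 * (a + 1) + 1"
proof -
  have 3: "(3 * a) div 3 = a" "(3 * a) mod 3 = 0" "(3 * a + 1) div 3 = a" "(3 * a + 1) mod 3 = 1"
    "(3 * a + 2) div 3 = a" "(3 * a + 2) mod 3 = 2" by presburger+
  show "gg_seq (3 * a) = 4 * (a + 1)" "gg_seq (3 * a + 1) = 4 * (a + 1) + 2" "gg_seq (3 * a + 2) = 2 * (a + 1) + 1"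
    unfolding gg_seq_def 3 Let_def by simp_all
qed

lemma gg_seq_ge: "3 \<le> gg_seq i"
proof -
  define a where "a = i div 3"
  have "i = 3 * a \<or> i = 3 * a + 1 \<or> i = 3 * a + 2" unfolding a_def by presburger
  then show ?thesis using gg_seq_cases[of a] by auto
qed

lemma gg_index_seq: "gg_index (gg_seq i) = i"
proof -
  define a where "a = i div 3"
  have 4: "(4 * (a + 1)) mod 4 = 0" "(4 * (a + 1) + 2) mod 4 = 2" "(4 * (a + 1)) div 4 = a + 1" "(4 * (a + 1) + 2) div 4 = a + 1"
    "(2 * (a + 1) + 1) div 2 = a + 1" by presburger+
  have "gg_index (4 * (a + 1)) = 3 * a" "gg_index (4 * (a + 1) + 2) = 3 * a + 1" "gg_index (2 * (a + 1) + 1) = 3 * a + 2"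
    unfolding gg_index_def 4 by simp_all
  moreover have "i = 3 * a \<or> i = 3 * a + 1 \<or> i = 3 * a + 2" unfolding a_def by presburger
  ultimately show ?thesis using gg_seq_cases[of a] by auto
qed

lemma gg_seq_index: assumes "3 \<le> n" shows "gg_seq (gg_index n) = n"
proof -
  have "\<exists>a. n = 4 * (a + 1) \<or> n = 4 * (a + 1) + 2 \<or> n = 2 * (a + 1) + 1"
  proof (cases "odd n")
    case True
    then have "n = 2 * (n div 2) + 1" "1 \<le> n div 2" using assms by presburger+
    then show ?thesis by (intro exI[of _ "n div 2 - 1"]) simp
  next
    case False
    then have "n = 4 * (n div 4) \<or> n = 4 * (n div 4) + 2" "1 \<le> n div 4" using assms by presburger+
    then show ?thesis by (intro exI[of _ "n div 4 - 1"]) auto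
  qed
  then obtain a where "n = gg_seq (3 * a) \<or> n = gg_seq (3 * a + 1) \<or> n = gg_seq (3 * a + 2)" unfolding gg_seq_cases by blast
  then show ?thesis using gg_index_seq by auto
qed

lemma gg_iff: "k \<ggreater> l \<longleftrightarrow> 3 \<le> k \<and> (3 \<le> l \<and> gg_index k < gg_index l \<or> l = 2 \<or> l = 1) \<or> k = 2 \<and> l = 1"
  unfolding gg_def using gg_seq_ge gg_index_seq gg_seq_index by (metis insert_iff empty_iff)

lemma not_one_gg: "\<not> 1 \<ggreater> l"
  by (auto simp: gg_iff)

lemma gg_total: assumes "0 < k" "0 < l" "k \<noteq> l" shows "k \<ggreater> l \<or> l \<ggreater> k"
proof (cases "3 \<le> k \<and> 3 \<le> l")
  case True
  then have "gg_index k \<noteq> gg_index l" using gg_seq_index assms(3) by metis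
  then show ?thesis using True by (auto simp: gg_iff)
next
  case False
  have s: "n = 1 \<or> n = 2" if "0 < n" "\<not> 3 \<le> n" for n :: nat using that by linarith
  show ?thesis using False s[OF assms(1)] s[OF assms(2)] assms(3) by (auto simp: gg_iff)
qed

lemma gg_greatest:
  assumes "k0 \<in> S" "\<And>k. k \<in> S \<Longrightarrow> 0 < k"
  shows "\<exists>k\<in>S. \<forall>l\<in>S. l \<noteq> k \<longrightarrow> k \<ggreater> l"
proof (cases "\<exists>k\<in>S. 3 \<le> k")
  case True
  then obtain k where k: "k \<in> S" "3 \<le> k" "\<And>l. l \<in> S \<Longrightarrow> 3 \<le> l \<Longrightarrow> gg_index k \<le> gg_index l"
    using exists_least_iff[of "\<lambda>i. \<exists>k\<in>S. 3 \<le> k \<and> gg_index k = i"] by (metis not_less)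
  have "k \<ggreater> l" if l: "l \<in> S" "l \<noteq> k" for l
  proof (rule ccontr)
    assume "\<not> k \<ggreater> l"
    then have "l \<ggreater> k" using gg_total[of k l] assms(2)[OF l(1)] k(2) l(2) by simp
    then have "3 \<le> l \<and> gg_index l < gg_index k" using k(2) by (auto simp: gg_iff)
    then show False using k(3)[OF l(1)] by simp
  qed
  then show ?thesis using k(1) by blast
next
  case False
  then have s: "n = 1 \<or> n = 2" if "n \<in> S" for n using that assms(2)[OF that] by force
  show ?thesis
  proof (cases "2 \<in> S")
    case True then show ?thesis using s by (intro bexI[of _ 2]) (auto simp: gg_iff)
  next
    case False then show ?thesis using s assms(1) by (intro bexI[of _ 1]) auto
  qed
qed

section \<open>Forcing of towers\<close>

lemma prods_entry:
  assumes "\<forall>m\<in>set (\<tau> @ [n]). 1 < m" "k \<in> prods (\<tau> @ [n])"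
  shows "k \<in> prods \<tau> \<and> k dvd prod_list \<tau> \<or> k = prod_list \<tau> * n \<and> \<not> k dvd prod_list \<tau>"
proof -
  have pos: "1 \<le> prod_list \<tau>" using assms(1) by (intro prod_list_ge1) auto
  have "k \<in> prods \<tau> \<or> k = prod_list \<tau> \<or> k = prod_list \<tau> * n" using assms(2) by (auto simp: prods_append prods_Cons)
  then show ?thesis
  proof (elim disjE)
    assume k: "k = prod_list \<tau> * n"
    have "\<not> k \<le> prod_list \<tau>" using assms(1) pos by (simp add: k)
    then show ?thesis using k pos by (auto dest!: dvd_imp_le)
  qed (auto simp: prods_dvd prod_list_in_prods)
qed

text \<open>The additional last entry makes the cycle of the connect-the-dots map long enough to be
  carried over to \<open>f\<close>.\<close>

lemma realizes_smaller_entry: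
  assumes f: "continuous_on {a..b} f" and r: "realizes f {a..b} (\<tau> @ [n])" and gt: "\<forall>m\<in>set (\<tau> @ [n]). 1 < m"
    and nm: "n \<ggreater> m" "1 < m" and tail: "\<forall>m\<in>set tail. 1 < m"
  shows "realizes f {a..b} (\<tau> @ m # tail)"
proof -
  have n3: "3 \<le> n" using nm by (auto simp: gg_iff)
  obtain p N where p: "cyc N p" "\<And>i. f (p i) = p (Suc i)" "range p \<subseteq> {a..b}" and D: "{k. blk N p k} = prods (\<tau> @ [n])"
    using r unfolding realizes_def by blast
  define K where "K = prod_list \<tau>"
  have K1: "1 \<le> K" using gt unfolding K_def by (intro prod_list_ge1) auto
  have bk: "blk N p k \<longleftrightarrow> k \<in> prods (\<tau> @ [n])" for k using D by blast
  have N: "N = n * K"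
  proof (rule dvd_antisym)
    have "N dvd prod_list (\<tau> @ [n])" using blk_N[OF p(1)] bk prods_dvd by blast
    then show "N dvd n * K" by (simp add: K_def mult.commute)
    have "blk N p (prod_list (\<tau> @ [n]))" using bk prod_list_in_prods by blast
    then show "n * K dvd N" using blk_dvd_period[of N p] by (simp add: K_def mult.commute)
  qed
  have bK: "blk N p K" unfolding bk K_def prods_append using prod_list_in_prods by blast
  obtain F where F: "dots_map (range p) F" "\<forall>x\<in>range p. F x = f x"
    using dots_map_exists[OF cyc_finite[OF p(1)]] by blast
  have Fp: "F (p i) = p (Suc i)" for i using F(2) p(2) by simp
  have bc: "block_cycle F p N K" by (rule block_cycle.intro[OF p(1) Fp F(1) bK])
  have big: "3 * K \<le> N" unfolding N using n3 by simp
  have prime: "k = N" if "blk N p k" "K < k" for k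
  proof -
    have "k dvd K \<or> k = K * n" using prods_entry[OF gt] that(1) unfolding bk K_def by blast
    then show ?thesis using that(2) K1 N by (auto dest!: dvd_imp_le)
  qed
  obtain c \<epsilon> where sp: "spiral F p N K c \<epsilon>" using block_cycle.centre_exists[OF bc big prime] by blast
  define l where "l = 3 + 2 * N"
  define ms where "ms = tail @ [l]"
  define q where "q = m * K * prod_list ms"
  have ms: "\<forall>m\<in>set ms. 1 < m" "ms \<noteq> []" "3 \<le> last ms" using tail by (auto simp: ms_def l_def)
  obtain Z where Z: "cyc q Z" "\<And>i. F (Z i) = Z (Suc i)" "\<And>i. \<exists>j l. p j \<le> Z i \<and> Z i \<le> p l"
    and DZ: "{k. blk q Z k} = {k. blk N p k \<and> k dvd K} \<union> (*) (m * K) ` prods ms"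
    using spiral.forced_period[OF sp N nm ms] unfolding spiral.forced_def[OF sp] q_def by blast
  have "1 * (1 * (1 * l)) \<le> m * (K * (prod_list tail * l))"
    using nm(2) K1 prod_list_ge1[OF tail] by (intro mult_le_mono) auto
  moreover have "q = m * (K * (prod_list tail * l))" by (simp add: q_def ms_def mult.assoc)
  ultimately have "l \<le> q" by (simp only: mult_1)
  then have "2 * N \<le> q" by (simp add: l_def)
  then obtain z where z: "cyc q z" "\<And>i. f (z i) = z (Suc i)" "range z \<subseteq> {a..b}" "\<And>i j. Z i < Z j \<longleftrightarrow> z i < z j"
    using dots_cycle_transfer[OF f p F(1) Fp Z] by blast
  have "{k. blk q z k} = {k. blk q Z k}" unfolding blk_def z(4) ..
  also have "\<dots> = prods ((\<tau> @ m # tail) @ [l])"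
  proof -
    have "{k. blk N p k \<and> k dvd K} = prods \<tau>"
    proof -
      have "blk N p k \<and> k dvd K \<longleftrightarrow> k \<in> prods \<tau>" for k
        using prods_entry[OF gt, of k] prods_dvd[of k \<tau>] unfolding bk K_def prods_append by blast
      then show ?thesis by blast
    qed
    moreover have "(\<tau> @ m # tail) @ [l] = \<tau> @ (m # ms)" by (simp add: ms_def)
    moreover have "K \<in> prods \<tau>" unfolding K_def by (rule prod_list_in_prods)
    moreover have "prods (\<tau> @ (m # ms)) = prods \<tau> \<union> (*) K ` insert 1 ((*) m ` prods ms)"
      by (simp only: prods_append prods_Cons K_def)
    moreover have "(*) K ` insert 1 ((*) m ` prods ms) = insert K ((*) (m * K) ` prods ms)"
      by (simp add: image_image mult.assoc mult.left_commute)
    ultimately show ?thesis unfolding DZ by auto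
  qed
  finally have "realizes f {a..b} ((\<tau> @ m # tail) @ [l])" unfolding realizes_def using z by blast
  then show ?thesis by (rule realizes_prefix[OF f]) (use gt nm tail in \<open>auto simp: l_def\<close>)
qed

lemma canonical_extension_gt1: "finite_tower M \<Longrightarrow> 1 < canonical_extension M i \<longleftrightarrow> i < length M"
  by (auto simp: canonical_extension_def finite_tower_def)

lemma canonical_extension_pos: "finite_tower M \<or> M = [] \<Longrightarrow> 0 < canonical_extension M i"
  using canonical_extension_gt1[of M i] by (cases "i < length M") (auto simp: canonical_extension_def)

text \<open>At the first difference the entry of the larger tower is replaced, and what follows it is arbitrary.\<close>

theorem realizes_forced:
  assumes f: "continuous_on {a..b} f" and N: "finite_tower \<N>" and M: "finite_tower \<M>" and NM: "\<N> \<ggreater>\<^sub>f \<M>"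
    and r: "realizes f {a..b} \<N>"
  shows "realizes f {a..b} \<M>"
proof -
  obtain i where i: "\<And>j. j < i \<Longrightarrow> canonical_extension \<N> j = canonical_extension \<M> j"
    "canonical_extension \<N> i \<ggreater> canonical_extension \<M> i"
    using NM unfolding gg_fin_def gg_inf_def by blast
  have "canonical_extension \<N> i \<noteq> 1" using i(2) not_one_gg by metis
  then have iN: "i < length \<N>" by (simp add: canonical_extension_def split: if_splits)
  have iM: "i \<le> length \<M>"
  proof (rule ccontr)
    assume "\<not> ?thesis"
    then have "canonical_extension \<N> (length \<M>) = canonical_extension \<M> (length \<M>)" "length \<M> < length \<N>" using i(1) iN by auto
    then show False using canonical_extension_gt1[OF N, of "length \<M>"] canonical_extension_gt1[OF M, of "length \<M>"] by simp
  qed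
  have tk: "take i \<N> = take i \<M>"
  proof (rule nth_equalityI)
    show "length (take i \<N>) = length (take i \<M>)" using iN iM by simp
    fix j assume "j < length (take i \<N>)"
    then show "take i \<N> ! j = take i \<M> ! j" using i(1)[of j] iN iM by (simp add: canonical_extension_def)
  qed
  have gN: "\<forall>m\<in>set \<N>. 1 < m" and gM: "\<forall>m\<in>set \<M>. 1 < m" "\<M> \<noteq> []" using N M by (auto simp: finite_tower_def)
  show ?thesis
  proof (cases "i < length \<M>")
    case True
    have sp: "\<N> = (take i \<N> @ [\<N> ! i]) @ drop (Suc i) \<N>" using iN by (simp add: id_take_nth_drop)
    have r': "realizes f {a..b} (take i \<N> @ [\<N> ! i])"
      by (rule realizes_prefix[OF f, of _ "drop (Suc i) \<N>"]) (use r gN sp in \<open>simp_all flip: sp\<close>)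
    have "realizes f {a..b} (take i \<N> @ \<M> ! i # drop (Suc i) \<M>)"
    proof (rule realizes_smaller_entry[OF f r'])
      show "\<forall>m\<in>set (take i \<N> @ [\<N> ! i]). 1 < m" using gN iN by (auto dest: in_set_takeD)
      show "\<N> ! i \<ggreater> \<M> ! i" using i(2) iN True by (simp add: canonical_extension_def)
      show "1 < \<M> ! i" using gM True by simp
      show "\<forall>m\<in>set (drop (Suc i) \<M>). 1 < m" using gM by (auto dest: in_set_dropD)
    qed
    then show ?thesis using True by (simp add: tk id_take_nth_drop[symmetric])
  next
    case False
    then have "\<M> = take i \<N>" using iM tk by simp
    moreover have "realizes f {a..b} (take i \<N>)"
      by (rule realizes_prefix[OF f, of _ "drop i \<N>"]) (use r gN in simp_all)
    ultimately show ?thesis by simp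
  qed
qed

section \<open>Initial segments of the order of towers\<close>

text \<open>The supremum of a set of towers is found one entry at a time, since every set of positive
  integers has a greatest element with respect to \<open>\<ggreater>\<close>.\<close>

lemma closed_set_is_Tow:
  assumes S: "\<And>M. M \<in> S \<Longrightarrow> finite_tower M"
    and down: "\<And>\<N> \<M>. \<N> \<in> S \<Longrightarrow> finite_tower \<M> \<Longrightarrow> \<N> \<ggreater>\<^sub>f \<M> \<Longrightarrow> \<M> \<in> S"
  shows "\<exists>\<K>. infinite_tower \<K> \<and> S = Tow \<K>"
proof -
  let ?e = canonical_extension
  define A where "A l = {M \<in> insert [] S. \<forall>j<length l. ?e M j = l ! j}" for l
  define mx where "mx l = (SOME k. k \<in> (\<lambda>M. ?e M (length l)) ` A l \<and> (\<forall>M\<in>A l. ?e M (length l) \<noteq> k \<longrightarrow> k \<ggreater> ?e M (length l)))" for l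
  define pre where "pre i = rec_nat [] (\<lambda>_ l. l @ [mx l]) i" for i
  have pre: "pre 0 = []" "pre (Suc i) = pre i @ [mx (pre i)]" for i by (simp_all add: pre_def)
  have len: "length (pre i) = i" for i by (induction i) (simp_all add: pre)
  define \<K> where "\<K> i = mx (pre i)" for i
  have nth: "pre i ! j = \<K> j" if "j < i" for i j
    using that by (induction i) (auto simp: pre nth_append len \<K>_def less_Suc_eq)
  have A: "M \<in> A (pre i) \<longleftrightarrow> M \<in> insert [] S \<and> (\<forall>j<i. ?e M j = \<K> j)" for M i
    by (simp add: A_def len nth)
  have mx: "(\<exists>M\<in>A l. mx l = ?e M (length l)) \<and> (\<forall>M\<in>A l. ?e M (length l) \<noteq> mx l \<longrightarrow> mx l \<ggreater> ?e M (length l))" if ne: "A l \<noteq> {}" for l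
  proof -
    obtain M0 where M0: "M0 \<in> A l" using ne by blast
    have "0 < k" if "k \<in> (\<lambda>M. ?e M (length l)) ` A l" for k
      using that S canonical_extension_pos by (auto simp: A_def)
    then have "\<exists>k\<in>(\<lambda>M. ?e M (length l)) ` A l. \<forall>l'\<in>(\<lambda>M. ?e M (length l)) ` A l. l' \<noteq> k \<longrightarrow> k \<ggreater> l'"
      by (rule gg_greatest[OF imageI[OF M0]])
    then obtain k where "k \<in> (\<lambda>M. ?e M (length l)) ` A l \<and> (\<forall>M\<in>A l. ?e M (length l) \<noteq> k \<longrightarrow> k \<ggreater> ?e M (length l))" by auto
    then have "mx l \<in> (\<lambda>M. ?e M (length l)) ` A l \<and> (\<forall>M\<in>A l. ?e M (length l) \<noteq> mx l \<longrightarrow> mx l \<ggreater> ?e M (length l))"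
      unfolding mx_def by (rule someI)
    then show ?thesis by blast
  qed
  have ne: "\<exists>M. M \<in> insert [] S \<and> (\<forall>j<i. ?e M j = \<K> j)" for i
  proof (induction i)
    case 0 then show ?case by blast
  next
    case (Suc i)
    then have "A (pre i) \<noteq> {}" using A by blast
    then obtain M where "M \<in> A (pre i)" "\<K> i = ?e M i" using mx[of "pre i"] len by (auto simp: \<K>_def)
    then show ?case using A by (auto simp: less_Suc_eq)
  qed
  have max: "\<K> i \<ggreater> ?e M i" if "M \<in> S" "\<forall>j<i. ?e M j = \<K> j" "?e M i \<noteq> \<K> i" for M i
  proof -
    have "M \<in> A (pre i)" using A that by blast
    then show ?thesis using mx[of "pre i"] that(3) len unfolding \<K>_def by fastforce
  qed
  have ft: "finite_tower M \<or> M = []" if "M \<in> insert [] S" for M using that S by blast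
  have pos: "0 < \<K> i" for i using ne[of "Suc i"] ft canonical_extension_pos by (metis lessI)
  have one: "\<K> i' = 1" if "\<K> i = 1" "i \<le> i'" for i i'
  proof -
    obtain M where M: "M \<in> insert [] S" "\<And>j. j < Suc i' \<Longrightarrow> ?e M j = \<K> j" using ne by blast
    then have "\<not> i < length M" using ft[OF M(1)] canonical_extension_gt1[of M i] M(2)[of i] that by auto
    then show ?thesis using M(2)[of i'] that(2) by (simp add: canonical_extension_def)
  qed
  have "infinite_tower \<K>"
  proof (cases "\<exists>i. \<K> i = 1")
    case True
    then have "\<K> (LEAST i. \<K> i = 1) = 1" by (rule LeastI_ex)
    moreover have "1 < \<K> i" if "i < (LEAST i. \<K> i = 1)" for i using not_less_Least[OF that] pos[of i] by linarith
    ultimately show ?thesis unfolding infinite_tower_def using one by blast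
  next
    case False
    then have "1 < \<K> i" for i using pos[of i] by (metis less_one linorder_neqE_nat not_less_zero neq0_conv)
    then show ?thesis unfolding infinite_tower_def by blast
  qed
  moreover have "S = Tow \<K>"
  proof
    show "S \<subseteq> Tow \<K>"
    proof
      fix M assume M: "M \<in> S"
      show "M \<in> Tow \<K>"
      proof (cases "\<K> = ?e M")
        case True then show ?thesis using S[OF M] by (simp add: Tow_def)
      next
        case False
        then have ex: "\<exists>i. \<K> i \<noteq> ?e M i" by auto
        define i where "i = (LEAST i. \<K> i \<noteq> ?e M i)"
        have i: "\<K> i \<noteq> ?e M i" unfolding i_def by (rule LeastI_ex[OF ex])
        have less: "\<K> j = ?e M j" if "j < i" for j using not_less_Least that unfolding i_def by blast
        have "\<K> i \<ggreater> ?e M i" by (rule max[OF M]) (use i less in auto)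
        then have "\<K> \<ggreater>\<^sub>\<omega> ?e M" unfolding gg_inf_def using i less by blast
        then show ?thesis using S[OF M] by (simp add: Tow_def)
      qed
    qed
    show "Tow \<K> \<subseteq> S"
    proof
      fix M assume "M \<in> Tow \<K>"
      then have fM: "finite_tower M" and "\<K> \<ggreater>\<^sub>\<omega> ?e M \<or> \<K> = ?e M" by (auto simp: Tow_def)
      then show "M \<in> S"
      proof (elim disjE)
        assume "\<K> \<ggreater>\<^sub>\<omega> ?e M"
        then obtain i where i: "\<forall>j<i. \<K> j = ?e M j" "\<K> i \<ggreater> ?e M i" "\<K> i \<noteq> ?e M i" unfolding gg_inf_def by blast
        obtain M' where M': "M' \<in> insert [] S" "\<And>j. j < Suc i \<Longrightarrow> ?e M' j = \<K> j" using ne by blast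
        have "?e M' i \<noteq> 1" using M'(2)[of i] i(2) not_one_gg by (metis lessI)
        then have "M' \<noteq> []" by (auto simp: canonical_extension_def)
        then have "M' \<in> S" using M' by blast
        moreover have "M' \<ggreater>\<^sub>f M" unfolding gg_fin_def gg_inf_def using i M'(2) by (intro exI[of _ i]) auto
        ultimately show ?thesis using down fM by blast
      next
        assume K: "\<K> = ?e M"
        obtain M' where M': "M' \<in> insert [] S" "\<And>j. j < Suc (length M) \<Longrightarrow> ?e M' j = ?e M j" using ne K by blast
        have M0: "0 < length M" using fM by (simp add: finite_tower_def)
        have "M' \<noteq> []"
        proof
          assume "M' = []"
          then have "?e M 0 = 1" using M'(2)[of 0] by (simp add: canonical_extension_def)
          then show False using canonical_extension_gt1[OF fM, of 0] M0 by simp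
        qed
        then have MS: "M' \<in> S" using M' by blast
        note f' = S[OF this]
        have lt: "j < length M' \<longleftrightarrow> j < length M" if "j \<le> length M" for j
          using canonical_extension_gt1[OF f', of j] canonical_extension_gt1[OF fM, of j] M'(2)[of j] that by simp
        have "\<not> length M < length M'" using lt[of "length M"] by simp
        moreover have "\<not> length M' < length M" using lt[of "length M'"] by force
        ultimately have "length M' = length M" by simp
        moreover have "M' ! j = M ! j" if "j < length M'" for j
          using M'(2)[of j] that \<open>length M' = length M\<close> by (simp add: canonical_extension_def)
        ultimately have "M' = M" by (rule nth_equalityI)
        then show ?thesis using MS by simp
      qed
    qed
  qed
  ultimately show ?thesis by blast
qed

section \<open>Truncated tent maps\<close>

definition tent :: "real \<Rightarrow> real" where "tent x = min (2 * x) (2 - 2 * x)"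
definition cut :: "real \<Rightarrow> real \<Rightarrow> real" where "cut h x = min (tent x) h"

definition tent_cycle :: "nat list \<Rightarrow> (nat \<Rightarrow> real) \<Rightarrow> bool" where
  "tent_cycle M x \<longleftrightarrow> cyc (prod_list M) x \<and> (\<forall>i. tent (x i) = x (Suc i)) \<and> range x \<subseteq> {0..1} \<and>
     {k. blk (prod_list M) x k} = prods M \<and> (\<forall>i. x i \<le> x 0)"

lemma tent_cont: "continuous_on S tent" and cut_cont: "continuous_on S (cut h)"
  unfolding tent_def cut_def by (auto intro!: continuous_intros)

lemma cut_range: "0 \<le> h \<Longrightarrow> h \<le> 1 \<Longrightarrow> cut h ` {0..1} \<subseteq> {0..1}"
  by (auto simp: cut_def tent_def min_def)

lemma tent_cycleD:
  assumes "tent_cycle M x"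
  shows "cyc (prod_list M) x" "tent (x i) = x (Suc i)" "0 \<le> x i" "x i \<le> 1" "{k. blk (prod_list M) x k} = prods M" "x i \<le> x 0"
  using assms unfolding tent_cycle_def by (auto simp: image_subset_iff)

lemma realizes_period:
  assumes "cyc N x" "{k. blk N x k} = prods M" shows "N = prod_list M"
proof (rule dvd_antisym)
  show "N dvd prod_list M" using blk_N[OF assms(1)] assms(2) prods_dvd by blast
  show "prod_list M dvd N" using prod_list_in_prods[of M] assms(2) blk_dvd_period by blast
qed

lemma tent_cycle_shift:
  assumes c: "cyc N y" "\<And>i. tent (y i) = y (Suc i)" "range y \<subseteq> {0..1}" "{k. blk N y k} = prods M"
  obtains s where "tent_cycle M (\<lambda>i. y (i + s))"
proof -
  have N: "N = prod_list M" by (rule realizes_period[OF c(1,4)])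
  have fin: "finite (range y)" "range y \<noteq> {}" using cyc_finite[OF c(1)] by auto
  obtain s where s: "y s = Max (range y)" using Max_in[OF fin] by (metis rangeE)
  then have le: "y i \<le> y s" for i using Max_ge[OF fin(1), of "y i"] by simp
  have b: "blk N (\<lambda>i. y (i + s)) k = blk N y k" for k by (rule blk_shift[of y N s k, OF cyc_periodic[OF c(1)] cyc_pos[OF c(1)]])
  have r: "range (\<lambda>i. y (i + s)) \<subseteq> {0..1}" using c(3) by auto
  have "tent_cycle M (\<lambda>i. y (i + s))"
    unfolding tent_cycle_def N[symmetric] b using cyc_shift[OF c(1)] c(2,4) r le by simp
  then show ?thesis by (rule that)
qed

lemma tent_cycle_exists: assumes "finite_tower M" shows "\<exists>x. tent_cycle M x"
proof -
  define A B where "A = (\<lambda>x::real. x / 2)" and "B = (\<lambda>x::real. 1 - x / 2)"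
  have bp: "branch_pair A B 0 1" unfolding branch_pair_def A_def B_def by auto
  have gt: "\<forall>m\<in>set (M @ [3]). 1 < m" using assms by (auto simp: finite_tower_def)
  obtain z C where z: "\<forall>i. (C i = A \<or> C i = B) \<and> z i \<in> {0..1} \<and> z i = C i (z (Suc i)) \<and> C (i + prod_list (M @ [3])) = C i"
    "cyc (prod_list (M @ [3])) z" "{k. blk (prod_list (M @ [3])) z k} = prods (M @ [3])"
    using branch_pair_cycle[OF bp gt] by auto
  have T: "tent (A u) = u" "tent (B u) = u" if "u \<in> {0..1}" for u using that by (auto simp: tent_def A_def B_def)
  have Tz: "tent (z i) = z (Suc i)" for i
  proof -
    have u: "z (Suc i) \<in> {0..1}" using z(1) by blast
    have "z i = A (z (Suc i)) \<or> z i = B (z (Suc i))" using z(1) by metis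
    then show ?thesis using T[OF u] by auto
  qed
  have rz: "range z \<subseteq> {0..1}" using z(1) by blast
  have "realizes tent {0..1} (M @ [3])" unfolding realizes_def using z(2,3) Tz rz by blast
  from realizes_prefix[OF tent_cont this gt] obtain y N where y: "cyc N y" "\<And>i. tent (y i) = y (Suc i)" "range y \<subseteq> {0..1}"
    "{k. blk N y k} = prods M" unfolding realizes_def by blast
  then show ?thesis using tent_cycle_shift[OF y] by blast
qed

text \<open>Two points of period \<open>q\<close> with the same itinerary coincide, because the tent map doubles
  distances on either side of \<open>1 / 2\<close>.  So there are finitely many cycles for each tower.\<close>

lemma tent_double: "(u \<le> 1 / 2 \<longleftrightarrow> v \<le> 1 / 2) \<Longrightarrow> \<bar>tent u - tent v\<bar> = 2 * \<bar>u - v\<bar>"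
  by (auto simp: tent_def min_def abs_if)

lemma lowest_tent_cycle:
  assumes "finite_tower M" shows "\<exists>x. tent_cycle M x \<and> (\<forall>z. tent_cycle M z \<longrightarrow> x 0 \<le> z 0)"
proof -
  define q where "q = prod_list M"
  define H where "H = {x 0 | x. tent_cycle M x}"
  define \<phi> where "\<phi> h = {i. i < q \<and> (tent ^^ i) h \<le> 1 / 2}" for h
  have it: "(tent ^^ i) (x 0) = x i" if "tent_cycle M x" for x i
    by (induction i) (simp_all add: tent_cycleD(2)[OF that])
  have "inj_on \<phi> H"
  proof (rule inj_onI)
    fix a b assume "a \<in> H" "b \<in> H" and eq: "\<phi> a = \<phi> b"
    then obtain x y where x: "tent_cycle M x" "a = x 0" and y: "tent_cycle M y" "b = y 0" unfolding H_def by blast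
    have same: "x i \<le> 1 / 2 \<longleftrightarrow> y i \<le> 1 / 2" if "i < q" for i
    proof -
      have "i \<in> \<phi> a \<longleftrightarrow> x i \<le> 1 / 2" "i \<in> \<phi> b \<longleftrightarrow> y i \<le> 1 / 2"
        using that unfolding \<phi>_def x(2) y(2) mem_Collect_eq it[OF x(1)] it[OF y(1)] by blast+
      then show ?thesis using eq by simp
    qed
    have "\<bar>x i - y i\<bar> = 2 ^ i * \<bar>x 0 - y 0\<bar>" if "i \<le> q" for i
      using that
    proof (induction i)
      case (Suc i)
      have "\<bar>tent (x i) - tent (y i)\<bar> = 2 * \<bar>x i - y i\<bar>" by (rule tent_double) (use same Suc.prems in simp)
      then show ?case using Suc unfolding tent_cycleD(2)[OF x(1)] tent_cycleD(2)[OF y(1)] by simp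
    qed simp
    from this[of q] have "\<bar>x q - y q\<bar> = 2 ^ q * \<bar>x 0 - y 0\<bar>" by simp
    moreover have "x q = x 0" "y q = y 0"
      using cyc_periodic[OF tent_cycleD(1)[OF x(1)], of 0] cyc_periodic[OF tent_cycleD(1)[OF y(1)], of 0] by (simp_all add: q_def)
    ultimately have *: "\<bar>x 0 - y 0\<bar> = 2 ^ q * \<bar>x 0 - y 0\<bar>" by simp
    have "0 < q" unfolding q_def by (rule cyc_pos[OF tent_cycleD(1)[OF x(1)]])
    then have "1 < (2::real) ^ q" by (intro one_less_power) simp_all
    then have "(2::real) ^ q \<noteq> 1" by simp
    then have "\<bar>x 0 - y 0\<bar> = 0" using * by (metis mult_cancel_right1)
    then show "a = b" using x y by simp
  qed
  moreover have "\<phi> ` H \<subseteq> Pow {..<q}" by (auto simp: \<phi>_def)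
  then have "finite (\<phi> ` H)" by (rule finite_subset) simp
  ultimately have fin: "finite H" by (metis finite_imageD)
  have "H \<noteq> {}" using tent_cycle_exists[OF assms] by (auto simp: H_def)
  then have "Min H \<in> H" using fin by simp
  then obtain x where x: "tent_cycle M x" "Min H = x 0" unfolding H_def by blast
  have "x 0 \<le> z 0" if "tent_cycle M z" for z
  proof -
    have "z 0 \<in> H" using that by (auto simp: H_def)
    then show ?thesis using Min_le[OF fin] x(2) by simp
  qed
  then show ?thesis using x(1) by blast
qed

lemma cut_cycle_below:
  assumes c: "cyc N y" and y: "\<And>i. cut h (y i) = y (Suc i)" and h: "h \<notin> range y"
  shows "tent (y i) = y (Suc i)" "y i < h"
proof -
  have lt: "y (Suc i) < h \<and> tent (y i) = y (Suc i)" for i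
  proof -
    have "y (Suc i) \<noteq> h" using h by blast
    then show ?thesis using y[of i] by (auto simp: cut_def min_def split: if_splits)
  qed
  show "tent (y i) = y (Suc i)" using lt by blast
  have "y i = y (Suc (i + N - 1))" using cyc_periodic[OF c, of i] cyc_pos[OF c] by simp
  then show "y i < h" using lt by simp
qed

lemma cut_cycle_not_top:
  assumes "cyc N y" "\<And>i. cut h (y i) = y (Suc i)" "range y \<subseteq> {0..1}" "{k. blk N y k} = prods M" "h \<notin> range y"
  shows "\<exists>z. tent_cycle M z \<and> z 0 < h"
proof -
  note b = cut_cycle_below[OF assms(1,2,5)]
  obtain s where "tent_cycle M (\<lambda>i. y (i + s))" using tent_cycle_shift[OF assms(1) b(1) assms(3,4)] by blast
  then show ?thesis using b(2)[of "0 + s"] by blast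
qed

lemma cut_realizes:
  assumes x: "tent_cycle M x" and h: "x 0 \<le> h" shows "realizes (cut h) {0..1} M"
proof -
  have "cut h (x i) = x (Suc i)" for i
    using tent_cycleD(2)[OF x, of i] tent_cycleD(6)[OF x, of "Suc i"] h by (simp add: cut_def)
  moreover have "range x \<subseteq> {0..1}" using x unfolding tent_cycle_def by blast
  ultimately show ?thesis unfolding realizes_def using tent_cycleD(1,5)[OF x] by blast
qed

text \<open>The cycles of the map truncated at the maximum of a tent cycle are that cycle and the tent
  cycles below it, because a cycle that meets the plateau is the orbit of its value.\<close>

lemma cut_at_cycle:
  assumes x: "tent_cycle M x" and r: "realizes (cut (x 0)) {0..1} M'"
    and gt: "\<forall>m\<in>set M. 1 < m" "\<forall>m\<in>set M'. 1 < m"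
  shows "M' = M \<or> (\<exists>z. tent_cycle M' z \<and> z 0 < x 0)"
proof -
  obtain y N where y: "cyc N y" "\<And>i. cut (x 0) (y i) = y (Suc i)" "range y \<subseteq> {0..1}" "{k. blk N y k} = prods M'"
    using r unfolding realizes_def by blast
  show ?thesis
  proof (cases "x 0 \<in> range y")
    case False then show ?thesis using cut_cycle_not_top[OF y] by blast
  next
    case True
    then obtain s where s: "y s = x 0" by (metis rangeE)
    have cx: "cut (x 0) (x i) = x (Suc i)" for i
      using tent_cycleD(2)[OF x, of i] tent_cycleD(6)[OF x, of "Suc i"] by (simp add: cut_def)
    have eq: "y (i + s) = x i" for i
    proof (induction i)
      case (Suc i) then show ?case using y(2)[of "i + s"] cx[of i] by simp
    qed (simp add: s)
    let ?q = "prod_list M"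
    have cy: "cyc N x" using cyc_shift[OF y(1), of s] unfolding eq .
    have "{k. blk N x k} = prods M'"
      using y(4) blk_shift[of y N s, OF cyc_periodic[OF y(1)] cyc_pos[OF y(1)]] unfolding eq by simp
    moreover have "N = ?q" using cyc_card[OF cy] cyc_card[OF tent_cycleD(1)[OF x]] by simp
    ultimately have "prods M' = prods M" using tent_cycleD(5)[OF x] by simp
    then show ?thesis using prods_inj gt by blast
  qed
qed

lemma gg_fin_irrefl: "\<not> M \<ggreater>\<^sub>f M"
  by (simp add: gg_fin_def gg_inf_def)

lemma tent_cycle_forced:
  assumes x: "tent_cycle M x" and M: "finite_tower M" "finite_tower M'" "M \<ggreater>\<^sub>f M'"
  shows "\<exists>z. tent_cycle M' z \<and> z 0 < x 0"
proof -
  have "realizes (cut (x 0)) {0..1} M'"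
    by (rule realizes_forced[OF cut_cont M cut_realizes[OF x order_refl]])
  then show ?thesis using cut_at_cycle[OF x] M gg_fin_irrefl by (metis finite_tower_def)
qed

text \<open>A cycle of a truncated tent map through the value \<open>h\<close> of the plateau cannot be a limit of tent
  cycles with maxima below \<open>h\<close> and with arbitrarily fine block structures.  By continuity
  \<open>h\<close> would be a periodic point of the tent map itself, which is expanding along that orbit; so for
  points slightly below \<open>h\<close> the iterates at multiples of the period move away monotonically, whereas a
  block would have to come back between them.\<close>

lemma plateau_not_limit:
  assumes c: "cyc N y" and y: "\<And>i. cut h (y i) = y (Suc i)" and y0: "y 0 = h"
    and X: "\<And>j i. tent (X j i) = X j (Suc i)" "\<And>j i. X j i \<le> X j 0" "\<And>j. X j 0 < h" "(\<lambda>j. X j 0) \<longlonglongrightarrow> h"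
    and fine: "\<And>j. j0 \<le> j \<Longrightarrow> blk (P j) (X j) Q" "\<And>j. j0 \<le> j \<Longrightarrow> X j N \<noteq> X j 0" "N < Q"
  shows False
proof -
  have N0: "0 < N" by (rule cyc_pos[OF c])
  have yN: "y (i + N) = y i" for i by (rule cyc_periodic[OF c])
  have yaN: "y (i + a * N) = y i" for i a by (rule periodic_add_mult[of y N, OF yN])
  have Tc: "isCont tent u" for u using tent_cont[of UNIV] by (simp add: continuous_on_eq_continuous_at)
  have lim: "(\<lambda>j. X j i) \<longlonglongrightarrow> y i" for i
  proof (induction i)
    case 0 then show ?case using X(4) y0 by simp
  next
    case (Suc i)
    have "(\<lambda>j. min (tent (X j i)) (X j 0)) \<longlonglongrightarrow> min (tent (y i)) h"
      by (intro tendsto_min isCont_tendsto_compose[OF Tc] Suc X(4))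
    moreover have "min (tent (X j i)) (X j 0) = X j (Suc i)" for j using X(1)[of j i] X(2)[of j "Suc i"] by simp
    ultimately show ?case using y[of i] by (simp add: cut_def)
  qed
  have Ty: "tent (y i) = y (Suc i)" for i
  proof (rule LIMSEQ_unique)
    show "(\<lambda>j. tent (X j i)) \<longlonglongrightarrow> tent (y i)" by (rule isCont_tendsto_compose[OF Tc lim])
    show "(\<lambda>j. tent (X j i)) \<longlonglongrightarrow> y (Suc i)" unfolding X(1) by (rule lim)
  qed
  have half: "y i \<noteq> 1 / 2" for i
  proof
    assume a: "y i = 1 / 2"
    have z: "y (Suc (Suc i) + n) = 0" for n
    proof (induction n)
      case 0 show ?case using Ty[of i] Ty[of "Suc i"] a by (simp add: tent_def)
    next
      case (Suc n) then show ?case using Ty[of "Suc (Suc i) + n"] by (simp add: tent_def)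
    qed
    have "i + 2 * N = Suc (Suc i) + (2 * N - 2)" using N0 by simp
    then have "y (i + 2 * N) = 0" using z[of "2 * N - 2"] by (simp only:)
    then show False unfolding yaN a by simp
  qed
  define s :: "nat \<Rightarrow> real" where "s i = (if y i < 1 / 2 then 2 else -2)" for i
  have sN: "s (a * N + i) = s i" for a i using yaN[of i a] by (simp add: s_def add.commute)
  have ev: "eventually (\<lambda>j. X j (Suc i) - y (Suc i) = s i * (X j i - y i)) sequentially" for i
  proof (cases "y i < 1 / 2")
    case True
    have "eventually (\<lambda>j. X j i < 1 / 2) sequentially" by (rule order_tendstoD(2)[OF lim True])
    then show ?thesis
    proof (rule eventually_mono)
      fix j assume "X j i < 1 / 2"
      then show "X j (Suc i) - y (Suc i) = s i * (X j i - y i)"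
        using True X(1)[of j i] Ty[of i] by (simp add: tent_def s_def min_def split: if_splits)
    qed
  next
    case False
    then have g: "1 / 2 < y i" using half[of i] by simp
    have "eventually (\<lambda>j. 1 / 2 < X j i) sequentially" by (rule order_tendstoD(1)[OF lim g])
    then show ?thesis
    proof (rule eventually_mono)
      fix j assume "1 / 2 < X j i"
      then show "X j (Suc i) - y (Suc i) = s i * (X j i - y i)"
        using g X(1)[of j i] Ty[of i] by (simp add: tent_def s_def min_def split: if_splits)
    qed
  qed
  have "eventually (\<lambda>j. \<forall>i\<in>{..<Q * N}. X j (Suc i) - y (Suc i) = s i * (X j i - y i)) sequentially"
    by (rule eventually_ball_finite) (use ev in auto)
  moreover have "eventually (\<lambda>j. j0 \<le> j) sequentially" by (rule eventually_ge_at_top)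
  ultimately have "eventually (\<lambda>j. (\<forall>i\<in>{..<Q * N}. X j (Suc i) - y (Suc i) = s i * (X j i - y i)) \<and> j0 \<le> j) sequentially"
    by (rule eventually_conj)
  then obtain j where j: "\<forall>i\<in>{..<Q * N}. X j (Suc i) - y (Suc i) = s i * (X j i - y i)" "j0 \<le> j"
    using eventually_happens'[OF sequentially_bot] by blast
  define D where "D n = X j n - y n" for n
  have D: "D (Suc i) = s i * D i" if "i < Q * N" for i using j(1) that by (simp add: D_def)
  define co where "co = (\<Prod>i<N. s i)"
  have Da: "D (a * N + m) = (\<Prod>i<m. s i) * D (a * N)" if "m \<le> N" "a < Q" for a m
    using that(1)
  proof (induction m)
    case (Suc m)
    have "a * N + N \<le> Q * N" using that(2) by (metis Suc_leI add.commute mult_Suc mult_le_mono1)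
    then have "a * N + m < Q * N" using Suc.prems by simp
    then have "D (a * N + Suc m) = s m * D (a * N + m)" using D[of "a * N + m"] sN[of a m] by simp
    then show ?case using Suc by simp
  qed simp
  have pw: "D (a * N) = co ^ a * D 0" if "a \<le> Q" for a
    using that
  proof (induction a)
    case (Suc a)
    have "D (Suc a * N) = co * D (a * N)" using Da[of N a] Suc.prems by (simp add: co_def add.commute)
    then show ?case using Suc by simp
  qed simp
  have D0: "D 0 < 0" using X(3)[of j] by (simp add: D_def y0)
  have yh: "y (a * N) = h" for a using yaN[of 0 a] y0 by simp
  have XN: "X j N < X j 0" using X(2)[of j N] fine(2)[OF j(2)] by simp
  have D1: "D N = co * D 0" using pw[of 1] fine(3) by simp
  have "D N < D 0" using XN yh[of 1] y0 by (simp add: D_def)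
  then have "1 * - D 0 < co * - D 0" using D1 by simp
  then have co: "1 < co" using D0 by (simp only: mult_less_cancel_right_pos neg_0_less_iff_less)
  have "co ^ 1 < co ^ Q" by (rule power_strict_increasing) (use co fine(3) N0 in auto)
  then have "co ^ Q * D 0 < co * D 0" using D0 by (simp add: mult_less_cancel_right)
  then have "D (Q * N) < D N" using pw[of Q] D1 by simp
  then have "X j (Q * N) < X j N" using yh[of Q] yh[of 1] by (simp add: D_def)
  from blkD[OF fine(1)[OF j(2)] this XN] have "N mod Q = 0" by simp
  then show False using fine(3) N0 by simp
qed

section \<open>Maps with a prescribed set of towers\<close>

lemma first_difference:
  fixes u v :: "nat \<Rightarrow> 'a" assumes "u \<noteq> v" shows "\<exists>i. (\<forall>j<i. u j = v j) \<and> u i \<noteq> v i"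
proof -
  have "\<exists>i. u i \<noteq> v i" using assms by auto
  then show ?thesis using exists_least_iff[of "\<lambda>i. u i \<noteq> v i"] by blast
qed

lemma gg_inf_total:
  assumes "\<And>i. 0 < u i" "\<And>i. 0 < v i" "u \<noteq> v" shows "u \<ggreater>\<^sub>\<omega> v \<or> v \<ggreater>\<^sub>\<omega> u"
proof -
  obtain i where i: "\<forall>j<i. u j = v j" "u i \<noteq> v i" using first_difference[OF assms(3)] by blast
  have i': "\<forall>j<i. v j = u j" "v i \<noteq> u i" using i by auto
  show ?thesis using gg_total[OF assms(1,2) i(2)] unfolding gg_inf_def using i i' by blast
qed

lemma canonical_extension_inj:
  assumes "finite_tower M" "finite_tower M'" "canonical_extension M = canonical_extension M'" shows "M = M'"
proof (rule nth_equalityI)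
  have lt: "j < length M \<longleftrightarrow> j < length M'" for j
    using canonical_extension_gt1[OF assms(1), of j] canonical_extension_gt1[OF assms(2), of j] assms(3) by simp
  show len: "length M = length M'" using lt[of "length M"] lt[of "length M'"] by simp
  show "M ! i = M' ! i" if "i < length M" for i
    using fun_cong[OF assms(3), of i] that len by (simp add: canonical_extension_def)
qed

text \<open>A tower above the given one would force it strictly below the minimal height.\<close>

lemma cut_finite_tower:
  assumes N: "finite_tower \<N>"
  shows "\<exists>h. 0 \<le> h \<and> h \<le> 1 \<and> {M. finite_tower M \<and> realizes (cut h) {0..1} M} = Tow (canonical_extension \<N>)"
proof -
  obtain x where x: "tent_cycle \<N> x" "\<And>z. tent_cycle \<N> z \<Longrightarrow> x 0 \<le> z 0" using lowest_tent_cycle[OF N] by blast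
  have r: "realizes (cut (x 0)) {0..1} \<N>" by (rule cut_realizes[OF x(1) order_refl])
  have "finite_tower M \<and> realizes (cut (x 0)) {0..1} M \<longleftrightarrow> M \<in> Tow (canonical_extension \<N>)" for M
  proof
    assume M: "finite_tower M \<and> realizes (cut (x 0)) {0..1} M"
    then have M': "finite_tower M" by blast
    show "M \<in> Tow (canonical_extension \<N>)"
    proof (cases "M = \<N>")
      case True then show ?thesis using N by (simp add: Tow_def)
    next
      case False
      then obtain z where z: "tent_cycle M z" "z 0 < x 0"
        using cut_at_cycle[OF x(1)] M N by (metis finite_tower_def)
      have "\<not> M \<ggreater>\<^sub>f \<N>"
      proof
        assume "M \<ggreater>\<^sub>f \<N>"
        then obtain z' where "tent_cycle \<N> z'" "z' 0 < z 0" using tent_cycle_forced[OF z(1) M' N] by blast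
        then show False using x(2) z(2) by fastforce
      qed
      moreover have "canonical_extension M \<noteq> canonical_extension \<N>" using canonical_extension_inj M' N False by blast
      ultimately have "canonical_extension \<N> \<ggreater>\<^sub>\<omega> canonical_extension M"
        using gg_inf_total[of "canonical_extension M" "canonical_extension \<N>"] canonical_extension_pos M' N
        unfolding gg_fin_def by blast
      then show ?thesis using M' by (simp add: Tow_def)
    qed
  next
    assume "M \<in> Tow (canonical_extension \<N>)"
    then have M: "finite_tower M" and "\<N> \<ggreater>\<^sub>f M \<or> canonical_extension \<N> = canonical_extension M"
      by (auto simp: Tow_def gg_fin_def)
    then have "\<N> \<ggreater>\<^sub>f M \<or> \<N> = M" using canonical_extension_inj N by blast
    then show "finite_tower M \<and> realizes (cut (x 0)) {0..1} M"
      using realizes_forced[OF cut_cont N M _ r] M r by blast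
  qed
  then show ?thesis using tent_cycleD(3,4)[OF x(1), of 0] by blast
qed

lemma cut_zero: "{M. finite_tower M \<and> realizes (cut 0) {0..1} M} = {}"
proof -
  have False if M: "finite_tower M" "realizes (cut 0) {0..1} M" for M
  proof -
    obtain x N where x: "cyc N x" "\<And>i. cut 0 (x i) = x (Suc i)" "range x \<subseteq> {0..1}" "{k. blk N x k} = prods M"
      using M(2) unfolding realizes_def by blast
    have z: "x (Suc i) = 0" for i
    proof -
      have "0 \<le> x (Suc i)" using x(3) by (metis atLeastAtMost_iff rangeI subsetD)
      then show ?thesis using x(2)[of i] by (simp add: cut_def min_def split: if_splits)
    qed
    then have "1 mod N = 2 mod N" using cyc_eq_iff[OF x(1), of 1 2] z[of 0] z[of 1] by (simp add: numeral_2_eq_2)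
    then have "N dvd 1" using add_mod_iff[of 1 1 N] by (simp add: numeral_2_eq_2)
    moreover have "1 < prod_list M" using M(1) prod_list_gt1 by (simp add: finite_tower_def)
    ultimately show False using realizes_period[OF x(1,4)] by simp
  qed
  then show ?thesis by blast
qed

lemma length_less_prod_list: "\<forall>m\<in>set M. 1 < m \<Longrightarrow> length M < prod_list (M :: nat list)"
proof (induction M)
  case (Cons m M)
  then have "length M < prod_list M" "2 \<le> m" by auto
  then have "2 * prod_list M \<le> m * prod_list M" "length M < prod_list M" by (auto intro: mult_le_mono1)
  then have "Suc (length M) < m * prod_list M" by linarith
  then show ?case by simp
qed simp

text \<open>The heights of the initial segments increase to \<open>h\<close>.  A tower above \<open>\<K>\<close> is above all sufficiently long initial
  segments; if its cycle stays below \<open>h\<close>, then it forces one of them below its minimal height.\<close>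

lemma cut_infinite_tower:
  assumes K: "\<And>i. 1 < \<K> i"
  shows "\<exists>h. 0 \<le> h \<and> h \<le> 1 \<and> {M. finite_tower M \<and> realizes (cut h) {0..1} M} = Tow \<K>"
proof -
  define M where "M j = map \<K> [0..<Suc j]" for j
  have ft: "finite_tower (M j)" for j using K by (auto simp: M_def finite_tower_def)
  have ce: "canonical_extension (M j) i = (if i \<le> j then \<K> i else 1)" for i j
    by (auto simp: canonical_extension_def M_def nth_append less_Suc_eq_le simp del: upt_Suc)
  have "\<forall>j. \<exists>x. tent_cycle (M j) x \<and> (\<forall>z. tent_cycle (M j) z \<longrightarrow> x 0 \<le> z 0)" using lowest_tent_cycle[OF ft] by blast
  then obtain X where X: "\<And>j. tent_cycle (M j) (X j)" "\<And>j z. tent_cycle (M j) z \<Longrightarrow> X j 0 \<le> z 0" by metis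
  have step: "X j 0 < X (Suc j) 0" for j
  proof -
    have "1 < \<K> (Suc j)" by (rule K)
    then have "\<K> (Suc j) \<ggreater> 1" by (auto simp: gg_iff)
    then have "M (Suc j) \<ggreater>\<^sub>f M j" unfolding gg_fin_def gg_inf_def using K[of "Suc j"] by (intro exI[of _ "Suc j"]) (simp add: ce)
    then obtain z where "tent_cycle (M j) z" "z 0 < X (Suc j) 0" using tent_cycle_forced[OF X(1) ft ft] by blast
    then show ?thesis using X(2) by fastforce
  qed
  have bd: "X j 0 \<le> 1" "0 \<le> X j 0" for j using tent_cycleD(3,4)[OF X(1)] by auto
  have inc: "incseq (\<lambda>j. X j 0)" by (rule incseq_SucI) (use step in \<open>simp add: less_imp_le\<close>)
  obtain h where h: "(\<lambda>j. X j 0) \<longlonglongrightarrow> h" "\<And>j. X j 0 \<le> h" using incseq_convergent[OF inc, of 1] bd by blast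
  have lt: "X j 0 < h" for j using step[of j] h(2)[of "Suc j"] by simp
  have h01: "0 \<le> h" "h \<le> 1" using bd(2)[of 0] lt[of 0] LIMSEQ_le_const2[OF h(1), of 1] bd(1) by auto
  have Kpos: "0 < \<K> i" for i using K[of i] by simp
  have "finite_tower A \<and> realizes (cut h) {0..1} A \<longleftrightarrow> A \<in> Tow \<K>" for A
  proof
    assume "A \<in> Tow \<K>"
    then have fA: "finite_tower A" and "\<K> \<ggreater>\<^sub>\<omega> canonical_extension A \<or> \<K> = canonical_extension A" by (auto simp: Tow_def)
    moreover have "\<K> \<noteq> canonical_extension A"
    proof
      assume "\<K> = canonical_extension A"
      then have "1 < canonical_extension A (length A)" using K by metis
      then show False by (simp add: canonical_extension_def)
    qed
    ultimately obtain i where i: "\<forall>j<i. \<K> j = canonical_extension A j" "\<K> i \<noteq> canonical_extension A i" "\<K> i \<ggreater> canonical_extension A i"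
      unfolding gg_inf_def by blast
    have "M i \<ggreater>\<^sub>f A" unfolding gg_fin_def gg_inf_def using i by (intro exI[of _ i]) (simp add: ce)
    then have "realizes (cut h) {0..1} A"
      by (rule realizes_forced[OF cut_cont ft fA _ cut_realizes[OF X(1) h(2)]])
    then show "finite_tower A \<and> realizes (cut h) {0..1} A" using fA by blast
  next
    assume A: "finite_tower A \<and> realizes (cut h) {0..1} A"
    then have fA: "finite_tower A" by blast
    obtain y N where y: "cyc N y" "\<And>i. cut h (y i) = y (Suc i)" "range y \<subseteq> {0..1}" "{k. blk N y k} = prods A"
      using A unfolding realizes_def by blast
    have "\<K> \<ggreater>\<^sub>\<omega> canonical_extension A"
    proof (rule ccontr)
      assume n: "\<not> ?thesis"
      have ne: "canonical_extension A \<noteq> \<K>"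
      proof
        assume "canonical_extension A = \<K>"
        then have "1 < canonical_extension A (length A)" using K by metis
        then show False by (simp add: canonical_extension_def)
      qed
      then have "canonical_extension A \<ggreater>\<^sub>\<omega> \<K>"
        using gg_inf_total[of "canonical_extension A" \<K>, OF canonical_extension_pos Kpos ne] fA n by blast
      then obtain i where i: "\<forall>j<i. canonical_extension A j = \<K> j" "canonical_extension A i \<noteq> \<K> i" "canonical_extension A i \<ggreater> \<K> i"
        unfolding gg_inf_def by blast
      have AM: "A \<ggreater>\<^sub>f M j" if "i \<le> j" for j
        unfolding gg_fin_def gg_inf_def using i that by (intro exI[of _ i]) (simp add: ce)
      show False
      proof (cases "h \<in> range y")
        case False
        obtain z where z: "tent_cycle A z" "z 0 < h" using cut_cycle_not_top[OF y False] by blast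
        have "eventually (\<lambda>j. z 0 < X j 0) sequentially" by (rule order_tendstoD(1)[OF h(1) z(2)])
        then obtain j0 where j0: "\<And>j. j0 \<le> j \<Longrightarrow> z 0 < X j 0" unfolding eventually_sequentially by blast
        define j where "j = max i j0"
        have ij: "i \<le> j" "j0 \<le> j" by (simp_all add: j_def)
        obtain z' where "tent_cycle (M j) z'" "z' 0 < z 0" using tent_cycle_forced[OF z(1) fA ft AM[OF ij(1)]] by blast
        then show False using X(2)[of j z'] j0[OF ij(2)] by simp
      next
        case True
        then obtain s where s: "y s = h" by (metis rangeE)
        define y' where "y' = (\<lambda>i. y (i + s))"
        have y': "cyc N y'" "\<And>i. cut h (y' i) = y' (Suc i)" "y' 0 = h"
          using cyc_shift[OF y(1)] y(2) s by (simp_all add: y'_def)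
        define Q where "Q = prod_list (M N)"
        have NQ: "N < Q" using length_less_prod_list[of "M N"] ft[of N] unfolding Q_def finite_tower_def by (simp add: M_def)
        have big: "N < prod_list (M j)" if "N \<le> j" for j
          using length_less_prod_list[of "M j"] ft[of j] that unfolding finite_tower_def by (simp add: M_def)
        show False
        proof (rule plateau_not_limit[OF y', of X N "\<lambda>j. prod_list (M j)" Q])
          show "tent (X j i) = X j (Suc i)" "X j i \<le> X j 0" for j i using tent_cycleD(2,6)[OF X(1)] by auto
          show "X j 0 < h" for j by (rule lt)
          show "(\<lambda>j. X j 0) \<longlonglongrightarrow> h" by (rule h(1))
          show "N < Q" by (rule NQ)
          show "X j N \<noteq> X j 0" if "N \<le> j" for j
            using cyc_eq_iff[OF tent_cycleD(1)[OF X(1)], of j N 0] big[OF that] cyc_pos[OF y(1)] by simp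
          show "blk (prod_list (M j)) (X j) Q" if "N \<le> j" for j
          proof -
            have "[0..<Suc j] = [0..<Suc N] @ [Suc N..<Suc j]" using that upt_add_eq_append[of 0 "Suc N" "j - N"] by simp
            then have "M j = M N @ map \<K> [Suc N..<Suc j]" unfolding M_def by simp
            then have "Q \<in> prods (M j)" unfolding Q_def using prod_list_in_prods[of "M N"] by (simp add: prods_append)
            then show ?thesis using tent_cycleD(5)[OF X(1), of j] by blast
          qed
        qed
      qed
    qed
    then show "A \<in> Tow \<K>" using fA by (simp add: Tow_def)
  qed
  then show ?thesis using h01 by blast
qed

lemma infinite_tower_cases:
  assumes "infinite_tower \<K>"
  obtains (infinite) "\<And>i. 1 < \<K> i" | (finite) \<N> where "finite_tower \<N>" "\<K> = canonical_extension \<N>" | (trivial) "\<K> = (\<lambda>_. 1)"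
proof -
  consider "\<forall>i. 1 < \<K> i" | j where "\<forall>i<j. 1 < \<K> i" "\<forall>i\<ge>j. \<K> i = 1" using assms unfolding infinite_tower_def by blast
  then show ?thesis
  proof cases
    case 1 then show ?thesis using infinite by blast
  next
    case (2 j)
    show ?thesis
    proof (cases "j = 0")
      case True then show ?thesis using 2 trivial by auto
    next
      case False
      have "finite_tower (map \<K> [0..<j])" using 2 False by (auto simp: finite_tower_def)
      moreover have "\<K> = canonical_extension (map \<K> [0..<j])" using 2 by (auto simp: canonical_extension_def)
      ultimately show ?thesis by (rule finite)
    qed
  qed
qed

lemma cut_any_tower:
  assumes "infinite_tower \<K>"
  shows "\<exists>h. 0 \<le> h \<and> h \<le> 1 \<and> {M. finite_tower M \<and> realizes (cut h) {0..1} M} = Tow \<K>"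
  using assms
proof (cases rule: infinite_tower_cases)
  case infinite then show ?thesis by (rule cut_infinite_tower)
next
  case (finite \<N>) then show ?thesis using cut_finite_tower by simp
next
  case trivial
  have "\<not> (\<lambda>_. 1) \<ggreater>\<^sub>\<omega> u" for u using not_one_gg by (auto simp: gg_inf_def)
  moreover have "(\<lambda>_. 1) \<noteq> canonical_extension M" if M: "finite_tower M" for M
  proof
    assume "(\<lambda>_. 1) = canonical_extension M"
    then have "canonical_extension M 0 = 1" by metis
    then show False using canonical_extension_gt1[OF M, of 0] M by (simp add: finite_tower_def)
  qed
  ultimately have "Tow \<K> = {}" by (auto simp: Tow_def trivial)
  then show ?thesis using cut_zero by (intro exI[of _ 0]) simp
qed

theorem mainTheorem1:
  shows "(\<forall>(a::real) b f. a \<le> b \<and> continuous_on {a..b} f \<and> f ` {a..b} \<subseteq> {a..b} \<longrightarrow>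
            (\<forall>\<N> \<M>. finite_tower \<N> \<and> finite_tower \<M> \<and> \<N> \<ggreater>\<^sub>f \<M>
                 \<and> \<N> \<in> towers_of_cycles a b f \<longrightarrow> \<M> \<in> towers_of_cycles a b f)
          \<and> (\<exists>\<K>. infinite_tower \<K> \<and> towers_of_cycles a b f = Tow \<K>))
       \<and> (\<forall>\<K>. infinite_tower \<K> \<longrightarrow>
            (\<exists>(a::real) b g. a < b \<and> continuous_on {a..b} g \<and> g ` {a..b} \<subseteq> {a..b}
                 \<and> towers_of_cycles a b g = Tow \<K>))"
proof (intro conjI allI impI)
  fix a b :: real and f assume "a \<le> b \<and> continuous_on {a..b} f \<and> f ` {a..b} \<subseteq> {a..b}"
  then have f: "continuous_on {a..b} f" by blast
  have down: "\<M> \<in> towers_of_cycles a b f" if "finite_tower \<M>" "\<N> \<ggreater>\<^sub>f \<M>" "\<N> \<in> towers_of_cycles a b f" for \<N> \<M>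
    using realizes_forced[OF f _ that(1,2)] that unfolding towers_of_cycles_eq by blast
  then show "\<M> \<in> towers_of_cycles a b f"
    if "finite_tower \<N> \<and> finite_tower \<M> \<and> \<N> \<ggreater>\<^sub>f \<M> \<and> \<N> \<in> towers_of_cycles a b f" for \<N> \<M>
    using that by blast
  show "\<exists>\<K>. infinite_tower \<K> \<and> towers_of_cycles a b f = Tow \<K>"
    by (rule closed_set_is_Tow) (use down towers_of_cycles_eq in blast)+
next
  fix \<K> assume "infinite_tower \<K>"
  then obtain h where h: "0 \<le> h" "h \<le> 1" "{M. finite_tower M \<and> realizes (cut h) {0..1} M} = Tow \<K>" using cut_any_tower by blast
  show "\<exists>(a::real) b g. a < b \<and> continuous_on {a..b} g \<and> g ` {a..b} \<subseteq> {a..b} \<and> towers_of_cycles a b g = Tow \<K>"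
    using cut_cont cut_range[OF h(1,2)] h(3) unfolding towers_of_cycles_eq
    by (intro exI[of _ 0] exI[of _ 1] exI[of _ "cut h"]) auto
qed

end
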